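(* Let $G$ be a metric group of order $N$, let $E\colon G\to\mathbb{C}$ be a finite quantum dilogarithm for $G$, and let $\alpha_g$ ($g\in G$) and $\rho$ be the unital endomorphisms of the Leavitt algebra $L_{2N}$ over $\mathbb{C}$ defined in the context. Let $\mathcal{E}=\{\rho^m\alpha_g: m\ge0,\ g\in G\}$. Then the Evans–Gannon construction applied to $\mathcal{E}$ gives a categorification of the Izumi fusion ring $R_G$; that is, $\overline{\mathcal{C}(\mathcal{E})}^{ds}$ is a fusion category over $\mathbb{C}$ whose Grothendieck ring, with the basis of classes of simple objects, is the fusion ring $R_G$.
   Context: Metric group: a finite abelian group $G$ with a function $\langle\cdot\rangle\colon G\to\mathbb{C}^\times$ such that $\langle x\rangle=\langle-x\rangle$ and $\langle x;y\rangle:=\langle x+y\rangle\langle x\rangle^{-1}\langle y\rangle^{-1}$ is a non-degenerate bicharacter. With $N=|G|$, put $\widehat f(y)=\frac1{\sqrt N}\sum_{x\in G}f(x)\langle x;-y\rangle$. Finite quantum dilogarithm: a function $E\colon G\to\mathbb{C}$ such that for some $C\in\mathbb{C}^\times$ and all $x,y\in G$, $\langle x;y\rangle E(x)E(y)=C+\frac1{\sqrt N}\sum_{z\in G}E(y-z)E(z)\langle z\rangle E(x-z)$; when $|G|\le4$ one additionally requires $E(0)^2=\sqrt N E(0)+1$. It is known that then $E$ has no zeros, $\widehat E(x)=\lambda\langle x\rangle E(x)$ for all $x$ with $\lambda=\widehat E(0)/E(0)$, and $d:=-\sqrt N/E(0)$ satisfies $d^2=N(d+1)$. Fix a square root $\sqrt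 d$. Izumi fusion ring $R_G$: the fusion ring with $\mathbb{Z}$-basis $[g]$ ($g\in G$), $[\rho]$, unit $[0]$, products $[g][h]=[g+h]$, $[g][\rho]=[\rho][g]=[\rho]$, $[\rho]^2=N[\rho]+\sum_{g\in G}[g]$, and involution $[g]^*=[-g]$, $[\rho]^*=[\rho]$. A fusion category over $\mathbb{C}$ is a $\mathbb{C}$-linear semisimple rigid tensor category with simple unit, finitely many isomorphism classes of simple objects and finite-dimensional morphism spaces. It is a categorification of a fusion ring $R$ if its tensor product multiplicities between simple objects are the structure constants of $R$ in its given basis. Leavitt algebra $L_{2N}$: the unital associative $\mathbb{C}$-algebra generated by $S_g,S_g',T_g,T_g'$ ($g\in G$) with relations $S_g'S_h=\delta_{g,h}$, $T_g'T_h=\delta_{g,h}$, $S_g'T_h=T_h'S_g=0$, $\sum_gS_gS_g'+\sum_gT_gT_g'=1$. Automorphisms $\alpha_g$: $\alpha_g(S_h)=S_{g+h}$, $\alpha_g(S_h')=S_{g+h}'$, $\alpha_g(T_h)=\langle g;h\rangle^{-1}T_h$, $\alpha_g(T_h')=\langle g;h\rangle T_h'$. Let $U_g=\sum_h\langle g;h\rangle^{-1}S_hS_h'+\sum_hT_{h-g}T_h'$ (one has $U_0=1$, $U_{g}U_{h}=U_{g+h}$). The unital endomorphism $\rho$ of $L_{2N}$ is given on generators by (all sums over $G$) $$\rho(S_g)=U_g\Big(\frac1d\sum_hS_h+\frac1{\sqrt d}\sum_h\langle h\rangle T_hT_{-h}\Big)U_{-g},$$ $$\rho(S_g')=U_g\Big(\frac1d\sum_hS_h'+\frac1{\sqrt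 d}\sum_h\langle h\rangle^{-1}T_{-h}'T_h'\Big)U_{-g},$$ $$\rho(T_g)=\frac{\lambda}{\sqrt d\sqrt N}\sum_{h,k}\langle h-g;k\rangle S_hT_k'+\frac{\lambda^{-1}}{\langle g\rangle\sqrt N}\sum_{h,k}\langle g+h;k\rangle^{-1}T_kS_hS_h'+\frac1{\sqrt N}\sum_{h,k}\langle h\rangle E(h+g)\langle g;k\rangle^{-1}T_{h+k}T_{-h}T_k',$$ $$\rho(T_g')=\frac{\lambda^{-1}}{\sqrt d\sqrt N}\sum_{h,k}\langle h-g;k\rangle^{-1}T_kS_h'+\frac{\lambda\langle g\rangle}{\sqrt N}\sum_{h,k}\langle g+h;k\rangle S_hS_h'T_k'+\frac1{\sqrt N}\sum_{h,k}\frac{\langle g+h\rangle}{\langle h\rangle}E(-h-g)\langle g;k\rangle T_kT_{-h}'T_{h+k}'.$$ Evans–Gannon construction: for a set $\mathcal{E}$ of unital endomorphisms of $L_{2N}$ containing the identity, one uses the monoidal category $\mathcal{C}(\mathcal{E})$ with objects generated by $\mathcal{E}$ under composition (here $\mathcal{E}$ consists, up to isomorphism, of all compositions of $\rho$'s and $\alpha_g$'s, since $\alpha_g\circ\rho=\rho$), morphisms $\mathrm{Hom}(\sigma,\tau)=\{x\in L_{2N}: x\sigma(y)=\tau(y)x\ \forall y\in L_{2N}\}$, tensor product $\sigma\otimes\tau=\sigma\circ\tau$ on objects and $r\otimes s=r\beta(s)=\gamma(s)r$ for $r\in\mathrm{Hom}(\beta,\gamma)$, $s\in\mathrm{Hom}(\sigma,\tau)$.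 $\overline{\mathcal{C}(\mathcal{E})}$ is its idempotent completion: objects $(p,\beta)$ with $\beta\in\mathcal{E}$, $p=p^2\in\mathrm{Hom}(\beta,\beta)$; morphisms $\mathrm{Hom}((p,\beta),(q,\gamma))=q\,\mathrm{Hom}(\beta,\gamma)\,p$; tensor product $(p,\beta)\otimes(q,\gamma)=(p\beta(q),\beta\circ\gamma)$. Finally $\overline{\mathcal{C}(\mathcal{E})}^{ds}$ is obtained by adjoining formal finite direct sums: objects are formal finite direct sums $\bigoplus_i(p_i,\beta_i)$, morphisms are matrices of morphisms of $\overline{\mathcal{C}(\mathcal{E})}$ with matrix multiplication as composition, and the tensor product is extended as the Kronecker product of matrices. *)

theory Defs
  imports Complex_Main "HOL-Library.Cardinality" "HOL-Library.Poly_Mapping" "HOL-Library.Function_Algebras"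
begin

section \<open>Metric groups and finite quantum dilogarithms\<close>

definition bichar :: "('g::ab_group_add \<Rightarrow> complex) \<Rightarrow> 'g \<Rightarrow> 'g \<Rightarrow> complex" where
  "bichar q x y = q (x + y) * inverse (q x) * inverse (q y)"

definition metric_group :: "('g::{ab_group_add,finite} \<Rightarrow> complex) \<Rightarrow> bool" where
  "metric_group q \<longleftrightarrow>
     (\<forall>x. q x \<noteq> 0) \<and>
     (\<forall>x. q x = q (- x)) \<and>
     (\<forall>x y z. bichar q (x + y) z = bichar q x z * bichar q y z) \<and>
     (\<forall>x y z. bichar q x (y + z) = bichar q x y * bichar q x z) \<and>
     (\<forall>x. (\<forall>y. bichar q x y = 1) \<longrightarrow> x = 0) \<and>
     (\<forall>y. (\<forall>x. bichar q x y = 1) \<longrightarrow> y = 0)"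

definition sqrt_card :: "'g::finite itself \<Rightarrow> complex" where
  "sqrt_card _ = complex_of_real (sqrt (real CARD('g)))"

definition fourier ::
  "('g::{ab_group_add,finite} \<Rightarrow> complex) \<Rightarrow> ('g \<Rightarrow> complex) \<Rightarrow> 'g \<Rightarrow> complex" where
  "fourier q f y = 1 / sqrt_card TYPE('g) * (\<Sum>x\<in>UNIV. f x * bichar q x (- y))"

definition finite_quantum_dilogarithm ::
  "('g::{ab_group_add,finite} \<Rightarrow> complex) \<Rightarrow> ('g \<Rightarrow> complex) \<Rightarrow> bool" where
  "finite_quantum_dilogarithm q E \<longleftrightarrow>
     (\<exists>C. C \<noteq> 0 \<and> (\<forall>x y. bichar q x y * E x * E y =
        C + 1 / sqrt_card TYPE('g) * (\<Sum>z\<in>UNIV. E (y - z) * E z * q z * E (x - z)))) \<and>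
     (CARD('g) \<le> 4 \<longrightarrow> (E 0)\<^sup>2 = sqrt_card TYPE('g) * E 0 + 1)"

definition dilog_lambda ::
  "('g::{ab_group_add,finite} \<Rightarrow> complex) \<Rightarrow> ('g \<Rightarrow> complex) \<Rightarrow> complex" where
  "dilog_lambda q E = fourier q E 0 / E 0"

definition dilog_d :: "('g::{ab_group_add,finite} \<Rightarrow> complex) \<Rightarrow> complex" where
  "dilog_d E = - sqrt_card TYPE('g) / E 0"


section \<open>The Leavitt algebra\<close>

datatype 'g lgen = GenS 'g | GenS' 'g | GenT 'g | GenT' 'g

datatype 'g lword = Word (letters: "'g lgen list")

instantiation lword :: (type) monoid_add
begin
definition "0 = Word []"
definition "u + v = Word (letters u @ letters v)"
instance
  by standard (simp_all add: zero_lword_def plus_lword_def)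
end

text \<open>Words in the generators form the free monoid, written additively because the product of
  finitely supported functions in \<^theory>\<open>HOL-Library.Poly_Mapping\<close> is the convolution over an additive
  monoid. Hence the following type is the free unital algebra on the generators.\<close>

type_synonym 'g lfree = "'g lword \<Rightarrow>\<^sub>0 complex"

definition free_gen :: "'g lgen \<Rightarrow> 'g lfree" where
  "free_gen l = Poly_Mapping.single (Word [l]) 1"

definition leavitt_relators :: "('g::finite) lfree set" where
  "leavitt_relators =
     {free_gen (GenS' g) * free_gen (GenS h) - (if g = h then 1 else 0) | g h. True} \<union>
     {free_gen (GenT' g) * free_gen (GenT h) - (if g = h then 1 else 0) | g h. True} \<union>
     {free_gen (GenS' g) * free_gen (GenT h) | g h. True} \<union>
     {free_gen (GenT' h) * free_gen (GenS g) | g h. True} \<union>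
     {(\<Sum>g\<in>UNIV. free_gen (GenS g) * free_gen (GenS' g)) +
      (\<Sum>g\<in>UNIV. free_gen (GenT g) * free_gen (GenT' g)) - 1}"

text \<open>The two-sided ideal generated by the relators.\<close>

inductive_set leavitt_ideal :: "('g::finite) lfree set" where
  zero: "0 \<in> leavitt_ideal"
| step: "r \<in> leavitt_relators \<Longrightarrow> x \<in> leavitt_ideal \<Longrightarrow> a * r * b + x \<in> leavitt_ideal"

lemma leavitt_ideal_add:
  "x \<in> leavitt_ideal \<Longrightarrow> y \<in> leavitt_ideal \<Longrightarrow> x + y \<in> leavitt_ideal"
  by (induction rule: leavitt_ideal.induct) (auto simp: add.assoc intro: leavitt_ideal.intros)

lemma leavitt_ideal_mult_left:
  assumes "x \<in> leavitt_ideal" shows "c * x \<in> leavitt_ideal"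
  using assms
proof (induction rule: leavitt_ideal.induct)
  case (step r x a b)
  from leavitt_ideal.step[OF step(1) step(3), of "c * a" b] show ?case
    by (simp add: algebra_simps)
qed (simp add: leavitt_ideal.zero)

lemma leavitt_ideal_mult_right:
  assumes "x \<in> leavitt_ideal" shows "x * c \<in> leavitt_ideal"
  using assms
proof (induction rule: leavitt_ideal.induct)
  case (step r x a b)
  from leavitt_ideal.step[OF step(1) step(3), of a "b * c"] show ?case
    by (simp add: algebra_simps)
qed (simp add: leavitt_ideal.zero)

lemma leavitt_ideal_uminus: "x \<in> leavitt_ideal \<Longrightarrow> - x \<in> leavitt_ideal"
  using leavitt_ideal_mult_left[of x "- 1"] by simp

lemma leavitt_ideal_relator: "r \<in> leavitt_relators \<Longrightarrow> r \<in> leavitt_ideal"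
  using leavitt_ideal.step[of r 0 1 1] leavitt_ideal.zero by simp

quotient_type (overloaded) 'g leavitt = "('g::finite) lfree" / "\<lambda>x y. x - y \<in> leavitt_ideal"
proof (rule equivpI)
  show "reflp (\<lambda>x y. x - y \<in> (leavitt_ideal :: 'g lfree set))"
    by (simp add: reflp_def leavitt_ideal.zero)
  show "symp (\<lambda>x y. x - y \<in> (leavitt_ideal :: 'g lfree set))"
  proof (rule sympI)
    fix x y :: "'g lfree"
    assume "x - y \<in> leavitt_ideal"
    then have "- (x - y) \<in> leavitt_ideal"
      by (rule leavitt_ideal_uminus)
    then show "y - x \<in> leavitt_ideal"
      by simp
  qed
  show "transp (\<lambda>x y. x - y \<in> (leavitt_ideal :: 'g lfree set))"
  proof (rule transpI)
    fix x y z :: "'g lfree"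
    assume "x - y \<in> leavitt_ideal" "y - z \<in> leavitt_ideal"
    then have "(x - y) + (y - z) \<in> leavitt_ideal"
      by (rule leavitt_ideal_add)
    then show "x - z \<in> leavitt_ideal"
      by simp
  qed
qed

instantiation leavitt :: (finite) "{ring, monoid_mult}"
begin

lift_definition zero_leavitt :: "'a leavitt" is 0 .
lift_definition one_leavitt :: "'a leavitt" is 1 .
lift_definition plus_leavitt :: "'a leavitt \<Rightarrow> 'a leavitt \<Rightarrow> 'a leavitt" is "(+)"
  by (metis (no_types, lifting) add_diff_add leavitt_ideal_add)
lift_definition uminus_leavitt :: "'a leavitt \<Rightarrow> 'a leavitt" is uminus
  using leavitt_ideal_uminus by fastforce
lift_definition minus_leavitt :: "'a leavitt \<Rightarrow> 'a leavitt \<Rightarrow> 'a leavitt" is "(-)"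
proof -
  fix a b c d :: "'a lfree"
  assume "a - b \<in> leavitt_ideal" "c - d \<in> leavitt_ideal"
  then have "(a - b) + - (c - d) \<in> leavitt_ideal"
    by (intro leavitt_ideal_add leavitt_ideal_uminus)
  then show "a - c - (b - d) \<in> leavitt_ideal"
    by (simp add: algebra_simps)
qed
lift_definition times_leavitt :: "'a leavitt \<Rightarrow> 'a leavitt \<Rightarrow> 'a leavitt" is "(*)"
proof -
  fix a b c d :: "'a lfree"
  assume "a - b \<in> leavitt_ideal" "c - d \<in> leavitt_ideal"
  then have "(a - b) * c + b * (c - d) \<in> leavitt_ideal"
    by (intro leavitt_ideal_add leavitt_ideal_mult_left leavitt_ideal_mult_right)
  then show "a * c - b * d \<in> leavitt_ideal"
    by (simp add: algebra_simps)
qed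

instance
  by standard (transfer; simp add: algebra_simps leavitt_ideal.zero)+

end

lift_definition lscale :: "complex \<Rightarrow> ('g::finite) leavitt \<Rightarrow> 'g leavitt" (infixr \<open>*\<^sub>L\<close> 75)
  is "\<lambda>c x. Poly_Mapping.single 0 c * x"
  by (metis leavitt_ideal_mult_left right_diff_distrib)

lift_definition leavitt_gen :: "'g lgen \<Rightarrow> ('g::finite) leavitt" is free_gen .

abbreviation "LS g \<equiv> leavitt_gen (GenS g)"
abbreviation "LS' g \<equiv> leavitt_gen (GenS' g)"
abbreviation "LT g \<equiv> leavitt_gen (GenT g)"
abbreviation "LT' g \<equiv> leavitt_gen (GenT' g)"

definition unital_endo :: "(('g::finite) leavitt \<Rightarrow> 'g leavitt) \<Rightarrow> bool" where
  "unital_endo f \<longleftrightarrow>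
     (\<forall>x y. f (x + y) = f x + f y) \<and> (\<forall>x y. f (x * y) = f x * f y) \<and> f 1 = 1 \<and>
     (\<forall>c x. f (c *\<^sub>L x) = c *\<^sub>L f x)"

lemma lfree_sum_single: "p = (\<Sum>w\<in>Poly_Mapping.keys p. Poly_Mapping.single w (Poly_Mapping.lookup p w))"
  for p :: "'g lfree"
  by (rule poly_mapping_eqI)
    (auto simp: lookup_sum lookup_single when_def sum.delta' in_keys_iff)

lemma single_zero_central:
  "Poly_Mapping.single 0 c * p = p * Poly_Mapping.single 0 c" for p :: "'g lfree"
proof -
  have "Poly_Mapping.single 0 c * (\<Sum>w\<in>Poly_Mapping.keys p. Poly_Mapping.single w (Poly_Mapping.lookup p w)) =
    (\<Sum>w\<in>Poly_Mapping.keys p. Poly_Mapping.single w (Poly_Mapping.lookup p w)) * Poly_Mapping.single 0 c"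
    by (simp add: sum_distrib_left sum_distrib_right mult_single mult.commute)
  then show ?thesis
    by (metis lfree_sum_single)
qed

lemma vector_space_lscale: "vector_space (*\<^sub>L)"
proof
  fix a b :: complex and x y :: "'a leavitt"
  show "a *\<^sub>L (x + y) = a *\<^sub>L x + a *\<^sub>L y"
    by transfer (simp add: distrib_left leavitt_ideal.zero)
  show "(a + b) *\<^sub>L x = a *\<^sub>L x + b *\<^sub>L x"
    by transfer (simp add: distrib_right single_add leavitt_ideal.zero)
  show "a *\<^sub>L b *\<^sub>L x = (a * b) *\<^sub>L x"
    by transfer (simp add: mult_single leavitt_ideal.zero flip: mult.assoc)
  show "1 *\<^sub>L x = x"
    by transfer (simp add: leavitt_ideal.zero)
qed

lemma lscale_mult_left: "(c *\<^sub>L x) * y = c *\<^sub>L (x * y)"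
  by transfer (simp add: mult.assoc leavitt_ideal.zero)

lemma lscale_mult_right: "x * (c *\<^sub>L y) = c *\<^sub>L (x * y)"
proof transfer
  fix x y :: "'a lfree" and c
  have "x * (Poly_Mapping.single 0 c * y) = Poly_Mapping.single 0 c * (x * y)"
    by (simp only: single_zero_central mult.assoc)
  then show "x * (Poly_Mapping.single 0 c * y) - Poly_Mapping.single 0 c * (x * y) \<in> leavitt_ideal"
    by (simp add: leavitt_ideal.zero)
qed

definition leavitt_word :: "('g lgen \<Rightarrow> ('g::finite) leavitt) \<Rightarrow> 'g lword \<Rightarrow> 'g leavitt" where
  "leavitt_word v w = prod_list (map v (letters w))"

definition eval_free :: "('g lgen \<Rightarrow> ('g::finite) leavitt) \<Rightarrow> 'g lfree \<Rightarrow> 'g leavitt" where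
  "eval_free v p =
     (\<Sum>w\<in>Poly_Mapping.keys p. Poly_Mapping.lookup p w *\<^sub>L leavitt_word v w)"

lemma leavitt_word_0 [simp]: "leavitt_word v 0 = 1"
  by (simp add: leavitt_word_def zero_lword_def)

lemma leavitt_word_add: "leavitt_word v (u + w) = leavitt_word v u * leavitt_word v w"
  by (simp add: leavitt_word_def plus_lword_def)

lemma eval_free_superset:
  assumes "finite A" "Poly_Mapping.keys p \<subseteq> A"
  shows "eval_free v p = (\<Sum>w\<in>A. Poly_Mapping.lookup p w *\<^sub>L leavitt_word v w)"
proof -
  interpret L: vector_space "(*\<^sub>L)" by (rule vector_space_lscale)
  show ?thesis
    unfolding eval_free_def using assms
    by (intro sum.mono_neutral_left) (auto simp: in_keys_iff)
qed

lemma eval_free_add: "eval_free v (p + q) = eval_free v p + eval_free v q"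
proof -
  interpret L: vector_space "(*\<^sub>L)" by (rule vector_space_lscale)
  let ?A = "Poly_Mapping.keys p \<union> Poly_Mapping.keys q"
  have "Poly_Mapping.keys (p + q) \<subseteq> ?A"
    by (rule Poly_Mapping.keys_add)
  then show ?thesis
    by (simp add: eval_free_superset[of ?A] lookup_add L.scale_left_distrib sum.distrib)
qed

lemma eval_free_0 [simp]: "eval_free v 0 = 0"
  by (simp add: eval_free_def)

lemma eval_free_sum: "eval_free v (\<Sum>i\<in>I. f i) = (\<Sum>i\<in>I. eval_free v (f i))"
  by (induction I rule: infinite_finite_induct) (auto simp: eval_free_add)

lemma eval_free_single [simp]: "eval_free v (Poly_Mapping.single w c) = c *\<^sub>L leavitt_word v w"
proof -
  interpret L: vector_space "(*\<^sub>L)" by (rule vector_space_lscale)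
  show ?thesis
    by (simp add: eval_free_superset[of "{w}"])
qed

lemma eval_free_mult: "eval_free v (p * q) = eval_free v p * eval_free v q"
proof -
  interpret L: vector_space "(*\<^sub>L)" by (rule vector_space_lscale)
  let ?s = "\<lambda>p. \<Sum>w\<in>Poly_Mapping.keys p. Poly_Mapping.single w (Poly_Mapping.lookup p w)"
  have "eval_free v (?s p * ?s q) = eval_free v (?s p) * eval_free v (?s q)"
    by (simp only: sum_product eval_free_sum mult_single eval_free_single leavitt_word_add
        lscale_mult_left lscale_mult_right L.scale_scale) (simp only: mult.commute)
  then show ?thesis
    by (simp only: lfree_sum_single[symmetric])
qed

lemma eval_free_1 [simp]: "eval_free v 1 = 1"
proof -
  interpret L: vector_space "(*\<^sub>L)" by (rule vector_space_lscale)
  show ?thesis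
    using eval_free_single[of v 0 1] by simp
qed

lemma eval_free_gen [simp]: "eval_free v (free_gen l) = v l"
proof -
  interpret L: vector_space "(*\<^sub>L)" by (rule vector_space_lscale)
  show ?thesis
    by (simp add: free_gen_def leavitt_word_def)
qed

lemma eval_free_uminus: "eval_free v (- p) = - eval_free v p"
  using eval_free_add[of v p "- p"] by (simp add: eq_neg_iff_add_eq_0 add.commute)

lemma eval_free_diff: "eval_free v (p - q) = eval_free v p - eval_free v q"
  using eval_free_add[of v p "- q"] by (simp add: eval_free_uminus)

lemma unital_endo_0: "unital_endo f \<Longrightarrow> f 0 = 0"
  unfolding unital_endo_def by (metis add_cancel_right_right)

lemma unital_endo_sum: "unital_endo f \<Longrightarrow> f (\<Sum>i\<in>I. h i) = (\<Sum>i\<in>I. f (h i))"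
  by (induction I rule: infinite_finite_induct) (auto simp: unital_endo_0, auto simp: unital_endo_def)

lemma unital_endo_prod_list: "unital_endo f \<Longrightarrow> f (prod_list xs) = prod_list (map f xs)"
  by (induction xs) (auto simp: unital_endo_def)

lemma abs_rep_leavitt: "abs_leavitt (rep_leavitt x) = x"
  by (rule Quotient3_abs_rep[OF Quotient3_leavitt])

lemma abs_leavitt_sum: "abs_leavitt (\<Sum>i\<in>I. f i) = (\<Sum>i\<in>I. abs_leavitt (f i))"
  by (induction I rule: infinite_finite_induct)
    (auto simp: zero_leavitt_def plus_leavitt.abs_eq[symmetric])

lemma abs_leavitt_single:
  fixes w :: "('g::finite) lword"
  shows "abs_leavitt (Poly_Mapping.single w c) = c *\<^sub>L leavitt_word leavitt_gen w"
proof -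
  have "abs_leavitt (Poly_Mapping.single (Word ls) 1) = prod_list (map leavitt_gen ls)" for ls :: "'g lgen list"
  proof (induction ls)
    case Nil
    then show ?case
      by (simp flip: zero_lword_def add: one_leavitt_def)
  next
    case (Cons l ls)
    have "Poly_Mapping.single (Word (l # ls)) 1 = free_gen l * Poly_Mapping.single (Word ls) (1::complex)"
      by (simp add: free_gen_def mult_single plus_lword_def)
    with Cons show ?case
      by (simp add: times_leavitt.abs_eq[symmetric] leavitt_gen_def)
  qed
  moreover have "Poly_Mapping.single w c = Poly_Mapping.single 0 c * Poly_Mapping.single w 1"
    by (simp add: mult_single)
  ultimately show ?thesis
    by (metis leavitt_word_def lscale.abs_eq lword.exhaust_sel)
qed

lemma abs_leavitt_eq_eval_free: "abs_leavitt p = eval_free leavitt_gen p"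
  by (subst lfree_sum_single[of p]) (simp add: abs_leavitt_sum abs_leavitt_single eval_free_def)

lemma unital_endo_eval_free:
  assumes "unital_endo f"
  shows "f (abs_leavitt p) = eval_free (\<lambda>l. f (leavitt_gen l)) p"
proof -
  have "f (c *\<^sub>L leavitt_word leavitt_gen w) = c *\<^sub>L leavitt_word (\<lambda>l. f (leavitt_gen l)) w" for c w
    using assms unital_endo_prod_list[OF assms]
    by (simp add: leavitt_word_def unital_endo_def o_def)
  then show ?thesis
    by (simp add: abs_leavitt_eq_eval_free eval_free_def unital_endo_sum[OF assms])
qed

lemma unital_endo_unique:
  assumes "unital_endo f" "unital_endo f'" "\<And>l. f (leavitt_gen l) = f' (leavitt_gen l)"
  shows "f = f'"
proof
  fix x
  show "f x = f' x"
    using unital_endo_eval_free[OF assms(1), of "rep_leavitt x"]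
      unital_endo_eval_free[OF assms(2), of "rep_leavitt x"]
    by (simp add: abs_rep_leavitt assms(3))
qed

theorem leavitt_universal:
  fixes v :: "'g lgen \<Rightarrow> ('g::finite) leavitt"
  assumes "\<And>g h. v (GenS' g) * v (GenS h) = (if g = h then 1 else 0)"
    and "\<And>g h. v (GenT' g) * v (GenT h) = (if g = h then 1 else 0)"
    and "\<And>g h. v (GenS' g) * v (GenT h) = 0"
    and "\<And>g h. v (GenT' h) * v (GenS g) = 0"
    and "(\<Sum>g\<in>UNIV. v (GenS g) * v (GenS' g)) + (\<Sum>g\<in>UNIV. v (GenT g) * v (GenT' g)) = 1"
  shows "\<exists>!f. unital_endo f \<and> (\<forall>l. f (leavitt_gen l) = v l)"
proof -
  have rel: "eval_free v r = 0" if "r \<in> leavitt_relators" for r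
    using that assms unfolding leavitt_relators_def
    by (auto simp: eval_free_diff eval_free_add eval_free_sum eval_free_mult)
  have ideal: "eval_free v x = 0" if "x \<in> leavitt_ideal" for x
    using that by induction (auto simp: eval_free_add eval_free_mult rel)
  define f where "f x = eval_free v (rep_leavitt x)" for x
  have f: "f (abs_leavitt p) = eval_free v p" for p
  proof -
    have "rep_leavitt (abs_leavitt p) - p \<in> leavitt_ideal"
      using Quotient3_leavitt leavitt.abs_eq_iff Quotient3_abs_rep by fastforce
    from ideal[OF this] show ?thesis
      by (simp add: f_def eval_free_diff)
  qed
  have "f (x + y) = f x + f y" "f (x * y) = f x * f y" "f (c *\<^sub>L x) = c *\<^sub>L f x" for x y c
  proof -
    obtain p q where "x = abs_leavitt p" "y = abs_leavitt q"
      by (metis abs_rep_leavitt)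
    then show "f (x + y) = f x + f y" "f (x * y) = f x * f y" "f (c *\<^sub>L x) = c *\<^sub>L f x"
      by (simp_all add: plus_leavitt.abs_eq times_leavitt.abs_eq lscale.abs_eq f
          eval_free_add eval_free_mult lscale_mult_left)
  qed
  moreover have "f 1 = 1" "f (leavitt_gen l) = v l" for l
    by (simp_all add: one_leavitt_def leavitt_gen_def f)
  ultimately have "unital_endo f \<and> (\<forall>l. f (leavitt_gen l) = v l)"
    by (simp add: unital_endo_def)
  then show ?thesis
    by (metis (no_types, lifting) unital_endo_unique)
qed

text \<open>The unital endomorphism with prescribed values on the generators. There is at most one by
  \<open>unital_endo_unique\<close> below; \<open>endo_of\<close> is meaningful only if there is one.\<close>

definition endo_of :: "(('g::finite) lgen \<Rightarrow> 'g leavitt) \<Rightarrow> 'g leavitt \<Rightarrow> 'g leavitt" where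
  "endo_of v = (THE f. unital_endo f \<and> (\<forall>l. f (leavitt_gen l) = v l))"



lemma leavitt_relations:
  fixes g h :: "'g::finite"
  shows "LS' g * LS h = (if g = h then 1 else 0)"
    and "LT' g * LT h = (if g = h then 1 else 0)"
    and "LS' g * LT h = 0"
    and "LT' h * LS g = 0"
    and "(\<Sum>g\<in>UNIV. LS g * LS' g) + (\<Sum>g\<in>UNIV. LT g * LT' (g::'g)) = 1"
proof -
  have eq: "eval_free leavitt_gen r = 0" if "r \<in> leavitt_relators" for r :: "'g lfree"
    using leavitt_ideal_relator[OF that]
    by (simp add: abs_leavitt_eq_eval_free[symmetric] zero_leavitt_def leavitt.abs_eq_iff)
  have "free_gen (GenS' g) * free_gen (GenS h) - (if g = h then 1 else 0) \<in> leavitt_relators"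
    "free_gen (GenT' g) * free_gen (GenT h) - (if g = h then 1 else 0) \<in> leavitt_relators"
    "free_gen (GenS' g) * free_gen (GenT h) \<in> leavitt_relators"
    "free_gen (GenT' h) * free_gen (GenS g) \<in> leavitt_relators"
    "(\<Sum>g\<in>UNIV. free_gen (GenS g) * free_gen (GenS' g)) +
      (\<Sum>g\<in>UNIV. free_gen (GenT g) * free_gen (GenT' (g::'g))) - 1 \<in> leavitt_relators"
    unfolding leavitt_relators_def by blast+
  note this[THEN eq]
  then show "LS' g * LS h = (if g = h then 1 else 0)"
    "LT' g * LT h = (if g = h then 1 else 0)"
    "LS' g * LT h = 0" "LT' h * LS g = 0"
    "(\<Sum>g\<in>UNIV. LS g * LS' g) + (\<Sum>g\<in>UNIV. LT g * LT' (g::'g)) = 1"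
    by (auto simp: eval_free_diff eval_free_add eval_free_sum eval_free_mult split: if_splits)
qed


section \<open>The endomorphisms\<close>

fun alpha_on_gens ::
  "('g::{ab_group_add,finite} \<Rightarrow> complex) \<Rightarrow> 'g \<Rightarrow> 'g lgen \<Rightarrow> 'g leavitt" where
  "alpha_on_gens q g (GenS h) = LS (g + h)"
| "alpha_on_gens q g (GenS' h) = LS' (g + h)"
| "alpha_on_gens q g (GenT h) = inverse (bichar q g h) *\<^sub>L LT h"
| "alpha_on_gens q g (GenT' h) = bichar q g h *\<^sub>L LT' h"

definition alpha ::
  "('g::{ab_group_add,finite} \<Rightarrow> complex) \<Rightarrow> 'g \<Rightarrow> 'g leavitt \<Rightarrow> 'g leavitt" where
  "alpha q g = endo_of (alpha_on_gens q g)"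

lemma alpha_well_defined:
  fixes q :: "'g::{ab_group_add,finite} \<Rightarrow> complex"
  assumes "metric_group q"
  shows "\<exists>!f. unital_endo f \<and> (\<forall>l. f (leavitt_gen l) = alpha_on_gens q g l)"
proof -
  interpret L: vector_space "(*\<^sub>L) :: complex \<Rightarrow> 'g leavitt \<Rightarrow> _" by (rule vector_space_lscale)
  have [simp]: "bichar q x y \<noteq> 0" for x y
    using assms by (simp add: metric_group_def bichar_def)
  have "(\<Sum>h\<in>UNIV. LS (g + h) * LS' (g + h)) = (\<Sum>h\<in>UNIV. LS h * LS' h)"
    by (rule sum.reindex_bij_witness[of _ "\<lambda>h. h - g" "\<lambda>h. g + h"]) auto
  then show ?thesis
    by (intro leavitt_universal)
      (auto simp: lscale_mult_left lscale_mult_right leavitt_relations)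
qed

definition leavitt_U ::
  "('g::{ab_group_add,finite} \<Rightarrow> complex) \<Rightarrow> 'g \<Rightarrow> 'g leavitt" where
  "leavitt_U q g =
     (\<Sum>h\<in>UNIV. inverse (bichar q g h) *\<^sub>L (LS h * LS' h)) +
     (\<Sum>h\<in>UNIV. LT (h - g) * LT' h)"

text \<open>The parameter \<open>s\<close> is the chosen square root of \<open>dilog_d E\<close>.\<close>

fun rho_on_gens ::
  "('g::{ab_group_add,finite} \<Rightarrow> complex) \<Rightarrow> ('g \<Rightarrow> complex) \<Rightarrow> complex \<Rightarrow>
   'g lgen \<Rightarrow> 'g leavitt" where
  "rho_on_gens q E s (GenS g) =
     leavitt_U q g *
     ((1 / dilog_d E) *\<^sub>L (\<Sum>h\<in>UNIV. LS h) +
      (1 / s) *\<^sub>L (\<Sum>h\<in>UNIV. q h *\<^sub>L (LT h * LT (- h)))) *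
     leavitt_U q (- g)"
| "rho_on_gens q E s (GenS' g) =
     leavitt_U q g *
     ((1 / dilog_d E) *\<^sub>L (\<Sum>h\<in>UNIV. LS' h) +
      (1 / s) *\<^sub>L (\<Sum>h\<in>UNIV. inverse (q h) *\<^sub>L (LT' (- h) * LT' h))) *
     leavitt_U q (- g)"
| "rho_on_gens q E s (GenT g) =
     (dilog_lambda q E / (s * sqrt_card TYPE('g))) *\<^sub>L
       (\<Sum>h\<in>UNIV. \<Sum>k\<in>UNIV. bichar q (h - g) k *\<^sub>L (LS h * LT' k)) +
     (inverse (dilog_lambda q E) / (q g * sqrt_card TYPE('g))) *\<^sub>L
       (\<Sum>h\<in>UNIV. \<Sum>k\<in>UNIV. inverse (bichar q (g + h) k) *\<^sub>L (LT k * LS h * LS' h)) +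
     (1 / sqrt_card TYPE('g)) *\<^sub>L
       (\<Sum>h\<in>UNIV. \<Sum>k\<in>UNIV.
          (q h * E (h + g) * inverse (bichar q g k)) *\<^sub>L (LT (h + k) * LT (- h) * LT' k))"
| "rho_on_gens q E s (GenT' g) =
     (inverse (dilog_lambda q E) / (s * sqrt_card TYPE('g))) *\<^sub>L
       (\<Sum>h\<in>UNIV. \<Sum>k\<in>UNIV. inverse (bichar q (h - g) k) *\<^sub>L (LT k * LS' h)) +
     (dilog_lambda q E * q g / sqrt_card TYPE('g)) *\<^sub>L
       (\<Sum>h\<in>UNIV. \<Sum>k\<in>UNIV. bichar q (g + h) k *\<^sub>L (LS h * LS' h * LT' k)) +
     (1 / sqrt_card TYPE('g)) *\<^sub>L
       (\<Sum>h\<in>UNIV. \<Sum>k\<in>UNIV.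
          (q (g + h) / q h * E (- h - g) * bichar q g k) *\<^sub>L (LT k * LT' (- h) * LT' (h + k)))"

definition rho ::
  "('g::{ab_group_add,finite} \<Rightarrow> complex) \<Rightarrow> ('g \<Rightarrow> complex) \<Rightarrow> complex \<Rightarrow>
   'g leavitt \<Rightarrow> 'g leavitt" where
  "rho q E s = endo_of (rho_on_gens q E s)"


section \<open>Fusion categories\<close>

text \<open>A category with a \<open>\<complex>\<close>-linear and a monoidal structure. Hom-sets are subsets of one ambient
  vector space \<open>'m\<close> and need not be disjoint, so operations on morphisms carry the objects:
  \<open>Comp C X Y Z g f\<close> is \<open>g \<circ> f\<close> for \<open>f : X \<rightarrow> Y\<close>, \<open>g : Y \<rightarrow> Z\<close>, and \<open>TMor C X Y X' Y' f f'\<close> is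
  \<open>f \<otimes> f'\<close> for \<open>f : X \<rightarrow> Y\<close>, \<open>f' : X' \<rightarrow> Y'\<close>. The morphism \<open>Assoc C X Y Z\<close> goes from
  \<open>(X \<otimes> Y) \<otimes> Z\<close> to \<open>X \<otimes> (Y \<otimes> Z)\<close>.\<close>

record ('o, 'm) moncat =
  Obj :: "'o set"
  Hom :: "'o \<Rightarrow> 'o \<Rightarrow> 'm set"
  Ident :: "'o \<Rightarrow> 'm"
  Comp :: "'o \<Rightarrow> 'o \<Rightarrow> 'o \<Rightarrow> 'm \<Rightarrow> 'm \<Rightarrow> 'm"
  Scal :: "complex \<Rightarrow> 'm \<Rightarrow> 'm"
  TObj :: "'o \<Rightarrow> 'o \<Rightarrow> 'o"
  TMor :: "'o \<Rightarrow> 'o \<Rightarrow> 'o \<Rightarrow> 'o \<Rightarrow> 'm \<Rightarrow> 'm \<Rightarrow> 'm"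
  Unit :: 'o
  Assoc :: "'o \<Rightarrow> 'o \<Rightarrow> 'o \<Rightarrow> 'm"
  LUnit :: "'o \<Rightarrow> 'm"
  RUnit :: "'o \<Rightarrow> 'm"

locale linear_category = vector_space "Scal C" for C :: "('o, 'm::ab_group_add) moncat" +
  assumes hom_subspace: "\<lbrakk>X \<in> Obj C; Y \<in> Obj C\<rbrakk> \<Longrightarrow> subspace (Hom C X Y)"
    and ident_in_hom: "X \<in> Obj C \<Longrightarrow> Ident C X \<in> Hom C X X"
    and comp_in_hom:
      "\<lbrakk>X \<in> Obj C; Y \<in> Obj C; Z \<in> Obj C; f \<in> Hom C X Y; g \<in> Hom C Y Z\<rbrakk>
       \<Longrightarrow> Comp C X Y Z g f \<in> Hom C X Z"
    and comp_ident_left: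
      "\<lbrakk>X \<in> Obj C; Y \<in> Obj C; f \<in> Hom C X Y\<rbrakk> \<Longrightarrow> Comp C X Y Y (Ident C Y) f = f"
    and comp_ident_right:
      "\<lbrakk>X \<in> Obj C; Y \<in> Obj C; f \<in> Hom C X Y\<rbrakk> \<Longrightarrow> Comp C X X Y f (Ident C X) = f"
    and comp_assoc:
      "\<lbrakk>W \<in> Obj C; X \<in> Obj C; Y \<in> Obj C; Z \<in> Obj C;
        f \<in> Hom C W X; g \<in> Hom C X Y; h \<in> Hom C Y Z\<rbrakk>
       \<Longrightarrow> Comp C W X Z (Comp C X Y Z h g) f = Comp C W Y Z h (Comp C W X Y g f)"
    and comp_add_left:
      "\<lbrakk>X \<in> Obj C; Y \<in> Obj C; Z \<in> Obj C; f \<in> Hom C X Y; g \<in> Hom C Y Z; g' \<in> Hom C Y Z\<rbrakk>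
       \<Longrightarrow> Comp C X Y Z (g + g') f = Comp C X Y Z g f + Comp C X Y Z g' f"
    and comp_add_right:
      "\<lbrakk>X \<in> Obj C; Y \<in> Obj C; Z \<in> Obj C; f \<in> Hom C X Y; f' \<in> Hom C X Y; g \<in> Hom C Y Z\<rbrakk>
       \<Longrightarrow> Comp C X Y Z g (f + f') = Comp C X Y Z g f + Comp C X Y Z g f'"
    and comp_scal_left:
      "\<lbrakk>X \<in> Obj C; Y \<in> Obj C; Z \<in> Obj C; f \<in> Hom C X Y; g \<in> Hom C Y Z\<rbrakk>
       \<Longrightarrow> Comp C X Y Z (Scal C c g) f = Scal C c (Comp C X Y Z g f)"
    and comp_scal_right:
      "\<lbrakk>X \<in> Obj C; Y \<in> Obj C; Z \<in> Obj C; f \<in> Hom C X Y; g \<in> Hom C Y Z\<rbrakk>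
       \<Longrightarrow> Comp C X Y Z g (Scal C c f) = Scal C c (Comp C X Y Z g f)"

definition inverse_arrows :: "('o, 'm) moncat \<Rightarrow> 'o \<Rightarrow> 'o \<Rightarrow> 'm \<Rightarrow> 'm \<Rightarrow> bool" where
  "inverse_arrows C X Y f g \<longleftrightarrow> f \<in> Hom C X Y \<and> g \<in> Hom C Y X \<and>
     Comp C X Y X g f = Ident C X \<and> Comp C Y X Y f g = Ident C Y"

definition iso_arrow :: "('o, 'm) moncat \<Rightarrow> 'o \<Rightarrow> 'o \<Rightarrow> 'm \<Rightarrow> bool" where
  "iso_arrow C X Y f \<longleftrightarrow> (\<exists>g. inverse_arrows C X Y f g)"

definition isomorphic :: "('o, 'm) moncat \<Rightarrow> 'o \<Rightarrow> 'o \<Rightarrow> bool" where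
  "isomorphic C X Y \<longleftrightarrow> (\<exists>f. iso_arrow C X Y f)"

definition zero_object :: "('o, 'm::ab_group_add) moncat \<Rightarrow> 'o \<Rightarrow> bool" where
  "zero_object C Z \<longleftrightarrow> Z \<in> Obj C \<and> (\<forall>X\<in>Obj C. Hom C Z X = {0} \<and> Hom C X Z = {0})"

definition monic :: "('o, 'm) moncat \<Rightarrow> 'o \<Rightarrow> 'o \<Rightarrow> 'm \<Rightarrow> bool" where
  "monic C X Y f \<longleftrightarrow> f \<in> Hom C X Y \<and>
     (\<forall>W\<in>Obj C. \<forall>g\<in>Hom C W X. \<forall>h\<in>Hom C W X.
        Comp C W X Y f g = Comp C W X Y f h \<longrightarrow> g = h)"

definition epic :: "('o, 'm) moncat \<Rightarrow> 'o \<Rightarrow> 'o \<Rightarrow> 'm \<Rightarrow> bool" where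
  "epic C X Y f \<longleftrightarrow> f \<in> Hom C X Y \<and>
     (\<forall>Z\<in>Obj C. \<forall>g\<in>Hom C Y Z. \<forall>h\<in>Hom C Y Z.
        Comp C X Y Z g f = Comp C X Y Z h f \<longrightarrow> g = h)"

definition is_kernel ::
  "('o, 'm::ab_group_add) moncat \<Rightarrow> 'o \<Rightarrow> 'o \<Rightarrow> 'm \<Rightarrow> 'o \<Rightarrow> 'm \<Rightarrow> bool" where
  "is_kernel C X Y f K k \<longleftrightarrow> K \<in> Obj C \<and> k \<in> Hom C K X \<and> Comp C K X Y f k = 0 \<and>
     (\<forall>W\<in>Obj C. \<forall>g\<in>Hom C W X. Comp C W X Y f g = 0 \<longrightarrow>
        (\<exists>!u. u \<in> Hom C W K \<and> Comp C W K X k u = g))"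

definition is_cokernel ::
  "('o, 'm::ab_group_add) moncat \<Rightarrow> 'o \<Rightarrow> 'o \<Rightarrow> 'm \<Rightarrow> 'o \<Rightarrow> 'm \<Rightarrow> bool" where
  "is_cokernel C X Y f Q p \<longleftrightarrow> Q \<in> Obj C \<and> p \<in> Hom C Y Q \<and> Comp C X Y Q p f = 0 \<and>
     (\<forall>Z\<in>Obj C. \<forall>g\<in>Hom C Y Z. Comp C X Y Z g f = 0 \<longrightarrow>
        (\<exists>!u. u \<in> Hom C Q Z \<and> Comp C Y Q Z u p = g))"

definition direct_sum :: "('o, 'm::ab_group_add) moncat \<Rightarrow> 'o list \<Rightarrow> 'o \<Rightarrow> bool" where
  "direct_sum C Xs X \<longleftrightarrow> set Xs \<subseteq> Obj C \<and> X \<in> Obj C \<and>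
     (\<exists>\<iota> \<pi>.
        (\<forall>i<length Xs. \<iota> i \<in> Hom C (Xs ! i) X \<and> \<pi> i \<in> Hom C X (Xs ! i)) \<and>
        (\<forall>i<length Xs. \<forall>j<length Xs.
           Comp C (Xs ! j) X (Xs ! i) (\<pi> i) (\<iota> j) = (if i = j then Ident C (Xs ! i) else 0)) \<and>
        (\<Sum>i<length Xs. Comp C X (Xs ! i) X (\<iota> i) (\<pi> i)) = Ident C X)"

locale abelian_category = linear_category C for C :: "('o, 'm::ab_group_add) moncat" +
  assumes has_zero_object: "\<exists>Z. zero_object C Z"
    and has_biproducts: "\<lbrakk>X \<in> Obj C; Y \<in> Obj C\<rbrakk> \<Longrightarrow> \<exists>Z. direct_sum C [X, Y] Z"
    and has_kernels:
      "\<lbrakk>X \<in> Obj C; Y \<in> Obj C; f \<in> Hom C X Y\<rbrakk> \<Longrightarrow> \<exists>K k. is_kernel C X Y f K k"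
    and has_cokernels:
      "\<lbrakk>X \<in> Obj C; Y \<in> Obj C; f \<in> Hom C X Y\<rbrakk> \<Longrightarrow> \<exists>Q p. is_cokernel C X Y f Q p"
    and monic_is_kernel:
      "\<lbrakk>X \<in> Obj C; Y \<in> Obj C; monic C X Y f\<rbrakk>
       \<Longrightarrow> \<exists>Z\<in>Obj C. \<exists>g\<in>Hom C Y Z. is_kernel C Y Z g X f"
    and epic_is_cokernel:
      "\<lbrakk>X \<in> Obj C; Y \<in> Obj C; epic C X Y f\<rbrakk>
       \<Longrightarrow> \<exists>W\<in>Obj C. \<exists>g\<in>Hom C W X. is_cokernel C W X g Y f"

definition simple_object :: "('o, 'm::ab_group_add) moncat \<Rightarrow> 'o \<Rightarrow> bool" where
  "simple_object C X \<longleftrightarrow> X \<in> Obj C \<and> \<not> zero_object C X \<and>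
     (\<forall>Y\<in>Obj C. \<forall>f. monic C Y X f \<longrightarrow> zero_object C Y \<or> iso_arrow C Y X f)"

locale semisimple_category = abelian_category C for C :: "('o, 'm::ab_group_add) moncat" +
  assumes semisimple:
    "X \<in> Obj C \<Longrightarrow> \<exists>Xs. (\<forall>Y\<in>set Xs. simple_object C Y) \<and> direct_sum C Xs X"

locale linear_monoidal_category = linear_category C for C :: "('o, 'm::ab_group_add) moncat" +
  assumes unit_obj: "Unit C \<in> Obj C"
    and tobj_obj: "\<lbrakk>X \<in> Obj C; Y \<in> Obj C\<rbrakk> \<Longrightarrow> TObj C X Y \<in> Obj C"
    and tmor_in_hom:
      "\<lbrakk>X \<in> Obj C; Y \<in> Obj C; X' \<in> Obj C; Y' \<in> Obj C; f \<in> Hom C X Y; f' \<in> Hom C X' Y'\<rbrakk>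
       \<Longrightarrow> TMor C X Y X' Y' f f' \<in> Hom C (TObj C X X') (TObj C Y Y')"
    and tmor_ident:
      "\<lbrakk>X \<in> Obj C; Y \<in> Obj C\<rbrakk>
       \<Longrightarrow> TMor C X X Y Y (Ident C X) (Ident C Y) = Ident C (TObj C X Y)"
    and tmor_comp:
      "\<lbrakk>X \<in> Obj C; Y \<in> Obj C; Z \<in> Obj C; X' \<in> Obj C; Y' \<in> Obj C; Z' \<in> Obj C;
        f \<in> Hom C X Y; g \<in> Hom C Y Z; f' \<in> Hom C X' Y'; g' \<in> Hom C Y' Z'\<rbrakk>
       \<Longrightarrow> TMor C X Z X' Z' (Comp C X Y Z g f) (Comp C X' Y' Z' g' f') =
           Comp C (TObj C X X') (TObj C Y Y') (TObj C Z Z')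
             (TMor C Y Z Y' Z' g g') (TMor C X Y X' Y' f f')"
    and tmor_add_left:
      "\<lbrakk>X \<in> Obj C; Y \<in> Obj C; X' \<in> Obj C; Y' \<in> Obj C;
        f \<in> Hom C X Y; g \<in> Hom C X Y; f' \<in> Hom C X' Y'\<rbrakk>
       \<Longrightarrow> TMor C X Y X' Y' (f + g) f' = TMor C X Y X' Y' f f' + TMor C X Y X' Y' g f'"
    and tmor_add_right:
      "\<lbrakk>X \<in> Obj C; Y \<in> Obj C; X' \<in> Obj C; Y' \<in> Obj C;
        f \<in> Hom C X Y; f' \<in> Hom C X' Y'; g' \<in> Hom C X' Y'\<rbrakk>
       \<Longrightarrow> TMor C X Y X' Y' f (f' + g') = TMor C X Y X' Y' f f' + TMor C X Y X' Y' f g'"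
    and tmor_scal_left:
      "\<lbrakk>X \<in> Obj C; Y \<in> Obj C; X' \<in> Obj C; Y' \<in> Obj C; f \<in> Hom C X Y; f' \<in> Hom C X' Y'\<rbrakk>
       \<Longrightarrow> TMor C X Y X' Y' (Scal C c f) f' = Scal C c (TMor C X Y X' Y' f f')"
    and tmor_scal_right:
      "\<lbrakk>X \<in> Obj C; Y \<in> Obj C; X' \<in> Obj C; Y' \<in> Obj C; f \<in> Hom C X Y; f' \<in> Hom C X' Y'\<rbrakk>
       \<Longrightarrow> TMor C X Y X' Y' f (Scal C c f') = Scal C c (TMor C X Y X' Y' f f')"
    and assoc_iso:
      "\<lbrakk>X \<in> Obj C; Y \<in> Obj C; Z \<in> Obj C\<rbrakk>
       \<Longrightarrow> iso_arrow C (TObj C (TObj C X Y) Z) (TObj C X (TObj C Y Z)) (Assoc C X Y Z)"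
    and assoc_natural:
      "\<lbrakk>X \<in> Obj C; Y \<in> Obj C; Z \<in> Obj C; X' \<in> Obj C; Y' \<in> Obj C; Z' \<in> Obj C;
        f \<in> Hom C X X'; g \<in> Hom C Y Y'; h \<in> Hom C Z Z'\<rbrakk>
       \<Longrightarrow> Comp C (TObj C (TObj C X Y) Z) (TObj C (TObj C X' Y') Z') (TObj C X' (TObj C Y' Z'))
             (Assoc C X' Y' Z')
             (TMor C (TObj C X Y) (TObj C X' Y') Z Z' (TMor C X X' Y Y' f g) h) =
           Comp C (TObj C (TObj C X Y) Z) (TObj C X (TObj C Y Z)) (TObj C X' (TObj C Y' Z'))
             (TMor C X X' (TObj C Y Z) (TObj C Y' Z') f (TMor C Y Y' Z Z' g h))
             (Assoc C X Y Z)"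
    and lunit_iso: "X \<in> Obj C \<Longrightarrow> iso_arrow C (TObj C (Unit C) X) X (LUnit C X)"
    and lunit_natural:
      "\<lbrakk>X \<in> Obj C; Y \<in> Obj C; f \<in> Hom C X Y\<rbrakk>
       \<Longrightarrow> Comp C (TObj C (Unit C) X) (TObj C (Unit C) Y) Y (LUnit C Y)
             (TMor C (Unit C) (Unit C) X Y (Ident C (Unit C)) f) =
           Comp C (TObj C (Unit C) X) X Y f (LUnit C X)"
    and runit_iso: "X \<in> Obj C \<Longrightarrow> iso_arrow C (TObj C X (Unit C)) X (RUnit C X)"
    and runit_natural:
      "\<lbrakk>X \<in> Obj C; Y \<in> Obj C; f \<in> Hom C X Y\<rbrakk>
       \<Longrightarrow> Comp C (TObj C X (Unit C)) (TObj C Y (Unit C)) Y (RUnit C Y)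
             (TMor C X Y (Unit C) (Unit C) f (Ident C (Unit C))) =
           Comp C (TObj C X (Unit C)) X Y f (RUnit C X)"
    and pentagon:
      "\<lbrakk>W \<in> Obj C; X \<in> Obj C; Y \<in> Obj C; Z \<in> Obj C\<rbrakk>
       \<Longrightarrow> Comp C (TObj C (TObj C (TObj C W X) Y) Z) (TObj C (TObj C W X) (TObj C Y Z))
                  (TObj C W (TObj C X (TObj C Y Z)))
             (Assoc C W X (TObj C Y Z)) (Assoc C (TObj C W X) Y Z) =
           Comp C (TObj C (TObj C (TObj C W X) Y) Z) (TObj C W (TObj C (TObj C X Y) Z))
                  (TObj C W (TObj C X (TObj C Y Z)))
             (TMor C W W (TObj C (TObj C X Y) Z) (TObj C X (TObj C Y Z))
                (Ident C W) (Assoc C X Y Z))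
             (Comp C (TObj C (TObj C (TObj C W X) Y) Z) (TObj C (TObj C W (TObj C X Y)) Z)
                     (TObj C W (TObj C (TObj C X Y) Z))
                (Assoc C W (TObj C X Y) Z)
                (TMor C (TObj C (TObj C W X) Y) (TObj C W (TObj C X Y)) Z Z
                   (Assoc C W X Y) (Ident C Z)))"
    and triangle:
      "\<lbrakk>X \<in> Obj C; Y \<in> Obj C\<rbrakk>
       \<Longrightarrow> Comp C (TObj C (TObj C X (Unit C)) Y) (TObj C X (TObj C (Unit C) Y)) (TObj C X Y)
             (TMor C X X (TObj C (Unit C) Y) Y (Ident C X) (LUnit C Y))
             (Assoc C X (Unit C) Y) =
           TMor C (TObj C X (Unit C)) X Y Y (RUnit C X) (Ident C Y)"

text \<open>\<open>is_left_dual C X D\<close>: there are \<open>ev : D \<otimes> X \<rightarrow> 1\<close> and \<open>coev : 1 \<rightarrow> X \<otimes> D\<close> satisfying the two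
  zigzag identities. They are stated as equations of morphisms \<open>1 \<otimes> X \<rightarrow> X\<close> and \<open>D \<otimes> 1 \<rightarrow> D\<close>;
  \<open>a'\<close> is the inverse of the associator.\<close>

definition is_left_dual :: "('o, 'm) moncat \<Rightarrow> 'o \<Rightarrow> 'o \<Rightarrow> bool" where
  "is_left_dual C X D \<longleftrightarrow> X \<in> Obj C \<and> D \<in> Obj C \<and>
     (\<exists>ev\<in>Hom C (TObj C D X) (Unit C). \<exists>coev\<in>Hom C (Unit C) (TObj C X D). \<exists>a'.
        inverse_arrows C (TObj C (TObj C D X) D) (TObj C D (TObj C X D)) (Assoc C D X D) a' \<and>
        Comp C (TObj C (Unit C) X) (TObj C X (Unit C)) X (RUnit C X)
          (Comp C (TObj C (Unit C) X) (TObj C X (TObj C D X)) (TObj C X (Unit C))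
             (TMor C X X (TObj C D X) (Unit C) (Ident C X) ev)
             (Comp C (TObj C (Unit C) X) (TObj C (TObj C X D) X) (TObj C X (TObj C D X))
                (Assoc C X D X)
                (TMor C (Unit C) (TObj C X D) X X coev (Ident C X)))) = LUnit C X \<and>
        Comp C (TObj C D (Unit C)) (TObj C (Unit C) D) D (LUnit C D)
          (Comp C (TObj C D (Unit C)) (TObj C (TObj C D X) D) (TObj C (Unit C) D)
             (TMor C (TObj C D X) (Unit C) D D ev (Ident C D))
             (Comp C (TObj C D (Unit C)) (TObj C D (TObj C X D)) (TObj C (TObj C D X) D)
                a'
                (TMor C D D (Unit C) (TObj C X D) (Ident C D) coev))) = RUnit C D)"

definition iso_class :: "('o, 'm) moncat \<Rightarrow> 'o \<Rightarrow> 'o set" where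
  "iso_class C X = {Y \<in> Obj C. isomorphic C X Y}"

definition simple_classes :: "('o, 'm::ab_group_add) moncat \<Rightarrow> 'o set set" where
  "simple_classes C = {iso_class C X | X. simple_object C X}"

locale fusion_category =
  semisimple_category C + linear_monoidal_category C for C :: "('o, 'm::ab_group_add) moncat" +
  assumes has_left_dual: "X \<in> Obj C \<Longrightarrow> \<exists>D. is_left_dual C X D"
    and has_right_dual: "X \<in> Obj C \<Longrightarrow> \<exists>D. is_left_dual C D X"
    and simple_unit: "simple_object C (Unit C)"
    and finite_simple_classes: "finite (simple_classes C)"
    and finite_dim_hom:
      "\<lbrakk>X \<in> Obj C; Y \<in> Obj C\<rbrakk> \<Longrightarrow> \<exists>B. finite B \<and> span B = Hom C X Y"


section \<open>Fusion rings and categorification\<close>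

text \<open>A ring with a distinguished \<open>\<int>\<close>-basis, given by its structure constants
  \<open>[a] [b] = (\<Sum>c. Coeff a b c [c])\<close>.\<close>

record 'b based_ring =
  Basis :: "'b set"
  Coeff :: "'b \<Rightarrow> 'b \<Rightarrow> 'b \<Rightarrow> nat"
  One :: 'b
  Star :: "'b \<Rightarrow> 'b"

locale fusion_ring =
  fixes R :: "'b based_ring"
  assumes finite_basis: "finite (Basis R)"
    and one_basis: "One R \<in> Basis R"
    and star_basis: "a \<in> Basis R \<Longrightarrow> Star R a \<in> Basis R"
    and one_left: "\<lbrakk>a \<in> Basis R; b \<in> Basis R\<rbrakk> \<Longrightarrow> Coeff R (One R) a b = (if a = b then 1 else 0)"
    and one_right: "\<lbrakk>a \<in> Basis R; b \<in> Basis R\<rbrakk> \<Longrightarrow> Coeff R a (One R) b = (if a = b then 1 else 0)"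
    and assoc:
      "\<lbrakk>a \<in> Basis R; b \<in> Basis R; c \<in> Basis R; e \<in> Basis R\<rbrakk>
       \<Longrightarrow> (\<Sum>x\<in>Basis R. Coeff R a b x * Coeff R x c e) =
           (\<Sum>x\<in>Basis R. Coeff R b c x * Coeff R a x e)"
    and star_star: "a \<in> Basis R \<Longrightarrow> Star R (Star R a) = a"
    and star_coeff:
      "\<lbrakk>a \<in> Basis R; b \<in> Basis R; c \<in> Basis R\<rbrakk>
       \<Longrightarrow> Coeff R (Star R b) (Star R a) (Star R c) = Coeff R a b c"
    and coeff_one:
      "\<lbrakk>a \<in> Basis R; b \<in> Basis R\<rbrakk> \<Longrightarrow> Coeff R a b (One R) = (if b = Star R a then 1 else 0)"

definition based_ring_iso :: "('a \<Rightarrow> 'b) \<Rightarrow> 'a based_ring \<Rightarrow> 'b based_ring \<Rightarrow> bool" where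
  "based_ring_iso \<phi> R R' \<longleftrightarrow> bij_betw \<phi> (Basis R) (Basis R') \<and>
     (\<forall>a\<in>Basis R. \<forall>b\<in>Basis R. \<forall>c\<in>Basis R. Coeff R' (\<phi> a) (\<phi> b) (\<phi> c) = Coeff R a b c) \<and>
     \<phi> (One R) = One R' \<and>
     (\<forall>a\<in>Basis R. \<phi> (Star R a) = Star R' (\<phi> a))"

text \<open>The basis consists of the isomorphism classes of simple objects; \<open>Coeff a b c\<close> is the number of
  summands in the class \<open>c\<close> in a decomposition of \<open>X \<otimes> Y\<close> into simple objects, for \<open>X\<close> in \<open>a\<close> and \<open>Y\<close>
  in \<open>b\<close>.\<close>

definition grothendieck_ring :: "('o, 'm::ab_group_add) moncat \<Rightarrow> 'o set based_ring" where
  "grothendieck_ring C = \<lparr>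
     Basis = simple_classes C,
     Coeff = (\<lambda>a b c. THE n. \<exists>X\<in>a. \<exists>Y\<in>b. \<exists>Zs. (\<forall>Z\<in>set Zs. simple_object C Z) \<and>
       direct_sum C Zs (TObj C X Y) \<and> n = length (filter (\<lambda>Z. Z \<in> c) Zs)),
     One = iso_class C (Unit C),
     Star = (\<lambda>a. {D. \<exists>X\<in>a. is_left_dual C X D})\<rparr>"

definition categorifies :: "('o, 'm::ab_group_add) moncat \<Rightarrow> 'b based_ring \<Rightarrow> bool" where
  "categorifies C R \<longleftrightarrow> fusion_category C \<and> (\<exists>\<phi>. based_ring_iso \<phi> (grothendieck_ring C) R)"

datatype 'g izumi = Grp 'g | Rho

fun izumi_coeff :: "('g::{ab_group_add,finite}) izumi \<Rightarrow> 'g izumi \<Rightarrow> 'g izumi \<Rightarrow> nat" where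
  "izumi_coeff (Grp g) (Grp h) c = (if c = Grp (g + h) then 1 else 0)"
| "izumi_coeff (Grp g) Rho c = (if c = Rho then 1 else 0)"
| "izumi_coeff Rho (Grp g) c = (if c = Rho then 1 else 0)"
| "izumi_coeff Rho Rho Rho = CARD('g)"
| "izumi_coeff Rho Rho (Grp g) = 1"

fun izumi_star :: "('g::ab_group_add) izumi \<Rightarrow> 'g izumi" where
  "izumi_star (Grp g) = Grp (- g)"
| "izumi_star Rho = Rho"

definition izumi_ring :: "('g::{ab_group_add,finite}) izumi based_ring" where
  "izumi_ring = \<lparr>Basis = UNIV, Coeff = izumi_coeff, One = Grp 0, Star = izumi_star\<rparr>"

lemma fusion_ring_izumi_ring: "fusion_ring (izumi_ring :: ('g::{ab_group_add,finite}) izumi based_ring)"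
proof -
  have U: "(UNIV :: 'g izumi set) = insert Rho (range Grp)"
    by (auto intro: izumi.exhaust)
  have fin: "finite (UNIV :: 'g izumi set)"
    by (subst U) simp
  have sum: "(\<Sum>x\<in>UNIV. f x) = f Rho + (\<Sum>g\<in>UNIV. f (Grp g))" for f :: "'g izumi \<Rightarrow> nat"
    by (subst U, subst sum.insert) (auto simp: sum.reindex inj_on_def)
  have delta: "(\<Sum>g\<in>UNIV. if e = g + b then f g else 0) = f (e - b)"
    "(\<Sum>g\<in>UNIV. if e = b + g then f g else 0) = f (e - b)" for e b :: 'g and f :: "'g \<Rightarrow> nat"
  proof -
    have "e = g + b \<longleftrightarrow> g = e - b" "e = b + g \<longleftrightarrow> g = e - b" for g
      by (auto simp: algebra_simps)
    then show "(\<Sum>g\<in>UNIV. if e = g + b then f g else 0) = f (e - b)"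
      "(\<Sum>g\<in>UNIV. if e = b + g then f g else 0) = f (e - b)"
      by simp_all
  qed
  have assoc: "(\<Sum>x\<in>UNIV. izumi_coeff a b x * izumi_coeff x c e) =
      (\<Sum>x\<in>UNIV. izumi_coeff b c x * izumi_coeff a x e)" for a b c e :: "'g izumi"
    unfolding sum
    by (cases a; cases b; cases c; cases e)
      (auto simp: if_distrib[where f = "\<lambda>x. x * _"] if_distrib[where f = "\<lambda>x. _ * x"]
        delta algebra_simps cong: if_cong)
  have star: "izumi_star (izumi_star a) = a"
    "izumi_coeff (izumi_star b) (izumi_star a) (izumi_star c) = izumi_coeff a b c"
    "izumi_coeff a b (Grp 0) = (if b = izumi_star a then 1 else 0)"
    "izumi_coeff (Grp 0) a b = (if a = b then 1 else 0)"
    "izumi_coeff a (Grp 0) b = (if a = b then 1 else 0)" for a b c :: "'g izumi"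
    by (cases a; cases b; cases c; auto simp: algebra_simps eq_neg_iff_add_eq_0)+
  show ?thesis
    unfolding izumi_ring_def
    by unfold_locales (simp_all add: fin assoc star)
qed


section \<open>The Evans--Gannon construction\<close>

inductive_set compositions :: "('a \<Rightarrow> 'a) set \<Rightarrow> ('a \<Rightarrow> 'a) set" for \<E> where
  base: "\<sigma> \<in> \<E> \<Longrightarrow> \<sigma> \<in> compositions \<E>"
| comp: "\<sigma> \<in> compositions \<E> \<Longrightarrow> \<tau> \<in> compositions \<E> \<Longrightarrow> \<sigma> \<circ> \<tau> \<in> compositions \<E>"

definition intertwiners ::
  "(('g::finite) leavitt \<Rightarrow> 'g leavitt) \<Rightarrow> ('g leavitt \<Rightarrow> 'g leavitt) \<Rightarrow> 'g leavitt set" where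
  "intertwiners \<sigma> \<tau> = {x. \<forall>y. x * \<sigma> y = \<tau> y * x}"

text \<open>Here \<open>\<beta>\<close> is the source of \<open>r\<close>; the target is not needed.\<close>

definition intertwiner_tensor ::
  "(('g::finite) leavitt \<Rightarrow> 'g leavitt) \<Rightarrow> 'g leavitt \<Rightarrow> 'g leavitt \<Rightarrow> 'g leavitt" where
  "intertwiner_tensor \<beta> r s = r * \<beta> s"

type_synonym 'g kobj = "'g leavitt \<times> ('g leavitt \<Rightarrow> 'g leavitt)"

definition karoubi_obj :: "(('g::finite) leavitt \<Rightarrow> 'g leavitt) set \<Rightarrow> 'g kobj set" where
  "karoubi_obj \<E> = {(p, \<beta>). \<beta> \<in> compositions \<E> \<and> p \<in> intertwiners \<beta> \<beta> \<and> p = p * p}"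

definition karoubi_hom :: "('g::finite) kobj \<Rightarrow> 'g kobj \<Rightarrow> 'g leavitt set" where
  "karoubi_hom X Y = {fst Y * x * fst X | x. x \<in> intertwiners (snd X) (snd Y)}"

definition karoubi_tensor :: "('g::finite) kobj \<Rightarrow> 'g kobj \<Rightarrow> 'g kobj" where
  "karoubi_tensor X Y = (intertwiner_tensor (snd X) (fst X) (fst Y), snd X \<circ> snd Y)"

text \<open>Formal direct sums are lists, the empty list being the zero object. A morphism from \<open>Xs\<close> to \<open>Ys\<close>
  is a \<open>length Ys \<times> length Xs\<close> matrix, encoded as a function on pairs of indices that vanishes outside
  this range. The summands of \<open>Xs \<otimes> Ys\<close> are in lexicographic order, so \<open>Xs ! i \<otimes> Ys ! k\<close> has index
  \<open>i * length Ys + k\<close>, and the tensor product is strictly associative and unital.\<close>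

definition ds_tensor :: "('g::finite) kobj list \<Rightarrow> 'g kobj list \<Rightarrow> 'g kobj list" where
  "ds_tensor Xs Ys = concat (map (\<lambda>X. map (karoubi_tensor X) Ys) Xs)"

definition ds_hom :: "('g::finite) kobj list \<Rightarrow> 'g kobj list \<Rightarrow> (nat \<Rightarrow> nat \<Rightarrow> 'g leavitt) set" where
  "ds_hom Xs Ys = {A. \<forall>i j. if i < length Ys \<and> j < length Xs
     then A i j \<in> karoubi_hom (Xs ! j) (Ys ! i) else A i j = 0}"

definition ds_ident :: "('g::finite) kobj list \<Rightarrow> nat \<Rightarrow> nat \<Rightarrow> 'g leavitt" where
  "ds_ident Xs = (\<lambda>i j. if i < length Xs \<and> i = j then fst (Xs ! i) else 0)"

definition ds_tensor_mor ::
  "('g::finite) kobj list \<Rightarrow> 'g kobj list \<Rightarrow> 'g kobj list \<Rightarrow> 'g kobj list \<Rightarrow>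
   (nat \<Rightarrow> nat \<Rightarrow> 'g leavitt) \<Rightarrow> (nat \<Rightarrow> nat \<Rightarrow> 'g leavitt) \<Rightarrow> nat \<Rightarrow> nat \<Rightarrow> 'g leavitt" where
  "ds_tensor_mor Xs Ys Xs' Ys' A B = (\<lambda>i j.
     if i < length Ys * length Ys' \<and> j < length Xs * length Xs'
     then intertwiner_tensor (snd (Xs ! (j div length Xs')))
            (A (i div length Ys') (j div length Xs')) (B (i mod length Ys') (j mod length Xs'))
     else 0)"

definition evans_gannon ::
  "(('g::finite) leavitt \<Rightarrow> 'g leavitt) set \<Rightarrow> ('g kobj list, nat \<Rightarrow> nat \<Rightarrow> 'g leavitt) moncat" where
  "evans_gannon \<E> = \<lparr>
     Obj = {Xs. set Xs \<subseteq> karoubi_obj \<E>},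
     Hom = ds_hom,
     Ident = ds_ident,
     Comp = (\<lambda>Xs Ys Zs B A. \<lambda>i k. \<Sum>j<length Ys. B i j * A j k),
     Scal = (\<lambda>c A. \<lambda>i j. c *\<^sub>L A i j),
     TObj = ds_tensor,
     TMor = ds_tensor_mor,
     Unit = [(1, id)],
     Assoc = (\<lambda>Xs Ys Zs. ds_ident (ds_tensor Xs (ds_tensor Ys Zs))),
     LUnit = ds_ident,
     RUnit = ds_ident\<rparr>"

end

theory Submission
  imports Defs
begin

text \<open>Taking Fourier transforms of the pentagon identity in one variable shows that \<open>E\<close> has no zeros,
  that its Fourier transform is \<open>\<lambda> \<langle>x\<rangle> E(x)\<close>, and how \<open>E\<close> behaves under reflection. With these identities the
  images of the generators under \<open>\<rho>\<close> satisfy the Leavitt relations, and comparing coefficients on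
  generators gives \<open>\<rho>(\<rho>(x)) = \<Sum>g. S\<^sub>g \<alpha>\<^sub>g(x) S\<^sub>g' + \<Sum>g. T\<^sub>g \<rho>(x) T\<^sub>g'\<close>; so \<open>\<rho> \<circ> \<rho>\<close> is the sum of all
  \<open>\<alpha>\<^sub>g\<close> and of \<open>N\<close> copies of \<open>\<rho>\<close>, whereas \<open>\<alpha>\<^sub>g \<circ> \<rho> = \<rho>\<close> and \<open>\<rho> \<circ> \<alpha>\<^sub>g\<close> is conjugate to \<open>\<rho>\<close> by \<open>U\<^sub>g\<close>.

  An intertwiner \<open>x\<close> between two of the endomorphisms \<open>\<alpha>\<^sub>g\<close>, \<open>\<rho>\<close> is an eigenvector of a compression such as
  \<open>x \<mapsto> S\<^sub>a' x S\<^sub>b\<close>. Iterated compressions of any element end up in the span of powers of one \<open>S\<^sub>a'\<close> and one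
  \<open>S\<^sub>b\<close>, which forces \<open>x\<close> to be a scalar, and to be zero if the endomorphisms differ. Hence the
  \<open>\<alpha>\<^sub>g\<close> and \<open>\<rho>\<close> satisfy Schur's lemma and the identity of every object is a sum of morphisms factoring
  through them. Every morphism \<open>f\<close> is then von Neumann regular (\<open>f g f = f\<close> for some \<open>g\<close>), which gives kernels and
  cokernels and makes the category semisimple abelian with these simple objects; its fusion rules and duals are read off from
  the decompositions above.\<close>

section \<open>Gauss sums and Fourier transforms on metric groups\<close>

text \<open>The Leavitt algebra carries neither an involution nor a norm here, so positivity cannot
  supply semisimplicity or Schur's lemma. Finiteness replaces it: an element is a finite combination
  of words in S, T followed by words in S', T', and d \<noteq> 1 keeps the eigenvalue 1 / d
  belonging to \<rho> apart from the eigenvalue 1 of the identity. Identities are tested by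
  coefficients: S'_a and T'_a, and equally their images under \<rho>, detect every element by left
  multiplication. The hardest test compares \<rho>(\<rho>(T_g)) T_c with T_c \<rho>(T_g). Its
  components require, in turn, a Gauss sum with a transform of E, the autocorrelation of E, and the
  full pentagon identity, whose constant term is exactly what cancels the contribution of the
  S-part. On the numerical side the obstacle is a degenerate branch on which q and E would be
  constant off 0; for |G| > 4 the size of a Gauss sum excludes it, for |G| \<le> 4 the extra
  quadratic condition on E(0) does.\<close>

lemma sum_shift:
  fixes f :: "'g::{ab_group_add,finite} \<Rightarrow> 'a::comm_monoid_add"
  shows "(\<Sum>x\<in>UNIV. f (x + a)) = sum f UNIV" "(\<Sum>x\<in>UNIV. f (a + x)) = sum f UNIV"
    "(\<Sum>x\<in>UNIV. f (x - a)) = sum f UNIV" "(\<Sum>x\<in>UNIV. f (a - x)) = sum f UNIV"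
    "(\<Sum>x\<in>UNIV. f (- x)) = sum f UNIV"
proof -
  show "(\<Sum>x\<in>UNIV. f (x + a)) = sum f UNIV"
    by (rule sum.reindex_bij_witness[of _ "\<lambda>x. x - a" "\<lambda>x. x + a"]) simp_all
  then show "(\<Sum>x\<in>UNIV. f (a + x)) = sum f UNIV"
    by (simp add: add.commute)
  show "(\<Sum>x\<in>UNIV. f (x - a)) = sum f UNIV"
    by (rule sum.reindex_bij_witness[of _ "\<lambda>x. x + a" "\<lambda>x. x - a"]) simp_all
  show "(\<Sum>x\<in>UNIV. f (a - x)) = sum f UNIV"
    by (rule sum.reindex_bij_witness[of _ "\<lambda>x. a - x" "\<lambda>x. a - x"]) simp_all
  show "(\<Sum>x\<in>UNIV. f (- x)) = sum f UNIV"
    by (rule sum.reindex_bij_witness[of _ uminus uminus]) simp_all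
qed

lemma sum_single:
  fixes f :: "'g::finite \<Rightarrow> 'a::comm_monoid_add"
  assumes "\<And>x. x \<noteq> a \<Longrightarrow> f x = 0"
  shows "sum f UNIV = f a"
  using sum.mono_neutral_right[of UNIV "{a}" f] assms by simp

text \<open>\<open>\<nu>\<close> is the square root of the order \<open>N\<close>. Both are
  parameters, so that rewriting treats them as atoms linked by \<open>nu_square\<close>.\<close>

locale metric_grp =
  fixes q :: "'g::{ab_group_add,finite} \<Rightarrow> complex" and \<nu> N :: complex
  assumes metric_group: "metric_group q"
    and nu_def: "\<nu> = sqrt_card TYPE('g)" and N_def: "N = of_nat CARD('g)"
begin

abbreviation b where "b \<equiv> bichar q"
definition gauss_sum :: complex where "gauss_sum = (\<Sum>x\<in>UNIV. q x)"

lemma q_nz [simp]: "q x \<noteq> 0"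
  using metric_group by (simp add: metric_group_def)

lemma b_nz [simp]: "b x y \<noteq> 0"
  by (simp add: bichar_def)

lemma q_minus [simp]: "q (- x) = q x"
  using metric_group unfolding metric_group_def by metis

lemma b_add_left: "b (x + y) z = b x z * b y z"
  and b_add_right: "b x (y + z) = b x y * b x z"
  using metric_group by (auto simp: metric_group_def)

lemma b_commute: "b x y = b y x"
  by (simp add: bichar_def add.commute)

lemma b_zero [simp]: "b 0 x = 1" "b x 0 = 1"
  using b_add_left[of 0 0 x] b_add_right[of x 0 0] by simp_all

lemma b_minus_left: "b (- x) y = inverse (b x y)"
  using b_add_left[of x "- x" y] by (simp add: inverse_eq_divide eq_divide_eq mult.commute)

lemma b_minus_right: "b x (- y) = inverse (b x y)"
  by (metis b_commute b_minus_left)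

lemma b_diff_left: "b (x - y) z = b x z / b y z"
  using b_add_left[of x "- y" z] by (simp add: b_minus_left divide_inverse)

lemma b_diff_right: "b x (y - z) = b x y / b x z"
  using b_add_right[of x y "- z"] by (simp add: b_minus_right divide_inverse)

lemma q_add: "q (x + y) = q x * q y * b x y"
  by (simp add: bichar_def field_simps)

lemma q_zero [simp]: "q 0 = 1"
  using q_add[of 0 0] by simp

lemma q_diff: "q (x - y) = q x * q y / b x y"
  using q_add[of x "- y"] by (simp add: b_minus_right divide_inverse)

lemma b_self: "b x x = (q x)\<^sup>2"
  using q_add[of x "- x"] by (simp add: b_minus_right field_simps power2_eq_square)

lemmas bq = b_add_left b_add_right b_minus_left b_minus_right b_diff_left b_diff_right
  q_add q_diff b_self

lemma N_nz [simp]: "N \<noteq> 0"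
  by (simp add: N_def)

lemma nu_square: "\<nu> * \<nu> = N" "\<nu>\<^sup>2 = N"
  by (simp_all add: nu_def N_def sqrt_card_def power2_eq_square flip: of_real_mult)

lemma nu_nz [simp]: "\<nu> \<noteq> 0"
  using nu_square N_nz by (metis mult_eq_0_iff)

lemma orthogonality: "(\<Sum>x\<in>UNIV. b x y) = (if y = 0 then N else 0)"
proof (cases "y = 0")
  case False
  then obtain x0 where x0: "b x0 y \<noteq> 1"
    using metric_group unfolding metric_group_def by blast
  have "(\<Sum>x\<in>UNIV. b x y) = (\<Sum>x\<in>UNIV. b (x0 + x) y)"
    by (simp add: sum_shift(2)[of "\<lambda>x. b x y"])
  also have "\<dots> = b x0 y * (\<Sum>x\<in>UNIV. b x y)"
    by (simp add: b_add_left sum_distrib_left)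
  finally show ?thesis
    using x0 False by simp
qed (simp add: N_def)

lemma orthogonality': "(\<Sum>x\<in>UNIV. b y x) = (if y = 0 then N else 0)"
  using orthogonality[of y] by (simp add: b_commute[of y])

text \<open>Completing the square: \<open>q x * b x y = q (x + y) / q y\<close>, after which the sum
  is translated.\<close>

lemma gauss_sum_twist: "(\<Sum>x\<in>UNIV. q x * b x y) = gauss_sum / q y"
proof -
  have "(\<Sum>x\<in>UNIV. q x * b x y) = (\<Sum>x\<in>UNIV. q (x + y) / q y)"
    by (simp add: q_add)
  also have "\<dots> = gauss_sum / q y"
    using sum_shift(1)[of q y] by (simp add: gauss_sum_def flip: sum_divide_distrib)
  finally show ?thesis .
qed

lemma fourier_sum: "(\<Sum>x\<in>UNIV. f x * b x y) = \<nu> * fourier q f (- y)"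
  by (simp add: fourier_def flip: nu_def)

lemma fourier_sum_minus: "(\<Sum>x\<in>UNIV. f x * b x (- y)) = \<nu> * fourier q f y"
  by (simp add: fourier_def flip: nu_def)

lemma fourier_fourier: "fourier q (fourier q f) x = f (- x)"
proof -
  have "fourier q (fourier q f) x =
      (\<Sum>y\<in>UNIV. \<Sum>z\<in>UNIV. f z * b z (- y) * b y (- x)) / N"
    by (simp add: fourier_def nu_def[symmetric] sum_distrib_left sum_distrib_right sum_divide_distrib mult.assoc
        nu_square flip: times_divide_eq_right)
  also have "\<dots> = (\<Sum>z\<in>UNIV. f z * (\<Sum>y\<in>UNIV. b y (- z - x))) / N"
    by (subst sum.swap) (simp add: sum_distrib_left bq b_commute field_simps)
  also have "\<dots> = f (- x)"
    unfolding orthogonality by (subst sum_single[of "- x"]) auto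
  finally show ?thesis .
qed

text \<open>The difference is a multiple of the delta function at 0, whose transform is constant.
  This serves formulas for \<open>E\<close> that are at first known only off 0.\<close>

lemma fourier_cong_0:
  assumes "\<And>x. x \<noteq> 0 \<Longrightarrow> f x = g x"
  shows "fourier q f y = fourier q g y + (f 0 - g 0) / \<nu>"
proof -
  have "(\<Sum>x\<in>UNIV. f x * b x (- y)) - (\<Sum>x\<in>UNIV. g x * b x (- y)) = f 0 - g 0"
    unfolding sum_subtractf[symmetric] using assms by (subst sum_single[of 0]) auto
  then have "(\<Sum>x\<in>UNIV. f x * b x (- y)) = (\<Sum>x\<in>UNIV. g x * b x (- y)) + (f 0 - g 0)"
    by (simp add: algebra_simps)
  then show ?thesis
    by (simp add: fourier_def distrib_left flip: nu_def)
qed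

end

section \<open>Finite quantum dilogarithms\<close>

locale pentagon_fn = metric_grp q \<nu> N for q :: "'g::{ab_group_add,finite} \<Rightarrow> complex" and \<nu> N +
  fixes E :: "'g \<Rightarrow> complex" and C :: complex
  assumes C_nz: "C \<noteq> 0"
    and pentagon: "b x y * E x * E y = C + 1 / \<nu> * (\<Sum>z\<in>UNIV. E (y - z) * E z * q z * E (x - z))"
    and small: "CARD('g) \<le> 4 \<Longrightarrow> (E 0)\<^sup>2 = \<nu> * E 0 + 1"
begin

section \<open>The pentagon identity transformed in one variable; absence of zeros\<close>

abbreviation Ehat where "Ehat \<equiv> fourier q E"

text \<open>The transform of the factor \<open>E (x - z)\<close> in \<open>x\<close> is
  \<open>\<nu> * b z (- u) * Ehat u\<close>; \<open>F\<close> is what remains of the pentagon sum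
  once \<open>\<nu> * Ehat u\<close> is taken out.\<close>

definition F where "F y u = (\<Sum>z\<in>UNIV. E (y - z) * E z * q z * b z (- u))"

lemma sum_E_b: "(\<Sum>x\<in>UNIV. E (x - z) * b x (- u)) = \<nu> * b z (- u) * Ehat u"
proof -
  have "(\<Sum>x\<in>UNIV. E (x - z) * b x (- u)) = (\<Sum>x\<in>UNIV. E x * b (x + z) (- u))"
    using sum_shift(1)[of "\<lambda>x. E (x - z) * b x (- u)" z] by simp
  also have "\<dots> = b z (- u) * (\<Sum>x\<in>UNIV. E x * b x (- u))"
    by (simp add: b_add_left sum_distrib_left mult_ac)
  finally show ?thesis
    by (simp add: fourier_def flip: nu_def)
qed

text \<open>On the left the factor \<open>b x y\<close> shifts the frequency from \<open>u\<close>
  to \<open>u - y\<close>. On the right the convolution with \<open>E\<close> becomes the factor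
  \<open>Ehat u\<close>, and the constant \<open>C\<close> survives at frequency 0 alone.\<close>

lemma pentagon_fourier:
  "E y * Ehat (u - y) = (if u = 0 then C * \<nu> else 0) + 1 / \<nu> * Ehat u * F y u"
proof -
  have "(\<Sum>x\<in>UNIV. b x y * E x * E y * b x (- u)) =
      (\<Sum>x\<in>UNIV. (C + 1 / \<nu> * (\<Sum>z\<in>UNIV. E (y - z) * E z * q z * E (x - z))) * b x (- u))"
    by (simp only: pentagon)
  moreover have "(\<Sum>x\<in>UNIV. b x y * E x * E y * b x (- u)) = \<nu> * E y * Ehat (u - y)"
    by (simp add: fourier_def nu_def[symmetric] sum_distrib_left bq field_simps)
  moreover have "(\<Sum>x\<in>UNIV. (C + 1 / \<nu> * (\<Sum>z\<in>UNIV. E (y - z) * E z * q z * E (x - z))) * b x (- u)) =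
     C * (\<Sum>x\<in>UNIV. b x (- u)) +
     1 / \<nu> * (\<Sum>x\<in>UNIV. \<Sum>z\<in>UNIV. E (y - z) * E z * q z * (E (x - z) * b x (- u)))"
    by (simp add: sum_distrib_left sum_distrib_right sum.distrib distrib_right mult.assoc)
  moreover have "(\<Sum>x\<in>UNIV. \<Sum>z\<in>UNIV. E (y - z) * E z * q z * (E (x - z) * b x (- u))) =
      (\<Sum>z\<in>UNIV. E (y - z) * E z * q z * (\<Sum>x\<in>UNIV. E (x - z) * b x (- u)))"
    by (subst sum.swap) (simp add: sum_distrib_left)
  moreover have "\<dots> = \<nu> * Ehat u * F y u"
    by (simp add: sum_E_b F_def sum_distrib_left mult_ac)
  ultimately have "\<nu> * E y * Ehat (u - y) = (if u = 0 then C * N else 0) + Ehat u * F y u"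
    by (simp add: orthogonality)
  then show ?thesis
    using nu_square(1) by (auto simp: field_simps split: if_splits)
qed

text \<open>The substitution of \<open>y - z\<close> for \<open>z\<close> exchanges the two factors
  \<open>E\<close>. It is the symmetry that couples the transformed equations at the frequencies
  \<open>u\<close> and \<open>y - u\<close>.\<close>

lemma F_reflect: "F y u = q y * b y (- u) * F y (y - u)"
proof -
  have "F y u = (\<Sum>z\<in>UNIV. E z * E (y - z) * q (y - z) * b (y - z) (- u))"
    using sum_shift(4)[of "\<lambda>z. E (y - z) * E z * q z * b z (- u)" y] by (simp add: F_def)
  also have "\<dots> = q y * b y (- u) * F y (y - u)"
    unfolding F_def sum_distrib_left
    by (rule sum.cong) (simp_all add: bq b_commute[of y] field_simps)
  finally show ?thesis .
qed

lemma Ehat_0_nz: "Ehat 0 \<noteq> 0"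
  using pentagon_fourier[of 0 0] C_nz by auto

text \<open>At \<open>u = 0\<close> only \<open>F y 0\<close> can balance the nonzero constant
  \<open>C\<close>; reflection carries the nonvanishing to \<open>F y y\<close>, and the equation at
  \<open>u = y\<close> then forces the conclusion.\<close>

lemma Ehat_zero_of_E_zero:
  assumes "y \<noteq> 0" "E y = 0" shows "Ehat y = 0"
proof -
  have "F y 0 \<noteq> 0"
    using pentagon_fourier[of y 0] assms C_nz by (auto simp: field_simps)
  then have "F y y \<noteq> 0"
    using F_reflect[of y 0] by auto
  then show ?thesis
    using pentagon_fourier[of y y] assms by (auto simp: field_simps)
qed

lemma E_zero_of_Ehat_zero:
  assumes "y \<noteq> 0" "Ehat y = 0" shows "E x = 0 \<or> Ehat (y - x) = 0"
  using pentagon_fourier[of x y] assms by auto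

text \<open>The complement of the zero set (with 0 adjoined) is closed under addition, which makes every
  term of the pentagon sum at a zero vanish, so that the constant \<open>C\<close> would vanish as well.\<close>

lemma E_nz_of_nz:
  assumes "y \<noteq> 0" shows "E y \<noteq> 0"
proof
  assume Ey: "E y = 0"
  define A where "A = {x. x = 0 \<or> E x \<noteq> 0}"
  have A: "x + x' \<in> A" if "x \<in> A" "x' \<in> A" for x x'
  proof (rule ccontr)
    assume "x + x' \<notin> A"
    then have nz: "x + x' \<noteq> 0" "E (x + x') = 0"
      by (auto simp: A_def)
    with that have "x \<noteq> 0" "x' \<noteq> 0"
      by (auto simp: A_def)
    moreover have "Ehat x' = 0 \<Longrightarrow> E x' = 0"
      using E_zero_of_Ehat_zero[OF \<open>x' \<noteq> 0\<close>, of x'] Ehat_0_nz by simp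
    ultimately show False
      using E_zero_of_Ehat_zero[OF nz(1) Ehat_zero_of_E_zero[OF nz], of x] that
      by (auto simp: A_def)
  qed
  have "E (y - z) * E z = 0" for z
    using A[of z "y - z"] Ey assms by (auto simp: A_def)
  then have "(\<Sum>z\<in>UNIV. E (y - z) * E z * q z * E (y - z)) = 0"
    by (intro sum.neutral) auto
  then show False
    using pentagon[of y y] Ey C_nz by simp
qed

lemma Ehat_nz: "Ehat y \<noteq> 0"
  using E_zero_of_Ehat_zero[of y y] E_nz_of_nz[of y] Ehat_0_nz by (cases "y = 0") auto

text \<open>For \<open>y = u - w\<close> the transformed equations at \<open>u\<close> and at
  \<open>y - u = - w\<close> involve the same \<open>F\<close> up to reflection; eliminating it and
  cancelling \<open>E y\<close> shows that \<open>Ehat u * Ehat (- u) / q u\<close> is the same for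
  all nonzero \<open>u\<close>.\<close>

lemma Ehat_reflect_aux:
  assumes "u \<noteq> 0" "w \<noteq> 0" "u \<noteq> w"
  shows "Ehat w * Ehat (- w) * q u = Ehat u * Ehat (- u) * q w"
proof -
  define y where "y = u - w"
  have y: "E y \<noteq> 0" "u - y = w" "y - u = - w" "u = y + w"
    using assms by (auto simp: y_def intro!: E_nz_of_nz)
  have 1: "\<nu> * E y * Ehat w = Ehat u * F y u" "\<nu> * E y * Ehat (- u) = Ehat (- w) * F y (- w)"
    using pentagon_fourier[of y u] pentagon_fourier[of y "y - u"] assms y(2,3)
    by (auto simp: field_simps)
  have 2: "F y u = q y * b y (- u) * F y (- w)"
    using F_reflect[of y u] y(3) by simp
  have "\<nu> * E y * Ehat w * Ehat (- w) = \<nu> * E y * (q y * b y (- u) * Ehat u * Ehat (- u))"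
    using 1 2 by algebra
  then have "Ehat w * Ehat (- w) = q y * b y (- u) * Ehat u * Ehat (- u)"
    using y(1) by simp
  moreover have "q y * b y (- u) * q u = q w"
    unfolding y(4) by (simp add: bq b_commute field_simps power2_eq_square)
  ultimately show ?thesis
    by algebra
qed

section \<open>Reflection constants and the determination of the value at 0\<close>

context
  fixes e :: 'g
  assumes e: "e \<noteq> 0"
begin

text \<open>By \<open>Ehat_reflect_aux\<close> the value is independent of \<open>e\<close>. The
  constants of this context measure the distance from the expected shape: the aim is
  \<open>t = E 0\<close> and \<open>eps = 1\<close>, after which \<open>mu\<close> is the eigenvalue
  \<open>dilog_lambda q E\<close>.\<close>

definition kappa where "kappa = Ehat e * Ehat (- e) / q e"
definition mu where "mu = (kappa - (Ehat 0)\<^sup>2) / (C * \<nu>)"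
definition eps where "eps = kappa / mu\<^sup>2"
definition t where "t = Ehat 0 / mu"

lemma Ehat_reflect: "u \<noteq> 0 \<Longrightarrow> Ehat u * Ehat (- u) = kappa * q u"
  using Ehat_reflect_aux[of e u] e by (cases "u = e") (auto simp: kappa_def field_simps)

text \<open>By reflection the equations at \<open>u = y\<close> and at \<open>u = 0\<close> contain
  the same unknown \<open>h\<close>. Eliminating it and inserting \<open>Ehat_reflect\<close> makes
  \<open>Ehat y\<close> proportional to \<open>q y * E y\<close> with a factor independent of
  \<open>y\<close>.\<close>

lemma Ehat_aux: "y \<noteq> 0 \<Longrightarrow> C * \<nu> * Ehat y = E y * q y * (kappa - (Ehat 0)\<^sup>2)"
proof -
  assume y: "y \<noteq> 0"
  define h where "h = 1 / \<nu> * F y y"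
  have "E y * Ehat 0 = Ehat y * h" "E y * Ehat (- y) = C * \<nu> + Ehat 0 * q y * h"
    using pentagon_fourier[of y y] pentagon_fourier[of y 0] F_reflect[of y 0] y
    by (simp_all add: h_def)
  then have "E y * (Ehat (- y) * Ehat y) = C * \<nu> * Ehat y + Ehat 0 * q y * (E y * Ehat 0)"
    by algebra
  then show ?thesis
    using Ehat_reflect[OF y] by (simp add: algebra_simps power2_eq_square)
qed

lemma mu_nz: "mu \<noteq> 0"
  using Ehat_aux[OF e] C_nz Ehat_nz[of e] by (auto simp: mu_def)

lemma Ehat_mu: "y \<noteq> 0 \<Longrightarrow> Ehat y = mu * q y * E y"
  using Ehat_aux[of y] C_nz by (auto simp: mu_def field_simps)

lemma E_reflect: "u \<noteq> 0 \<Longrightarrow> E u * E (- u) * q u = eps"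
  using Ehat_reflect[of u] Ehat_mu[of u] Ehat_mu[of "- u"] mu_nz
  by (simp add: eps_def field_simps power2_eq_square)

lemma eps_nz: "eps \<noteq> 0"
  using E_reflect[OF e] E_nz_of_nz[OF e] E_nz_of_nz[of "- e"] e by auto

text \<open>Off 0 the summand \<open>E (- z) * E z * q z\<close> is constantly \<open>eps\<close>,
  which leaves a character sum and a correction from \<open>z = 0\<close>.\<close>

lemma F_0: "F 0 u = (if u = 0 then eps * N else 0) + (E 0)\<^sup>2 - eps"
proof -
  have "F 0 u - (\<Sum>z\<in>UNIV. eps * b z (- u)) = (E 0)\<^sup>2 - eps"
    unfolding F_def sum_subtractf[symmetric]
    by (subst sum_single[of 0]) (auto simp: E_reflect[symmetric] power2_eq_square)
  moreover have "(\<Sum>z\<in>UNIV. eps * b z (- u)) = (if u = 0 then eps * N else 0)"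
    by (simp add: orthogonality flip: sum_distrib_left)
  ultimately show ?thesis
    by (simp add: algebra_simps split: if_splits)
qed

lemma E_0_square: "(E 0)\<^sup>2 = \<nu> * E 0 + eps"
proof -
  have "Ehat e * ((E 0)\<^sup>2 - \<nu> * E 0 - eps) = 0"
    using pentagon_fourier[of 0 e] e by (simp add: F_0 field_simps)
  then have "(E 0)\<^sup>2 - \<nu> * E 0 - eps = 0"
    using Ehat_nz[of e] by (metis mult_eq_0_iff)
  then show ?thesis
    by algebra
qed

lemma C_eq: "C = - Ehat 0 * eps"
proof -
  have "E 0 * Ehat 0 = C * \<nu> + 1 / \<nu> * Ehat 0 * (eps * N + \<nu> * E 0)"
    using pentagon_fourier[of 0 0] by (simp add: F_0 E_0_square)
  then have "N * (C + Ehat 0 * eps) = 0"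
    using nu_square(1) by (simp add: field_simps)
  then have "C + Ehat 0 * eps = 0"
    using N_nz by (metis mult_eq_0_iff)
  then show ?thesis
    by algebra
qed

lemma Ehat_0: "Ehat 0 = mu * t"
  using mu_nz by (simp add: t_def)

lemma t_nz: "t \<noteq> 0"
  using Ehat_nz[of 0] by (auto simp: Ehat_0)

text \<open>Compared with \<open>E_0_square\<close>, this is the same quadratic once
  \<open>eps = 1\<close>. Whether \<open>t\<close> is the root \<open>E 0\<close> or the other one
  is the remaining difficulty.\<close>

lemma t_square: "t\<^sup>2 = eps * (\<nu> * t + 1)"
proof -
  have "kappa = mu\<^sup>2 * eps"
    using mu_nz by (simp add: eps_def)
  moreover have "mu * C * \<nu> = kappa - (Ehat 0)\<^sup>2"
    using C_nz by (simp add: mu_def)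
  ultimately have "mu\<^sup>2 * (t\<^sup>2 - eps * (\<nu> * t + 1)) = 0"
    using C_eq Ehat_0 by algebra
  then have "t\<^sup>2 - eps * (\<nu> * t + 1) = 0"
    using mu_nz by (metis mult_eq_0_iff power2_eq_square)
  then show ?thesis
    by algebra
qed

lemma F_y_0: "F y 0 = \<nu> * t + (if y = 0 then N * eps + \<nu> * E 0 - \<nu> * t else 0)"
proof (cases "y = 0")
  case False
  then have "E y * Ehat 0 = 1 / \<nu> * Ehat y * F y y" "F y 0 = q y * F y y"
    using pentagon_fourier[of y y] F_reflect[of y 0] by simp_all
  then show ?thesis
    using False E_nz_of_nz[OF False] mu_nz by (simp add: Ehat_mu[OF False] Ehat_0 field_simps)
qed (simp add: F_0 E_0_square)

text \<open>\<open>F y 0\<close> is transformed in \<open>y\<close> in two ways: as a convolution of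
  \<open>E\<close> with \<open>q * E\<close> it becomes a product, and by \<open>F_y_0\<close> it is
  a constant plus a delta function. The transform of \<open>q * E\<close> is known by Fourier
  inversion up to the defect \<open>t - E 0\<close>. The resulting equation factors into the two
  alternatives.\<close>

lemma dichotomy:
  assumes "u \<noteq> 0" shows "t = E 0 \<or> mu * q u * E u = 1"
proof -
  define f where "f x = E x * q x" for x
  have Ehat: "Ehat x = mu * f x + (if x = 0 then mu * (t - E 0) else 0)" for x
    by (simp add: Ehat_mu f_def Ehat_0 algebra_simps)
  have "E (- u) = fourier q (\<lambda>x. mu * f x) u + mu * (t - E 0) / \<nu>"
    using fourier_cong_0[of Ehat "\<lambda>x. mu * f x" u] by (simp add: fourier_fourier Ehat)
  also have "fourier q (\<lambda>x. mu * f x) u = mu * fourier q f u"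
    by (simp add: fourier_def nu_def[symmetric] sum_distrib_left mult_ac)
  finally have f: "mu * fourier q f u = E (- u) - mu * (t - E 0) / \<nu>"
    by simp
  have "(\<Sum>y\<in>UNIV. F y 0 * b y (- u)) = (\<Sum>y\<in>UNIV. \<nu> * t * b y (- u)) + (N * eps + \<nu> * E 0 - \<nu> * t)"
  proof -
    have "(\<Sum>y\<in>UNIV. F y 0 * b y (- u)) - (\<Sum>y\<in>UNIV. \<nu> * t * b y (- u)) = N * eps + \<nu> * E 0 - \<nu> * t"
      unfolding sum_subtractf[symmetric]
      by (subst sum_single[of 0]) (auto simp: F_y_0 algebra_simps)
    then show ?thesis
      by (simp add: algebra_simps)
  qed
  moreover have "(\<Sum>y\<in>UNIV. F y 0 * b y (- u)) = (\<Sum>z\<in>UNIV. f z * (\<Sum>y\<in>UNIV. E (y - z) * b y (- u)))"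
    unfolding F_def sum_distrib_left sum_distrib_right f_def
    by (subst sum.swap) (simp add: mult_ac)
  moreover have "(\<Sum>z\<in>UNIV. f z * (\<Sum>y\<in>UNIV. E (y - z) * b y (- u))) = N * fourier q f u * Ehat u"
  proof -
    have "(\<Sum>z\<in>UNIV. f z * (\<Sum>y\<in>UNIV. E (y - z) * b y (- u))) = \<nu> * Ehat u * (\<Sum>z\<in>UNIV. f z * b z (- u))"
      unfolding sum_E_b sum_distrib_left by (simp add: mult_ac)
    then show ?thesis
      by (simp add: fourier_sum_minus nu_square(1)[symmetric])
  qed
  moreover have "(\<Sum>y\<in>UNIV. \<nu> * t * b y (- u)) = 0"
    using orthogonality[of "- u"] assms by (simp flip: sum_distrib_left)
  ultimately have "N * fourier q f u * Ehat u = N * eps + \<nu> * E 0 - \<nu> * t"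
    by simp
  then have "N * (mu * fourier q f u) * Ehat u = mu * (N * eps + \<nu> * E 0 - \<nu> * t)"
    by algebra
  then have "N * (E (- u) - mu * (t - E 0) / \<nu>) * (mu * q u * E u) = mu * (N * eps + \<nu> * E 0 - \<nu> * t)"
    by (simp add: f Ehat_mu[OF assms])
  moreover have "\<nu> * ((t - E 0) / \<nu>) = t - E 0"
    by simp
  ultimately have "mu * \<nu> * ((t - E 0) * (mu * q u * E u - 1)) = 0"
    using E_reflect[OF assms] nu_square(1) unfolding times_divide_eq_right[symmetric] by algebra
  then show ?thesis
    using mu_nz by auto
qed

text \<open>Otherwise \<open>dichotomy\<close> gives \<open>E u = 1 / (mu * q u)\<close> off 0, and
  reflection makes \<open>q\<close> equal to one constant \<open>w\<close> there. For small groups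
  the extra condition on \<open>E 0\<close> yields incompatible quadratics for \<open>mu\<close>;
  for larger ones the Gauss sum gives \<open>(N - 2) * w = - (w\<^sup>2 + 1)\<close> with
  \<open>norm w = 1\<close>, hence order at most 4.\<close>

lemma t_eq: "t = E 0"
proof (rule ccontr)
  assume t: "t \<noteq> E 0"
  define w where "w = 1 / (mu\<^sup>2 * eps)"
  have E: "E u = 1 / (mu * q u)" if "u \<noteq> 0" for u
    using dichotomy[OF that] t mu_nz by (auto simp: field_simps)
  have qw: "q u = w" if "u \<noteq> 0" for u
    using E_reflect[OF that] that mu_nz eps_nz by (simp add: E w_def field_simps power2_eq_square)
  show False
  proof (cases "CARD('g) \<le> 4")
    case True
    have E0: "(E 0)\<^sup>2 = \<nu> * E 0 + 1"
      using small True by simp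
    then have eps: "eps = 1"
      using E_0_square by simp
    have Emu: "E u = mu" if "u \<noteq> 0" for u
      using that mu_nz by (simp add: E qw w_def eps field_simps power2_eq_square)
    have Ehat1: "Ehat e = 1"
      using Ehat_mu[OF e] E[OF e] mu_nz by simp
    have "(\<Sum>x\<in>UNIV. E x * b x (- u)) = (\<Sum>x\<in>UNIV. mu * b x (- u)) + (E 0 - mu)" for u
    proof -
      have "(\<Sum>x\<in>UNIV. E x * b x (- u)) - (\<Sum>x\<in>UNIV. mu * b x (- u)) = E 0 - mu"
        unfolding sum_subtractf[symmetric] by (subst sum_single[of 0]) (auto simp: Emu)
      then show ?thesis
        by (simp add: algebra_simps)
    qed
    then have Ehat: "\<nu> * Ehat u = (if u = 0 then mu * N else 0) + E 0 - mu" for u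
      using orthogonality[of "- u"] by (simp add: fourier_def nu_def[symmetric] flip: sum_distrib_left)
    have E0mu: "E 0 = \<nu> + mu"
      using Ehat[of e] e Ehat1 by (simp add: algebra_simps)
    \<comment> \<open>With \<open>eps = 1\<close> both \<open>t\<close> and \<open>E 0\<close> are
      roots of the same quadratic; being distinct, they add up to \<open>\<nu>\<close>.\<close>
    have "(t - E 0) * (t + E 0 - \<nu>) = 0"
      using t_square E0 unfolding eps by algebra
    then have "t + E 0 - \<nu> = 0"
      using t by (metis mult_eq_0_iff right_minus_eq)
    then have "t = \<nu> - E 0"
      by algebra
    then have "t = - mu"
      using E0mu by simp
    moreover have "\<nu> * Ehat 0 = mu * N + E 0 - mu"
      using Ehat[of 0] by simp
    ultimately have "\<nu> * (mu * (- mu)) = \<nu> * (1 + \<nu> * mu)"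
      using Ehat_0 E0mu nu_square(1) by algebra
    then have "mu * (- mu) = 1 + \<nu> * mu"
      by (simp only: mult_cancel_left nu_nz simp_thms)
    then have "mu\<^sup>2 + \<nu> * mu + 1 = 0"
      by algebra
    moreover have "mu\<^sup>2 + \<nu> * mu = 1"
      using E0 E0mu by algebra
    ultimately show False
      by simp
  next
    case False
    have sum: "(\<Sum>x\<in>UNIV. q x * b x u) = (\<Sum>x\<in>UNIV. w * b x u) + (1 - w)" for u
    proof -
      have "(\<Sum>x\<in>UNIV. q x * b x u) - (\<Sum>x\<in>UNIV. w * b x u) = 1 - w"
        unfolding sum_subtractf[symmetric] by (subst sum_single[of 0]) (auto simp: qw)
      then show ?thesis
        by (simp add: algebra_simps)
    qed
    have w_sum: "(\<Sum>x\<in>UNIV. w * b x u) = (if u = 0 then w * N else 0)" for u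
      by (simp add: orthogonality flip: sum_distrib_left)
    \<comment> \<open>The Gauss sum twisted by \<open>e\<close> and the untwisted one, both computed
      from \<open>q\<close> being \<open>w\<close> off 0 and 1 at 0.\<close>
    have "gauss_sum / w = 1 - w" "gauss_sum = w * N + (1 - w)"
      using sum[of e] sum[of 0] e by (simp_all only: w_sum gauss_sum_twist qw[OF e]) auto
    moreover have "w \<noteq> 0"
      using qw[OF e] q_nz[of e] by simp
    ultimately have "w * (1 - w) = w * N + (1 - w)"
      by (simp add: field_simps)
    then have "(N - 2) * w = - (w\<^sup>2 + 1)"
      by algebra
    \<comment> \<open>\<open>q (e + e)\<close> is \<open>w ^ 4\<close> by bilinearity; it is also 1
      or \<open>w\<close> according to whether \<open>e + e\<close> vanishes. So \<open>w\<close> is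
      a root of unity.\<close>
    moreover have "norm w = 1"
    proof -
      have q2: "q (e + e) = w ^ 4"
        by (simp add: bq qw[OF e] power2_eq_square power4_eq_xxxx)
      have "w ^ 4 = 1 \<or> w ^ 3 = 1"
      proof (cases "e + e = 0")
        case True
        then show ?thesis using q2 by simp
      next
        case False
        then have "w * w ^ 3 = w * 1"
          using q2 qw[OF False] by (simp add: power4_eq_xxxx power3_eq_cube)
        then show ?thesis
          using qw[OF e] q_nz[of e] by simp
      qed
      then have "norm w ^ 4 = 1 \<or> norm w ^ 3 = 1"
        by (metis norm_one norm_power)
      then show ?thesis
        using power_eq_imp_eq_base[of "norm w" 4 1] power_eq_imp_eq_base[of "norm w" 3 1] by auto
    qed
    ultimately have "norm (N - 2) \<le> 2"
      using norm_triangle_ineq[of "w\<^sup>2" 1] by (metis mult.right_neutral norm_minus_cancel norm_mult norm_one norm_power one_add_one power_one)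
    moreover have "N - 2 = of_nat (CARD('g) - 2)"
      using False by (simp add: of_nat_diff N_def)
    ultimately show False
      using False by (simp only: norm_of_nat)
  qed
qed

lemma eps_eq: "eps = 1"
proof -
  have "\<nu> * t * (eps - 1) = 0"
    using t_square E_0_square t_eq by algebra
  then show ?thesis
    using t_nz by simp
qed

end

lemma dilog_facts:
  "E 0 \<noteq> 0 \<and> (E 0)\<^sup>2 = \<nu> * E 0 + 1 \<and>
    (\<forall>x. Ehat x = dilog_lambda q E * q x * E x) \<and>
    C = - dilog_lambda q E * E 0 \<and> dilog_lambda q E \<noteq> 0 \<and>
    (\<forall>x. E x * E (- x) * q x = 1 + (if x = 0 then \<nu> * E 0 else 0)) \<and>
    (\<forall>y. (\<Sum>z\<in>UNIV. E (y - z) * E z * q z) = \<nu> * E 0 + (if y = 0 then N else 0))"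
proof (cases "\<exists>e::'g. e \<noteq> 0")
  case True
  then obtain e :: 'g where e: "e \<noteq> 0" by blast
  note t = t_eq[OF e] and eps = eps_eq[OF e]
  have E0: "E 0 \<noteq> 0"
    using t_nz[OF e] t by simp
  have lam: "dilog_lambda q E = mu e"
    using Ehat_0[OF e] E0 by (simp add: dilog_lambda_def t)
  have sq: "(E 0)\<^sup>2 = \<nu> * E 0 + 1"
    using E_0_square[OF e] eps by simp
  have "Ehat x = mu e * q x * E x" for x
    using Ehat_mu[OF e, of x] Ehat_0[OF e] t by (cases "x = 0") auto
  moreover have "E x * E (- x) * q x = 1 + (if x = 0 then \<nu> * E 0 else 0)" for x
    using E_reflect[OF e, of x] eps sq by (auto simp: power2_eq_square)
  moreover have "(\<Sum>z\<in>UNIV. E (y - z) * E z * q z) = \<nu> * E 0 + (if y = 0 then N else 0)" for y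
    using F_y_0[OF e, of y] t eps by (auto simp: F_def)
  ultimately show ?thesis
    using E0 sq mu_nz[OF e] C_eq[OF e] Ehat_0[OF e] t eps lam by simp
next
  case False
  \<comment> \<open>The trivial group offers no nonzero \<open>e\<close>; there the condition
    imposed for small groups provides the quadratic equation for \<open>E 0\<close>.\<close>
  then have all: "x = 0" for x :: 'g by blast
  then have U: "(UNIV :: 'g set) = {0}" by auto
  then have card: "CARD('g) = 1"
    by (metis card_1_singleton_iff One_nat_def)
  have nu: "\<nu> = 1" "N = 1"
    by (simp_all add: nu_def N_def sqrt_card_def card)
  have sum: "sum f UNIV = f 0" for f :: "'g \<Rightarrow> complex"
    by (simp add: U)
  have sq: "(E 0)\<^sup>2 = E 0 + 1"
    using small card nu by simp
  then have E0: "E 0 \<noteq> 0"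
    by auto
  have Ehat0: "Ehat 0 = E 0"
    by (simp add: fourier_def sum nu flip: nu_def)
  have C: "C = - E 0"
    using pentagon[of 0 0] sq by (simp add: sum nu) algebra
  have "Ehat x = E x" "E x * E (- x) * q x = 1 + E 0" "x = 0" for x
    using all[of x] Ehat0 sq by (auto simp: power2_eq_square)
  then show ?thesis
    using sq E0 C Ehat0 all by (auto simp: dilog_lambda_def sum nu power2_eq_square) (metis all q_zero)+
qed

end

section \<open>Numerical identities for the dilogarithm, its eigenvalue and the dimension\<close>

locale dilogarithm = metric_grp q \<nu> N for q :: "'g::{ab_group_add,finite} \<Rightarrow> complex" and \<nu> N +
  fixes E :: "'g \<Rightarrow> complex" and s d \<mu> :: complex
  assumes fqd: "finite_quantum_dilogarithm q E"
    and d_def: "d = dilog_d E" and s_square: "s\<^sup>2 = d" and lam_def: "\<mu> = dilog_lambda q E"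
begin

lemma
  shows E_0_nz: "E 0 \<noteq> 0"
    and E_0_square: "(E 0)\<^sup>2 = \<nu> * E 0 + 1"
    and fourier_E: "fourier q E x = \<mu> * q x * E x"
    and lam_nz [simp]: "\<mu> \<noteq> 0"
    and E_reflect: "E x * E (- x) * q x = 1 + (if x = 0 then \<nu> * E 0 else 0)"
    and E_conv: "(\<Sum>z\<in>UNIV. E (y - z) * E z * q z) = \<nu> * E 0 + (if y = 0 then N else 0)"
    and pentagon: "(\<Sum>z\<in>UNIV. E (y - z) * E z * q z * E (x - z)) = \<nu> * (b x y * E x * E y + \<mu> * E 0)"
proof -
  obtain C where "C \<noteq> 0"
    and C: "\<forall>x y. b x y * E x * E y = C + 1 / \<nu> * (\<Sum>z\<in>UNIV. E (y - z) * E z * q z * E (x - z))"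
    and small: "CARD('g) \<le> 4 \<longrightarrow> (E 0)\<^sup>2 = \<nu> * E 0 + 1"
    using fqd unfolding finite_quantum_dilogarithm_def nu_def by blast
  then interpret pentagon_fn q \<nu> N E C
    by unfold_locales auto
  note facts = dilog_facts[folded lam_def]
  show "E 0 \<noteq> 0" "(E 0)\<^sup>2 = \<nu> * E 0 + 1" "fourier q E x = \<mu> * q x * E x" "\<mu> \<noteq> 0"
    "E x * E (- x) * q x = 1 + (if x = 0 then \<nu> * E 0 else 0)"
    "(\<Sum>z\<in>UNIV. E (y - z) * E z * q z) = \<nu> * E 0 + (if y = 0 then N else 0)"
    using facts by blast+
  show "(\<Sum>z\<in>UNIV. E (y - z) * E z * q z * E (x - z)) = \<nu> * (b x y * E x * E y + \<mu> * E 0)"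
    using C[rule_format, of x y] facts by (simp add: field_simps)
qed

lemma E_0_eq: "E 0 = - \<nu> / d"
  using E_0_nz by (simp add: d_def dilog_d_def field_simps flip: nu_def)

lemma d_nz [simp]: "d \<noteq> 0"
  using E_0_nz E_0_eq by auto

lemma s_nz [simp]: "s \<noteq> 0"
  using s_square by auto

lemma s_times_s: "s * s = d"
  using s_square by (simp add: power2_eq_square)

lemma d_square: "d\<^sup>2 = N * (d + 1)"
proof -
  have "d * E 0 = - \<nu>"
    by (simp add: E_0_eq)
  then have "N = d\<^sup>2 * (\<nu> * E 0 + 1)"
    using E_0_square nu_square(2) by algebra
  also have "\<dots> = d\<^sup>2 - d * N"
    using \<open>d * E 0 = - \<nu>\<close> nu_square(2) by algebra
  finally show ?thesis
    by algebra
qed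

text \<open>\<open>1 / d\<close> is the eigenvalue by which \<rho> is told apart from the identity
  in \<open>compress_eigen\<close>. The value 1 would give \<open>2 * N = 1\<close>, impossible by
  parity.\<close>

lemma d_neq_1: "d \<noteq> 1"
proof
  assume "d = 1"
  then have "of_nat (2 * CARD('g)) = (of_nat 1 :: complex)"
    using d_square by (simp add: N_def mult.commute)
  then show False
    by (simp only: of_nat_eq_iff) presburger
qed

lemma fourier_qE: "fourier q (\<lambda>x. q x * E x) x = E (- x) / \<mu>"
proof -
  have "fourier q E = (\<lambda>x. \<mu> * q x * E x)"
    by (simp add: fourier_E fun_eq_iff)
  then have "E (- x) = fourier q (\<lambda>x. \<mu> * q x * E x) x"
    using fourier_fourier[of E x] by simp
  also have "\<dots> = \<mu> * fourier q (\<lambda>x. q x * E x) x"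
    by (simp add: fourier_def sum_distrib_left mult_ac)
  finally show ?thesis
    by simp
qed

lemma sum_E: "(\<Sum>x\<in>UNIV. E x * b x y) = \<nu> * \<mu> * q y * E (- y)"
  using fourier_sum[of E y] by (simp add: fourier_E)

lemma sum_qE: "(\<Sum>x\<in>UNIV. q x * E x * b x y) = \<nu> * E y / \<mu>"
  using fourier_sum[of "\<lambda>x. q x * E x" y] by (simp add: fourier_qE)

text \<open>The sum of \<open>q x * E x\<close> is evaluated twice: directly, and by writing
  \<open>E x\<close> as a transform of \<open>q * E\<close> and carrying out the Gauss sum over
  \<open>x\<close> first, which returns the sum of \<open>E\<close>.\<close>

lemma gauss_lambda: "\<mu> ^ 3 * gauss_sum = \<nu>"
proof -
  have "\<nu> * (\<nu> * E 0 / \<mu>) = \<nu> * (\<Sum>x\<in>UNIV. q x * E x)"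
    using sum_qE[of 0] by simp
  also have "\<dots> = \<mu> * (\<Sum>x\<in>UNIV. q x * (\<nu> * E x / \<mu>))"
    by (simp add: sum_distrib_left mult_ac)
  also have "\<dots> = \<mu> * (\<Sum>x\<in>UNIV. q x * (\<Sum>z\<in>UNIV. q z * E z * b z x))"
    by (simp add: sum_qE)
  also have "\<dots> = \<mu> * (\<Sum>z\<in>UNIV. q z * E z * (\<Sum>x\<in>UNIV. q x * b x z))"
    unfolding sum_distrib_left by (subst sum.swap) (simp add: b_commute mult_ac)
  also have "\<dots> = \<mu> * gauss_sum * (\<Sum>z\<in>UNIV. E z)"
    by (simp add: gauss_sum_twist sum_distrib_left mult_ac)
  also have "(\<Sum>z\<in>UNIV. E z) = \<nu> * \<mu> * E 0"
    using sum_E[of 0] by simp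
  finally have "\<nu> * E 0 * (\<mu> ^ 3 * gauss_sum) = \<nu> * E 0 * \<nu>"
    by (auto simp: field_simps power3_eq_cube)
  then show ?thesis
    using E_0_nz by simp
qed

text \<open>A Parseval computation: \<open>E (z + m)\<close> is expanded in characters, the sum over
  \<open>z\<close> produces \<open>E u * E (- u) * q u\<close>, and this is 1 off 0. What remains is
  a twisted Gauss sum and the excess \<open>\<nu> * E 0\<close> at 0.\<close>

lemma E_correlation:
  "(\<Sum>z\<in>UNIV. E z * E (z + m)) = \<mu>\<^sup>2 * (gauss_sum / q m + \<nu> * E 0)"
proof -
  have "E (z + m) = (1 / \<nu>) * (\<Sum>u\<in>UNIV. \<mu> * q u * E u * b u (z + m))" for z
    using sum_qE[of "z + m"] by (simp add: mult.assoc flip: sum_distrib_left)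
  then have "(\<Sum>z\<in>UNIV. E z * E (z + m)) =
      (\<Sum>z\<in>UNIV. \<Sum>u\<in>UNIV. 1 / \<nu> * \<mu> * q u * E u * b u m * (E z * b z u))"
    by (simp add: sum_distrib_left b_add_right b_commute mult_ac)
  also have "\<dots> = (\<Sum>u\<in>UNIV. 1 / \<nu> * \<mu> * q u * E u * b u m * (\<Sum>z\<in>UNIV. E z * b z u))"
    by (subst sum.swap) (simp add: sum_distrib_left)
  also have "\<dots> = \<mu>\<^sup>2 * (\<Sum>u\<in>UNIV. q u * b u m * (E u * E (- u) * q u))"
    by (simp add: sum_E sum_distrib_left power2_eq_square mult_ac)
  also have "(\<Sum>u\<in>UNIV. q u * b u m * (E u * E (- u) * q u)) = gauss_sum / q m + \<nu> * E 0"
  proof -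
    have "(\<Sum>u\<in>UNIV. q u * b u m * (E u * E (- u) * q u)) - (\<Sum>u\<in>UNIV. q u * b u m) = \<nu> * E 0"
      unfolding sum_subtractf[symmetric] E_reflect by (subst sum_single[of 0]) (auto simp: algebra_simps)
    then show ?thesis
      by (simp add: gauss_sum_twist algebra_simps)
  qed
  finally show ?thesis .
qed

end

section \<open>The Leavitt algebra\<close>

interpretation lvs: vector_space "(*\<^sub>L) :: complex \<Rightarrow> ('g::finite) leavitt \<Rightarrow> 'g leavitt"
  by (rule vector_space_lscale)

text \<open>A single index set for all 2N generators, so that the compression arguments apply to S
  and T alike and to any pair of them.\<close>

fun up :: "bool \<times> 'g \<Rightarrow> ('g::finite) leavitt" where
  "up (True, g) = LS g"
| "up (False, g) = LT g"

fun dn :: "bool \<times> 'g \<Rightarrow> ('g::finite) leavitt" where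
  "dn (True, g) = LS' g"
| "dn (False, g) = LT' g"

lemma sum_bool_pair:
  "(\<Sum>i\<in>UNIV. f i) = (\<Sum>g\<in>UNIV. f (True, g)) + (\<Sum>g\<in>UNIV. f (False, g))"
  for f :: "bool \<times> 'g::finite \<Rightarrow> 'a::comm_monoid_add"
  using sum.cartesian_product[of "\<lambda>x y. f (x, y)" UNIV UNIV, unfolded UNIV_Times_UNIV] by (simp add: UNIV_bool add.commute)

lemma dn_up: "dn i * up j = (if i = j then 1 else 0)"
  by (cases i rule: dn.cases; cases j rule: up.cases) (auto simp: leavitt_relations)

lemma dn_up_assoc: "dn i * (up j * x) = (if i = j then x else 0)"
  by (simp add: dn_up flip: mult.assoc)

lemma sum_up_dn: "(\<Sum>i\<in>UNIV. up i * dn i) = (1 :: ('g::finite) leavitt)"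
  using leavitt_relations(5) by (simp add: sum_bool_pair)

lemma leavitt_expand_left: "x = (\<Sum>i\<in>UNIV. up i * (dn i * x))"
  by (simp add: sum_up_dn flip: mult.assoc sum_distrib_right)

lemma leavitt_eqI:
  assumes "\<And>a. LS' a * x = LS' a * y" "\<And>a. LT' a * x = LT' a * y"
  shows "x = y"
proof -
  have "dn i * x = dn i * y" for i
    using assms by (cases i rule: dn.cases) auto
  then show ?thesis
    using leavitt_expand_left[of x] leavitt_expand_left[of y] by simp
qed

subsection \<open>Non-triviality\<close>

text \<open>The algebra acts on functions of infinite sequences of letters: \<open>up i\<close> strips a leading \<open>i\<close>
  from the argument and \<open>dn i\<close> prepends it.\<close>

fun seq_act :: "'g lgen \<Rightarrow> ((nat \<Rightarrow> bool \<times> 'g) \<Rightarrow> complex) \<Rightarrow> (nat \<Rightarrow> bool \<times> 'g) \<Rightarrow> complex" where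
  "seq_act (GenS g) f = (\<lambda>\<omega>. if \<omega> 0 = (True, g) then f (\<lambda>n. \<omega> (Suc n)) else 0)"
| "seq_act (GenT g) f = (\<lambda>\<omega>. if \<omega> 0 = (False, g) then f (\<lambda>n. \<omega> (Suc n)) else 0)"
| "seq_act (GenS' g) f = (\<lambda>\<omega>. f (case_nat (True, g) \<omega>))"
| "seq_act (GenT' g) f = (\<lambda>\<omega>. f (case_nat (False, g) \<omega>))"

definition word_act where "word_act w f = foldr seq_act (letters w) f"

definition free_act :: "'g lfree \<Rightarrow> ((nat \<Rightarrow> bool \<times> 'g) \<Rightarrow> complex) \<Rightarrow> (nat \<Rightarrow> bool \<times> 'g) \<Rightarrow> complex" where
  "free_act p f = (\<lambda>\<omega>. \<Sum>w\<in>Poly_Mapping.keys p. Poly_Mapping.lookup p w * word_act w f \<omega>)"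

lemma free_act_superset:
  assumes "finite A" "Poly_Mapping.keys p \<subseteq> A"
  shows "free_act p f \<omega> = (\<Sum>w\<in>A. Poly_Mapping.lookup p w * word_act w f \<omega>)"
  unfolding free_act_def using assms
  by (intro sum.mono_neutral_left) (auto simp: in_keys_iff)

lemma free_act_add: "free_act (p + r) f \<omega> = free_act p f \<omega> + free_act r f \<omega>"
proof -
  let ?A = "Poly_Mapping.keys p \<union> Poly_Mapping.keys r"
  have "Poly_Mapping.keys (p + r) \<subseteq> ?A"
    by (rule Poly_Mapping.keys_add)
  then show ?thesis
    by (simp add: free_act_superset[of ?A] lookup_add distrib_right sum.distrib)
qed

lemma free_act_zero: "free_act 0 f \<omega> = 0"
  by (simp add: free_act_def)

lemma free_act_sum: "free_act (\<Sum>i\<in>I. p i) f \<omega> = (\<Sum>i\<in>I. free_act (p i) f \<omega>)"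
  by (induction I rule: infinite_finite_induct) (auto simp: free_act_add free_act_zero)

lemma free_act_single: "free_act (Poly_Mapping.single w c) f \<omega> = c * word_act w f \<omega>"
  by (simp add: free_act_superset[of "{w}"])

lemma seq_act_sum: "seq_act l (\<lambda>\<omega>. \<Sum>i\<in>I. c i * f i \<omega>) = (\<lambda>\<omega>. \<Sum>i\<in>I. c i * seq_act l (f i) \<omega>)"
  by (cases l) (auto simp: fun_eq_iff)

lemma word_act_sum: "word_act w (\<lambda>\<omega>. \<Sum>i\<in>I. c i * f i \<omega>) = (\<lambda>\<omega>. \<Sum>i\<in>I. c i * word_act w (f i) \<omega>)"
proof -
  have "foldr seq_act ls (\<lambda>\<omega>. \<Sum>i\<in>I. c i * f i \<omega>) = (\<lambda>\<omega>. \<Sum>i\<in>I. c i * foldr seq_act ls (f i) \<omega>)" for ls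
    by (induction ls) (simp_all add: seq_act_sum)
  then show ?thesis
    by (simp add: word_act_def)
qed

lemma word_act_add: "word_act (u + w) f = word_act u (word_act w f)"
  by (simp add: word_act_def plus_lword_def)

lemma free_act_mult: "free_act (p * r) f = free_act p (free_act r f)"
proof
  fix \<omega>
  let ?s = "\<lambda>p. \<Sum>w\<in>Poly_Mapping.keys p. Poly_Mapping.single w (Poly_Mapping.lookup p w)"
  have "free_act (?s p * ?s r) f \<omega> = free_act p (free_act r f) \<omega>"
    unfolding free_act_def[of p] free_act_def[of r] word_act_sum
    by (simp only: sum_product free_act_sum mult_single free_act_single word_act_add)
      (simp only: sum_distrib_left mult.assoc)
  then show "free_act (p * r) f \<omega> = free_act p (free_act r f) \<omega>"
    by (simp only: lfree_sum_single[symmetric])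
qed

lemma free_act_gen: "free_act (free_gen l) f = seq_act l f"
  by (auto simp: free_gen_def free_act_single word_act_def fun_eq_iff)

lemma free_act_one: "free_act 1 f = f"
  using free_act_single[of 0 1 f] by (simp add: word_act_def fun_eq_iff) (simp add: zero_lword_def)

lemma free_act_minus: "free_act (p - r) f \<omega> = free_act p f \<omega> - free_act r f \<omega>"
  using free_act_add[of "p - r" r f \<omega>] by simp

lemma case_nat_tail: "case_nat (\<omega> 0) (\<lambda>n. \<omega> (Suc n)) = \<omega>"
  by (auto simp: fun_eq_iff split: nat.split)

lemma sum_delta_pair:
  fixes c :: "bool \<times> 'g::finite"
  shows "(\<Sum>g\<in>UNIV. if c = (True, g) then f g else 0) + (\<Sum>g\<in>UNIV. if c = (False, g) then f' g else 0) =
    (if fst c then f (snd c) else (f' (snd c) :: complex))"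
  by (cases c; cases "fst c") auto

lemma free_act_relator: "r \<in> leavitt_relators \<Longrightarrow> free_act r f \<omega> = 0" for r :: "('g::finite) lfree"
proof -
  have *: "(\<Sum>g\<in>UNIV. if \<omega> 0 = (True, g) then f (case_nat (True, g) (\<lambda>n. \<omega> (Suc n))) else 0) +
    (\<Sum>g\<in>UNIV. if \<omega> 0 = (False, g) then f (case_nat (False, g) (\<lambda>n. \<omega> (Suc n))) else 0) = f \<omega>"
    using case_nat_tail[of \<omega>] by (subst sum_delta_pair) (metis (full_types) prod.collapse)
  show "r \<in> leavitt_relators \<Longrightarrow> free_act r f \<omega> = 0"
    unfolding leavitt_relators_def
    by (auto simp: free_act_minus free_act_mult free_act_gen free_act_one free_act_zero free_act_add
        free_act_sum *)
qed

lemma free_act_0: "free_act p (\<lambda>_. 0) \<omega> = 0"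
proof -
  have "word_act w (\<lambda>_. 0) = (\<lambda>_. 0)" for w :: "'a lword"
    using word_act_sum[of w "\<lambda>_::nat. 0" "\<lambda>_ _. 0" "{}"] by simp
  then show ?thesis
    by (simp add: free_act_def)
qed

lemma free_act_ideal: "x \<in> leavitt_ideal \<Longrightarrow> free_act x f \<omega> = 0"
proof (induction arbitrary: f \<omega> rule: leavitt_ideal.induct)
  case (step r x a b)
  have "free_act r (free_act b f) = (\<lambda>_. 0)"
    using free_act_relator[OF step(1)] by auto
  then show ?case
    by (simp add: free_act_add free_act_mult mult.assoc step.IH free_act_0)
qed (simp add: free_act_zero)

text \<open>The ideal annihilates every function, while 1 fixes the constant function 1. This is
  what keeps the identities of the simple objects from being zero.\<close>

lemma leavitt_one_neq_zero: "(1 :: ('g::finite) leavitt) \<noteq> 0"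
proof
  assume "(1 :: 'g leavitt) = 0"
  then have "(1 :: 'g lfree) - 0 \<in> leavitt_ideal"
    by transfer
  from free_act_ideal[OF this, of "\<lambda>_. 1"] show False
    by (simp add: free_act_one)
qed

subsection \<open>Compression by generators\<close>

definition upw :: "(bool \<times> 'g) list \<Rightarrow> ('g::finite) leavitt" where "upw u = prod_list (map up u)"
text \<open>The reversal makes \<open>dnw u\<close> the left inverse of
  \<open>upw u\<close>.\<close>

definition dnw :: "(bool \<times> 'g) list \<Rightarrow> ('g::finite) leavitt" where "dnw u = prod_list (map dn (rev u))"

definition monomials :: "('g::finite) leavitt set" where "monomials = {upw u * dnw v | u v. True}"

text \<open>Left multiplication by a generator respects the span: \<open>up i\<close> lengthens the
  first word, \<open>dn i\<close> strips its first letter or kills the monomial, and if the first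
  word is empty it lengthens the second.\<close>

lemma span_monomials: "lvs.span monomials = (UNIV :: ('g::finite) leavitt set)"
proof -
  have step: "leavitt_gen l * x \<in> lvs.span monomials" if "x \<in> lvs.span monomials" for l and x :: "'g leavitt"
    using that
  proof (induction rule: lvs.span_induct_alt)
    case (step c x y)
    then obtain u v where x: "x = upw u * dnw v"
      by (auto simp: monomials_def)
    have "leavitt_gen l * x \<in> lvs.span monomials"
    proof (cases "\<exists>i. leavitt_gen l = up i")
      case True
      then obtain i where "leavitt_gen l * x = upw (i # u) * dnw v"
        by (auto simp: x upw_def mult.assoc)
      then show ?thesis
        by (intro lvs.span_base) (auto simp: monomials_def)
    next
      case False
      then obtain i where i: "leavitt_gen l = dn i"
        by (cases l) (metis up.simps dn.simps)+
      show ?thesis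
      proof (cases u)
        case Nil
        then have "leavitt_gen l * x = upw [] * dnw (v @ [i])"
          by (simp add: x i upw_def dnw_def)
        then show ?thesis
          by (intro lvs.span_base) (auto simp: monomials_def)
      next
        case (Cons j u')
        then have "leavitt_gen l * x = (if i = j then upw u' * dnw v else 0)"
          by (simp add: x i upw_def mult.assoc dn_up_assoc)
        then show ?thesis
          by (auto simp: monomials_def intro: lvs.span_base lvs.span_zero)
      qed
    qed
    then show ?case
      using step by (simp add: distrib_left lscale_mult_right lvs.span_add lvs.span_scale)
  qed (simp add: lvs.span_zero)
  have word: "leavitt_word leavitt_gen w \<in> lvs.span (monomials :: 'g leavitt set)" for w
  proof -
    have "1 \<in> lvs.span (monomials :: 'g leavitt set)"
      by (intro lvs.span_base) (auto simp: monomials_def upw_def dnw_def intro!: exI[of _ "[]"])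
    then have "prod_list (map leavitt_gen ls) \<in> lvs.span (monomials :: 'g leavitt set)" for ls
      by (induction ls) (auto intro: step)
    then show ?thesis
      by (simp add: leavitt_word_def)
  qed
  have "x \<in> lvs.span monomials" for x :: "'g leavitt"
  proof -
    have "eval_free leavitt_gen (rep_leavitt x) \<in> lvs.span monomials"
      unfolding eval_free_def by (intro lvs.span_sum lvs.span_scale word)
    then show ?thesis
      by (metis abs_rep_leavitt abs_leavitt_eq_eval_free)
  qed
  then show ?thesis
    by auto
qed

lemma dn_power_upw:
  "length u \<le> n \<Longrightarrow> dn a ^ n * upw u = (if set u \<subseteq> {a} then dn a ^ (n - length u) else 0)"
proof (induction u arbitrary: n)
  case (Cons i u)
  then obtain m where n: "n = Suc m"
    by (cases n) auto
  have "dn a ^ n * upw (i # u) = dn a ^ m * (if a = i then upw u else 0)"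
    unfolding n upw_def power_Suc2 by (simp add: mult.assoc dn_up_assoc)
  then show ?case
    using Cons.IH[of m] Cons.prems by (cases "a = i") (simp_all add: n)
qed (simp add: upw_def)

lemma dnw_power_up:
  "length v \<le> n \<Longrightarrow> dnw v * up a ^ n = (if set v \<subseteq> {a} then up a ^ (n - length v) else 0)"
proof (induction v arbitrary: n)
  case (Cons i v)
  then obtain m where n: "n = Suc m"
    by (cases n) auto
  have "dnw (i # v) * up a ^ n = dnw v * (if i = a then up a ^ m else 0)"
    unfolding n dnw_def power_Suc by (simp add: mult.assoc dn_up_assoc)
  then show ?case
    using Cons.IH[of m] Cons.prems by (cases "i = a") (simp_all add: n)
qed (simp add: dnw_def)

lemma compress_monomial:
  assumes "length u \<le> n" "length v \<le> n"
  shows "dn a ^ n * (upw u * dnw v) * up b ^ n =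
    (if set u \<subseteq> {a} \<and> set v \<subseteq> {b} then dn a ^ (n - length u) * up b ^ (n - length v) else 0)"
proof -
  have "dn a ^ n * (upw u * dnw v) * up b ^ n = (dn a ^ n * upw u) * (dnw v * up b ^ n)"
    by (simp add: mult.assoc)
  then show ?thesis
    using assms by (auto simp: dn_power_upw dnw_power_up)
qed

text \<open>Once \<open>n\<close> exceeds the lengths of both words, compressing a monomial gives
  zero or a product of pure powers of \<open>dn a\<close> and \<open>up b\<close>; a linear property
  of such products therefore holds for all high compressions of any element.\<close>

lemma eventually_compress:
  assumes P: "\<And>i j. P (dn a ^ Suc i * up b ^ Suc j)" "P 0"
    "\<And>x y. P x \<Longrightarrow> P y \<Longrightarrow> P (x + y)" "\<And>c x. P x \<Longrightarrow> P (c *\<^sub>L x)"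
  shows "\<exists>m. \<forall>n\<ge>m. P (dn a ^ n * x * up b ^ n)"
proof -
  have "x \<in> lvs.span monomials"
    using span_monomials by auto
  then show ?thesis
  proof (induction rule: lvs.span_induct_alt)
    case base
    then show ?case using P(2) by simp
  next
    case (step c x y)
    then obtain u v where x: "x = upw u * dnw v"
      by (auto simp: monomials_def)
    from step obtain m where m: "\<And>n. n \<ge> m \<Longrightarrow> P (dn a ^ n * y * up b ^ n)"
      by blast
    \<comment> \<open>The \<open>Suc\<close> keeps both remaining exponents positive, as the
      hypothesis on \<open>P\<close> demands.\<close>
    have "P (dn a ^ n * (c *\<^sub>L x + y) * up b ^ n)" if "n \<ge> max m (Suc (length u + length v))" for n
    proof -
      have n: "Suc (n - length u - 1) = n - length u" "Suc (n - length v - 1) = n - length v"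
        using that by auto
      have "P (dn a ^ n * x * up b ^ n)"
        using that P(1)[of "n - length u - 1" "n - length v - 1", unfolded n] P(2)
        unfolding x by (subst compress_monomial) auto
      then have "P (c *\<^sub>L (dn a ^ n * x * up b ^ n) + dn a ^ n * y * up b ^ n)"
        using that by (intro P(3,4) m) auto
      then show ?thesis
        by (simp add: distrib_left distrib_right lscale_mult_left lscale_mult_right)
    qed
    then show ?case by blast
  qed
qed

lemma iterate_compress:
  assumes "dn a * x * up b = c *\<^sub>L x"
  shows "dn a ^ n * x * up b ^ n = c ^ n *\<^sub>L x"
proof (induction n)
  case (Suc n)
  have "dn a ^ Suc n * x * up b ^ Suc n = dn a ^ n * (dn a * x * up b) * up b ^ n"
    unfolding power_Suc2[of "dn a"] power_Suc[of "up b"] by (simp add: mult.assoc)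
  then show ?case
    by (simp add: assms Suc lscale_mult_left lscale_mult_right mult.commute)
qed simp

text \<open>For distinct letters the surviving powers contain \<open>dn a * up b = 0\<close>, so a
  high compression of \<open>x\<close> vanishes; but it is a nonzero multiple of
  \<open>x\<close>.\<close>

lemma compress_distinct:
  assumes "a \<noteq> b" "dn a * x * up b = c *\<^sub>L x" "c \<noteq> 0"
  shows "x = 0"
proof -
  have "dn a ^ Suc i * up b ^ Suc j = 0" for i j
  proof -
    have "dn a ^ Suc i * up b ^ Suc j = dn a ^ i * (dn a * (up b * up b ^ j))"
      unfolding power_Suc2[of "dn a"] power_Suc[of "up b"] by (simp add: mult.assoc)
    then show ?thesis
      using assms(1) by (simp add: dn_up_assoc)
  qed
  then obtain n where "dn a ^ n * x * up b ^ n = 0"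
    using eventually_compress[of "\<lambda>y. y = 0" a b x] by auto
  then show ?thesis
    using assms(3) by (simp add: iterate_compress[OF assms(2)])
qed

lemma dn_power_up_power: "dn a ^ Suc i * up a ^ Suc j = dn a ^ i * up a ^ j"
proof -
  have "dn a ^ Suc i * up a ^ Suc j = dn a ^ i * (dn a * (up a * up a ^ j))"
    unfolding power_Suc2[of "dn a"] power_Suc[of "up a"] by (simp add: mult.assoc)
  then show ?thesis
    by (simp add: dn_up_assoc)
qed

text \<open>High compressions of any element are fixed by one further compression, because inner
  pairs \<open>dn a * up a\<close> cancel. For an eigenvector this reads
  \<open>c ^ n * c = c ^ n\<close> unless \<open>x = 0\<close>.\<close>

lemma compress_eigen:
  assumes "dn a * x * up a = c *\<^sub>L x" "c \<noteq> 0" "c \<noteq> 1"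
  shows "x = 0"
proof -
  have "dn a * (dn a ^ Suc i * up a ^ Suc j) * up a = dn a ^ Suc i * up a ^ Suc j" for i j
    using dn_power_up_power[of a "Suc i" "Suc j"]
    unfolding power_Suc[of "dn a" "Suc i"] power_Suc2[of "up a" "Suc j"]
    by (simp only: mult.assoc)
  then obtain n where n: "dn a * (dn a ^ n * x * up a ^ n) * up a = dn a ^ n * x * up a ^ n"
    using eventually_compress[of "\<lambda>y. dn a * y * up a = y" a a x]
    by (auto simp: distrib_left distrib_right lscale_mult_left lscale_mult_right)
  then have "(c ^ n * c) *\<^sub>L x = c ^ n *\<^sub>L x"
    using assms(1) by (simp add: iterate_compress[OF assms(1)] lscale_mult_left lscale_mult_right)
  then show ?thesis
    using assms by simp
qed

text \<open>Being fixed by compression at \<open>a\<close>, \<open>x\<close> lies in the span of the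
  products \<open>dn a ^ i * up a ^ j\<close>. A compression at a second letter \<open>b\<close>
  kills those with \<open>i \<noteq> j\<close> and sends the others to 1, and \<open>x\<close> is
  fixed by it too.\<close>

lemma compress_scalar:
  assumes "a \<noteq> b" "dn a * x * up a = x" "dn b * x * up b = x"
  shows "\<exists>c. x = c *\<^sub>L 1"
proof -
  define P where "P y \<longleftrightarrow> (\<exists>c. dn b * y * up b = c *\<^sub>L 1)" for y
  have P_power: "P (dn a ^ i * up a ^ j)" for i j
  proof (induction i arbitrary: j)
    case 0
    show ?case
    proof (cases j)
      case (Suc j')
      then show ?thesis
        using assms(1) by (auto simp: P_def mult.assoc dn_up_assoc intro!: exI[of _ 0])
    qed (auto simp: P_def dn_up intro!: exI[of _ 1])
  next
    case (Suc i)
    show ?case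
    proof (cases j)
      case 0
      have "dn b * (dn a ^ Suc i * up a ^ j) * up b = dn b * (dn a ^ i * (dn a * up b))"
        unfolding power_Suc2 0 by (simp add: mult.assoc)
      then show ?thesis
        using assms(1) by (auto simp: P_def dn_up intro!: exI[of _ 0])
    qed (simp only: dn_power_up_power Suc)
  qed
  have "P 0" "P (y + z)" "P (k *\<^sub>L y)" if "P y" "P z" for y z k
  proof -
    show "P 0"
      unfolding P_def by (rule exI[of _ 0]) simp
    show "P (y + z)"
      using that unfolding P_def distrib_left distrib_right by (metis lvs.scale_left_distrib)
    show "P (k *\<^sub>L y)"
      using that unfolding P_def by (metis lscale_mult_left lscale_mult_right lvs.scale_scale)
  qed
  moreover have "P 0"
    unfolding P_def by (rule exI[of _ 0]) simp
  ultimately obtain n where "P (dn a ^ n * x * up a ^ n)"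
    using eventually_compress[of P a a x] P_power by blast
  then show ?thesis
    using iterate_compress[of a x a 1] assms by (simp add: P_def)
qed

subsection \<open>Endomorphisms\<close>

text \<open>The values on S' and T' are forced: insert the image under \<open>h\<close> of the
  resolution of 1 behind \<open>f (dn i)\<close> and use that \<open>f\<close> and \<open>h\<close>
  agree on each \<open>up j\<close>.\<close>

lemma unital_endo_eqI:
  assumes f: "unital_endo f" and h: "unital_endo h"
    and S: "\<And>g. f (LS g) = h (LS g)" and T: "\<And>g. f (LT g) = h (LT g)"
  shows "f = h"
proof -
  have up: "f (up i) = h (up i)" for i
    using S T by (cases i rule: up.cases) auto
  have mult: "f (x * y) = f x * f y" "h (x * y) = h x * h y" "f 1 = 1" "h 1 = 1" for x y
    using f h by (auto simp: unital_endo_def)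
  have "f (dn i) = h (dn i)" for i
  proof -
    have "f (dn i) = f (dn i) * h (\<Sum>j\<in>UNIV. up j * dn j)"
      by (simp add: sum_up_dn mult)
    also have "\<dots> = (\<Sum>j\<in>UNIV. f (dn i * up j) * h (dn j))"
      by (simp add: unital_endo_sum[OF h] mult sum_distrib_left up mult.assoc)
    also have "\<dots> = (\<Sum>j\<in>UNIV. if i = j then h (dn j) else 0)"
      by (rule sum.cong) (auto simp: dn_up mult unital_endo_0[OF f])
    also have "\<dots> = h (dn i)"
      by simp
    finally show ?thesis .
  qed
  note dn = this
  have "f (leavitt_gen l) = h (leavitt_gen l)" for l
    using S T dn[of "(True, _)"] dn[of "(False, _)"] by (cases l) auto
  then show ?thesis
    using unital_endo_unique[OF f h] by blast
qed

lemma unital_endo_comp: "unital_endo f \<Longrightarrow> unital_endo h \<Longrightarrow> unital_endo (f \<circ> h)"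
  by (simp add: unital_endo_def)

lemma unital_endo_id: "unital_endo id"
  by (simp add: unital_endo_def)

lemma endo_of:
  assumes "\<exists>!f. unital_endo f \<and> (\<forall>l. f (leavitt_gen l) = v l)"
  shows "unital_endo (endo_of v)" "endo_of v (leavitt_gen l) = v l"
  using theI'[OF assms] by (auto simp: endo_of_def)

section \<open>The endomorphism \<open>\<rho>\<close>\<close>

lemma if_zero_mult:
  "(if P then x else 0) * y = (if P then x * y else 0)"
  "y * (if P then x else 0) = (if P then y * x else 0)" for x y :: "('g::finite) leavitt"
  by simp_all

lemma lscale_if: "c *\<^sub>L (if P then x else 0) = (if P then c *\<^sub>L x else 0)"
  by simp

lemma sum_if_const: "(\<Sum>k\<in>A. if P then f k else 0) = (if P then \<Sum>k\<in>A. f k else 0)"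
  by simp

lemma shift_eq:
  fixes f :: "'g::{ab_group_add,finite} \<Rightarrow> 'a::comm_monoid_add"
  shows "(\<Sum>k\<in>UNIV. if a = h + k then f k else 0) = f (a - h)"
    "(\<Sum>k\<in>UNIV. if h + k = a then f k else 0) = f (a - h)"
    "(\<Sum>h\<in>UNIV. if a = h - k then f h else 0) = f (a + k)"
    "(\<Sum>h\<in>UNIV. if a = - h then f h else 0) = f (- a)"
proof -
  have "a = h + k \<longleftrightarrow> k = a - h" "h + k = a \<longleftrightarrow> k = a - h" "a = h - k \<longleftrightarrow> h = a + k" "a = - h \<longleftrightarrow> h = - a" for h k
    by auto
  then show "(\<Sum>k\<in>UNIV. if a = h + k then f k else 0) = f (a - h)"
    "(\<Sum>k\<in>UNIV. if h + k = a then f k else 0) = f (a - h)"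
    "(\<Sum>h\<in>UNIV. if a = h - k then f h else 0) = f (a + k)"
    "(\<Sum>h\<in>UNIV. if a = - h then f h else 0) = f (- a)"
    by simp_all
qed

text \<open>The recurring manoeuvre of the coefficient computations: for a fixed word
  \<open>X h\<close> the scalar sum is done first, by orthogonality or by a Fourier identity for
  \<open>E\<close>.\<close>

lemma sum_swap_coeff:
  "(\<And>h. (\<Sum>g\<in>A. f g h) = c h) \<Longrightarrow>
    (\<Sum>g\<in>A. \<Sum>h\<in>B. f g h *\<^sub>L X h) = (\<Sum>h\<in>B. c h *\<^sub>L X h)"
  by (subst sum.swap) (simp flip: lvs.scale_sum_left)

lemmas gnorm = diff_conv_add_uminus add_ac

lemma mult_assoc_rule: "x * y = z \<Longrightarrow> x * (y * w) = z * (w :: ('g::finite) leavitt)"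
  by (simp flip: mult.assoc)

lemmas leavitt_relations_assoc = leavitt_relations(1-4)[THEN mult_assoc_rule]

lemmas lexpand = leavitt_relations(1-4) leavitt_relations_assoc
  sum_distrib_left sum_distrib_right distrib_left distrib_right mult.assoc
  lscale_mult_left lscale_mult_right lvs.scale_sum_right lvs.scale_right_distrib lvs.scale_scale
  if_zero_mult lscale_if sum_if_const

text \<open>The resolution of 1 is inserted between the factors, so that \<open>x\<close> enters by
  its right and \<open>y\<close> by its left coefficients.\<close>

lemma leavitt_mult_expand:
  "x * y = (\<Sum>a\<in>UNIV. (x * LS a) * (LS' a * y)) + (\<Sum>a\<in>UNIV. (x * LT a) * (LT' a * y))"
proof -
  have "x * y = x * ((\<Sum>a\<in>UNIV. LS a * LS' a) + (\<Sum>a\<in>UNIV. LT a * LT' a)) * y"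
    by (simp add: leavitt_relations)
  then show ?thesis
    by (simp add: sum_distrib_left sum_distrib_right distrib_left distrib_right mult.assoc)
qed

context dilogarithm
begin

section \<open>Coefficients of the images of the generators\<close>

abbreviation U where "U \<equiv> leavitt_U q"
abbreviation RS where "RS g \<equiv> rho_on_gens q E s (GenS g)"
abbreviation RS' where "RS' g \<equiv> rho_on_gens q E s (GenS' g)"
abbreviation RT where "RT g \<equiv> rho_on_gens q E s (GenT g)"
abbreviation RT' where "RT' g \<equiv> rho_on_gens q E s (GenT' g)"


lemma S'_U: "LS' a * U g = inverse (b g a) *\<^sub>L LS' a"
  and T'_U: "LT' a * U g = LT' (a + g)"
  and U_S: "U g * LS a = inverse (b g a) *\<^sub>L LS a"
  and U_T: "U g * LT a = LT (a - g)"
  by (simp_all add: leavitt_U_def lexpand shift_eq)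

lemmas U_rules = S'_U T'_U U_S U_T S'_U[THEN mult_assoc_rule] T'_U[THEN mult_assoc_rule]
  U_S[THEN mult_assoc_rule] U_T[THEN mult_assoc_rule]

lemma U_zero: "U 0 = 1"
  by (rule leavitt_eqI) (simp_all add: S'_U T'_U)

lemma U_add: "U g * U h = U (g + h)"
  by (rule leavitt_eqI) (simp_all add: U_rules lscale_mult_left bq add.assoc mult.commute)

lemmas U_add_assoc = U_add[THEN mult_assoc_rule]

text \<open>The image of S_0. The other \<open>RS g\<close> are its conjugates by
  \<open>U g\<close>, which reduces the relations among them to one.\<close>

definition sig where
  "sig = (1 / d) *\<^sub>L (\<Sum>h\<in>UNIV. LS h) + (1 / s) *\<^sub>L (\<Sum>h\<in>UNIV. q h *\<^sub>L (LT h * LT (- h)))"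
definition sig' where
  "sig' = (1 / d) *\<^sub>L (\<Sum>h\<in>UNIV. LS' h) + (1 / s) *\<^sub>L (\<Sum>h\<in>UNIV. inverse (q h) *\<^sub>L (LT' (- h) * LT' h))"

lemma RS_eq: "RS g = U g * (sig * U (- g))" and RS'_eq: "RS' g = U g * (sig' * U (- g))"
  by (simp_all add: sig_def sig'_def mult.assoc flip: d_def)

lemma RT_eq: "RT g =
  (\<mu> / (s * \<nu>)) *\<^sub>L (\<Sum>h\<in>UNIV. \<Sum>k\<in>UNIV. b (h - g) k *\<^sub>L (LS h * LT' k)) +
  (inverse \<mu> / (q g * \<nu>)) *\<^sub>L (\<Sum>h\<in>UNIV. \<Sum>k\<in>UNIV. inverse (b (g + h) k) *\<^sub>L (LT k * LS h * LS' h)) +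
  (1 / \<nu>) *\<^sub>L (\<Sum>h\<in>UNIV. \<Sum>k\<in>UNIV. (q h * E (h + g) * inverse (b g k)) *\<^sub>L (LT (h + k) * LT (- h) * LT' k))"
  by (simp flip: lam_def nu_def)

lemma RT'_eq: "RT' g =
  (inverse \<mu> / (s * \<nu>)) *\<^sub>L (\<Sum>h\<in>UNIV. \<Sum>k\<in>UNIV. inverse (b (h - g) k) *\<^sub>L (LT k * LS' h)) +
  (\<mu> * q g / \<nu>) *\<^sub>L (\<Sum>h\<in>UNIV. \<Sum>k\<in>UNIV. b (g + h) k *\<^sub>L (LS h * LS' h * LT' k)) +
  (1 / \<nu>) *\<^sub>L (\<Sum>h\<in>UNIV. \<Sum>k\<in>UNIV. (q (g + h) / q h * E (- h - g) * b g k) *\<^sub>L (LT k * LT' (- h) * LT' (h + k)))"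
  by (simp flip: lam_def nu_def)

lemmas [simp del] = rho_on_gens.simps

lemma S'_sig: "LS' a * sig = (1 / d) *\<^sub>L 1"
  and T'_sig: "LT' a * sig = (q a / s) *\<^sub>L LT (- a)"
  and sig'_S: "sig' * LS a = (1 / d) *\<^sub>L 1"
  and sig'_T: "sig' * LT a = (1 / (s * q a)) *\<^sub>L LT' (- a)"
  by (simp_all add: sig_def sig'_def lexpand shift_eq field_simps)

lemma S'_RS: "LS' a * RS g = (inverse (b g a) / d) *\<^sub>L U (- g)"
  and T'_RS: "LT' a * RS g = (q (a + g) / s) *\<^sub>L (LT (- a - g) * U (- g))"
  by (simp_all add: RS_eq U_rules lexpand S'_sig[THEN mult_assoc_rule] T'_sig[THEN mult_assoc_rule] field_simps)

lemma RS'_S: "RS' g * LS a = (b g a / d) *\<^sub>L U g"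
  and RS'_T: "RS' g * LT a = (1 / (s * q (a + g))) *\<^sub>L (U g * LT' (- a - g))"
  by (simp_all add: RS'_eq mult.assoc U_S U_T lscale_mult_right sig'_S sig'_T b_minus_left)

lemma S'_RT: "LS' a * RT g = (\<mu> / (s * \<nu>)) *\<^sub>L (\<Sum>k\<in>UNIV. b (a - g) k *\<^sub>L LT' k)"
  and T'_RT: "LT' a * RT g =
    (1 / (\<mu> * q g * \<nu>)) *\<^sub>L (\<Sum>h\<in>UNIV. inverse (b (g + h) a) *\<^sub>L (LS h * LS' h)) +
    (1 / \<nu>) *\<^sub>L (\<Sum>h\<in>UNIV. (q h * E (h + g) * inverse (b g (a - h))) *\<^sub>L (LT (- h) * LT' (a - h)))"
  by (simp_all add: RT_eq lexpand shift_eq field_simps)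

lemma RT'_S: "RT' g * LS a = (1 / (\<mu> * s * \<nu>)) *\<^sub>L (\<Sum>k\<in>UNIV. inverse (b (a - g) k) *\<^sub>L LT k)"
  and RT'_T: "RT' g * LT a =
    (\<mu> * q g / \<nu>) *\<^sub>L (\<Sum>h\<in>UNIV. b (g + h) a *\<^sub>L (LS h * LS' h)) +
    (1 / \<nu>) *\<^sub>L (\<Sum>h\<in>UNIV. (q (g + h) / q h * E (- h - g) * b g (a - h)) *\<^sub>L (LT (a - h) * LT' (- h)))"
  by (simp_all add: RT'_eq lexpand shift_eq field_simps)

lemma S'_RT': "LS' a * RT' g = (\<mu> * q g / \<nu>) *\<^sub>L (\<Sum>k\<in>UNIV. b (g + a) k *\<^sub>L (LS' a * LT' k))"
  and T'_RT': "LT' a * RT' g =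
    (1 / (\<mu> * s * \<nu>)) *\<^sub>L (\<Sum>h\<in>UNIV. inverse (b (h - g) a) *\<^sub>L LS' h) +
    (1 / \<nu>) *\<^sub>L (\<Sum>h\<in>UNIV. (q (g + h) / q h * E (- h - g) * b g a) *\<^sub>L (LT' (- h) * LT' (h + a)))"
  by (simp_all add: RT'_eq lexpand shift_eq field_simps)

text \<open>A letter T' followed by any second letter reduces \<open>RT g\<close> to a scalar
  multiple of a single generator. This is why tests with two letters are preferred for
  \<open>RT\<close>.\<close>

lemma S'_T'_RT: "LS' c * (LT' a * RT g) = (inverse (b (g + c) a) / (\<mu> * q g * \<nu>)) *\<^sub>L LS' c"
  and T'_T'_RT: "LT' c * (LT' a * RT g) = (q c * E (g - c) / (b g (a + c) * \<nu>)) *\<^sub>L LT' (a + c)"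
  by (simp_all add: T'_RT lexpand shift_eq field_simps)

subsection \<open>The defining relations\<close>

lemma d_recip: "N / d\<^sup>2 + N / d = 1"
proof -
  have "N / d\<^sup>2 + N / d = N * (d + 1) / d\<^sup>2"
    by (simp add: field_simps power2_eq_square)
  then show ?thesis
    by (simp flip: d_square)
qed

lemma sum_const_lscale: "(\<Sum>a\<in>(UNIV :: 'g set). c *\<^sub>L x) = (N * c) *\<^sub>L x"
  by (simp add: N_def flip: lvs.scale_sum_left)

text \<open>The S-part is a character sum and the T-part contains a delta, so both vanish for
  \<open>k \<noteq> 0\<close>. At \<open>k = 0\<close> they weigh \<open>N / d\<^sup>2\<close> and
  \<open>N / d\<close>, which add up to 1 by the quadratic equation for \<open>d\<close>.\<close>

lemma sig'_U_sig: "sig' * (U k * sig) = (if k = 0 then 1 else 0)"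
proof -
  have "sig' * (U k * sig) = (\<Sum>a\<in>(UNIV :: 'g set). (inverse (b k a) / d\<^sup>2) *\<^sub>L 1) +
      (\<Sum>a\<in>(UNIV :: 'g set). if k = 0 then (1 / d) *\<^sub>L 1 else 0)"
    by (subst leavitt_mult_expand)
      (simp add: sig'_S sig'_T U_rules S'_sig T'_sig lexpand power2_eq_square divide_simps s_times_s cong: if_cong)
  also have "(\<Sum>a\<in>UNIV. (inverse (b k a) / d\<^sup>2) *\<^sub>L (1::'g leavitt)) = ((\<Sum>a\<in>UNIV. b (- k) a) / d\<^sup>2) *\<^sub>L 1"
    by (simp add: b_minus_left sum_divide_distrib flip: lvs.scale_sum_left)
  finally show ?thesis
    by (simp add: orthogonality' sum_const_lscale d_recip flip: lvs.scale_left_distrib)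
qed

lemma RS'_RS: "RS' g * RS h = (if g = h then 1 else 0)"
proof -
  have "RS' g * RS h = U g * ((sig' * (U (h - g) * sig)) * U (- h))"
    by (simp add: RS_eq RS'_eq mult.assoc U_add_assoc)
  then show ?thesis
    by (simp add: sig'_U_sig U_add U_zero)
qed

lemma orth_coeff:
  assumes "\<And>a. f a = c * b a y"
  shows "(\<Sum>a\<in>UNIV. f a) = (if y = 0 then c * N else 0)"
  using assms orthogonality[of y] by (simp flip: sum_distrib_left)

text \<open>Both parts are multiples of \<open>U g * LT' (- g)\<close>: the S-part by orthogonality,
  the T-part through the sum of all values of \<open>E\<close>. They cancel because
  \<open>E 0 = - \<nu> / d\<close>.\<close>

lemma RS'_RT: "RS' g * RT h = 0"
proof -
  have "(\<Sum>a\<in>UNIV. (RS' g * LS a) * (LS' a * RT h)) =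
      U g * (\<Sum>a\<in>UNIV. \<Sum>k\<in>UNIV. (b g a / d * (\<mu> / (s * \<nu>)) * b (a - h) k) *\<^sub>L LT' k)"
    by (simp add: RS'_S S'_RT lexpand mult_ac)
  also have "\<dots> = U g * (\<Sum>k\<in>UNIV. (if g + k = 0 then \<mu> / (d * s * \<nu>) / b h k * N else 0) *\<^sub>L LT' k)"
    by (rule arg_cong[where f = "\<lambda>x. U g * x"], intro sum_swap_coeff orth_coeff)
      (simp add: bq b_commute field_simps)
  also have "\<dots> = U g * ((\<mu> / (d * s * \<nu>) * b h g * N) *\<^sub>L LT' (- g))"
    by (subst sum_single[of "- g"]) (auto simp: add_eq_0_iff bq field_simps)
  finally have 1: "(\<Sum>a\<in>UNIV. (RS' g * LS a) * (LS' a * RT h)) =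
      (\<mu> / (d * s * \<nu>) * b h g * N) *\<^sub>L (U g * LT' (- g))"
    by (simp add: lscale_mult_right)
  have "(\<Sum>a\<in>UNIV. (RS' g * LT a) * (LT' a * RT h)) =
      (\<Sum>a\<in>UNIV. (E (a + (g + h)) * b h g / (s * \<nu>)) *\<^sub>L (U g * LT' (- g)))"
    by (rule sum.cong) (simp_all add: RS'_T T'_T'_RT lscale_mult_left lscale_mult_right mult.assoc
        bq b_commute divide_simps add_ac, simp add: gnorm del: add_uminus_conv_diff uminus_add_conv_diff)
  also have "\<dots> = (b h g / (s * \<nu>) * (\<Sum>a\<in>UNIV. E (a + (g + h)))) *\<^sub>L (U g * LT' (- g))"
    by (simp add: sum_distrib_left mult_ac flip: lvs.scale_sum_left)
  also have "(\<Sum>a\<in>UNIV. E (a + (g + h))) = \<nu> * \<mu> * E 0"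
    using sum_E[of 0] by (simp add: sum_shift(1)[of E])
  finally show ?thesis
    by (subst leavitt_mult_expand)
      (simp add: 1 E_0_eq nu_square flip: lvs.scale_left_distrib, (simp add: field_simps flip: nu_square(1))?)
qed

text \<open>The cancellation of \<open>RS'_RT\<close> again, with the sum of \<open>q * E\<close> in
  place of the sum of \<open>E\<close>.\<close>

lemma RT'_RS: "RT' g * RS h = 0"
proof -
  have "(\<Sum>a\<in>UNIV. (RT' g * LS a) * (LS' a * RS h)) =
      (\<Sum>a\<in>UNIV. \<Sum>k\<in>UNIV. (inverse (b h a) / d / (\<mu> * s * \<nu>) * inverse (b (a - g) k)) *\<^sub>L LT k) * U (- h)"
    by (simp add: RT'_S S'_RS lexpand mult_ac)
  also have "\<dots> = (\<Sum>k\<in>UNIV. (if - h - k = 0 then b g k / (d * \<mu> * s * \<nu>) * N else 0) *\<^sub>L LT k) * U (- h)"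
    by (rule arg_cong[where f = "\<lambda>x. x * U (- h)"], intro sum_swap_coeff orth_coeff)
      (simp add: bq b_commute field_simps)
  also have "\<dots> = ((1 / (d * \<mu> * s * \<nu>) / b g h * N) *\<^sub>L LT (- h)) * U (- h)"
    by (subst sum_single[of "- h"]) (auto simp: bq field_simps)
  finally have 1: "(\<Sum>a\<in>UNIV. (RT' g * LS a) * (LS' a * RS h)) =
      (1 / (d * \<mu> * s * \<nu>) / b g h * N) *\<^sub>L (LT (- h) * U (- h))"
    by (simp add: lscale_mult_left)
  have "(\<Sum>a\<in>UNIV. (RT' g * LT a) * (LT' a * RS h)) =
      (\<Sum>a\<in>UNIV. (q (- (g + h) - a) * E (- (g + h) - a) / (s * \<nu> * b g h)) *\<^sub>L (LT (- h) * U (- h)))"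
    apply (rule sum.cong)
    apply (simp_all add: RT'_T T'_RS lexpand shift_eq)
    apply (simp add: bq b_commute divide_simps algebra_simps)
    apply (simp add: gnorm del: add_uminus_conv_diff uminus_add_conv_diff)
    done
  also have "\<dots> = (1 / (s * \<nu> * b g h) * (\<Sum>a\<in>UNIV. q (- (g + h) - a) * E (- (g + h) - a))) *\<^sub>L (LT (- h) * U (- h))"
    by (simp add: sum_distrib_left mult_ac flip: lvs.scale_sum_left)
  also have "(\<Sum>a\<in>UNIV. q (- (g + h) - a) * E (- (g + h) - a)) = \<nu> * E 0 / \<mu>"
    using sum_qE[of 0] sum_shift(4)[of "\<lambda>x. q x * E x" "- (g + h)"] by simp
  finally show ?thesis
    by (subst leavitt_mult_expand)
      (simp add: 1 E_0_eq nu_square flip: lvs.scale_left_distrib, (simp add: field_simps flip: nu_square(1))?)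
qed

text \<open>Tested by S'_a it is orthogonality. Tested by T'_a the convolution identity
  \<open>E_conv\<close> appears: its constant part \<open>\<nu> * E 0 / N = - 1 / d\<close> cancels
  the contribution of the S-part, and its delta part is the result.\<close>

lemma RT'_RT: "RT' g * RT h = (if g = h then 1 else 0)"
proof (rule leavitt_eqI)
  fix a
  have "LS' a * (RT' g * RT h) = (\<mu> * q g / \<nu>) *\<^sub>L (\<Sum>k\<in>UNIV. b (g + a) k *\<^sub>L (LS' a * (LT' k * RT h)))"
    by (simp add: S'_RT'[THEN mult_assoc_rule] lexpand)
  also have "\<dots> = (\<Sum>k\<in>UNIV. q g / (q h * N) * b k (g - h)) *\<^sub>L LS' a"
    by (simp add: S'_T'_RT lvs.scale_sum_left lvs.scale_sum_right bq b_commute field_simps flip: nu_square(1))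
  also have "(\<Sum>k\<in>UNIV. q g / (q h * N) * b k (g - h)) = (if g = h then 1 else 0)"
    by (subst orth_coeff[OF refl]) auto
  finally show "LS' a * (RT' g * RT h) = LS' a * (if g = h then 1 else 0)"
    by simp
next
  fix a
  have "LT' a * (RT' g * RT h) =
      (\<Sum>f\<in>UNIV. \<Sum>k\<in>UNIV. (1 / (d * N) * inverse (b (f - g) a) * b (f - h) k) *\<^sub>L LT' k) +
      (\<Sum>f\<in>UNIV. (E (h - g - (- g - f)) * E (- g - f) * q (- g - f) * (b (g - h) a / N)) *\<^sub>L LT' a)"
    apply (simp add: T'_RT'[THEN mult_assoc_rule] distrib_right sum_distrib_right lscale_mult_left mult.assoc
      S'_RT T'_T'_RT lvs.scale_sum_right)
    apply (simp add: bq b_commute divide_simps s_times_s[symmetric] nu_square(1)[symmetric] algebra_simps)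
    apply (simp add: gnorm del: add_uminus_conv_diff uminus_add_conv_diff)
    done
  also have "(\<Sum>f\<in>UNIV. \<Sum>k\<in>UNIV. (1 / (d * N) * inverse (b (f - g) a) * b (f - h) k) *\<^sub>L LT' k) =
      (\<Sum>k\<in>UNIV. (if k - a = 0 then 1 / (d * N) * b g a / b h k * N else 0) *\<^sub>L LT' k)"
    by (intro sum_swap_coeff orth_coeff) (simp add: bq b_commute field_simps)
  also have "\<dots> = (b (g - h) a / d) *\<^sub>L LT' a"
    by (subst sum_single[of a]) (auto simp: bq field_simps)
  also have "(\<Sum>f\<in>UNIV. (E (h - g - (- g - f)) * E (- g - f) * q (- g - f) * (b (g - h) a / N)) *\<^sub>L LT' a) =
      ((\<Sum>z\<in>UNIV. E (h - g - z) * E z * q z) * (b (g - h) a / N)) *\<^sub>L LT' a"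
    unfolding lvs.scale_sum_left[symmetric] sum_distrib_right[symmetric]
    using sum_shift(4)[of "\<lambda>z. E (h - g - z) * E z * q z" "- g"]
    by (simp add: mult_ac gnorm del: add_uminus_conv_diff uminus_add_conv_diff flip: sum_distrib_right)
  finally show "LT' a * (RT' g * RT h) = LT' a * (if g = h then 1 else 0)"
    by (simp add: E_conv E_0_eq flip: lvs.scale_left_distrib) (simp add: field_simps nu_square flip: nu_square(1))
qed


lemma U_RS': "U (- g) * RS' g = sig' * U (- g)"
  by (simp add: RS'_eq U_add_assoc U_zero)

lemma sig'_U: "sig' * U k = (1 / d) *\<^sub>L (\<Sum>h\<in>UNIV. inverse (b k h) *\<^sub>L LS' h) +
    (1 / s) *\<^sub>L (\<Sum>h\<in>UNIV. inverse (q h) *\<^sub>L (LT' (- h) * LT' (h + k)))"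
  by (simp add: sig'_def distrib_right sum_distrib_right lscale_mult_left mult.assoc S'_U T'_U)

definition comp_sum where
  "comp_sum = (\<Sum>g\<in>UNIV. RS g * RS' g) + (\<Sum>g\<in>UNIV. RT g * RT' g)"

lemma sum_qE_shift: "(\<Sum>g\<in>UNIV. q (g + h) * E (- h - g)) = \<nu> * E 0 / \<mu>"
proof -
  have "(\<Sum>g\<in>UNIV. q (g + h) * E (- h - g)) = (\<Sum>g\<in>UNIV. q (- h - g) * E (- h - g))"
    by (rule sum.cong) (simp_all add: bq b_commute field_simps)
  then show ?thesis
    using sum_qE[of 0] sum_shift(4)[of "\<lambda>x. q x * E x" "- h"] by simp
qed

lemma sum_E_total: "sum E UNIV = - (\<mu> * N / d)"
  using sum_E[of 0] by (simp add: E_0_eq flip: nu_square(1))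

text \<open>The images of S contribute \<open>N / d\<^sup>2\<close> and those of T contribute
  \<open>N / d\<close> to the coefficient of S'_a; the words T' T' that both produce cancel through
  the sum of \<open>q * E\<close>.\<close>

lemma S'_comp_sum: "LS' a * comp_sum = LS' a"
proof -
  have "LS' a * comp_sum = (\<Sum>g\<in>UNIV. (b (- g) a / d) *\<^sub>L (sig' * U (- g))) +
      (\<Sum>g\<in>UNIV. (\<mu> / (s * \<nu>)) *\<^sub>L (\<Sum>k\<in>UNIV. b (a - g) k *\<^sub>L (LT' k * RT' g)))"
    by (simp add: comp_sum_def distrib_left sum_distrib_left S'_RS[THEN mult_assoc_rule] U_RS'
      S'_RT[THEN mult_assoc_rule] lscale_mult_left sum_distrib_right b_minus_left)
  also have "(\<Sum>g\<in>UNIV. (b (- g) a / d) *\<^sub>L (sig' * U (- g))) = (\<Sum>g\<in>UNIV. (b g a / d) *\<^sub>L (sig' * U g))"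
    using sum_shift(5)[of "\<lambda>g. (b g a / d) *\<^sub>L (sig' * U g)"] by simp
  also have "\<dots> = (\<Sum>g\<in>UNIV. \<Sum>h\<in>UNIV. (b g a / d * (1 / d) * inverse (b g h)) *\<^sub>L LS' h) +
      (\<Sum>g\<in>UNIV. \<Sum>h\<in>UNIV. (b g a / (d * s) / q h) *\<^sub>L (LT' (- h) * LT' (h + g)))"
    by (simp add: sig'_U lvs.scale_right_distrib lvs.scale_sum_right sum.distrib divide_inverse mult_ac)
  also have "(\<Sum>g\<in>UNIV. \<Sum>h\<in>UNIV. (b g a / d * (1 / d) * inverse (b g h)) *\<^sub>L LS' h) =
      (\<Sum>h\<in>UNIV. (if a - h = 0 then 1 / d\<^sup>2 * N else 0) *\<^sub>L LS' h)"
    by (intro sum_swap_coeff orth_coeff) (simp add: bq b_commute field_simps power2_eq_square)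
  also have "\<dots> = (N / d\<^sup>2) *\<^sub>L LS' a"
    by (subst sum_single[of a]) auto
  also have "(\<Sum>g\<in>UNIV. (\<mu> / (s * \<nu>)) *\<^sub>L (\<Sum>k\<in>UNIV. b (a - g) k *\<^sub>L (LT' k * RT' g))) =
     (\<Sum>g\<in>(UNIV :: 'g set). \<Sum>k\<in>UNIV. \<Sum>h\<in>UNIV. (1 / (d * N) * b (a - h) k) *\<^sub>L LS' h) +
     (\<Sum>g\<in>UNIV. \<Sum>k\<in>UNIV. \<Sum>h\<in>UNIV. (\<mu> / (s * N) * b a k / q h * (q (g + h) * E (- h - g))) *\<^sub>L (LT' (- h) * LT' (h + k)))"
    by (simp add: T'_RT' lvs.scale_right_distrib lvs.scale_sum_right sum.distrib bq b_commute field_simps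
       s_times_s[symmetric] nu_square(1)[symmetric])
  also have "(\<Sum>g\<in>(UNIV :: 'g set). \<Sum>k\<in>UNIV. \<Sum>h\<in>UNIV. (1 / (d * N) * b (a - h) k) *\<^sub>L LS' h) =
     (\<Sum>g\<in>(UNIV :: 'g set). \<Sum>h\<in>UNIV. (if a - h = 0 then 1 / (d * N) * N else 0) *\<^sub>L LS' h)"
    by (rule sum.cong, rule refl, rule sum_swap_coeff, rule orth_coeff) (simp add: bq b_commute field_simps)
  also have "\<dots> = (N / d) *\<^sub>L LS' a"
    by (subst sum_single[of a]) (auto simp: sum_const_lscale)
  also have "(\<Sum>g\<in>UNIV. \<Sum>k\<in>UNIV. \<Sum>h\<in>UNIV. (\<mu> / (s * N) * b a k / q h * (q (g + h) * E (- h - g))) *\<^sub>L (LT' (- h) * LT' (h + k))) =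
    (\<Sum>k\<in>UNIV. \<Sum>g\<in>UNIV. \<Sum>h\<in>UNIV. (\<mu> / (s * N) * b a k / q h * (q (g + h) * E (- h - g))) *\<^sub>L (LT' (- h) * LT' (h + k)))"
    by (rule sum.swap)
  also have "\<dots> = (\<Sum>k\<in>UNIV. \<Sum>h\<in>UNIV. (- (b k a / (d * s) / q h)) *\<^sub>L (LT' (- h) * LT' (h + k)))"
  proof (rule sum.cong, rule refl, rule sum_swap_coeff)
    fix k h
    show "(\<Sum>g\<in>UNIV. \<mu> / (s * N) * b a k / q h * (q (g + h) * E (- h - g))) = - (b k a / (d * s) / q h)"
      unfolding sum_distrib_left[symmetric] sum_qE_shift
      by (simp add: E_0_eq b_commute field_simps nu_square flip: nu_square(1))
  qed
  finally show ?thesis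
    by (simp add: sum_negf d_recip flip: lvs.scale_left_distrib) 
qed

lemma S'_T'_comp_sum: "LS' c * (LT' a * comp_sum) = LS' c * LT' a"
proof -
  have "LS' c * (LT' a * comp_sum) = (\<Sum>g\<in>UNIV. (q (a + g) / s) *\<^sub>L (LS' c * (LT (- a - g) * (U (- g) * RS' g)))) +
      (\<Sum>g\<in>UNIV. (inverse (b (g + c) a) / (\<mu> * q g * \<nu>)) *\<^sub>L (LS' c * RT' g))"
    by (simp add: comp_sum_def distrib_left sum_distrib_left T'_RS[THEN mult_assoc_rule] lscale_mult_left lscale_mult_right
      mult.assoc mult_assoc_rule[OF S'_T'_RT[unfolded mult.assoc[symmetric]], unfolded mult.assoc])
  also have "\<dots> = (\<Sum>g\<in>UNIV. \<Sum>k\<in>UNIV. (1 / N / b c (a - k) * b g (k - a)) *\<^sub>L (LS' c * LT' k))"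
    by (simp add: lexpand S'_RT' bq b_commute field_simps flip: nu_square(1))
  also have "\<dots> = (\<Sum>k\<in>UNIV. (if k - a = 0 then 1 / N / b c (a - k) * N else 0) *\<^sub>L (LS' c * LT' k))"
    by (intro sum_swap_coeff orth_coeff) simp
  also have "\<dots> = LS' c * LT' a"
    by (subst sum_single[of a]) auto
  finally show ?thesis .
qed

text \<open>The S' terms cancel through the sum of \<open>E\<close>. In the T' T' terms the constant
  part of \<open>E_conv\<close> cancels the contribution of the images of S, and its delta part
  singles out the one word wanted.\<close>

lemma T'_T'_comp_sum: "LT' c * (LT' a * comp_sum) = LT' c * LT' a"
proof -
  have "LT' c * (LT' a * comp_sum) = (\<Sum>g\<in>UNIV. (q (a + g) / s) *\<^sub>L (LT' c * (LT (- a - g) * (U (- g) * RS' g)))) +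
      (\<Sum>g\<in>UNIV. (q c * E (g - c) / (b g (a + c) * \<nu>)) *\<^sub>L (LT' (a + c) * RT' g))"
    by (simp add: comp_sum_def distrib_left sum_distrib_left T'_RS[THEN mult_assoc_rule] lscale_mult_left lscale_mult_right
      mult.assoc mult_assoc_rule[OF T'_T'_RT[unfolded mult.assoc[symmetric]], unfolded mult.assoc])
  also have "(\<Sum>g\<in>UNIV. (q (a + g) / s) *\<^sub>L (LT' c * (LT (- a - g) * (U (- g) * RS' g)))) =
      (q c / s) *\<^sub>L (sig' * U (a + c))"
    using U_RS'[of "- a - c"]
    by (subst sum_single[of "- a - c"]) (auto simp: leavitt_relations_assoc add.commute)
  also have "\<dots> = (\<Sum>h\<in>UNIV. (q c / (s * d) / b (a + c) h) *\<^sub>L LS' h) +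
      (\<Sum>h\<in>UNIV. (q c / d / q h) *\<^sub>L (LT' (- h) * LT' (h + (a + c))))"
    unfolding sig'_U by (simp add: lexpand, simp add: divide_inverse mult_ac flip: s_times_s)
  also have "(\<Sum>g\<in>UNIV. (q c * E (g - c) / (b g (a + c) * \<nu>)) *\<^sub>L (LT' (a + c) * RT' g)) =
      (\<Sum>g\<in>UNIV. \<Sum>h\<in>UNIV. (q c / (\<mu> * s * N) / b (a + c) h * E (g - c)) *\<^sub>L LS' h) +
      (\<Sum>g\<in>UNIV. \<Sum>h\<in>UNIV. (q c / N / q h * (E (g - c) * (q (g + h) * E (- h - g)))) *\<^sub>L (LT' (- h) * LT' (h + (a + c))))"
    by (simp add: T'_RT' lvs.scale_right_distrib lvs.scale_sum_right sum.distrib bq b_commute field_simps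
       nu_square(1)[symmetric])
  also have "(\<Sum>g\<in>UNIV. \<Sum>h\<in>UNIV. (q c / (\<mu> * s * N) / b (a + c) h * E (g - c)) *\<^sub>L LS' h) =
      (\<Sum>h\<in>UNIV. (- (q c / (s * d) / b (a + c) h)) *\<^sub>L LS' h)"
  proof (rule sum_swap_coeff)
    show "(\<Sum>g\<in>UNIV. q c / (\<mu> * s * N) / b (a + c) h * E (g - c)) = - (q c / (s * d) / b (a + c) h)" for h
      unfolding sum_distrib_left[symmetric] sum_shift(3)[of E]
      by (simp add: sum_E_total field_simps)
  qed
  also have "(\<Sum>g\<in>UNIV. \<Sum>h\<in>UNIV. (q c / N / q h * (E (g - c) * (q (g + h) * E (- h - g)))) *\<^sub>L (LT' (- h) * LT' (h + (a + c)))) =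
     (\<Sum>h\<in>UNIV. (q c / N / q h * (\<nu> * E 0 + (if - c - h = 0 then N else 0))) *\<^sub>L (LT' (- h) * LT' (h + (a + c))))"
  proof (rule sum_swap_coeff)
    fix h
    have "(\<Sum>g\<in>UNIV. E (g - c) * (q (g + h) * E (- h - g))) = (\<Sum>z\<in>UNIV. E (- c - h - z) * E z * q z)"
    proof -
      have "- c - h - (- h - g) = g - c" "q (- h - g) = q (g + h)" for g
        by (simp_all add: bq b_commute field_simps)
      then show ?thesis
        unfolding sum_shift(4)[of "\<lambda>z. E (- c - h - z) * E z * q z" "- h", symmetric] by (simp add: mult_ac)
    qed
    then show "(\<Sum>g\<in>UNIV. q c / N / q h * (E (g - c) * (q (g + h) * E (- h - g)))) =
        q c / N / q h * (\<nu> * E 0 + (if - c - h = 0 then N else 0))"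
      unfolding sum_distrib_left[symmetric] by (simp add: E_conv)
  qed
  also have "\<dots> = (\<Sum>h\<in>UNIV. (- (q c / d / q h)) *\<^sub>L (LT' (- h) * LT' (h + (a + c)))) + LT' c * LT' a"
  proof -
    have "q c / N / q h * (\<nu> * E 0 + (if - c - h = 0 then N else 0)) = - (q c / d / q h) + (if - c = h then 1 else 0)" for h
      by (auto simp: E_0_eq field_simps nu_square simp flip: nu_square(1))
    moreover have "(if P then c else 0) *\<^sub>L x = (if P then c *\<^sub>L x else 0)" for P c and x :: "'g leavitt"
      by simp
    ultimately show ?thesis
      by (simp only: lvs.scale_left_distrib sum.distrib) simp
  qed
  finally show ?thesis
    by (simp add: sum_negf)
qed

lemma comp_sum: "comp_sum = 1"
proof (rule leavitt_eqI)
  show "LT' a * comp_sum = LT' a * 1" for a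
    by (rule leavitt_eqI) (simp_all add: S'_T'_comp_sum T'_T'_comp_sum)
qed (simp add: S'_comp_sum)

theorem rho_well_defined: "\<exists>!f. unital_endo f \<and> (\<forall>l. f (leavitt_gen l) = rho_on_gens q E s l)"
  using comp_sum unfolding comp_sum_def
  by (intro leavitt_universal) (simp_all add: RS'_RS RT'_RT RS'_RT RT'_RS)

section \<open>Relations between \<open>\<rho>\<close>, \<open>\<alpha>\<close> and
  \<open>U\<close>\<close>

abbreviation \<rho> where "\<rho> \<equiv> rho q E s"
abbreviation \<alpha> where "\<alpha> g \<equiv> alpha q g"

lemma endo_rho: "unital_endo \<rho>"
  and rho_gen: "\<rho> (leavitt_gen l) = rho_on_gens q E s l"
  using endo_of[OF rho_well_defined] by (simp_all add: rho_def)

lemma endo_alpha: "unital_endo (\<alpha> g)"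
  and alpha_gen: "\<alpha> g (leavitt_gen l) = alpha_on_gens q g l"
  using endo_of[OF alpha_well_defined[OF metric_group]] by (simp_all add: alpha_def)

lemma endo_simps:
  assumes "unital_endo f"
  shows "f (x + y) = f x + f y" "f (x * y) = f x * f y" "f 1 = 1" "f (c *\<^sub>L x) = c *\<^sub>L f x"
    "f (\<Sum>i\<in>I. h i) = (\<Sum>i\<in>I. f (h i))" "f 0 = 0"
  using assms unital_endo_sum[OF assms] unital_endo_0[OF assms] by (auto simp: unital_endo_def)

lemmas rho_simps [simp] = endo_simps[OF endo_rho] and alpha_simps [simp] = endo_simps[OF endo_alpha]

lemma alpha_gens [simp]: "\<alpha> g (LS h) = LS (g + h)" "\<alpha> g (LS' h) = LS' (g + h)"
  "\<alpha> g (LT h) = inverse (b g h) *\<^sub>L LT h" "\<alpha> g (LT' h) = b g h *\<^sub>L LT' h"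
  by (simp_all add: alpha_gen)

lemma alpha_add: "\<alpha> g \<circ> \<alpha> h = \<alpha> (g + h)"
  by (rule unital_endo_eqI) (simp_all add: unital_endo_comp endo_alpha add.assoc bq mult.commute)

lemma alpha_zero: "\<alpha> 0 = id"
  by (rule unital_endo_eqI) (simp_all add: endo_alpha unital_endo_id)

lemma alpha_add': "\<alpha> g (\<alpha> h x) = \<alpha> (g + h) x"
  using alpha_add by (metis comp_apply)

lemma alpha_U: "\<alpha> g (U h) = b g h *\<^sub>L U h"
proof -
  have "(\<Sum>k\<in>UNIV. inverse (b h k) *\<^sub>L (LS (g + k) * LS' (g + k))) =
      (\<Sum>k\<in>UNIV. inverse (b h (k - g)) *\<^sub>L (LS k * LS' k))"
    using sum_shift(2)[of "\<lambda>k. inverse (b h (k - g)) *\<^sub>L (LS k * LS' k)" g] by simp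
  then show ?thesis
    by (simp add: leavitt_U_def lexpand bq b_commute field_simps)
qed

lemma alpha_sig: "\<alpha> g sig = sig"
proof -
  have "(\<Sum>h\<in>UNIV. (1 / d) *\<^sub>L LS (g + h)) = (\<Sum>h\<in>UNIV. (1 / d) *\<^sub>L LS h)"
    by (rule sum_shift)
  then show ?thesis
    by (simp add: sig_def lexpand bq)
qed

text \<open>On S, \<open>\<alpha> g\<close> fixes \<open>sig\<close> and multiplies
  \<open>U h\<close> and \<open>U (- h)\<close> by inverse scalars. On T, translating the index of
  the S-letters absorbs the characters.\<close>

lemma alpha_rho: "\<alpha> g \<circ> \<rho> = \<rho>"
proof (rule unital_endo_eqI)
  fix h
  show "(\<alpha> g \<circ> \<rho>) (LS h) = \<rho> (LS h)"
    by (simp add: rho_gen RS_eq alpha_U alpha_sig lexpand b_minus_right)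
  have *: "(\<Sum>h\<in>UNIV. f (g + h)) = sum f UNIV" for f :: "'g \<Rightarrow> 'g leavitt"
    by (rule sum_shift)
  have "(\<Sum>x\<in>UNIV. \<Sum>k\<in>UNIV. (b (x - h) k * b g k) *\<^sub>L (LS (g + x) * LT' k)) =
      (\<Sum>x\<in>UNIV. \<Sum>k\<in>UNIV. b (x - h) k *\<^sub>L (LS x * LT' k))"
    using *[of "\<lambda>x. \<Sum>k\<in>UNIV. b (x - h) k *\<^sub>L (LS x * LT' k)"] by (simp add: bq mult_ac)
  moreover have "(\<Sum>x\<in>UNIV. \<Sum>k\<in>UNIV. (inverse (b (h + x) k) * inverse (b g k)) *\<^sub>L (LT k * (LS (g + x) * LS' (g + x)))) =
      (\<Sum>x\<in>UNIV. \<Sum>k\<in>UNIV. inverse (b (h + x) k) *\<^sub>L (LT k * (LS x * LS' x)))"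
    using *[of "\<lambda>x. \<Sum>k\<in>UNIV. inverse (b (h + x) k) *\<^sub>L (LT k * (LS x * LS' x))"] by (simp add: bq mult_ac)
  ultimately show "(\<alpha> g \<circ> \<rho>) (LT h) = \<rho> (LT h)"
    by (simp add: rho_gen RT_eq mult.assoc lscale_mult_left lscale_mult_right) (simp add: bq field_simps)
qed (simp_all add: unital_endo_comp endo_alpha endo_rho)

lemma U_conj_RT: "U g * RT h = inverse (b g h) *\<^sub>L (RT h * U g)"
proof (rule leavitt_eqI)
  fix a
  show "LS' a * (U g * RT h) = LS' a * (inverse (b g h) *\<^sub>L (RT h * U g))"
  proof -
    let ?f = "\<lambda>k. (\<mu> / (s * \<nu>) * b (a - h) (k - g) / b g h) *\<^sub>L LT' k"
    have "(\<Sum>k\<in>UNIV. ?f (k + g)) = (\<Sum>k\<in>UNIV. ?f k)"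
      by (rule sum_shift)
    then show ?thesis
      by (simp add: U_rules S'_RT S'_RT[THEN mult_assoc_rule] lscale_mult_left lscale_mult_right sum_distrib_right
        lvs.scale_sum_right bq b_commute field_simps)
  qed
  show "LT' a * (U g * RT h) = LT' a * (inverse (b g h) *\<^sub>L (RT h * U g))"
  proof (rule leavitt_eqI)
    fix c
    show "LS' c * (LT' a * (U g * RT h)) = LS' c * (LT' a * (inverse (b g h) *\<^sub>L (RT h * U g)))"
      by (simp add: U_rules S'_T'_RT lexpand mult_assoc_rule[OF S'_T'_RT[unfolded mult.assoc[symmetric]], unfolded mult.assoc] bq b_commute field_simps)
    show "LT' c * (LT' a * (U g * RT h)) = LT' c * (LT' a * (inverse (b g h) *\<^sub>L (RT h * U g)))"
      by (simp add: U_rules T'_T'_RT lexpand mult_assoc_rule[OF T'_T'_RT[unfolded mult.assoc[symmetric]], unfolded mult.assoc] bq b_commute field_simps add_ac)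
  qed
qed

text \<open>The conjugate of \<rho> by \<open>U g\<close> is again a unital endomorphism, so
  generators suffice. On S the claim is the form \<open>RS_eq\<close> of the images; on T it is
  \<open>U_conj_RT\<close>.\<close>

lemma rho_alpha: "\<rho> (\<alpha> g x) = U g * \<rho> x * U (- g)"
proof -
  define f where "f x = U g * \<rho> x * U (- g)" for x
  have inv: "U (- g) * (U g * x) = x" for x
    by (simp add: U_zero U_add_assoc)
  have f: "unital_endo f"
    by (simp add: unital_endo_def f_def lexpand inv U_add U_zero)
  have "\<rho> \<circ> \<alpha> g = f"
  proof (rule unital_endo_eqI)
    show "(\<rho> \<circ> \<alpha> g) (LS h) = f (LS h)" for h
      by (simp add: f_def rho_gen RS_eq mult.assoc U_add U_add_assoc add.commute)
    show "(\<rho> \<circ> \<alpha> g) (LT h) = f (LT h)" for h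
      by (simp add: f_def rho_gen U_conj_RT lscale_mult_left mult.assoc U_add U_zero)
  qed (simp_all add: unital_endo_comp endo_alpha endo_rho f)
  then show ?thesis
    by (simp add: f_def fun_eq_iff)
qed

subsection \<open>The square of \<open>\<rho>\<close>\<close>

lemma rho_gens: "\<rho> (LS' g) = RS' g" "\<rho> (LT' g) = RT' g" "\<rho> (LS g) = RS g" "\<rho> (LT g) = RT g"
  by (simp_all add: rho_gen)

text \<open>The images of the generators resolve 1 as well. Testing with them suits products
  \<open>\<rho> x * y\<close>, because \<open>RS' a\<close> and \<open>RT' a\<close> are values of
  \<rho> and can be moved inside.\<close>

lemma rho_eqI:
  assumes "\<And>a. RS' a * x = RS' a * y" "\<And>a. RT' a * x = RT' a * y"
  shows "x = y"
proof -
  have "x = comp_sum * x" "y = comp_sum * y"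
    by (simp_all add: comp_sum)
  moreover have "comp_sum * x = comp_sum * y"
    by (simp add: comp_sum_def distrib_right sum_distrib_right mult.assoc assms)
  ultimately show ?thesis
    by simp
qed

lemma RS'_mult_rho: "RS' a * (\<rho> x * y) = \<rho> (LS' a * x) * y" "RT' a * (\<rho> x * y) = \<rho> (LT' a * x) * y"
  by (simp_all add: rho_gens mult.assoc)

lemma RS'_mult_rho2:
  "RS' c * (RT' a * (\<rho> x * y)) = \<rho> (LS' c * (LT' a * x)) * y"
  "RT' c * (RT' a * (\<rho> x * y)) = \<rho> (LT' c * (LT' a * x)) * y"
  by (simp_all add: rho_gens mult.assoc)

text \<open>In particular S_g is \<open>\<rho> (U (- g)) * LS 0\<close>, so the study of \<rho>
  \<circ> \<rho> on the S-letters reduces to S_0.\<close>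

lemma rho_U_S: "\<rho> (U g) * LS h = LS (h - g)"
  by (rule rho_eqI)
    (simp_all add: RS'_mult_rho S'_U T'_U rho_gens RS'_S RT'_S lscale_mult_left diff_diff_eq bq b_commute add_ac field_simps)

lemma rho_U_T: "\<rho> (U g) * LT c = (q g * b g c) *\<^sub>L (LT (c + g) * U g)"
proof (rule rho_eqI)
  fix a
  show "RS' a * (\<rho> (U g) * LT c) = RS' a * ((q g * b g c) *\<^sub>L (LT (c + g) * U g))"
    by (simp add: RS'_mult_rho S'_U rho_gens RS'_T RS'_T[THEN mult_assoc_rule] lscale_mult_left lscale_mult_right mult.assoc
        T'_U bq b_commute field_simps) (simp add: gnorm del: add_uminus_conv_diff uminus_add_conv_diff)
  let ?f = "\<lambda>h. (q g * b g c / \<nu> * (q (a + h) / q h * E (- h - a) * b a (c + g - h))) *\<^sub>L (LT (c + g - h) * LT' (g - h))"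
  have "(\<Sum>h\<in>UNIV. ?f h) = (\<Sum>h\<in>UNIV. ?f (h + g))"
    by (rule sum_shift[symmetric])
  then show "RT' a * (\<rho> (U g) * LT c) = RT' a * ((q g * b g c) *\<^sub>L (LT (c + g) * U g))"
    by (simp add: RS'_mult_rho T'_U rho_gens RT'_T RT'_T[THEN mult_assoc_rule] lexpand S'_U
        bq b_commute field_simps diff_diff_eq add_ac)
qed

lemma rho2_S0_S: "\<rho> (RS g) * LS 0 = LS 0 * LS g"
proof (rule rho_eqI)
  show "RS' a * (\<rho> (RS g) * LS 0) = RS' a * (LS 0 * LS g)" for a
    by (simp add: RS'_mult_rho S'_RS rho_U_S RS'_S[THEN mult_assoc_rule] lscale_mult_left U_S b_commute)
  show "RT' a * (\<rho> (RS g) * LS 0) = RT' a * (LS 0 * LS g)" for a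
    by (simp add: RS'_mult_rho T'_RS rho_U_S rho_gens mult.assoc RT'_S[THEN mult_assoc_rule] lexpand RT_eq
      bq b_commute field_simps)
qed

lemma rho2_S0_T: "\<rho> (RT g) * LS 0 = LS 0 * LT g"
proof (rule rho_eqI)
  fix a
  have "\<rho> (LS' a * RT g) * LS 0 =
      (\<Sum>k\<in>UNIV. \<Sum>j\<in>UNIV. (1 / (d * N) * b k (a - g + j)) *\<^sub>L LT j)"
    by (simp add: S'_RT rho_gens RT'_S lexpand bq b_commute field_simps s_times_s[symmetric] nu_square(1)[symmetric])
  also have "\<dots> = (\<Sum>j\<in>UNIV. (if a - g + j = 0 then 1 / (d * N) * N else 0) *\<^sub>L LT j)"
    by (rule sum_swap_coeff, rule orth_coeff) simp
  also have "\<dots> = (1 / d) *\<^sub>L LT (g - a)"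
    by (subst sum_single[of "g - a"]) (auto simp: add_eq_0_iff)
  finally show "RS' a * (\<rho> (RT g) * LS 0) = RS' a * (LS 0 * LT g)"
    by (simp add: RS'_mult_rho RS'_S[THEN mult_assoc_rule] lscale_mult_left U_T)
  show "RT' a * (\<rho> (RT g) * LS 0) = RT' a * (LS 0 * LT g)"
  \<comment> \<open>A second letter is taken because \<open>LT' a * RT g\<close> is still a sum,
    while after two letters \<open>S'_T'_RT\<close> and \<open>T'_T'_RT\<close> leave one
    generator.\<close>
  proof (rule rho_eqI)
    fix c
    have *: "RS' c * (LT j * LT g) = (if j = - g - c then (1 / (s * q g)) *\<^sub>L U c else 0)" for j
    proof -
      have "- j - c = g \<longleftrightarrow> j = - g - c"
        by auto
      then show ?thesis
        by (simp add: RS'_T[THEN mult_assoc_rule] lscale_mult_left mult.assoc leavitt_relations)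
    qed
    have "RS' c * (RT' a * (LS 0 * LT g)) =
        (1 / (\<mu> * s * \<nu>) * inverse (b (- a) (- g - c)) * (1 / (s * q g))) *\<^sub>L U c"
      by (simp add: RT'_S[THEN mult_assoc_rule] lscale_mult_left lscale_mult_right sum_distrib_left sum_distrib_right
          * lscale_if)
    also have "\<dots> = (inverse (b (g + c) a) / (\<mu> * q g * \<nu>) * (1 / d)) *\<^sub>L U c"
      by (simp add: bq b_commute field_simps flip: s_times_s)
    finally show "RS' c * (RT' a * (\<rho> (RT g) * LS 0)) = RS' c * (RT' a * (LS 0 * LT g))"
      by (simp only: RS'_mult_rho2 S'_T'_RT) (simp add: rho_gens RS'_S lscale_mult_left)
    have **: "RT' c * (LT j * LT g) = (1 / \<nu> * q (c - g) / q g * E (g - c) * b c (j + g)) *\<^sub>L LT (j + g)" for j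
      by (simp add: RT'_T[THEN mult_assoc_rule] lexpand) (subst sum_single[of "- g"]; force simp: algebra_simps)
    let ?f = "\<lambda>j. (1 / (\<mu> * s * \<nu>) * b a (j - g) * (1 / \<nu> * q (c - g) / q g * E (g - c) * b c j)) *\<^sub>L LT j"
    have "RT' c * (RT' a * (LS 0 * LT g)) = (\<Sum>j\<in>UNIV. ?f (j + g))"
      by (simp add: RT'_S[THEN mult_assoc_rule] lscale_mult_left lscale_mult_right sum_distrib_left sum_distrib_right
          lvs.scale_sum_right b_minus_left **)
    also have "\<dots> = sum ?f UNIV"
      by (rule sum_shift)
    also have "\<dots> = (\<Sum>j\<in>UNIV. (q c * E (g - c) / (b g (a + c) * \<nu>) * (1 / (\<mu> * s * \<nu>)) * b (a + c) j) *\<^sub>L LT j)"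
      by (rule sum.cong) (simp_all add: bq b_commute field_simps power2_eq_square)
    finally show "RT' c * (RT' a * (\<rho> (RT g) * LS 0)) = RT' c * (RT' a * (LS 0 * LT g))"
      by (simp only: RS'_mult_rho2 T'_T'_RT)
        (simp add: rho_gens RT'_S lscale_mult_left lvs.scale_sum_right bq b_commute field_simps)
  qed
qed

lemma RS'_RT'_T: "RT' a * (LT c * x) = (q a * b a c / \<nu>) *\<^sub>L
    (\<mu> *\<^sub>L (\<Sum>h\<in>UNIV. b h c *\<^sub>L (LS h * (LS' h * x))) +
     (\<Sum>h\<in>UNIV. E (- h - a) *\<^sub>L (LT (c - h) * (LT' (- h) * x))))"
  by (simp add: RT'_T[THEN mult_assoc_rule] lexpand bq b_commute field_simps)

lemma RT_T: "RT x * LT y = (\<mu> / (s * \<nu>)) *\<^sub>L (\<Sum>h\<in>UNIV. b (h - x) y *\<^sub>L LS h) +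
    (1 / \<nu>) *\<^sub>L (\<Sum>h\<in>UNIV. (q h * E (h + x) * inverse (b x y)) *\<^sub>L (LT (h + y) * LT (- h)))"
  by (simp add: RT_eq lexpand)

lemma sum_lscale_reflect:
  assumes "\<And>h. f h *\<^sub>L X h = f' (a - h) *\<^sub>L X' (a - h)"
  shows "(\<Sum>h\<in>UNIV. f h *\<^sub>L X h) = (\<Sum>h\<in>(UNIV :: 'g set). f' h *\<^sub>L (X' h :: 'g leavitt))"
  using sum_shift(4)[of "\<lambda>h. f' h *\<^sub>L X' h" a] by (simp add: assms)

lemma rho2_T_S: "\<rho> (RS g) * LT c = LT c * RS g"
proof (rule rho_eqI)
  fix a
  show "RS' a * (\<rho> (RS g) * LT c) = RS' a * (LT c * RS g)"
    by (simp add: RS'_mult_rho S'_RS rho_U_T RS'_T[THEN mult_assoc_rule] lscale_mult_left lscale_mult_right mult.assoc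
      T'_RS U_rules bq b_commute field_simps s_times_s[symmetric])
  have "RT' a * (\<rho> (RS g) * LT c) = (q (a + g) / s * (q g * b (- g) c)) *\<^sub>L (RT (- a - g) * LT (c - g) * U (- g))"
    by (simp add: RS'_mult_rho T'_RS rho_U_T rho_gens mult.assoc lscale_mult_left lscale_mult_right)
  also have "\<dots> = (\<Sum>h\<in>UNIV. (q (a + g) / s * (q g * b (- g) c) * (\<mu> / (s * \<nu>) * b (h - (- a - g)) (c - g))) *\<^sub>L (LS h * U (- g))) +
      (\<Sum>h\<in>UNIV. (q (a + g) / s * (q g * b (- g) c) * (1 / \<nu> * (q h * E (h + (- a - g)) * inverse (b (- a - g) (c - g))))) *\<^sub>L (LT (h + (c - g)) * (LT (- h) * U (- g))))"
    unfolding RT_T by (simp add: lexpand)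
  also have "(\<Sum>h\<in>UNIV. (q (a + g) / s * (q g * b (- g) c) * (1 / \<nu> * (q h * E (h + (- a - g)) * inverse (b (- a - g) (c - g))))) *\<^sub>L (LT (h + (c - g)) * (LT (- h) * U (- g)))) =
      (\<Sum>h\<in>UNIV. (q a * b a c / \<nu> * (E (- h - a) * (q (- h + g) / s))) *\<^sub>L (LT (c - h) * (LT (h - g) * U (- g))))"
  \<comment> \<open>Replacing \<open>h\<close> by \<open>g - h\<close> matches the arguments of
    \<open>E\<close> and the words at once; the scalars then agree by the bicharacter rules.\<close>
  proof (rule sum_lscale_reflect[where a = g])
    fix h
    have 1: "- (g - h) - a = h + (- a - g)" "- (g - h) + g = h" "c - (g - h) = h + (c - g)" "g - h - g = - h"
      by (simp_all add: algebra_simps)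
    have "q (a + g) / s * (q g * b (- g) c) * (1 / \<nu> * (q h * E (h + (- a - g)) * inverse (b (- a - g) (c - g)))) =
        q a * b a c / \<nu> * (E (h + (- a - g)) * (q h / s))"
      by (simp add: bq b_commute field_simps power2_eq_square)
    then show "(q (a + g) / s * (q g * b (- g) c) * (1 / \<nu> * (q h * E (h + (- a - g)) * inverse (b (- a - g) (c - g))))) *\<^sub>L (LT (h + (c - g)) * (LT (- h) * U (- g))) =
      (q a * b a c / \<nu> * (E (- (g - h) - a) * (q (- (g - h) + g) / s))) *\<^sub>L (LT (c - (g - h)) * (LT (g - h - g) * U (- g)))"
      unfolding 1 by simp
  qed
  also have "(\<Sum>h\<in>UNIV. (q (a + g) / s * (q g * b (- g) c) * (\<mu> / (s * \<nu>) * b (h - (- a - g)) (c - g))) *\<^sub>L (LS h * U (- g))) =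
      (\<Sum>h\<in>UNIV. (q a * b a c / \<nu> * (\<mu> * (b h c * (inverse (b g h) / d)))) *\<^sub>L (LS h * U (- g)))"
    by (rule sum.cong) (simp_all add: bq b_commute field_simps power2_eq_square flip: s_times_s)
  finally show "RT' a * (\<rho> (RS g) * LT c) = RT' a * (LT c * RS g)"
    by (simp add: RS'_RT'_T S'_RS T'_RS lexpand)
qed

lemma sum_lscale_reindex:
  assumes "\<And>h. f h *\<^sub>L X h = f' (h + a) *\<^sub>L X' (h + a)"
  shows "(\<Sum>h\<in>UNIV. f h *\<^sub>L X h) = (\<Sum>h\<in>(UNIV :: 'g set). f' h *\<^sub>L (X' h :: 'g leavitt))"
  using sum_shift(1)[of "\<lambda>h. f' h *\<^sub>L X' h" a] by (simp add: assms)

text \<open>The coefficients of the words S S' are twisted Gauss sums, evaluated by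
  \<open>gauss_lambda\<close>; those of the words T T' are transforms of \<open>q * E\<close>, given
  by \<open>sum_qE\<close>.\<close>

lemma rho2_T_T_S: "RS' a * (\<rho> (RT g) * LT c) = RS' a * (LT c * RT g)"
proof -
  have neg: "- c - a = - a - c"
    by simp
  have "RS' a * (\<rho> (RT g) * LT c) =
      (\<Sum>k\<in>UNIV. (\<mu> / (s * \<nu>) * b (a - g) k) *\<^sub>L (RT' k * LT c))"
    by (simp add: RS'_mult_rho S'_RT rho_gens lexpand)
  also have "\<dots> = (\<Sum>k\<in>UNIV. \<Sum>h\<in>UNIV. (\<mu> / (s * \<nu>) * b (a - g) k * (\<mu> * q k / \<nu> * b (k + h) c)) *\<^sub>L (LS h * LS' h)) +
      (\<Sum>k\<in>UNIV. \<Sum>h\<in>UNIV. (\<mu> / (s * \<nu>) * b (a - g) k * (1 / \<nu> * (q (k + h) / q h * E (- h - k) * b k (c - h)))) *\<^sub>L (LT (c - h) * LT' (- h)))"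
    by (simp add: RT'_T lvs.scale_right_distrib lvs.scale_sum_right sum.distrib mult.assoc)
  also have "(\<Sum>k\<in>UNIV. \<Sum>h\<in>UNIV. (\<mu> / (s * \<nu>) * b (a - g) k * (\<mu> * q k / \<nu> * b (k + h) c)) *\<^sub>L (LS h * LS' h)) =
      (\<Sum>h\<in>UNIV. (1 / (\<mu> * s * \<nu>) * b h c / q (a + c - g)) *\<^sub>L (LS h * LS' h))"
  proof (rule sum_swap_coeff)
    fix h
    have "(\<Sum>k\<in>UNIV. \<mu> / (s * \<nu>) * b (a - g) k * (\<mu> * q k / \<nu> * b (k + h) c)) =
        \<mu>\<^sup>2 / (s * N) * b h c * (\<Sum>k\<in>UNIV. q k * b k (a + c - g))"
      unfolding sum_distrib_left
      by (rule sum.cong) (simp_all add: bq b_commute field_simps power2_eq_square flip: nu_square(1))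
    also have "\<dots> = 1 / (\<mu> * s * \<nu>) * b h c / q (a + c - g)"
      unfolding gauss_sum_twist using gauss_lambda
      by (simp add: field_simps power2_eq_square power3_eq_cube flip: nu_square(1))
    finally show "(\<Sum>k\<in>UNIV. \<mu> / (s * \<nu>) * b (a - g) k * (\<mu> * q k / \<nu> * b (k + h) c)) =
      1 / (\<mu> * s * \<nu>) * b h c / q (a + c - g)" .
  qed
  also have "(\<Sum>k\<in>UNIV. \<Sum>h\<in>UNIV. (\<mu> / (s * \<nu>) * b (a - g) k * (1 / \<nu> * (q (k + h) / q h * E (- h - k) * b k (c - h)))) *\<^sub>L (LT (c - h) * LT' (- h))) =
      (\<Sum>h\<in>UNIV. (1 / (s * \<nu>) * E (h + g - a - c) * q h * b h (g - a - c)) *\<^sub>L (LT (c - h) * LT' (- h)))"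
  proof (rule sum_swap_coeff)
    fix h
    let ?y = "a - g + c - h"
    have "(\<Sum>k\<in>UNIV. \<mu> / (s * \<nu>) * b (a - g) k * (1 / \<nu> * (q (k + h) / q h * E (- h - k) * b k (c - h)))) =
        \<mu> / (s * N) / q h / b h ?y * (\<Sum>k\<in>UNIV. q (- h - k) * E (- h - k) * b (- h - k) (- ?y))"
      unfolding sum_distrib_left
      by (rule sum.cong) (simp_all add: bq b_commute field_simps power2_eq_square flip: nu_square(1))
    also have "(\<Sum>k\<in>UNIV. q (- h - k) * E (- h - k) * b (- h - k) (- ?y)) = \<nu> * E (- ?y) / \<mu>"
      unfolding sum_shift(4)[of "\<lambda>k. q k * E k * b k (- ?y)" "- h"] by (rule sum_qE)
    also have "- ?y = h + g - a - c"
      by simp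
    finally show "(\<Sum>k\<in>UNIV. \<mu> / (s * \<nu>) * b (a - g) k * (1 / \<nu> * (q (k + h) / q h * E (- h - k) * b k (c - h)))) =
        1 / (s * \<nu>) * E (h + g - a - c) * q h * b h (g - a - c)"
      by (simp add: bq b_commute field_simps power2_eq_square flip: nu_square(1))
  qed
  also have "(\<Sum>h\<in>UNIV. (1 / (s * \<nu>) * E (h + g - a - c) * q h * b h (g - a - c)) *\<^sub>L (LT (c - h) * LT' (- h))) =
      (\<Sum>h\<in>UNIV. (1 / (s * q (a + c)) * (1 / \<nu> * (q h * E (h + g) * inverse (b g (- a - c - h))))) *\<^sub>L (LT (- h - a) * LT' (- a - c - h)))"
  proof (rule sum_lscale_reindex[where a = "- a - c"])
    fix h
    have 1: "- (h + (- a - c)) - a = c - h" "- a - c - (h + (- a - c)) = - h" "h + (- a - c) + g = h + g - a - c"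
      by (simp_all add: algebra_simps)
    have "1 / (s * \<nu>) * E (h + g - a - c) * q h * b h (g - a - c) =
        1 / (s * q (a + c)) * (1 / \<nu> * (q (h + (- a - c)) * E (h + g - a - c) * inverse (b g (- h))))"
      by (simp add: bq b_commute field_simps power2_eq_square)
    then show "(1 / (s * \<nu>) * E (h + g - a - c) * q h * b h (g - a - c)) *\<^sub>L (LT (c - h) * LT' (- h)) =
      (1 / (s * q (a + c)) * (1 / \<nu> * (q (h + (- a - c)) * E (h + (- a - c) + g) * inverse (b g (- a - c - (h + (- a - c))))))) *\<^sub>L
      (LT (- (h + (- a - c)) - a) * LT' (- a - c - (h + (- a - c))))"
      unfolding 1 by simp
  qed
  also have "(\<Sum>h\<in>UNIV. (1 / (\<mu> * s * \<nu>) * b h c / q (a + c - g)) *\<^sub>L (LS h * LS' h)) =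
     (\<Sum>h\<in>UNIV. (1 / (s * q (a + c)) * (1 / (\<mu> * q g * \<nu>) * (inverse (b (g + h) (- a - c)) * inverse (b a h)))) *\<^sub>L (LS h * LS' h))"
    by (rule sum.cong) (simp_all add: bq b_commute field_simps power2_eq_square)
  finally show ?thesis
    by (simp add: neg RS'_T[THEN mult_assoc_rule] T'_RT lexpand U_rules add.commute[of c a])
qed

text \<open>The T-part is an autocorrelation of \<open>E\<close>. The constant
  \<open>- N / d\<close> in \<open>E_correlation\<close> cancels the S-part, and the remaining Gauss
  sum is converted by \<open>gauss_lambda\<close>.\<close>

lemma rho2_T_T_ST: "RS' f * (RT' a * (\<rho> (RT g) * LT c)) = RS' f * (RT' a * (LT c * RT g))"
proof -
  let ?X = "U f * LT' (- f - c)"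
  have neg: "- c - f = - f - c"
    by simp
  have 1: "RS' f * (\<Sum>h\<in>UNIV. b h c *\<^sub>L (LS h * (LS' h * RT g))) = (\<mu> * \<nu> / (d * s) * b g (f + c)) *\<^sub>L ?X"
  proof -
    have "RS' f * (\<Sum>h\<in>UNIV. b h c *\<^sub>L (LS h * (LS' h * RT g))) =
        U f * (\<Sum>h\<in>UNIV. \<Sum>k\<in>UNIV. (b h c * (b f h / d) * (\<mu> / (s * \<nu>) * b (h - g) k)) *\<^sub>L LT' k)"
      by (simp add: lexpand RS'_S[THEN mult_assoc_rule] S'_RT mult_ac)
    also have "\<dots> = U f * (\<Sum>k\<in>UNIV. (if c + f + k = 0 then \<mu> / (d * s * \<nu>) / b g k * N else 0) *\<^sub>L LT' k)"
      by (rule arg_cong[where f = "\<lambda>x. U f * x"], intro sum_swap_coeff orth_coeff)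
        (simp add: bq b_commute field_simps)
    also have "\<dots> = U f * ((\<mu> / (d * s * \<nu>) / b g (- f - c) * N) *\<^sub>L LT' (- f - c))"
    proof (subst sum_single[of "- f - c"])
      fix k assume "k \<noteq> - f - c"
      moreover have "k = (c + f + k) - f - c"
        by simp
      ultimately have "c + f + k \<noteq> 0"
        by force
      then show "(if c + f + k = 0 then \<mu> / (d * s * \<nu>) / b g k * N else 0) *\<^sub>L LT' k = 0"
        by simp
    qed (simp add: bq field_simps)
    finally show ?thesis
      by (simp add: lscale_mult_right bq field_simps flip: nu_square(1))
  qed
  let ?m = "g + f + c + a"
  have 2: "RS' f * (\<Sum>h\<in>UNIV. E (- h - a) *\<^sub>L (LT (c - h) * (LT' (- h) * RT g))) =
     (\<mu>\<^sup>2 / (s * \<nu>) * b g (f + c) * (gauss_sum / q ?m - N / d)) *\<^sub>L ?X"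
  proof -
    have r: "- (c - h + f) + - h - (- h) = h - c - f" "- f - (c - h) = h - c - f" "g - (h - c - f) = g + f + c - h" "- h + (h - c - f) = - f - c" for h
      by (simp_all add: algebra_simps)
    have "RS' f * (LT (c - h) * (LT' (- h) * RT g)) =
        (1 / (s * \<nu>) * b g (f + c) * E (g + f + c - h)) *\<^sub>L ?X" for h
    proof -
      have "RS' f * (LT (c - h) * (LT' (- h) * RT g)) =
        (1 / (s * q (f + (c - h)))) *\<^sub>L (U f * (LT' (- f - (c - h)) * (LT' (- h) * RT g)))"
        by (simp add: RS'_T[THEN mult_assoc_rule] lscale_mult_left mult.assoc RS'_T add.commute)
          (simp add: gnorm del: add_uminus_conv_diff uminus_add_conv_diff)
      also have "\<dots> = (1 / (s * q (f + (c - h))) * (q (h - c - f) * E (g + f + c - h) / (b g (- f - c) * \<nu>))) *\<^sub>L ?X"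
        by (simp only: r T'_T'_RT lscale_mult_right lvs.scale_scale)
      also have "1 / (s * q (f + (c - h))) * (q (h - c - f) * E (g + f + c - h) / (b g (- f - c) * \<nu>)) =
          1 / (s * \<nu>) * b g (f + c) * E (g + f + c - h)"
        by (simp add: bq b_commute field_simps power2_eq_square)
      finally show ?thesis .
    qed
    then have "RS' f * (\<Sum>h\<in>UNIV. E (- h - a) *\<^sub>L (LT (c - h) * (LT' (- h) * RT g))) =
        (1 / (s * \<nu>) * b g (f + c) * (\<Sum>h\<in>UNIV. E (- h - a) * E (g + f + c - h))) *\<^sub>L ?X"
      by (simp add: sum_distrib_left lscale_mult_right lvs.scale_sum_left mult_ac)
    also have "(\<Sum>h\<in>UNIV. E (- h - a) * E (g + f + c - h)) = (\<Sum>z\<in>UNIV. E z * E (z + ?m))"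
    proof -
      have r: "- a - h + ?m = g + f + c - h" "- h - a = - a - h" for h
        by (simp_all add: algebra_simps)
      show ?thesis
        unfolding sum_shift(4)[of "\<lambda>z. E z * E (z + ?m)" "- a", symmetric] by (simp only: r)
    qed
    finally show ?thesis
      by (simp add: E_correlation E_0_eq mult_ac flip: nu_square(1))
  qed
  have "RS' f * (RT' a * (LT c * RT g)) =
      (q a * b a c / \<nu> * (\<mu> * (\<mu> * \<nu> / (d * s) * b g (f + c)) + \<mu>\<^sup>2 / (s * \<nu>) * b g (f + c) * (gauss_sum / q ?m - N / d))) *\<^sub>L ?X"
    by (simp only: RS'_RT'_T lscale_mult_right distrib_left 1 2 lvs.scale_scale lvs.scale_right_distrib
      lvs.scale_left_distrib mult.assoc)
  also have "q a * b a c / \<nu> * (\<mu> * (\<mu> * \<nu> / (d * s) * b g (f + c)) + \<mu>\<^sup>2 / (s * \<nu>) * b g (f + c) * (gauss_sum / q ?m - N / d)) =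
      q a * b a c / \<nu> * b g (f + c) / (s * \<nu>) * (\<mu>\<^sup>2 * gauss_sum) / q ?m"
    by (simp add: field_simps power2_eq_square flip: nu_square(1))
  also have "\<mu>\<^sup>2 * gauss_sum = \<nu> / \<mu>"
    using gauss_lambda by (simp add: field_simps power2_eq_square power3_eq_cube)
  also have "q a * b a c / \<nu> * b g (f + c) / (s * \<nu>) * (\<nu> / \<mu>) / q ?m =
      inverse (b (g + f) a) / (\<mu> * q g * \<nu>) * (1 / (s * q (c + f)))"
    by (simp add: bq b_commute field_simps power2_eq_square)
  finally show ?thesis
    by (simp only: RS'_mult_rho2 S'_T'_RT) (simp add: neg rho_gens RS'_T lscale_mult_left add.commute)
qed

text \<open>The component that carries the full pentagon identity. The coefficient of each word T T'
  is a sum of products of three values of \<open>E\<close>; the constant \<open>\<mu> * E 0\<close>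
  of the pentagon cancels the contribution of the S-part. The words S S' only need a transform of
  \<open>E\<close>.\<close>

lemma rho2_T_T_TT: "RT' f * (RT' a * (\<rho> (RT g) * LT c)) = RT' f * (RT' a * (LT c * RT g))"
proof -
  have 1: "RT' f * (\<Sum>h\<in>UNIV. b h c *\<^sub>L (LS h * (LS' h * RT g))) =
      (\<Sum>j\<in>UNIV. (b f (c + j) / (d * b g j)) *\<^sub>L (LT (c + j) * LT' j))"
  proof -
    have "RT' f * (\<Sum>h\<in>UNIV. b h c *\<^sub>L (LS h * (LS' h * RT g))) =
        (\<Sum>h\<in>UNIV. \<Sum>j\<in>UNIV. \<Sum>k\<in>UNIV. (b f k / b g j / (d * N) * b h (c + j - k)) *\<^sub>L (LT k * LT' j))"
      by (simp add: lexpand RT'_S[THEN mult_assoc_rule] S'_RT bq b_commute field_simps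
          s_times_s[symmetric] nu_square(1)[symmetric])
    also have "\<dots> = (\<Sum>j\<in>UNIV. \<Sum>h\<in>UNIV. \<Sum>k\<in>UNIV. (b f k / b g j / (d * N) * b h (c + j - k)) *\<^sub>L (LT k * LT' j))"
      by (rule sum.swap)
    also have "\<dots> = (\<Sum>j\<in>UNIV. \<Sum>k\<in>UNIV. (if c + j - k = 0 then b f k / b g j / (d * N) * N else 0) *\<^sub>L (LT k * LT' j))"
      by (rule sum.cong, rule refl, rule sum_swap_coeff, rule orth_coeff) (rule refl)
    also have "\<dots> = (\<Sum>j\<in>UNIV. (b f (c + j) / (d * b g j)) *\<^sub>L (LT (c + j) * LT' j))"
    proof (rule sum.cong)
      show "(\<Sum>k\<in>UNIV. (if c + j - k = 0 then b f k / b g j / (d * N) * N else 0) *\<^sub>L (LT k * LT' j)) =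
          (b f (c + j) / (d * b g j)) *\<^sub>L (LT (c + j) * LT' j)" for j
        by (subst sum_single[of "c + j"]) (auto simp: mult_ac)
    qed simp
    finally show ?thesis .
  qed
  let ?A = "\<lambda>h i. E (- h - a) * (q f * b f (c - h) / \<nu>) * (\<mu> * (b i (c - h) * (inverse (b (g + i) (- h)) / (\<mu> * q g * \<nu>))))"
  let ?B = "\<lambda>h i. E (- h - a) * (q f * b f (c - h) / \<nu>) * (E (- i - f) * (q (- i) * E (g - - i) / (b g (- h + - i) * \<nu>)))"
  have "RT' f * (\<Sum>h\<in>UNIV. E (- h - a) *\<^sub>L (LT (c - h) * (LT' (- h) * RT g))) =
      (\<Sum>h\<in>UNIV. \<Sum>i\<in>UNIV. ?A h i *\<^sub>L (LS i * LS' i)) +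
      (\<Sum>h\<in>UNIV. \<Sum>i\<in>UNIV. ?B h i *\<^sub>L (LT (c - h - i) * LT' (- h + - i)))"
    by (simp only: sum_distrib_left lscale_mult_right RS'_RT'_T S'_T'_RT T'_T'_RT lvs.scale_right_distrib
        lvs.scale_sum_right lvs.scale_scale sum.distrib mult.assoc)
  also have "(\<Sum>h\<in>UNIV. \<Sum>i\<in>UNIV. ?A h i *\<^sub>L (LS i * LS' i)) =
      (\<Sum>i\<in>UNIV. (q f * b f c * b i c / (N * q g) * (\<nu> * \<mu> * q (f - g) * E (g - f) * b a (f - g))) *\<^sub>L (LS i * LS' i))"
  proof (rule sum_swap_coeff)
    fix i
    have "(\<Sum>h\<in>UNIV. ?A h i) = q f * b f c * b i c / (N * q g) * b a (f - g) * (\<Sum>h\<in>UNIV. E (- a - h) * b (- a - h) (f - g))"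
      unfolding sum_distrib_left
      by (rule sum.cong) (simp_all add: bq b_commute field_simps flip: nu_square(1), simp add: gnorm del: add_uminus_conv_diff uminus_add_conv_diff)
    also have "(\<Sum>h\<in>UNIV. E (- a - h) * b (- a - h) (f - g)) = \<nu> * \<mu> * q (f - g) * E (- (f - g))"
      unfolding sum_shift(4)[of "\<lambda>k. E k * b k (f - g)" "- a"] by (rule sum_E)
    finally show "(\<Sum>h\<in>UNIV. ?A h i) = q f * b f c * b i c / (N * q g) * (\<nu> * \<mu> * q (f - g) * E (g - f) * b a (f - g))"
      by simp
  qed
  also have "(\<Sum>h\<in>UNIV. \<Sum>i\<in>UNIV. ?B h i *\<^sub>L (LT (c - h - i) * LT' (- h + - i))) =
      (\<Sum>h\<in>UNIV. \<Sum>j\<in>UNIV. ?B h (- h - j) *\<^sub>L (LT (c + j) * LT' j))"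
  proof (rule sum.cong)
    fix h
    show "(\<Sum>i\<in>UNIV. ?B h i *\<^sub>L (LT (c - h - i) * LT' (- h + - i))) =
      (\<Sum>j\<in>UNIV. ?B h (- h - j) *\<^sub>L (LT (c + j) * LT' j))"
    proof (rule sum_lscale_reflect[where a = "- h"])
      fix i
      have e: "- h - (- h - i) = i" "c + (- h - i) = c - h - i" "- h - i = - h + - i"
        by (simp_all add: algebra_simps)
      show "?B h i *\<^sub>L (LT (c - h - i) * LT' (- h + - i)) = ?B h (- h - (- h - i)) *\<^sub>L (LT (c + (- h - i)) * LT' (- h - i))"
        unfolding e(1) unfolding e(2) unfolding e(3) by (rule refl)
    qed
  qed simp
  also have "\<dots> = (\<Sum>j\<in>UNIV. (1 / N * b f (c + j) / b g j * (\<nu> * (b (g - f) (j - a - f) * E (g - f) * E (j - a - f) + \<mu> * E 0))) *\<^sub>L (LT (c + j) * LT' j))"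
  proof (rule sum_swap_coeff)
    fix j
    \<comment> \<open>The pentagon summand for the pair \<open>x = g - f\<close>,
      \<open>y = j - a - f\<close>; its variable is \<open>z = h + (j - f)\<close>.\<close>
    let ?P = "\<lambda>z. E (j - a - f - z) * E z * q z * E (g - f - z)"
    have "(\<Sum>h\<in>UNIV. ?B h (- h - j)) = (\<Sum>h\<in>UNIV. 1 / N * b f (c + j) / b g j * ?P (h + (j - f)))"
    proof (rule sum.cong)
      fix h
      have 1: "- (- h - j) = h + j" "- h + (h + j) = j" "- (- h - j) - f = h + j - f" "g - (h + j) = g - f - (h + j - f)"
        "j - a - f - (h + j - f) = - h - a" "h + (j - f) = h + j - f" "- h - - h = 0" "- h - (- h - j) = j"
        by (simp_all add: algebra_simps)
      have "q f * b f (c - h) / \<nu> * (q (h + j) / (b g (- h + (h + j)) * \<nu>)) = 1 / N * b f (c + j) / b g j * q (h + j - f)"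
        by (simp add: bq b_commute field_simps power2_eq_square flip: nu_square(1))
      then have "E (- h - a) * E (h + j - f) * E (g - (h + j)) * (q f * b f (c - h) / \<nu> * (q (h + j) / (b g (- h + (h + j)) * \<nu>))) =
        E (- h - a) * E (h + j - f) * E (g - (h + j)) * (1 / N * b f (c + j) / b g j * q (h + j - f))"
        by (rule arg_cong)
      then show "?B h (- h - j) = 1 / N * b f (c + j) / b g j * ?P (h + (j - f))"
        unfolding 1 by (simp add: mult_ac)
    qed simp
    also have "\<dots> = 1 / N * b f (c + j) / b g j * (\<Sum>z\<in>UNIV. ?P z)"
      unfolding sum_distrib_left[symmetric] sum_shift(1)[of ?P "j - f"] ..
    finally show "(\<Sum>h\<in>UNIV. ?B h (- h - j)) =
        1 / N * b f (c + j) / b g j * (\<nu> * (b (g - f) (j - a - f) * E (g - f) * E (j - a - f) + \<mu> * E 0))"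
      unfolding pentagon .
  qed
  finally have 2: "RT' f * (\<Sum>h\<in>UNIV. E (- h - a) *\<^sub>L (LT (c - h) * (LT' (- h) * RT g))) =
      (\<Sum>i\<in>UNIV. (q f * b f c * b i c / (N * q g) * (\<nu> * \<mu> * q (f - g) * E (g - f) * b a (f - g))) *\<^sub>L (LS i * LS' i)) +
      (\<Sum>j\<in>UNIV. (1 / N * b f (c + j) / b g j * (\<nu> * (b (g - f) (j - a - f) * E (g - f) * E (j - a - f) + \<mu> * E 0))) *\<^sub>L (LT (c + j) * LT' j))" .
  have "RT' f * (RT' a * (LT c * RT g)) =
      (\<Sum>i\<in>UNIV. (q a * b a c / \<nu> * (q f * b f c * b i c / (N * q g) * (\<nu> * \<mu> * q (f - g) * E (g - f) * b a (f - g)))) *\<^sub>L (LS i * LS' i)) +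
      (\<Sum>j\<in>UNIV. (q a * b a c / \<nu> * (\<mu> * (b f (c + j) / (d * b g j)) + 1 / N * b f (c + j) / b g j * (\<nu> * (b (g - f) (j - a - f) * E (g - f) * E (j - a - f) + \<mu> * E 0)))) *\<^sub>L (LT (c + j) * LT' j))"
  proof -
    have "RT' f * (RT' a * (LT c * RT g)) = (q a * b a c / \<nu>) *\<^sub>L
       (\<mu> *\<^sub>L (RT' f * (\<Sum>h\<in>UNIV. b h c *\<^sub>L (LS h * (LS' h * RT g)))) +
        RT' f * (\<Sum>h\<in>UNIV. E (- h - a) *\<^sub>L (LT (c - h) * (LT' (- h) * RT g))))"
      by (simp only: RS'_RT'_T lscale_mult_right distrib_left)
    then show ?thesis
      by (simp only: 1 2 lvs.scale_right_distrib lvs.scale_left_distrib distrib_left[of "q a * b a c / \<nu>"]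
        lvs.scale_sum_right lvs.scale_scale sum.distrib add_ac mult.assoc)
  qed
  also have "(\<Sum>i\<in>UNIV. (q a * b a c / \<nu> * (q f * b f c * b i c / (N * q g) * (\<nu> * \<mu> * q (f - g) * E (g - f) * b a (f - g)))) *\<^sub>L (LS i * LS' i)) =
      (\<Sum>i\<in>UNIV. (q f * E (g - f) / (b g (a + f) * \<nu>) * (\<mu> * q (a + f) / \<nu> * b (a + f + i) c)) *\<^sub>L (LS i * LS' i))"
    by (rule sum.cong) (simp_all add: bq b_commute field_simps power2_eq_square flip: nu_square(1))
  also have "(\<Sum>j\<in>UNIV. (q a * b a c / \<nu> * (\<mu> * (b f (c + j) / (d * b g j)) + 1 / N * b f (c + j) / b g j * (\<nu> * (b (g - f) (j - a - f) * E (g - f) * E (j - a - f) + \<mu> * E 0)))) *\<^sub>L (LT (c + j) * LT' j)) =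
      (\<Sum>h\<in>UNIV. (q f * E (g - f) / (b g (a + f) * \<nu>) * (1 / \<nu> * (q (a + f + h) / q h * E (- h - (a + f)) * b (a + f) (c - h)))) *\<^sub>L (LT (c - h) * LT' (- h)))"
  proof (rule sum_lscale_reflect[where a = 0])
    fix j
    have 1: "- (0 - j) = j" "c - (0 - j) = c + j" "- (0 - j) - (a + f) = j - a - f" "a + f + (0 - j) = a + f - j" "0 - j = - j"
      by (simp_all add: algebra_simps)
    have "q a * b a c / \<nu> * (\<mu> * (b f (c + j) / (d * b g j)) + 1 / N * b f (c + j) / b g j * (\<nu> * (b (g - f) (j - a - f) * E (g - f) * E (j - a - f) + \<mu> * E 0))) =
        q a * b a c / N * b f (c + j) / b g j * b (g - f) (j - a - f) * (E (g - f) * E (j - a - f))"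
      by (simp add: E_0_eq field_simps flip: nu_square(1))
    also have "q a * b a c / N * b f (c + j) / b g j * b (g - f) (j - a - f) = q f / (b g (a + f) * \<nu>) * (1 / \<nu> * (q (a + f - j) / q j * b (a + f) (c + j)))"
      by (simp add: bq b_commute field_simps power2_eq_square flip: nu_square(1))
    finally show "(q a * b a c / \<nu> * (\<mu> * (b f (c + j) / (d * b g j)) + 1 / N * b f (c + j) / b g j * (\<nu> * (b (g - f) (j - a - f) * E (g - f) * E (j - a - f) + \<mu> * E 0)))) *\<^sub>L (LT (c + j) * LT' j) =
      (q f * E (g - f) / (b g (a + f) * \<nu>) * (1 / \<nu> * (q (a + f + (0 - j)) / q (0 - j) * E (- (0 - j) - (a + f)) * b (a + f) (c - (0 - j))))) *\<^sub>L (LT (c - (0 - j)) * LT' (- (0 - j)))"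
      unfolding 1 by (simp add: mult_ac diff_diff_eq)
  qed
  finally show ?thesis
    by (simp only: RS'_mult_rho2 T'_T'_RT) (simp add: rho_gens RT'_T lexpand)
qed

lemma rho2_T_T: "\<rho> (RT g) * LT c = LT c * RT g"
proof (rule rho_eqI)
  show "RT' a * (\<rho> (RT g) * LT c) = RT' a * (LT c * RT g)" for a
    by (rule rho_eqI) (rule rho2_T_T_ST rho2_T_T_TT)+
qed (rule rho2_T_T_S)

subsection \<open>Fusion rules and intertwiners\<close>

definition Phi where
  "Phi x = (\<Sum>g\<in>UNIV. LS g * (\<alpha> g x * LS' g)) + (\<Sum>g\<in>UNIV. LT g * (\<rho> x * LT' g))"

lemma Phi_S: "Phi x * LS g = LS g * \<alpha> g x" and Phi_T: "Phi x * LT g = LT g * \<rho> x"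
  by (simp_all add: Phi_def lexpand)

lemma endo_Phi: "unital_endo Phi"
proof -
  have "Phi (x * y) = Phi x * Phi y" for x y
    by (simp add: Phi_def lexpand)
  moreover have "Phi 1 = 1"
    using leavitt_relations(5) by (simp add: Phi_def)
  ultimately show ?thesis
    by (simp add: unital_endo_def Phi_def lexpand sum.distrib)
qed

lemma mult_right_eqI:
  assumes "\<And>g. x * LS g = y * LS g" "\<And>g. x * LT g = y * LT g"
  shows "x = (y :: 'g leavitt)"
  using leavitt_mult_expand[of x 1] leavitt_mult_expand[of y 1] by (simp add: assms)

text \<open>S_g is obtained from S_0 by \<open>\<rho> (U (- g))\<close>, and commuting
  \<open>U (- g)\<close> past \<open>\<rho> x\<close> replaces \<open>x\<close> by
  \<open>\<alpha> g x\<close>. So the relation at S_0, known on the orbit of \<open>x\<close>,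
  spreads to all S_g.\<close>

lemma rho_rho_S_aux:
  assumes "\<And>h. \<rho> (\<rho> (\<alpha> h x)) * LS 0 = LS 0 * \<alpha> h x"
  shows "\<rho> (\<rho> x) * LS g = LS g * \<alpha> g x"
proof -
  have "\<rho> (\<rho> x) * LS g = \<rho> (\<rho> x) * (\<rho> (U (- g)) * LS 0)"
    by (simp add: rho_U_S)
  also have "\<dots> = \<rho> (\<rho> x * U (- g)) * LS 0"
    by (simp add: mult.assoc)
  also have "\<rho> x * U (- g) = U (- g) * \<rho> (\<alpha> g x)"
    by (simp add: rho_alpha mult.assoc U_add_assoc U_zero)
  also have "\<rho> \<dots> * LS 0 = \<rho> (U (- g)) * (\<rho> (\<rho> (\<alpha> g x)) * LS 0)"
    by (simp add: mult.assoc)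
  also have "\<dots> = \<rho> (U (- g)) * LS 0 * \<alpha> g x"
    by (simp only: assms mult.assoc)
  also have "\<dots> = LS g * \<alpha> g x"
    by (simp add: rho_U_S)
  finally show ?thesis .
qed

lemma rho_rho: "\<rho> \<circ> \<rho> = Phi"
proof (rule unital_endo_eqI)
  fix h
  show "(\<rho> \<circ> \<rho>) (LS h) = Phi (LS h)"
  proof (rule mult_right_eqI)
    show "(\<rho> \<circ> \<rho>) (LS h) * LS g = Phi (LS h) * LS g" for g
      using rho_rho_S_aux[of "LS h" g] rho2_S0_S by (simp add: Phi_S rho_gens)
    show "(\<rho> \<circ> \<rho>) (LS h) * LT g = Phi (LS h) * LT g" for g
      using rho2_T_S by (simp add: Phi_T rho_gens)
  qed
  show "(\<rho> \<circ> \<rho>) (LT h) = Phi (LT h)"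
  proof (rule mult_right_eqI)
    show "(\<rho> \<circ> \<rho>) (LT h) * LS g = Phi (LT h) * LS g" for g
      using rho_rho_S_aux[of "LT h" g] rho2_S0_T by (simp add: Phi_S rho_gens lscale_mult_left lscale_mult_right)
    show "(\<rho> \<circ> \<rho>) (LT h) * LT g = Phi (LT h) * LT g" for g
      using rho2_T_T by (simp add: Phi_T rho_gens)
  qed
qed (simp_all add: unital_endo_comp endo_rho endo_Phi)

text \<open>The intertwining relation at S_0 gives \<open>LS' g * x * LS 0 = x\<close>, a
  compression between distinct letters.\<close>

lemma inter_id_alpha: "x \<in> intertwiners id (\<alpha> g) \<Longrightarrow> g \<noteq> 0 \<Longrightarrow> x = 0"
  using compress_distinct[of "(True, g)" "(True, 0)" x 1]
  by (simp add: intertwiners_def mult.assoc leavitt_relations_assoc)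

text \<open>A central element is fixed by compression at S_0 and at T_0, two different
  letters.\<close>

lemma inter_id_id: "x \<in> intertwiners id id \<Longrightarrow> \<exists>c. x = c *\<^sub>L (1 :: 'g leavitt)"
  using compress_scalar[of "(True, 0)" "(False, 0)" x]
  by (simp add: intertwiners_def mult.assoc leavitt_relations_assoc)

text \<open>Since \<open>LS' 0 * \<rho> (LS 0)\<close> is \<open>1 / d\<close>, compression at S_0
  multiplies \<open>x\<close> by \<open>1 / d\<close>, which is neither 0 nor 1.\<close>

lemma inter_id_rho: "x \<in> intertwiners id \<rho> \<Longrightarrow> x = 0"
  using compress_eigen[of "(True, 0)" x "1 / d"] d_neq_1
  by (simp add: intertwiners_def mult.assoc rho_gens S'_RS[THEN mult_assoc_rule] lscale_mult_left U_zero)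

lemma inter_rho_id: "x \<in> intertwiners \<rho> id \<Longrightarrow> x = 0"
proof -
  assume x: "x \<in> intertwiners \<rho> id"
  have "LS' 0 * x * LS 0 = x * \<rho> (LS' 0) * LS 0"
    using x by (simp add: intertwiners_def)
  also have "\<dots> = (1 / d) *\<^sub>L x"
    by (simp add: rho_gens mult.assoc RS'_S U_zero lscale_mult_right)
  finally show "x = 0"
    using compress_eigen[of "(True, 0)" x "1 / d"] d_neq_1 by simp
qed

lemma inter_alpha_alpha: "x \<in> intertwiners (\<alpha> g) (\<alpha> h) \<Longrightarrow> x \<in> intertwiners id (\<alpha> (h - g))"
proof -
  assume x: "x \<in> intertwiners (\<alpha> g) (\<alpha> h)"
  have "x * \<alpha> g (\<alpha> (- g) y) = \<alpha> h (\<alpha> (- g) y) * x" for y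
    using x by (simp add: intertwiners_def)
  then show ?thesis
    by (simp add: intertwiners_def alpha_add' alpha_zero)
qed

text \<open>\<rho> \<circ> \<alpha>_{-g} is conjugate to \<rho> by \<open>U g\<close>, so
  \<open>U g * x\<close> intertwines the identity with \<rho>.\<close>

lemma inter_alpha_rho: "x \<in> intertwiners (\<alpha> g) \<rho> \<Longrightarrow> x = 0"
proof -
  assume x: "x \<in> intertwiners (\<alpha> g) \<rho>"
  have "x * \<alpha> g (\<alpha> (- g) y) = \<rho> (\<alpha> (- g) y) * x" for y
    using x by (simp add: intertwiners_def)
  then have "x * y = U (- g) * (\<rho> y * (U g * x))" for y
    by (simp add: alpha_add' alpha_zero rho_alpha mult.assoc)
  then have "U g * x * y = \<rho> y * (U g * x)" for y
    by (simp add: mult.assoc U_add_assoc U_zero)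
  then have "U g * x \<in> intertwiners id \<rho>"
    by (simp add: intertwiners_def)
  then have "U g * x = 0"
    by (rule inter_id_rho)
  then have "U (- g) * (U g * x) = 0"
    by simp
  then show "x = 0"
    by (simp add: U_add_assoc U_zero)
qed

lemma inter_rho_alpha: "x \<in> intertwiners \<rho> (\<alpha> g) \<Longrightarrow> x = 0"
proof -
  assume x: "x \<in> intertwiners \<rho> (\<alpha> g)"
  have "\<alpha> (- g) (x * \<rho> y) = \<alpha> (- g) (\<alpha> g y * x)" for y
    using x by (simp add: intertwiners_def)
  moreover have "\<alpha> (- g) (\<rho> y) = \<rho> y" for y
    using alpha_rho by (metis comp_apply)
  ultimately have "\<alpha> (- g) x \<in> intertwiners \<rho> id"
    by (simp add: intertwiners_def alpha_add' alpha_zero)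
  then have "\<alpha> (- g) x = 0"
    by (rule inter_rho_id)
  then have "\<alpha> g (\<alpha> (- g) x) = 0"
    by simp
  then show "x = 0"
    by (simp only: alpha_add') (simp add: alpha_zero)
qed

text \<open>Frobenius reciprocity: \<open>x * LS 0\<close> intertwines the identity with \<rho>
  \<circ> \<rho>. Its components along S_g with \<open>g \<noteq> 0\<close> and along all T_g vanish
  by the preceding cases, so it is a multiple of S_0, and \<open>x\<close> can be recovered from
  it.\<close>

lemma inter_rho_rho: "x \<in> intertwiners \<rho> \<rho> \<Longrightarrow> \<exists>c. x = c *\<^sub>L 1"
proof -
  assume x: "x \<in> intertwiners \<rho> \<rho>"
  have r2: "\<rho> (\<rho> y) = Phi y" for y
    using rho_rho by (metis comp_apply)
  have xS: "x * LS 0 * y = Phi y * (x * LS 0)" for y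
  proof -
    have "x * LS 0 * y = x * (Phi y * LS 0)"
      by (simp add: Phi_S alpha_zero mult.assoc)
    also have "\<dots> = x * \<rho> (\<rho> y) * LS 0"
      by (simp only: r2 mult.assoc)
    also have "\<dots> = \<rho> (\<rho> y) * x * LS 0"
      using x by (simp add: intertwiners_def)
    finally show ?thesis
      by (simp only: r2 mult.assoc)
  qed
  have S'_Phi: "LS' g * Phi y = \<alpha> g y * LS' g" and T'_Phi: "LT' g * Phi y = \<rho> y * LT' g" for g y
    by (simp_all add: Phi_def lexpand)
  have "LS' g * (x * LS 0) \<in> intertwiners id (\<alpha> g)" for g
    using xS by (simp add: intertwiners_def mult.assoc) (simp add: S'_Phi flip: mult.assoc)
  then have 1: "g \<noteq> 0 \<Longrightarrow> LS' g * (x * LS 0) = 0" and "\<exists>c. LS' 0 * (x * LS 0) = c *\<^sub>L 1" for g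
    using inter_id_alpha inter_id_id[of "LS' 0 * (x * LS 0)"] by (blast, metis alpha_zero)
  then obtain c where c: "LS' 0 * (x * LS 0) = c *\<^sub>L 1"
    by blast
  have "LT' g * (x * LS 0) \<in> intertwiners id \<rho>" for g
    using xS by (simp add: intertwiners_def mult.assoc) (simp add: T'_Phi flip: mult.assoc)
  then have 2: "LT' g * (x * LS 0) = 0" for g
    using inter_id_rho by blast
  have xS0: "x * LS 0 = c *\<^sub>L LS 0"
  proof (rule leavitt_eqI)
    show "LS' a * (x * LS 0) = LS' a * (c *\<^sub>L LS 0)" for a
      using 1[of a] c by (cases "a = 0") (auto simp: lscale_mult_right leavitt_relations)
    show "LT' a * (x * LS 0) = LT' a * (c *\<^sub>L LS 0)" for a
      by (simp add: 2 lscale_mult_right leavitt_relations)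
  qed
  \<comment> \<open>Moving \<open>x\<close> to the left gives \<open>x / d\<close>, while
    \<open>x * LS 0 = c *\<^sub>L LS 0\<close> gives \<open>c / d\<close>.\<close>
  have "\<rho> (LS' 0) * x * LS 0 = x * (\<rho> (LS' 0) * LS 0)"
    using x by (simp add: intertwiners_def flip: mult.assoc)
  then have "(c / d) *\<^sub>L 1 = (1 / d) *\<^sub>L x"
    by (simp add: mult.assoc xS0 rho_gens RS'_S lscale_mult_right U_zero)
  then have "d *\<^sub>L ((c / d) *\<^sub>L 1) = d *\<^sub>L ((1 / d) *\<^sub>L x)"
    by (rule arg_cong)
  then show ?thesis
    by (intro exI[of _ c]) simp
qed

end

section \<open>Linear categories generated by Schur objects\<close>

lemma direct_sumI:
  assumes "\<And>i. i < length Zs \<Longrightarrow> Zs ! i \<in> Obj C" "X \<in> Obj C"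
    and "\<And>i. i < length Zs \<Longrightarrow> \<iota> i \<in> Hom C (Zs ! i) X" "\<And>i. i < length Zs \<Longrightarrow> \<pi> i \<in> Hom C X (Zs ! i)"
    and "\<And>i j. i < length Zs \<Longrightarrow> j < length Zs \<Longrightarrow>
      Comp C (Zs ! j) X (Zs ! i) (\<pi> i) (\<iota> j) = (if i = j then Ident C (Zs ! i) else 0)"
    and "(\<Sum>i<length Zs. Comp C X (Zs ! i) X (\<iota> i) (\<pi> i)) = Ident C X"
  shows "direct_sum C Zs X"
proof -
  have "set Zs \<subseteq> Obj C"
    using assms(1) by (auto simp: in_set_conv_nth)
  then show ?thesis
    unfolding direct_sum_def using assms(2-) by (intro conjI exI[of _ \<iota>] exI[of _ \<pi>]) simp_all
qed

definition sum_data where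
  "sum_data C Zs X \<iota> \<pi> \<longleftrightarrow> set Zs \<subseteq> Obj C \<and> X \<in> Obj C \<and>
    (\<forall>i<length Zs. \<iota> i \<in> Hom C (Zs ! i) X \<and> \<pi> i \<in> Hom C X (Zs ! i)) \<and>
    (\<forall>i<length Zs. \<forall>j<length Zs.
      Comp C (Zs ! j) X (Zs ! i) (\<pi> i) (\<iota> j) = (if i = j then Ident C (Zs ! i) else 0)) \<and>
    (\<Sum>i<length Zs. Comp C X (Zs ! i) X (\<iota> i) (\<pi> i)) = Ident C X"

lemma direct_sum_iff: "direct_sum C Zs X \<longleftrightarrow> (\<exists>\<iota> \<pi>. sum_data C Zs X \<iota> \<pi>)"
  unfolding direct_sum_def sum_data_def by blast

lemma sum_dataD:
  assumes "sum_data C Zs X \<iota> \<pi>"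
  shows "\<And>i. i < length Zs \<Longrightarrow> Zs ! i \<in> Obj C" "X \<in> Obj C"
    "\<And>i. i < length Zs \<Longrightarrow> \<iota> i \<in> Hom C (Zs ! i) X" "\<And>i. i < length Zs \<Longrightarrow> \<pi> i \<in> Hom C X (Zs ! i)"
    "\<And>i j. i < length Zs \<Longrightarrow> j < length Zs \<Longrightarrow>
      Comp C (Zs ! j) X (Zs ! i) (\<pi> i) (\<iota> j) = (if i = j then Ident C (Zs ! i) else 0)"
    "(\<Sum>i<length Zs. Comp C X (Zs ! i) X (\<iota> i) (\<pi> i)) = Ident C X"
  using assms unfolding sum_data_def using nth_mem by blast+

context linear_category
begin

lemmas [simp] = comp_in_hom ident_in_hom comp_ident_left comp_ident_right

lemma zero_in_hom [simp]: "X \<in> Obj C \<Longrightarrow> Y \<in> Obj C \<Longrightarrow> 0 \<in> Hom C X Y"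
  using hom_subspace by (rule subspace_0)

lemma diff_in_hom [simp]:
  "X \<in> Obj C \<Longrightarrow> Y \<in> Obj C \<Longrightarrow> f \<in> Hom C X Y \<Longrightarrow> g \<in> Hom C X Y \<Longrightarrow> f - g \<in> Hom C X Y"
  using hom_subspace by (rule subspace_diff)

lemma scal_in_hom [simp]:
  "X \<in> Obj C \<Longrightarrow> Y \<in> Obj C \<Longrightarrow> f \<in> Hom C X Y \<Longrightarrow> Scal C c f \<in> Hom C X Y"
  using hom_subspace by (rule subspace_scale)

lemma sum_in_hom:
  "X \<in> Obj C \<Longrightarrow> Y \<in> Obj C \<Longrightarrow> (\<And>i. i \<in> A \<Longrightarrow> f i \<in> Hom C X Y) \<Longrightarrow> sum f A \<in> Hom C X Y"
  using hom_subspace subspace_sum by metis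

lemma comp_zero [simp]:
  assumes "X \<in> Obj C" "Y \<in> Obj C" "Z \<in> Obj C"
  shows "f \<in> Hom C X Y \<Longrightarrow> Comp C X Y Z 0 f = 0" "g \<in> Hom C Y Z \<Longrightarrow> Comp C X Y Z g 0 = 0"
  using comp_add_left[OF assms, of f 0 0] comp_add_right[OF assms, of 0 0 g] assms by simp_all

lemma comp_diff:
  assumes "X \<in> Obj C" "Y \<in> Obj C" "Z \<in> Obj C"
  shows "f \<in> Hom C X Y \<Longrightarrow> g \<in> Hom C Y Z \<Longrightarrow> g' \<in> Hom C Y Z \<Longrightarrow>
      Comp C X Y Z (g - g') f = Comp C X Y Z g f - Comp C X Y Z g' f"
    "f \<in> Hom C X Y \<Longrightarrow> f' \<in> Hom C X Y \<Longrightarrow> g \<in> Hom C Y Z \<Longrightarrow>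
      Comp C X Y Z g (f - f') = Comp C X Y Z g f - Comp C X Y Z g f'"
  using comp_add_left[OF assms, of f "g - g'" g'] comp_add_right[OF assms, of "f - f'" f' g] assms
  by (simp_all add: eq_diff_eq)

lemma comp_sum_left:
  assumes "X \<in> Obj C" "Y \<in> Obj C" "Z \<in> Obj C" "f \<in> Hom C X Y" "\<And>i. i \<in> A \<Longrightarrow> g i \<in> Hom C Y Z"
  shows "Comp C X Y Z (\<Sum>i\<in>A. g i) f = (\<Sum>i\<in>A. Comp C X Y Z (g i) f)"
  using assms(5)
proof (induction A rule: infinite_finite_induct)
  case (insert i A)
  then have "(\<Sum>i\<in>A. g i) \<in> Hom C Y Z"
    using assms by (intro sum_in_hom) auto
  then show ?case
    using insert assms by (simp add: comp_add_left)
qed (use assms in simp_all)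

lemma comp_sum_right:
  assumes "X \<in> Obj C" "Y \<in> Obj C" "Z \<in> Obj C" "g \<in> Hom C Y Z" "\<And>i. i \<in> A \<Longrightarrow> f i \<in> Hom C X Y"
  shows "Comp C X Y Z g (\<Sum>i\<in>A. f i) = (\<Sum>i\<in>A. Comp C X Y Z g (f i))"
  using assms(5)
proof (induction A rule: infinite_finite_induct)
  case (insert i A)
  then have "(\<Sum>i\<in>A. f i) \<in> Hom C X Y"
    using assms by (intro sum_in_hom) auto
  then show ?case
    using insert assms by (simp add: comp_add_right)
qed (use assms in simp_all)

lemma zero_objectI:
  assumes "X \<in> Obj C" "Ident C X = 0"
  shows "zero_object C X"
proof -
  have "f = 0" if "W \<in> Obj C" "f \<in> Hom C W X" for f W
    using comp_ident_left[of W X f] that assms by simp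
  moreover have "f = 0" if "W \<in> Obj C" "f \<in> Hom C X W" for f W
    using comp_ident_right[of X W f] that assms by simp
  ultimately show ?thesis
    using assms by (auto simp: zero_object_def)
qed

lemma isomorphicI:
  "inverse_arrows C X Y f g \<Longrightarrow> isomorphic C X Y"
  by (auto simp: isomorphic_def iso_arrow_def)

lemma isomorphic_refl: "X \<in> Obj C \<Longrightarrow> isomorphic C X X"
  by (rule isomorphicI[of X X "Ident C X" "Ident C X"]) (simp add: inverse_arrows_def)

lemma isomorphic_sym: "isomorphic C X Y \<Longrightarrow> isomorphic C Y X"
  by (auto simp: isomorphic_def iso_arrow_def inverse_arrows_def)

lemma isomorphic_trans:
  assumes "isomorphic C X Y" "isomorphic C Y Z" "X \<in> Obj C" "Y \<in> Obj C" "Z \<in> Obj C"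
  shows "isomorphic C X Z"
proof -
  obtain f f' g g' where f: "f \<in> Hom C X Y" "f' \<in> Hom C Y X" "Comp C X Y X f' f = Ident C X" "Comp C Y X Y f f' = Ident C Y"
    and g: "g \<in> Hom C Y Z" "g' \<in> Hom C Z Y" "Comp C Y Z Y g' g = Ident C Y" "Comp C Z Y Z g g' = Ident C Z"
    using assms by (auto simp: isomorphic_def iso_arrow_def inverse_arrows_def)
  have "Comp C X Z X (Comp C Z Y X f' g') (Comp C X Y Z g f) = Comp C X Y X f' (Comp C X Y Y (Comp C Y Z Y g' g) f)"
    using assms f(1,2) g(1,2) by (simp add: comp_assoc)
  moreover have "Comp C Z X Z (Comp C X Y Z g f) (Comp C Z Y X f' g') = Comp C Z Y Z g (Comp C Z Y Y (Comp C Y X Y f f') g')"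
    using assms f(1,2) g(1,2) by (simp add: comp_assoc)
  ultimately show ?thesis
    using assms f g by (intro isomorphicI[of X Z "Comp C X Y Z g f" "Comp C Z Y X f' g'"])
      (simp add: inverse_arrows_def)
qed

lemma iso_class_eq_iff:
  assumes "X \<in> Obj C" "Y \<in> Obj C"
  shows "iso_class C X = iso_class C Y \<longleftrightarrow> isomorphic C X Y"
proof
  assume "iso_class C X = iso_class C Y"
  then have "Y \<in> iso_class C X"
    using assms by (simp add: iso_class_def isomorphic_refl)
  then show "isomorphic C X Y"
    by (simp add: iso_class_def)
next
  assume XY: "isomorphic C X Y"
  then have "isomorphic C Y X"
    by (rule isomorphic_sym)
  with XY show "iso_class C X = iso_class C Y"
    using assms isomorphic_trans unfolding iso_class_def by blast
qed

lemma direct_sum_iso: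
  assumes "direct_sum C Zs X" "isomorphic C X Y" "Y \<in> Obj C"
  shows "direct_sum C Zs Y"
proof -
  obtain \<iota> \<pi> where "sum_data C Zs X \<iota> \<pi>"
    using assms(1) unfolding direct_sum_iff by blast
  note D = sum_dataD[OF this]
  note Zs = D(1) and X = D(2) and i = D(3,4) and d = D(5) and s = D(6)
  obtain f f' where f: "f \<in> Hom C X Y" "f' \<in> Hom C Y X" "Comp C X Y X f' f = Ident C X" "Comp C Y X Y f f' = Ident C Y"
    using assms by (auto simp: isomorphic_def iso_arrow_def inverse_arrows_def)
  have "Comp C (Zs ! j) Y (Zs ! i) (Comp C Y X (Zs ! i) (\<pi> i) f') (Comp C (Zs ! j) X Y f (\<iota> j)) = (if i = j then Ident C (Zs ! i) else 0)"
    if "i < length Zs" "j < length Zs" for i j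
  proof -
    have "Comp C (Zs ! j) Y (Zs ! i) (Comp C Y X (Zs ! i) (\<pi> i) f') (Comp C (Zs ! j) X Y f (\<iota> j)) =
      Comp C (Zs ! j) X (Zs ! i) (\<pi> i) (Comp C (Zs ! j) X X (Comp C X Y X f' f) (\<iota> j))"
      using that X Zs i f(1,2) assms(3) by (simp add: comp_assoc)
    then show ?thesis
      using that X Zs i f d by simp
  qed
  moreover have "(\<Sum>i<length Zs. Comp C Y (Zs ! i) Y (Comp C (Zs ! i) X Y f (\<iota> i)) (Comp C Y X (Zs ! i) (\<pi> i) f')) = Ident C Y"
  proof -
    have "(\<Sum>i<length Zs. Comp C Y (Zs ! i) Y (Comp C (Zs ! i) X Y f (\<iota> i)) (Comp C Y X (Zs ! i) (\<pi> i) f')) =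
      (\<Sum>i<length Zs. Comp C Y X Y f (Comp C Y X X (Comp C X (Zs ! i) X (\<iota> i) (\<pi> i)) f'))"
      using X Zs i f(1,2) assms(3) by (intro sum.cong) (simp_all add: comp_assoc)
    also have "\<dots> = Comp C Y X Y f (Comp C Y X X (\<Sum>i<length Zs. Comp C X (Zs ! i) X (\<iota> i) (\<pi> i)) f')"
    proof -
      have "Comp C Y X X (\<Sum>i<length Zs. Comp C X (Zs ! i) X (\<iota> i) (\<pi> i)) f' =
          (\<Sum>i<length Zs. Comp C Y X X (Comp C X (Zs ! i) X (\<iota> i) (\<pi> i)) f')"
        using X Zs i f(1,2) assms(3) by (intro comp_sum_left) auto
      then show ?thesis
        using X Zs i f(1,2) assms(3) by (simp only:) (intro comp_sum_right[symmetric]; simp)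
    qed
    finally show ?thesis
      using X s f assms(3) by simp
  qed
  ultimately show ?thesis
    using X Zs i f(1,2) assms(3)
    by (intro direct_sumI[of Zs C Y "\<lambda>i. Comp C (Zs ! i) X Y f (\<iota> i)" "\<lambda>i. Comp C Y X (Zs ! i) (\<pi> i) f'"]) simp_all
qed

end

text \<open>\<open>I\<close> holds the candidates for the simple objects. The assumption
  \<open>generated\<close> asks only that identities factor through \<open>I\<close>, with no
  orthogonality between the maps \<open>i j\<close> and \<open>p j\<close>;
  \<open>idempotent_decomposition\<close> turns this into direct sums.\<close>

locale schur_category = linear_category C for C :: "('o, 'm::ab_group_add) moncat" +
  fixes I :: "'o set"
  assumes I_obj: "Z \<in> I \<Longrightarrow> Z \<in> Obj C" and I_finite: "finite I"
    and schur_same: "Z \<in> I \<Longrightarrow> f \<in> Hom C Z Z \<Longrightarrow> \<exists>c. f = Scal C c (Ident C Z)"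
    and schur_diff: "Z \<in> I \<Longrightarrow> Z' \<in> I \<Longrightarrow> Z \<noteq> Z' \<Longrightarrow> f \<in> Hom C Z Z' \<Longrightarrow> f = 0"
    and ident_nz: "Z \<in> I \<Longrightarrow> Ident C Z \<noteq> 0"
    and sums_exist: "set Zs \<subseteq> I \<Longrightarrow> \<exists>X. direct_sum C Zs X"
    and generated: "X \<in> Obj C \<Longrightarrow> \<exists>Zs i p. set Zs \<subseteq> I \<and>
      (\<forall>j<length Zs. i j \<in> Hom C (Zs ! j) X \<and> p j \<in> Hom C X (Zs ! j)) \<and>
      (\<Sum>j<length Zs. Comp C X (Zs ! j) X (i j) (p j)) = Ident C X"
begin

lemmas [simp] = I_obj

definition gen_data where
  "gen_data X Zs i p \<longleftrightarrow> set Zs \<subseteq> I \<and>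
      (\<forall>j<length Zs. i j \<in> Hom C (Zs ! j) X \<and> p j \<in> Hom C X (Zs ! j)) \<and>
      (\<Sum>j<length Zs. Comp C X (Zs ! j) X (i j) (p j)) = Ident C X"

lemma gen_data_exists: "X \<in> Obj C \<Longrightarrow> \<exists>Zs i p. gen_data X Zs i p"
  using generated unfolding gen_data_def by blast

lemma gen_dataD:
  assumes "gen_data X Zs i p"
  shows "\<And>j. j < length Zs \<Longrightarrow> Zs ! j \<in> I"
    "\<And>j. j < length Zs \<Longrightarrow> i j \<in> Hom C (Zs ! j) X"
    "\<And>j. j < length Zs \<Longrightarrow> p j \<in> Hom C X (Zs ! j)"
    "(\<Sum>j<length Zs. Comp C X (Zs ! j) X (i j) (p j)) = Ident C X"
  using assms unfolding gen_data_def using nth_mem by blast+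

lemma hom_expand:
  assumes "Z \<in> Obj C" "X \<in> Obj C" "h \<in> Hom C Z X"
    and "\<And>j. j < length Zs \<Longrightarrow> Zs ! j \<in> Obj C" "\<And>j. j < length Zs \<Longrightarrow> i j \<in> Hom C (Zs ! j) X"
    and "\<And>j. j < length Zs \<Longrightarrow> p j \<in> Hom C X (Zs ! j)"
    and "(\<Sum>j<length Zs. Comp C X (Zs ! j) X (i j) (p j)) = Ident C X"
  shows "h = (\<Sum>j<length Zs. Comp C Z (Zs ! j) X (i j) (Comp C Z X (Zs ! j) (p j) h))"
proof -
  have "h = Comp C Z X X (\<Sum>j<length Zs. Comp C X (Zs ! j) X (i j) (p j)) h"
    using assms by simp
  also have "\<dots> = (\<Sum>j<length Zs. Comp C Z X X (Comp C X (Zs ! j) X (i j) (p j)) h)"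
    using assms by (intro comp_sum_left) auto
  also have "\<dots> = (\<Sum>j<length Zs. Comp C Z (Zs ! j) X (i j) (Comp C Z X (Zs ! j) (p j) h))"
    using assms by (intro sum.cong) (auto simp: comp_assoc)
  finally show ?thesis .
qed

text \<open>The identity of \<open>X\<close> factors through objects of \<open>I\<close>, so a
  morphism out of \<open>X\<close> is rebuilt from its composites with maps out of
  \<open>I\<close>.\<close>

lemma faithful:
  assumes "X \<in> Obj C" "W \<in> Obj C" "a \<in> Hom C X W" "a' \<in> Hom C X W"
    and eq: "\<And>Z h. Z \<in> I \<Longrightarrow> h \<in> Hom C Z X \<Longrightarrow> Comp C Z X W a h = Comp C Z X W a' h"
  shows "a = a'"
proof -
  obtain Zs i p where "gen_data X Zs i p"
    using gen_data_exists[OF assms(1)] by blast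
  note Zs = gen_dataD[OF this]
  have *: "b = (\<Sum>j<length Zs. Comp C X (Zs ! j) W (Comp C (Zs ! j) X W b (i j)) (p j))"
    if b: "b \<in> Hom C X W" for b
  proof -
    have "b = Comp C X X W b (\<Sum>j<length Zs. Comp C X (Zs ! j) X (i j) (p j))"
      using assms(1,2) b Zs(4) by simp
    also have "\<dots> = (\<Sum>j<length Zs. Comp C X X W b (Comp C X (Zs ! j) X (i j) (p j)))"
      using assms(1,2) b Zs by (intro comp_sum_right) auto
    also have "\<dots> = (\<Sum>j<length Zs. Comp C X (Zs ! j) W (Comp C (Zs ! j) X W b (i j)) (p j))"
      using assms(1,2) b Zs by (intro sum.cong) (auto simp: comp_assoc)
    finally show ?thesis .
  qed
  have "(\<Sum>j<length Zs. Comp C X (Zs ! j) W (Comp C (Zs ! j) X W a (i j)) (p j)) =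
      (\<Sum>j<length Zs. Comp C X (Zs ! j) W (Comp C (Zs ! j) X W a' (i j)) (p j))"
    using Zs eq by (intro sum.cong) auto
  then show ?thesis
    using *[OF assms(3)] *[OF assms(4)] by simp
qed

text \<open>The functor \<open>X \<mapsto> (Hom Z X)\<^bsub>Z \<in> I\<^esub>\<close> to families of vector spaces is full.\<close>

lemma induced_morphism:
  assumes X: "X \<in> Obj C" and W: "W \<in> Obj C"
    and \<phi>: "\<And>Z h. Z \<in> I \<Longrightarrow> h \<in> Hom C Z X \<Longrightarrow> \<phi> Z h \<in> Hom C Z W"
    and add: "\<And>Z h h'. Z \<in> I \<Longrightarrow> h \<in> Hom C Z X \<Longrightarrow> h' \<in> Hom C Z X \<Longrightarrow> \<phi> Z (h + h') = \<phi> Z h + \<phi> Z h'"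
    and scal: "\<And>Z h c. Z \<in> I \<Longrightarrow> h \<in> Hom C Z X \<Longrightarrow> \<phi> Z (Scal C c h) = Scal C c (\<phi> Z h)"
  shows "\<exists>g\<in>Hom C X W. \<forall>Z\<in>I. \<forall>h\<in>Hom C Z X. Comp C Z X W g h = \<phi> Z h"
proof -
  obtain Zs i p where "gen_data X Zs i p"
    using gen_data_exists[OF X] by blast
  note Zs = gen_dataD[OF this]
  define g where "g = (\<Sum>j<length Zs. Comp C X (Zs ! j) W (\<phi> (Zs ! j) (i j)) (p j))"
  have g: "g \<in> Hom C X W"
    unfolding g_def using X W Zs \<phi> by (intro sum_in_hom) auto
  have zero: "\<phi> Z 0 = 0" if "Z \<in> I" for Z
    using scal[OF that, of 0 0] that X by simp
  have "Comp C Z X W g h = \<phi> Z h" if Z: "Z \<in> I" and h: "h \<in> Hom C Z X" for Z h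
  proof -
    let ?t = "\<lambda>j. Comp C Z (Zs ! j) X (i j) (Comp C Z X (Zs ! j) (p j) h)"
    have t: "?t j \<in> Hom C Z X" if "j < length Zs" for j
      using that Zs Z h X by simp
    have "Comp C Z X W g h = (\<Sum>j<length Zs. Comp C Z X W (Comp C X (Zs ! j) W (\<phi> (Zs ! j) (i j)) (p j)) h)"
      unfolding g_def using X W Z h Zs \<phi> by (intro comp_sum_left) auto
    also have "\<dots> = (\<Sum>j<length Zs. \<phi> Z (?t j))"
    proof (rule sum.cong)
      fix j assume "j \<in> {..<length Zs}"
      then have j: "Zs ! j \<in> I" "i j \<in> Hom C (Zs ! j) X" "p j \<in> Hom C X (Zs ! j)"
        using Zs by auto
      have ph: "Comp C Z X (Zs ! j) (p j) h \<in> Hom C Z (Zs ! j)"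
        using j Z h X by simp
      have "Comp C Z X W (Comp C X (Zs ! j) W (\<phi> (Zs ! j) (i j)) (p j)) h =
          Comp C Z (Zs ! j) W (\<phi> (Zs ! j) (i j)) (Comp C Z X (Zs ! j) (p j) h)"
        using j Z h X W \<phi> by (simp add: comp_assoc)
      also have "\<dots> = \<phi> Z (?t j)"
      \<comment> \<open>By Schur the composite of \<open>p j\<close> and \<open>h\<close> is a
        scalar or zero, which is all that is needed to pull it through the linear map
        \<open>\<phi> Z\<close>.\<close>
      proof (cases "Zs ! j = Z")
        case True
        then obtain c where "Comp C Z X (Zs ! j) (p j) h = Scal C c (Ident C Z)"
          using schur_same[OF Z] ph by metis
        then show ?thesis
          using True j Z X W \<phi> by (simp add: comp_scal_right scal)
      next
        case False
        then have "Comp C Z X (Zs ! j) (p j) h = 0"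
          using schur_diff[OF Z j(1)] ph by metis
        then show ?thesis
          using j Z X W \<phi> zero by simp
      qed
      finally show "Comp C Z X W (Comp C X (Zs ! j) W (\<phi> (Zs ! j) (i j)) (p j)) h = \<phi> Z (?t j)" .
    qed simp
    also have "\<dots> = \<phi> Z (\<Sum>j<length Zs. ?t j)"
    proof -
      have "finite A \<Longrightarrow> A \<subseteq> {..<length Zs} \<Longrightarrow> (\<Sum>j\<in>A. \<phi> Z (?t j)) = \<phi> Z (\<Sum>j\<in>A. ?t j)" for A
      proof (induction A rule: finite_induct)
        case (insert j A)
        then have "(\<Sum>j\<in>A. ?t j) \<in> Hom C Z X"
          using Z X t by (intro sum_in_hom) auto
        then show ?case
          using insert t Z by (simp add: add)
      qed (simp add: zero Z)
      then show ?thesis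
        by simp
    qed
    also have "(\<Sum>j<length Zs. ?t j) = h"
      using hom_expand[of Z X h Zs i p] Z X h Zs by simp
    finally show ?thesis .
  qed
  then show ?thesis
    using g by blast
qed

lemma hom_finite_span:
  assumes X: "X \<in> Obj C" and Z: "Z \<in> I"
  shows "\<exists>B. finite B \<and> span B = Hom C Z X"
proof -
  obtain Zs i p where "gen_data X Zs i p"
    using gen_data_exists[OF X] by blast
  note Zs = gen_dataD[OF this]
  let ?B = "i ` {j. j < length Zs \<and> Zs ! j = Z}"
  have "h \<in> span ?B" if h: "h \<in> Hom C Z X" for h
  proof -
    have "Comp C Z (Zs ! j) X (i j) (Comp C Z X (Zs ! j) (p j) h) \<in> span ?B" if j: "j < length Zs" for j
    proof -
      have ph: "Comp C Z X (Zs ! j) (p j) h \<in> Hom C Z (Zs ! j)"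
        using j Z h X Zs by simp
      show ?thesis
      proof (cases "Zs ! j = Z")
        case True
        then obtain c where "Comp C Z X (Zs ! j) (p j) h = Scal C c (Ident C Z)"
          using schur_same[OF Z] ph by metis
        then have "Comp C Z (Zs ! j) X (i j) (Comp C Z X (Zs ! j) (p j) h) = Scal C c (i j)"
          using True j Z X Zs(2)[OF j] by (simp add: comp_scal_right)
        then show ?thesis
          using True j by (auto intro: span_scale span_base)
      next
        case False
        then have "Comp C Z X (Zs ! j) (p j) h = 0"
          using schur_diff[OF Z Zs(1)[OF j]] ph by metis
        then show ?thesis
          using j Z X Zs by (simp add: span_zero)
      qed
    qed
    then have "(\<Sum>j<length Zs. Comp C Z (Zs ! j) X (i j) (Comp C Z X (Zs ! j) (p j) h)) \<in> span ?B"
      by (intro span_sum) auto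
    then show ?thesis
      using hom_expand[of Z X h Zs i p] Z X h Zs by simp
  qed
  moreover have "span ?B \<subseteq> Hom C Z X"
    using Zs X Z hom_subspace by (intro span_minimal) auto
  ultimately show ?thesis
    by (intro exI[of _ ?B]) auto
qed

lemma hom_finite_span_general:
  assumes X: "X \<in> Obj C" and Y: "Y \<in> Obj C"
  shows "\<exists>B. finite B \<and> span B = Hom C X Y"
proof -
  obtain Zs i p where "gen_data X Zs i p"
    using gen_data_exists[OF X] by blast
  note Zs = gen_dataD[OF this]
  obtain B where B: "\<And>Z. Z \<in> I \<Longrightarrow> finite (B Z)" "\<And>Z. Z \<in> I \<Longrightarrow> span (B Z) = Hom C Z Y"
    using hom_finite_span[OF Y] by metis
  let ?B = "\<Union>j<length Zs. (\<lambda>b. Comp C X (Zs ! j) Y b (p j)) ` B (Zs ! j)"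
  have "f \<in> span ?B" if f: "f \<in> Hom C X Y" for f
  proof -
    have "f = Comp C X X Y f (\<Sum>j<length Zs. Comp C X (Zs ! j) X (i j) (p j))"
      using X Y f Zs(4) by simp
    also have "\<dots> = (\<Sum>j<length Zs. Comp C X X Y f (Comp C X (Zs ! j) X (i j) (p j)))"
      using X Y f Zs by (intro comp_sum_right) auto
    also have "\<dots> = (\<Sum>j<length Zs. Comp C X (Zs ! j) Y (Comp C (Zs ! j) X Y f (i j)) (p j))"
      using X Y f Zs by (intro sum.cong) (auto simp: comp_assoc)
    finally have f_eq: "f = (\<Sum>j<length Zs. Comp C X (Zs ! j) Y (Comp C (Zs ! j) X Y f (i j)) (p j))" .
    have "Comp C X (Zs ! j) Y (Comp C (Zs ! j) X Y f (i j)) (p j) \<in> span ?B" if j: "j < length Zs" for j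
    proof -
      have Bj: "finite (B (Zs ! j))" "span (B (Zs ! j)) = Hom C (Zs ! j) Y"
        using B Zs(1)[OF j] by auto
      have "Comp C (Zs ! j) X Y f (i j) \<in> span (B (Zs ! j))"
        using Bj Zs(1,2)[OF j] X Y f by simp
      then obtain u where u: "Comp C (Zs ! j) X Y f (i j) = (\<Sum>b\<in>B (Zs ! j). Scal C (u b) b)"
        using span_finite[OF Bj(1)] by auto
      have hom: "b \<in> Hom C (Zs ! j) Y" if "b \<in> B (Zs ! j)" for b
        using Bj(2) that span_base by blast
      have "Comp C X (Zs ! j) Y (Comp C (Zs ! j) X Y f (i j)) (p j) =
          (\<Sum>b\<in>B (Zs ! j). Comp C X (Zs ! j) Y (Scal C (u b) b) (p j))"
        unfolding u using X Y Zs(1)[OF j] Zs(3)[OF j] hom by (intro comp_sum_left) auto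
      also have "\<dots> = (\<Sum>b\<in>B (Zs ! j). Scal C (u b) (Comp C X (Zs ! j) Y b (p j)))"
        using X Y Zs(1)[OF j] Zs(3)[OF j] hom by (intro sum.cong) (auto simp: comp_scal_left)
      also have "\<dots> \<in> span ?B"
        using j by (intro span_sum span_scale span_base) auto
      finally show ?thesis .
    qed
    then show ?thesis
      by (subst f_eq) (intro span_sum, auto)
  qed
  moreover have "span ?B \<subseteq> Hom C X Y"
  proof (rule span_minimal)
    show "?B \<subseteq> Hom C X Y"
    proof
      fix x assume "x \<in> ?B"
      then obtain j b where "j < length Zs" "b \<in> B (Zs ! j)" "x = Comp C X (Zs ! j) Y b (p j)"
        by auto
      then show "x \<in> Hom C X Y"
        using Zs X Y B(2)[of "Zs ! j"] span_base[of b "B (Zs ! j)"] by simp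
    qed
  qed (rule hom_subspace[OF X Y])
  moreover have "finite ?B"
    using B(1) Zs(1) by auto
  ultimately show ?thesis
    by (intro exI[of _ ?B]) auto
qed

text \<open>On each space \<open>Hom C Z X\<close> the idempotent acts as a projection. Bases of its
  images serve as inclusions, and the coordinate functionals composed with the projection are
  realised by morphisms through \<open>induced_morphism\<close>.\<close>

lemma idempotent_decomposition:
  assumes X: "X \<in> Obj C" and e: "e \<in> Hom C X X" and ee: "Comp C X X X e e = e"
  shows "\<exists>Zs b \<psi>. set Zs \<subseteq> I \<and> (\<forall>j<length Zs. b j \<in> Hom C (Zs ! j) X \<and> \<psi> j \<in> Hom C X (Zs ! j)) \<and>
    (\<forall>i<length Zs. \<forall>j<length Zs. Comp C (Zs ! j) X (Zs ! i) (\<psi> i) (b j) = (if i = j then Ident C (Zs ! i) else 0)) \<and>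
    (\<Sum>j<length Zs. Comp C X (Zs ! j) X (b j) (\<psi> j)) = e"
proof -
  define V where "V Z = {h \<in> Hom C Z X. Comp C Z X X e h = h}" for Z
  have "\<exists>B. finite B \<and> independent B \<and> B \<subseteq> V Z \<and> V Z \<subseteq> span B" if Z: "Z \<in> I" for Z
  proof -
    obtain B where B: "B \<subseteq> V Z" "independent B" "V Z \<subseteq> span B"
      using maximal_independent_subset[of "V Z"] by auto
    obtain B0 where "finite B0" "span B0 = Hom C Z X"
      using hom_finite_span[OF X Z] by blast
    then have "finite B"
      using independent_span_bound[of B0 B] B by (auto simp: V_def)
    then show ?thesis
      using B by blast
  qed
  then obtain B where B: "\<And>Z. Z \<in> I \<Longrightarrow> finite (B Z)" "\<And>Z. Z \<in> I \<Longrightarrow> independent (B Z)"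
    "\<And>Z. Z \<in> I \<Longrightarrow> B Z \<subseteq> V Z" "\<And>Z. Z \<in> I \<Longrightarrow> V Z \<subseteq> span (B Z)"
    by metis
  have eV: "Comp C Z X X e h \<in> V Z" if "Z \<in> I" "h \<in> Hom C Z X" for Z h
    using that X e by (simp add: V_def comp_assoc[symmetric] ee)
  then have eS: "Comp C Z X X e h \<in> span (B Z)" if "Z \<in> I" "h \<in> Hom C Z X" for Z h
    using that B(4) by blast
  have "finite (Sigma I B)"
    using B(1) I_finite by blast
  \<comment> \<open>\<open>L\<close> lists all pairs of an object of \<open>I\<close> and a basis
    vector of the image over it; a summand index is a position in this list, so an object recurs
    once per basis vector.\<close>
  then obtain L where L: "set L = Sigma I B" "distinct L"
    using finite_distinct_list by blast
  define Zs where "Zs = map fst L"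
  define b where "b j = snd (L ! j)" for j
  have Lj: "L ! j = (Zs ! j, b j)" "Zs ! j \<in> I" "b j \<in> B (Zs ! j)" if "j < length Zs" for j
    using that L(1) nth_mem[of j L] by (auto simp: Zs_def b_def)
  have bj: "b j \<in> Hom C (Zs ! j) X" "Comp C (Zs ! j) X X e (b j) = b j" if "j < length Zs" for j
    using B(3)[of "Zs ! j"] Lj[OF that] by (auto simp: V_def)
  \<comment> \<open>The coordinate of \<open>e h\<close> along the basis vector \<open>b j\<close>,
    as a scalar endomorphism of \<open>Z\<close>; it vanishes on the other objects of
    \<open>I\<close>, as Schur requires.\<close>
  define \<phi> where "\<phi> j Z h = (if Z = Zs ! j then Scal C (representation (B Z) (Comp C Z X X e h) (b j)) (Ident C Z) else 0)" for j Z h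
  have "\<exists>g\<in>Hom C X (Zs ! j). \<forall>Z\<in>I. \<forall>h\<in>Hom C Z X. Comp C Z X (Zs ! j) g h = \<phi> j Z h" if j: "j < length Zs" for j
  proof (rule induced_morphism[OF X])
    show "\<phi> j Z (h + h') = \<phi> j Z h + \<phi> j Z h'" if "Z \<in> I" "h \<in> Hom C Z X" "h' \<in> Hom C Z X" for Z h h'
    proof -
      have "representation (B Z) (Comp C Z X X e (h + h')) =
          (\<lambda>b. representation (B Z) (Comp C Z X X e h) b + representation (B Z) (Comp C Z X X e h') b)"
        using that X e eS B(2) by (simp add: comp_add_right representation_add)
      then show ?thesis
        unfolding \<phi>_def by (simp only:) (simp add: scale_left_distrib)
    qed
    show "\<phi> j Z (Scal C c h) = Scal C c (\<phi> j Z h)" if "Z \<in> I" "h \<in> Hom C Z X" for Z h c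
    proof -
      have "representation (B Z) (Comp C Z X X e (Scal C c h)) = (\<lambda>b. c * representation (B Z) (Comp C Z X X e h) b)"
        using that X e eS B(2) by (simp add: comp_scal_right representation_scale)
      then show ?thesis
        unfolding \<phi>_def by (simp only:) simp
    qed
  qed (use Lj[OF j] X in \<open>auto simp: \<phi>_def\<close>)
  then obtain \<psi> where \<psi>: "\<And>j. j < length Zs \<Longrightarrow> \<psi> j \<in> Hom C X (Zs ! j)"
    "\<And>j Z h. j < length Zs \<Longrightarrow> Z \<in> I \<Longrightarrow> h \<in> Hom C Z X \<Longrightarrow> Comp C Z X (Zs ! j) (\<psi> j) h = \<phi> j Z h"
    by metis
  have "Comp C (Zs ! j) X (Zs ! i) (\<psi> i) (b j) = (if i = j then Ident C (Zs ! i) else 0)"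
    if i: "i < length Zs" and j: "j < length Zs" for i j
  proof -
    have "representation (B (Zs ! j)) (b j) = (\<lambda>v. if v = b j then 1 else 0)"
      by (rule representation_basis[OF B(2)[OF Lj(2)[OF j]] Lj(3)[OF j]])
    then have *: "Comp C (Zs ! j) X (Zs ! i) (\<psi> i) (b j) =
        (if Zs ! j = Zs ! i then Scal C (if b i = b j then 1 else 0) (Ident C (Zs ! j)) else 0)"
      unfolding \<psi>(2)[OF i Lj(2)[OF j] bj(1)[OF j]] \<phi>_def bj(2)[OF j] by (simp only:)
    show ?thesis
    proof (cases "i = j")
      case False
      have len: "i < length L" "j < length L"
        using i j by (simp_all add: Zs_def)
      have "L ! i \<noteq> L ! j"
        using False by (simp add: nth_eq_iff_index_eq[OF L(2) len])
      then have "\<not> (Zs ! j = Zs ! i \<and> b j = b i)"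
        unfolding Lj(1)[OF i] Lj(1)[OF j] by metis
      then show ?thesis
        unfolding * using False by auto
    qed (use * in simp)
  qed
  moreover have "(\<Sum>j<length Zs. Comp C X (Zs ! j) X (b j) (\<psi> j)) = e"
  proof (rule faithful[OF X X _ e])
    show "(\<Sum>j<length Zs. Comp C X (Zs ! j) X (b j) (\<psi> j)) \<in> Hom C X X"
      using X Lj \<psi> bj by (intro sum_in_hom) auto
    fix Z h assume Z: "Z \<in> I" and h: "h \<in> Hom C Z X"
    let ?r = "representation (B Z) (Comp C Z X X e h)"
    have "Comp C Z X X (\<Sum>j<length Zs. Comp C X (Zs ! j) X (b j) (\<psi> j)) h =
        (\<Sum>j<length Zs. Comp C Z X X (Comp C X (Zs ! j) X (b j) (\<psi> j)) h)"
      using X Z h Lj \<psi> bj by (intro comp_sum_left) auto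
    also have "\<dots> = (\<Sum>j<length Zs. if Z = fst (L ! j) then Scal C (?r (snd (L ! j))) (snd (L ! j)) else 0)"
    proof (rule sum.cong)
      fix j assume "j \<in> {..<length Zs}"
      then have j: "j < length Zs" by simp
      have "Comp C Z X X (Comp C X (Zs ! j) X (b j) (\<psi> j)) h = Comp C Z (Zs ! j) X (b j) (\<phi> j Z h)"
        using X Z h Lj[OF j] \<psi>[OF j] bj[OF j] by (simp add: comp_assoc)
      also have "\<dots> = (if Z = Zs ! j then Scal C (?r (b j)) (b j) else 0)"
        using X Z Lj[OF j] bj[OF j] by (simp add: \<phi>_def comp_scal_right)
      finally show "Comp C Z X X (Comp C X (Zs ! j) X (b j) (\<psi> j)) h =
          (if Z = fst (L ! j) then Scal C (?r (snd (L ! j))) (snd (L ! j)) else 0)"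
        using Lj(1)[OF j] by simp
    qed simp
    also have "\<dots> = (\<Sum>x\<in>set L. if Z = fst x then Scal C (?r (snd x)) (snd x) else 0)"
      using sum.reindex_bij_betw[OF bij_betw_nth[OF L(2) refl refl],
          of "\<lambda>x. if Z = fst x then Scal C (?r (snd x)) (snd x) else 0"] by (simp add: Zs_def)
    also have "\<dots> = (\<Sum>Z'\<in>I. \<Sum>x\<in>B Z'. if Z = Z' then Scal C (?r x) x else 0)"
      unfolding L(1) by (subst sum.Sigma) (use I_finite B(1) in \<open>auto intro!: sum.cong\<close>)
    also have "\<dots> = (\<Sum>Z'\<in>I. if Z = Z' then \<Sum>x\<in>B Z. Scal C (?r x) x else 0)"
      by (rule sum.cong) auto
    also have "\<dots> = (\<Sum>x\<in>B Z. Scal C (?r x) x)"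
      using I_finite Z by simp
    also have "\<dots> = Comp C Z X X e h"
      using sum_representation_eq[OF B(2)[OF Z] eS[OF Z h] B(1)[OF Z]] by simp
    finally show "Comp C Z X X (\<Sum>j<length Zs. Comp C X (Zs ! j) X (b j) (\<psi> j)) h = Comp C Z X X e h" .
  qed
  ultimately show ?thesis
    using Lj(2) bj \<psi> by (intro exI[of _ Zs] exI[of _ b] exI[of _ \<psi>]) (auto simp: in_set_conv_nth)
qed

lemma decomposition: "X \<in> Obj C \<Longrightarrow> \<exists>Zs. set Zs \<subseteq> I \<and> direct_sum C Zs X"
proof -
  assume X: "X \<in> Obj C"
  then have "Comp C X X X (Ident C X) (Ident C X) = Ident C X"
    by simp
  from idempotent_decomposition[OF X ident_in_hom[OF X] this] obtain Zs b \<psi> where Zs: "set Zs \<subseteq> I"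
    and D: "\<forall>j<length Zs. b j \<in> Hom C (Zs ! j) X \<and> \<psi> j \<in> Hom C X (Zs ! j)"
    "\<forall>i<length Zs. \<forall>j<length Zs. Comp C (Zs ! j) X (Zs ! i) (\<psi> i) (b j) = (if i = j then Ident C (Zs ! i) else 0)"
    "(\<Sum>j<length Zs. Comp C X (Zs ! j) X (b j) (\<psi> j)) = Ident C X"
    by blast
  have "set Zs \<subseteq> Obj C"
    using Zs I_obj by blast
  then have "sum_data C Zs X b \<psi>"
    unfolding sum_data_def using X D by blast
  then show ?thesis
    using Zs unfolding direct_sum_iff by blast
qed

text \<open>The maps that decompose \<open>e\<close> are matched, summand by summand, with the
  inclusions and projections of a direct sum \<open>K\<close> of the same list.\<close>

lemma split_idempotent:
  assumes X: "X \<in> Obj C" and e: "e \<in> Hom C X X" and ee: "Comp C X X X e e = e"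
  shows "\<exists>K\<in>Obj C. \<exists>r\<in>Hom C X K. \<exists>s\<in>Hom C K X. Comp C X K X s r = e \<and> Comp C K X K r s = Ident C K"
proof -
  from idempotent_decomposition[OF assms] obtain Zs b \<psi> where Zs: "set Zs \<subseteq> I"
    and b: "\<And>j. j < length Zs \<Longrightarrow> b j \<in> Hom C (Zs ! j) X" "\<And>j. j < length Zs \<Longrightarrow> \<psi> j \<in> Hom C X (Zs ! j)"
    and \<psi>: "\<And>i j. i < length Zs \<Longrightarrow> j < length Zs \<Longrightarrow> Comp C (Zs ! j) X (Zs ! i) (\<psi> i) (b j) = (if i = j then Ident C (Zs ! i) else 0)"
    and be: "(\<Sum>j<length Zs. Comp C X (Zs ! j) X (b j) (\<psi> j)) = e"
    by blast
  obtain K \<iota> \<pi> where "sum_data C Zs K \<iota> \<pi>"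
    using sums_exist[OF Zs] unfolding direct_sum_iff by blast
  note D = sum_dataD[OF this]
  define s where "s = (\<Sum>j<length Zs. Comp C K (Zs ! j) X (b j) (\<pi> j))"
  define r where "r = (\<Sum>j<length Zs. Comp C X (Zs ! j) K (\<iota> j) (\<psi> j))"
  have s: "s \<in> Hom C K X" and r: "r \<in> Hom C X K"
    unfolding s_def r_def using X D b by (auto intro!: sum_in_hom)
  have s\<iota>: "Comp C (Zs ! j) K X s (\<iota> j) = b j" if j: "j < length Zs" for j
  proof -
    have "Comp C (Zs ! j) K X s (\<iota> j) = (\<Sum>i<length Zs. Comp C (Zs ! j) K X (Comp C K (Zs ! i) X (b i) (\<pi> i)) (\<iota> j))"
      unfolding s_def using X D b j by (intro comp_sum_left) auto
    also have "\<dots> = (\<Sum>i<length Zs. if i = j then b j else 0)"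
      using X D b j by (intro sum.cong) (auto simp: comp_assoc)
    finally show ?thesis
      using j by simp
  qed
  have rb: "Comp C (Zs ! j) X K r (b j) = \<iota> j" if j: "j < length Zs" for j
  proof -
    have "Comp C (Zs ! j) X K r (b j) = (\<Sum>i<length Zs. Comp C (Zs ! j) X K (Comp C X (Zs ! i) K (\<iota> i) (\<psi> i)) (b j))"
      unfolding r_def using X D b j by (intro comp_sum_left) auto
    also have "\<dots> = (\<Sum>i<length Zs. if i = j then \<iota> j else 0)"
      using X D b j \<psi> by (intro sum.cong) (auto simp: comp_assoc)
    finally show ?thesis
      using j by simp
  qed
  have "Comp C X K X s r = (\<Sum>j<length Zs. Comp C X K X s (Comp C X (Zs ! j) K (\<iota> j) (\<psi> j)))"
    unfolding r_def using X D b s by (intro comp_sum_right) auto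
  also have "\<dots> = (\<Sum>j<length Zs. Comp C X (Zs ! j) X (b j) (\<psi> j))"
    using X D b s s\<iota> by (intro sum.cong) (auto simp: comp_assoc[symmetric])
  finally have sr: "Comp C X K X s r = e"
    by (simp add: be)
  have "Comp C K X K r s = (\<Sum>j<length Zs. Comp C K X K r (Comp C K (Zs ! j) X (b j) (\<pi> j)))"
    unfolding s_def using X D b r by (intro comp_sum_right) auto
  also have "\<dots> = (\<Sum>j<length Zs. Comp C K (Zs ! j) K (\<iota> j) (\<pi> j))"
    using X D b r rb by (intro sum.cong) (auto simp: comp_assoc[symmetric])
  finally have "Comp C K X K r s = Ident C K"
    by (simp add: D)
  then show ?thesis
    using sr s r D(2) by blast
qed

text \<open>On each space \<open>Hom C Z X\<close> postcomposition with \<open>f\<close> is linear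
  and has a linear section on its image. The sections, extended to everything, are induced by a
  single morphism \<open>g\<close>; then \<open>f g f = f\<close> can be tested on maps from
  \<open>I\<close>.\<close>

lemma von_Neumann_regular:
  assumes X: "X \<in> Obj C" and Y: "Y \<in> Obj C" and f: "f \<in> Hom C X Y"
  shows "\<exists>g\<in>Hom C Y X. Comp C X Y Y (Comp C Y X Y f g) f = f"
proof -
  interpret vsp: vector_space_pair "Scal C" "Scal C" ..
  have "\<exists>\<phi>. Vector_Spaces.linear (Scal C) (Scal C) \<phi> \<and> range \<phi> \<subseteq> Hom C Z X \<and> (\<forall>h\<in>Hom C Z X. Comp C Z X Y f (\<phi> (Comp C Z X Y f h)) = Comp C Z X Y f h)"
    if Z: "Z \<in> I" for Z
  proof -
    let ?S = "Comp C Z X Y f ` Hom C Z X"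
    obtain B where B: "B \<subseteq> ?S" "independent B" "?S \<subseteq> span B"
      using maximal_independent_subset[of ?S] by auto
    then have "\<forall>w\<in>B. \<exists>h. h \<in> Hom C Z X \<and> Comp C Z X Y f h = w"
      by blast
    then obtain c where "\<forall>w\<in>B. c w \<in> Hom C Z X \<and> Comp C Z X Y f (c w) = w"
      by (rule bchoice[THEN exE])
    then have c: "\<And>w. w \<in> B \<Longrightarrow> c w \<in> Hom C Z X" "\<And>w. w \<in> B \<Longrightarrow> Comp C Z X Y f (c w) = w"
      by blast+
    \<comment> \<open>The extension is taken with range in the span of the chosen preimages, so that
      its values stay in \<open>Hom C Z X\<close>.\<close>
    obtain \<phi> where \<phi>: "Vector_Spaces.linear (Scal C) (Scal C) \<phi>" "\<And>w. w \<in> B \<Longrightarrow> \<phi> w = c w" "range \<phi> = span (c ` B)"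
      using vsp.linear_independent_extend_subspace[OF B(2)] by metis
    have range: "range \<phi> \<subseteq> Hom C Z X"
      unfolding \<phi>(3) using c Z X hom_subspace by (intro span_minimal) auto
    have "Comp C Z X Y f (\<phi> w) = w" if "w \<in> span B" for w
      using that
    proof (induction rule: span_induct_alt)
      case base
      then show ?case
        using vsp.linear_0[OF \<phi>(1)] X Y Z f by simp
    next
      case (step a w w')
      have "\<phi> w \<in> Hom C Z X" "\<phi> w' \<in> Hom C Z X"
        using range by auto
      then show ?case
        using step \<phi>(2) c vsp.linear_add[OF \<phi>(1)] vsp.linear_scale[OF \<phi>(1)] X Y Z f
        by (simp add: comp_add_right comp_scal_right)
    qed
    then show ?thesis
      using \<phi>(1) range B(3) by (intro exI[of _ \<phi>]) auto
  qed
  then obtain \<phi> where \<phi>: "\<And>Z. Z \<in> I \<Longrightarrow> Vector_Spaces.linear (Scal C) (Scal C) (\<phi> Z)" "\<And>Z. Z \<in> I \<Longrightarrow> range (\<phi> Z) \<subseteq> Hom C Z X"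
    "\<And>Z h. Z \<in> I \<Longrightarrow> h \<in> Hom C Z X \<Longrightarrow> Comp C Z X Y f (\<phi> Z (Comp C Z X Y f h)) = Comp C Z X Y f h"
    by metis
  have "\<exists>g\<in>Hom C Y X. \<forall>Z\<in>I. \<forall>h\<in>Hom C Z Y. Comp C Z Y X g h = \<phi> Z h"
    using \<phi>(2) vsp.linear_add[OF \<phi>(1)] vsp.linear_scale[OF \<phi>(1)] by (intro induced_morphism[OF Y X]) auto
  then obtain g where g: "g \<in> Hom C Y X" "\<And>Z h. Z \<in> I \<Longrightarrow> h \<in> Hom C Z Y \<Longrightarrow> Comp C Z Y X g h = \<phi> Z h"
    by blast
  have "Comp C X Y Y (Comp C Y X Y f g) f = f"
  proof (rule faithful[OF X Y _ f])
    show "Comp C X Y Y (Comp C Y X Y f g) f \<in> Hom C X Y"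
      using X Y f g by simp
    fix Z h assume Z: "Z \<in> I" and h: "h \<in> Hom C Z X"
    have "Comp C Z X Y (Comp C X Y Y (Comp C Y X Y f g) f) h = Comp C Z X Y f (Comp C Z Y X g (Comp C Z X Y f h))"
      using X Y f g Z h by (simp add: comp_assoc)
    then show "Comp C Z X Y (Comp C X Y Y (Comp C Y X Y f g) f) h = Comp C Z X Y f h"
      using X Y f g Z h \<phi>(3) by simp
  qed
  then show ?thesis
    using g(1) by blast
qed

end

context linear_category
begin

lemma monicD:
  "monic C X Y f \<Longrightarrow> W \<in> Obj C \<Longrightarrow> g \<in> Hom C W X \<Longrightarrow> h \<in> Hom C W X \<Longrightarrow>
    Comp C W X Y f g = Comp C W X Y f h \<Longrightarrow> g = h"
  unfolding monic_def by blast

lemma epicD: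
  "epic C X Y f \<Longrightarrow> Z \<in> Obj C \<Longrightarrow> g \<in> Hom C Y Z \<Longrightarrow> h \<in> Hom C Y Z \<Longrightarrow>
    Comp C X Y Z g f = Comp C X Y Z h f \<Longrightarrow> g = h"
  unfolding epic_def by blast

lemma split_monic:
  assumes "X \<in> Obj C" "Y \<in> Obj C" "f \<in> Hom C X Y" "g \<in> Hom C Y X" "Comp C X Y X g f = Ident C X"
  shows "monic C X Y f"
  unfolding monic_def
proof (intro conjI ballI impI)
  fix W h h' assume W: "W \<in> Obj C" "h \<in> Hom C W X" "h' \<in> Hom C W X"
    and "Comp C W X Y f h = Comp C W X Y f h'"
  then have "Comp C W X X (Comp C X Y X g f) h = Comp C W X X (Comp C X Y X g f) h'"
    using assms(1-4) by (simp add: comp_assoc)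
  then show "h = h'"
    using assms W by simp
qed (use assms in simp)

end

lemma sum_lessThan_add:
  "(\<Sum>j<m + n. f j) = (\<Sum>j<m. f j) + (\<Sum>j<n. f (m + j))" for m n :: nat
  by (induction n) (simp_all add: add.assoc)

section \<open>The abelian structure\<close>

context schur_category
begin

lemma zero_object_exists: "\<exists>Z. zero_object C Z"
proof -
  obtain X \<iota> \<pi> where "sum_data C [] X \<iota> \<pi>"
    using sums_exist[of "[]"] unfolding direct_sum_iff by auto
  then show ?thesis
    using zero_objectI[of X] by (auto simp: sum_data_def)
qed

text \<open>Decompositions of \<open>X\<close> and \<open>Y\<close> are concatenated and summed to
  \<open>Z\<close>; the summands of \<open>Y\<close> sit at the indices shifted by
  \<open>?m\<close>. Comparing summands embeds \<open>X\<close> and \<open>Y\<close> into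
  \<open>Z\<close>.\<close>

lemma biproduct_exists:
  assumes X: "X \<in> Obj C" and Y: "Y \<in> Obj C"
  shows "\<exists>Z. direct_sum C [X, Y] Z"
proof -
  obtain Zs1 b1 \<psi>1 where Zs1: "set Zs1 \<subseteq> I" and "sum_data C Zs1 X b1 \<psi>1"
    using decomposition[OF X] unfolding direct_sum_iff by blast
  note D1 = sum_dataD[OF this(2)]
  obtain Zs2 b2 \<psi>2 where Zs2: "set Zs2 \<subseteq> I" and "sum_data C Zs2 Y b2 \<psi>2"
    using decomposition[OF Y] unfolding direct_sum_iff by blast
  note D2 = sum_dataD[OF this(2)]
  have "set (Zs1 @ Zs2) \<subseteq> I"
    using Zs1 Zs2 by simp
  then obtain Z \<iota> \<pi> where "sum_data C (Zs1 @ Zs2) Z \<iota> \<pi>"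
    using sums_exist unfolding direct_sum_iff by blast
  note D = sum_dataD[OF this]
  let ?m = "length Zs1" and ?n = "length Zs2"
  have i1: "\<iota> j \<in> Hom C (Zs1 ! j) Z" "\<pi> j \<in> Hom C Z (Zs1 ! j)" if "j < ?m" for j
    using D(3)[of j] D(4)[of j] that by (simp_all add: nth_append)
  have i2: "\<iota> (?m + j) \<in> Hom C (Zs2 ! j) Z" "\<pi> (?m + j) \<in> Hom C Z (Zs2 ! j)" if "j < ?n" for j
    using D(3)[of "?m + j"] D(4)[of "?m + j"] that by (simp_all add: nth_append)
  have d11: "Comp C (Zs1 ! j) Z (Zs1 ! i) (\<pi> i) (\<iota> j) = (if i = j then Ident C (Zs1 ! i) else 0)" if "i < ?m" "j < ?m" for i j
    using D(5)[of i j] that by (simp add: nth_append)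
  have d12: "Comp C (Zs2 ! j) Z (Zs1 ! i) (\<pi> i) (\<iota> (?m + j)) = 0" if "i < ?m" "j < ?n" for i j
    using D(5)[of i "?m + j"] that by (simp add: nth_append)
  have d21: "Comp C (Zs1 ! j) Z (Zs2 ! i) (\<pi> (?m + i)) (\<iota> j) = 0" if "i < ?n" "j < ?m" for i j
    using D(5)[of "?m + i" j] that by (simp add: nth_append)
  have d22: "Comp C (Zs2 ! j) Z (Zs2 ! i) (\<pi> (?m + i)) (\<iota> (?m + j)) = (if i = j then Ident C (Zs2 ! i) else 0)" if "i < ?n" "j < ?n" for i j
    using D(5)[of "?m + i" "?m + j"] that by (simp add: nth_append)
  define iX where "iX = (\<Sum>j<?m. Comp C X (Zs1 ! j) Z (\<iota> j) (\<psi>1 j))"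
  define pX where "pX = (\<Sum>j<?m. Comp C Z (Zs1 ! j) X (b1 j) (\<pi> j))"
  define iY where "iY = (\<Sum>j<?n. Comp C Y (Zs2 ! j) Z (\<iota> (?m + j)) (\<psi>2 j))"
  define pY where "pY = (\<Sum>j<?n. Comp C Z (Zs2 ! j) Y (b2 j) (\<pi> (?m + j)))"
  have hom: "iX \<in> Hom C X Z" "pX \<in> Hom C Z X" "iY \<in> Hom C Y Z" "pY \<in> Hom C Z Y"
    unfolding iX_def pX_def iY_def pY_def using X Y D(2) D1 D2 i1 i2 by (auto intro!: sum_in_hom)
  have p1: "Comp C X Z (Zs1 ! i) (\<pi> i) iX = \<psi>1 i" if i: "i < ?m" for i
  proof -
    have "Comp C X Z (Zs1 ! i) (\<pi> i) iX = (\<Sum>j<?m. Comp C X Z (Zs1 ! i) (\<pi> i) (Comp C X (Zs1 ! j) Z (\<iota> j) (\<psi>1 j)))"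
      unfolding iX_def using X D(2) D1 i1 i by (intro comp_sum_right) auto
    also have "\<dots> = (\<Sum>j<?m. if i = j then \<psi>1 i else 0)"
      using X D(2) D1 i1 i d11 by (intro sum.cong) (auto simp: comp_assoc[symmetric])
    finally show ?thesis using i by simp
  qed
  have p2: "Comp C Y Z (Zs2 ! i) (\<pi> (?m + i)) iY = \<psi>2 i" if i: "i < ?n" for i
  proof -
    have "Comp C Y Z (Zs2 ! i) (\<pi> (?m + i)) iY = (\<Sum>j<?n. Comp C Y Z (Zs2 ! i) (\<pi> (?m + i)) (Comp C Y (Zs2 ! j) Z (\<iota> (?m + j)) (\<psi>2 j)))"
      unfolding iY_def using Y D(2) D2 i2 i by (intro comp_sum_right) auto
    also have "\<dots> = (\<Sum>j<?n. if i = j then \<psi>2 i else 0)"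
      using Y D(2) D2 i2 i d22 by (intro sum.cong) (auto simp: comp_assoc[symmetric])
    finally show ?thesis using i by simp
  qed
  have p3: "Comp C Y Z (Zs1 ! i) (\<pi> i) iY = 0" if i: "i < ?m" for i
  proof -
    have "Comp C Y Z (Zs1 ! i) (\<pi> i) iY = (\<Sum>j<?n. Comp C Y Z (Zs1 ! i) (\<pi> i) (Comp C Y (Zs2 ! j) Z (\<iota> (?m + j)) (\<psi>2 j)))"
      unfolding iY_def using Y D(2) D1 D2 i1 i2 i by (intro comp_sum_right) auto
    also have "\<dots> = 0"
      using Y D(2) D1 D2 i1 i2 i d12 by (intro sum.neutral) (auto simp: comp_assoc[symmetric])
    finally show ?thesis .
  qed
  have p4: "Comp C X Z (Zs2 ! i) (\<pi> (?m + i)) iX = 0" if i: "i < ?n" for i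
  proof -
    have "Comp C X Z (Zs2 ! i) (\<pi> (?m + i)) iX = (\<Sum>j<?m. Comp C X Z (Zs2 ! i) (\<pi> (?m + i)) (Comp C X (Zs1 ! j) Z (\<iota> j) (\<psi>1 j)))"
      unfolding iX_def using X D(2) D1 D2 i1 i2 i by (intro comp_sum_right) auto
    also have "\<dots> = 0"
      using X D(2) D1 D2 i1 i2 i d21 by (intro sum.neutral) (auto simp: comp_assoc[symmetric])
    finally show ?thesis .
  qed
  have q1: "Comp C W Z X pX a = (\<Sum>j<?m. Comp C W (Zs1 ! j) X (b1 j) (Comp C W Z (Zs1 ! j) (\<pi> j) a))"
    if "W \<in> Obj C" "a \<in> Hom C W Z" for W a
  proof -
    have "Comp C W Z X pX a = (\<Sum>j<?m. Comp C W Z X (Comp C Z (Zs1 ! j) X (b1 j) (\<pi> j)) a)"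
      unfolding pX_def using X D(2) D1 i1 that by (intro comp_sum_left) auto
    then show ?thesis
      using X D(2) D1 i1 that by (simp add: comp_assoc)
  qed
  have q2: "Comp C W Z Y pY a = (\<Sum>j<?n. Comp C W (Zs2 ! j) Y (b2 j) (Comp C W Z (Zs2 ! j) (\<pi> (?m + j)) a))"
    if "W \<in> Obj C" "a \<in> Hom C W Z" for W a
  proof -
    have "Comp C W Z Y pY a = (\<Sum>j<?n. Comp C W Z Y (Comp C Z (Zs2 ! j) Y (b2 j) (\<pi> (?m + j))) a)"
      unfolding pY_def using Y D(2) D2 i2 that by (intro comp_sum_left) auto
    then show ?thesis
      using Y D(2) D2 i2 that by (simp add: comp_assoc)
  qed
  have c: "Comp C X Z X pX iX = Ident C X" "Comp C Y Z Y pY iY = Ident C Y"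
    "Comp C Y Z X pX iY = 0" "Comp C X Z Y pY iX = 0"
    using q1[OF X hom(1)] q2[OF Y hom(3)] q1[OF Y hom(3)] q2[OF X hom(1)] X Y D1 D2
    by (simp_all add: p1 p2 p3 p4)
  have x1: "Comp C Z X Z iX pX = (\<Sum>j<?m. Comp C Z (Zs1 ! j) Z (\<iota> j) (\<pi> j))"
  proof -
    have "Comp C Z X Z iX pX = (\<Sum>j<?m. Comp C Z X Z (Comp C X (Zs1 ! j) Z (\<iota> j) (\<psi>1 j)) pX)"
      unfolding iX_def using X D(2) D1 i1 hom(2) by (intro comp_sum_left) auto
    also have "\<dots> = (\<Sum>j<?m. Comp C Z (Zs1 ! j) Z (\<iota> j) (Comp C Z X (Zs1 ! j) (\<psi>1 j) pX))"
      using X D(2) D1 i1 hom(2) by (intro sum.cong) (auto simp: comp_assoc)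
    also have "\<dots> = (\<Sum>j<?m. Comp C Z (Zs1 ! j) Z (\<iota> j) (\<pi> j))"
    proof (rule sum.cong)
      fix j assume "j \<in> {..<?m}"
      then have j: "j < ?m" by simp
      have "Comp C Z X (Zs1 ! j) (\<psi>1 j) pX = (\<Sum>k<?m. Comp C Z X (Zs1 ! j) (\<psi>1 j) (Comp C Z (Zs1 ! k) X (b1 k) (\<pi> k)))"
        unfolding pX_def using X D(2) D1 i1 j by (intro comp_sum_right) auto
      also have "\<dots> = (\<Sum>k<?m. if j = k then \<pi> j else 0)"
        using X D(2) D1 i1 j by (intro sum.cong) (auto simp: comp_assoc[symmetric])
      finally show "Comp C Z (Zs1 ! j) Z (\<iota> j) (Comp C Z X (Zs1 ! j) (\<psi>1 j) pX) = Comp C Z (Zs1 ! j) Z (\<iota> j) (\<pi> j)"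
        using j by simp
    qed simp
    finally show ?thesis .
  qed
  have x2: "Comp C Z Y Z iY pY = (\<Sum>j<?n. Comp C Z (Zs2 ! j) Z (\<iota> (?m + j)) (\<pi> (?m + j)))"
  proof -
    have "Comp C Z Y Z iY pY = (\<Sum>j<?n. Comp C Z Y Z (Comp C Y (Zs2 ! j) Z (\<iota> (?m + j)) (\<psi>2 j)) pY)"
      unfolding iY_def using Y D(2) D2 i2 hom(4) by (intro comp_sum_left) auto
    also have "\<dots> = (\<Sum>j<?n. Comp C Z (Zs2 ! j) Z (\<iota> (?m + j)) (Comp C Z Y (Zs2 ! j) (\<psi>2 j) pY))"
      using Y D(2) D2 i2 hom(4) by (intro sum.cong) (auto simp: comp_assoc)
    also have "\<dots> = (\<Sum>j<?n. Comp C Z (Zs2 ! j) Z (\<iota> (?m + j)) (\<pi> (?m + j)))"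
    proof (rule sum.cong)
      fix j assume "j \<in> {..<?n}"
      then have j: "j < ?n" by simp
      have "Comp C Z Y (Zs2 ! j) (\<psi>2 j) pY = (\<Sum>k<?n. Comp C Z Y (Zs2 ! j) (\<psi>2 j) (Comp C Z (Zs2 ! k) Y (b2 k) (\<pi> (?m + k))))"
        unfolding pY_def using Y D(2) D2 i2 j by (intro comp_sum_right) auto
      also have "\<dots> = (\<Sum>k<?n. if j = k then \<pi> (?m + j) else 0)"
        using Y D(2) D2 i2 j by (intro sum.cong) (auto simp: comp_assoc[symmetric])
      finally show "Comp C Z (Zs2 ! j) Z (\<iota> (?m + j)) (Comp C Z Y (Zs2 ! j) (\<psi>2 j) pY) = Comp C Z (Zs2 ! j) Z (\<iota> (?m + j)) (\<pi> (?m + j))"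
        using j by simp
    qed simp
    finally show ?thesis .
  qed
  have "Comp C Z X Z iX pX + Comp C Z Y Z iY pY = Ident C Z"
    unfolding x1 x2 D(6)[symmetric] by (simp add: sum_lessThan_add nth_append)
  then have "direct_sum C [X, Y] Z"
    using X Y D(2) hom c
    by (intro direct_sumI[of _ _ _ "\<lambda>i. if i = 0 then iX else iY" "\<lambda>i. if i = 0 then pX else pY"])
      (auto simp: less_Suc_eq)
  then show ?thesis ..
qed

text \<open>With \<open>f g f = f\<close>, the idempotent \<open>1 - g f\<close> is annihilated by
  \<open>f\<close> and fixes every morphism annihilated by \<open>f\<close>. Its splitting is the
  kernel.\<close>

lemma kernel_exists:
  assumes X: "X \<in> Obj C" and Y: "Y \<in> Obj C" and f: "f \<in> Hom C X Y"
  shows "\<exists>K k. is_kernel C X Y f K k"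
proof -
  obtain g where g: "g \<in> Hom C Y X" and fgf: "Comp C X Y Y (Comp C Y X Y f g) f = f"
    using von_Neumann_regular[OF assms] by blast
  let ?e = "Ident C X - Comp C X Y X g f"
  have gfgf: "Comp C X X X (Comp C X Y X g f) (Comp C X Y X g f) = Comp C X Y X g f"
  proof -
    have "Comp C X X X (Comp C X Y X g f) (Comp C X Y X g f) = Comp C X Y X g (Comp C X Y Y (Comp C Y X Y f g) f)"
      using X Y f g by (simp add: comp_assoc)
    then show ?thesis
      by (simp add: fgf)
  qed
  have e: "?e \<in> Hom C X X" "Comp C X X X ?e ?e = ?e"
    using X Y f g by (simp_all add: comp_diff gfgf)
  obtain K r s where K: "K \<in> Obj C" "r \<in> Hom C X K" "s \<in> Hom C K X" "Comp C X K X s r = ?e" "Comp C K X K r s = Ident C K"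
    using split_idempotent[OF X e] by blast
  have fe: "Comp C X X Y f ?e = 0"
    using X Y f g fgf by (simp add: comp_diff comp_assoc)
  have "is_kernel C X Y f K s"
    unfolding is_kernel_def
  proof (intro conjI ballI impI)
    have "s = Comp C K X X ?e s"
      using X K(1-3,5) by (simp add: K(4)[symmetric] comp_assoc)
    then have "Comp C K X Y f s = Comp C K X Y (Comp C X X Y f ?e) s"
      using X Y f g K(1,3) e(1) by (metis comp_assoc)
    then show "Comp C K X Y f s = 0"
      using fe X Y K by simp
    fix W h assume W: "W \<in> Obj C" "h \<in> Hom C W X" and fh: "Comp C W X Y f h = 0"
    have "Comp C W X X ?e h = h"
      using X Y W f g fh by (simp add: comp_diff comp_assoc)
    then have *: "Comp C W K X s (Comp C W X K r h) = h"
      using X W K(1-3) by (simp add: K(4) flip: comp_assoc)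
    show "\<exists>!u. u \<in> Hom C W K \<and> Comp C W K X s u = h"
    proof (rule ex1I)
      show "Comp C W X K r h \<in> Hom C W K \<and> Comp C W K X s (Comp C W X K r h) = h"
        using * X W K by simp
      fix u assume u: "u \<in> Hom C W K \<and> Comp C W K X s u = h"
      have "u = Comp C W K K (Comp C K X K r s) u"
        using u W K by simp
      also have "\<dots> = Comp C W X K r (Comp C W K X s u)"
        using u W X K(1-3) by (simp add: comp_assoc)
      finally show "u = Comp C W X K r h"
        using u by simp
    qed
  qed (use K in auto)
  then show ?thesis by blast
qed

lemma cokernel_exists:
  assumes X: "X \<in> Obj C" and Y: "Y \<in> Obj C" and f: "f \<in> Hom C X Y"
  shows "\<exists>Q p. is_cokernel C X Y f Q p"
proof -
  obtain g where g: "g \<in> Hom C Y X" and fgf: "Comp C X Y Y (Comp C Y X Y f g) f = f"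
    using von_Neumann_regular[OF assms] by blast
  let ?e = "Ident C Y - Comp C Y X Y f g"
  have "Comp C Y Y Y (Comp C Y X Y f g) (Comp C Y X Y f g) = Comp C Y X Y (Comp C X Y Y (Comp C Y X Y f g) f) g"
    using X Y f g by (simp add: comp_assoc)
  then have fgfg: "Comp C Y Y Y (Comp C Y X Y f g) (Comp C Y X Y f g) = Comp C Y X Y f g"
    by (simp add: fgf)
  have e: "?e \<in> Hom C Y Y" "Comp C Y Y Y ?e ?e = ?e"
    using X Y f g by (simp_all add: comp_diff fgfg)
  obtain K r s where K: "K \<in> Obj C" "r \<in> Hom C Y K" "s \<in> Hom C K Y" "Comp C Y K Y s r = ?e" "Comp C K Y K r s = Ident C K"
    using split_idempotent[OF Y e] by blast
  have ef: "Comp C X Y Y ?e f = 0"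
    using X Y f g fgf by (simp add: comp_diff)
  have "is_cokernel C X Y f K r"
    unfolding is_cokernel_def
  proof (intro conjI ballI impI)
    have "r = Comp C Y Y K r ?e"
      using Y K(1-3,5) by (simp add: K(4)[symmetric] flip: comp_assoc)
    then have "Comp C X Y K r f = Comp C X Y K r (Comp C X Y Y ?e f)"
      using X Y f g K(1,2) e(1) by (metis comp_assoc)
    then show "Comp C X Y K r f = 0"
      using ef X Y K by simp
    fix W h assume W: "W \<in> Obj C" "h \<in> Hom C Y W" and hf: "Comp C X Y W h f = 0"
    have "Comp C Y Y W h ?e = h"
      using X Y W f g hf by (simp add: comp_diff flip: comp_assoc)
    then have *: "Comp C Y K W (Comp C K Y W h s) r = h"
      using Y W K(1-3) by (simp add: K(4) comp_assoc)
    show "\<exists>!u. u \<in> Hom C K W \<and> Comp C Y K W u r = h"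
    proof (rule ex1I)
      show "Comp C K Y W h s \<in> Hom C K W \<and> Comp C Y K W (Comp C K Y W h s) r = h"
        using * Y W K by simp
      fix u assume u: "u \<in> Hom C K W \<and> Comp C Y K W u r = h"
      have "u = Comp C K K W u (Comp C K Y K r s)"
        using u W K by simp
      also have "\<dots> = Comp C K Y W (Comp C Y K W u r) s"
        using u W Y K(1-3) by (simp flip: comp_assoc)
      finally show "u = Comp C K Y W h s"
        using u by simp
    qed
  qed (use K in auto)
  then show ?thesis by blast
qed

lemma monic_left_inverse:
  assumes X: "X \<in> Obj C" and Y: "Y \<in> Obj C" and f: "monic C X Y f"
  shows "\<exists>g\<in>Hom C Y X. Comp C X Y X g f = Ident C X"
proof -
  have fh: "f \<in> Hom C X Y"
    using f by (simp add: monic_def)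
  obtain g where g: "g \<in> Hom C Y X" and fgf: "Comp C X Y Y (Comp C Y X Y f g) f = f"
    using von_Neumann_regular[OF X Y fh] by blast
  have "Comp C X X Y f (Comp C X Y X g f) = Comp C X X Y f (Ident C X)"
    using X Y fh g fgf by (simp flip: comp_assoc)
  then have "Comp C X Y X g f = Ident C X"
    using monicD[OF f X] X Y fh g by simp
  then show ?thesis
    using g by blast
qed

lemma epic_right_inverse:
  assumes X: "X \<in> Obj C" and Y: "Y \<in> Obj C" and f: "epic C X Y f"
  shows "\<exists>g\<in>Hom C Y X. Comp C Y X Y f g = Ident C Y"
proof -
  have fh: "f \<in> Hom C X Y"
    using f by (simp add: epic_def)
  obtain g where g: "g \<in> Hom C Y X" and fgf: "Comp C X Y Y (Comp C Y X Y f g) f = f"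
    using von_Neumann_regular[OF X Y fh] by blast
  have "Comp C X Y Y (Comp C Y X Y f g) f = Comp C X Y Y (Ident C Y) f"
    using X Y fh fgf by simp
  then have "Comp C Y X Y f g = Ident C Y"
    using epicD[OF f Y] X Y fh g by simp
  then show ?thesis
    using g by blast
qed

text \<open>A monomorphism splits by regularity; with left inverse \<open>g\<close> it is the kernel
  of \<open>1 - f g\<close>.\<close>

lemma monic_is_kernel_of:
  assumes X: "X \<in> Obj C" and Y: "Y \<in> Obj C" and f: "monic C X Y f"
  shows "\<exists>Z\<in>Obj C. \<exists>g\<in>Hom C Y Z. is_kernel C Y Z g X f"
proof -
  have fh: "f \<in> Hom C X Y"
    using f by (simp add: monic_def)
  obtain g where g: "g \<in> Hom C Y X" and gf: "Comp C X Y X g f = Ident C X"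
    using monic_left_inverse[OF assms] by blast
  let ?e = "Ident C Y - Comp C Y X Y f g"
  have "is_kernel C Y Y ?e X f"
    unfolding is_kernel_def
  proof (intro conjI ballI impI)
    show "Comp C X Y Y ?e f = 0"
      using X Y fh g gf by (simp add: comp_diff comp_assoc)
    fix W h assume W: "W \<in> Obj C" "h \<in> Hom C W Y" and eh: "Comp C W Y Y ?e h = 0"
    have "Comp C W X Y f (Comp C W Y X g h) = h"
      using eh X Y W fh g by (simp add: comp_diff comp_assoc)
    then show "\<exists>!u. u \<in> Hom C W X \<and> Comp C W X Y f u = h"
      using monicD[OF f W(1)] X Y W g by (intro ex1I[of _ "Comp C W Y X g h"]) auto
  qed (use X fh in auto)
  then show ?thesis
    using Y X fh g by (intro bexI[of _ Y] bexI[of _ ?e]) auto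
qed

lemma epic_is_cokernel_of:
  assumes X: "X \<in> Obj C" and Y: "Y \<in> Obj C" and f: "epic C X Y f"
  shows "\<exists>W\<in>Obj C. \<exists>g\<in>Hom C W X. is_cokernel C W X g Y f"
proof -
  have fh: "f \<in> Hom C X Y"
    using f by (simp add: epic_def)
  obtain g where g: "g \<in> Hom C Y X" and fg: "Comp C Y X Y f g = Ident C Y"
    using epic_right_inverse[OF assms] by blast
  let ?e = "Ident C X - Comp C X Y X g f"
  have "is_cokernel C X X ?e Y f"
    unfolding is_cokernel_def
  proof (intro conjI ballI impI)
    show "Comp C X X Y f ?e = 0"
      using X Y fh g fg by (simp add: comp_diff flip: comp_assoc)
    fix W h assume W: "W \<in> Obj C" "h \<in> Hom C X W" and he: "Comp C X X W h ?e = 0"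
    have "Comp C X Y W (Comp C Y X W h g) f = h"
      using he X Y W fh g by (simp add: comp_diff comp_assoc)
    then show "\<exists>!u. u \<in> Hom C Y W \<and> Comp C X Y W u f = h"
      using epicD[OF f W(1)] X Y W g by (intro ex1I[of _ "Comp C Y X W h g"]) auto
  qed (use Y fh in auto)
  then show ?thesis
    using Y X fh g by (intro bexI[of _ X] bexI[of _ ?e]) auto
qed

section \<open>Simple objects and multiplicities\<close>

lemma simple_generator: "Z \<in> I \<Longrightarrow> simple_object C Z"
  unfolding simple_object_def
proof (intro conjI ballI allI impI)
  assume Z: "Z \<in> I"
  then show ZO: "Z \<in> Obj C" by simp
  show "\<not> zero_object C Z"
    using ident_nz[OF Z] ident_in_hom[OF ZO] by (auto simp: zero_object_def)
  fix Y f assume Y: "Y \<in> Obj C" and f: "monic C Y Z f"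
  then have fh: "f \<in> Hom C Y Z"
    by (simp add: monic_def)
  obtain g where g: "g \<in> Hom C Z Y" and gf: "Comp C Y Z Y g f = Ident C Y"
    using monic_left_inverse[OF Y ZO f] by blast
  \<comment> \<open>By Schur \<open>f g\<close> is a scalar \<open>c\<close>; from
    \<open>g f = 1\<close> follows \<open>f = c f\<close>, so \<open>f\<close> is zero or
    \<open>c\<close> is 1 and \<open>f\<close> is invertible.\<close>
  obtain c where c: "Comp C Z Y Z f g = Scal C c (Ident C Z)"
    using schur_same[OF Z, of "Comp C Z Y Z f g"] Y ZO fh g by auto
  have "f = Comp C Y Y Z f (Comp C Y Z Y g f)"
    using gf Y ZO fh by simp
  also have "\<dots> = Scal C c f"
    using Y ZO fh g c by (simp add: comp_scal_left flip: comp_assoc)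
  finally have fc: "f = Scal C c f" .
  show "zero_object C Y \<or> iso_arrow C Y Z f"
  proof (cases "f = 0")
    case True
    then show ?thesis
      using gf Y ZO g zero_objectI[OF Y] by simp
  next
    case False
    have "Scal C 1 f = Scal C c f"
      using fc by simp
    then have "c = 1"
      using False by (simp only: scale_cancel_right) simp
    then have "inverse_arrows C Y Z f g"
      using c gf fh g by (simp add: inverse_arrows_def)
    then show ?thesis
      by (auto simp: iso_arrow_def)
  qed
qed

lemma simple_iso_generator:
  assumes "simple_object C X" shows "\<exists>Z\<in>I. isomorphic C Z X"
proof -
  have X: "X \<in> Obj C" and nz: "\<not> zero_object C X"
    and simple: "\<And>Y f. Y \<in> Obj C \<Longrightarrow> monic C Y X f \<Longrightarrow> zero_object C Y \<or> iso_arrow C Y X f"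
    using assms by (auto simp: simple_object_def)
  obtain Zs b \<psi> where Zs: "set Zs \<subseteq> I" and "sum_data C Zs X b \<psi>"
    using decomposition[OF X] unfolding direct_sum_iff by blast
  note D = sum_dataD[OF this(2)]
  have "Zs \<noteq> []"
    using D(6) nz zero_objectI[OF X] by auto
  then have l: "0 < length Zs" by simp
  have Z0: "Zs ! 0 \<in> I"
    using Zs l nth_mem by blast
  \<comment> \<open>The inclusion of a first summand is a split monomorphism into a simple object
    with nonzero source, hence an isomorphism.\<close>
  have "monic C (Zs ! 0) X (b 0)"
    using split_monic[OF D(1)[OF l] X D(3)[OF l] D(4)[OF l]] D(5)[OF l l] by simp
  then have "iso_arrow C (Zs ! 0) X (b 0)"
    using simple[OF D(1)[OF l]] simple_generator[OF Z0] by (auto simp: simple_object_def)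
  then show ?thesis
    using Z0 by (auto simp: isomorphic_def)
qed

lemma semisimple: "semisimple_category C"
proof (unfold_locales, goal_cases)
  case 1 then show ?case by (rule zero_object_exists)
next
  case 2 then show ?case by (rule biproduct_exists)
next
  case 3 then show ?case by (rule kernel_exists)
next
  case 4 then show ?case by (rule cokernel_exists)
next
  case 5 then show ?case by (rule monic_is_kernel_of)
next
  case 6 then show ?case by (rule epic_is_cokernel_of)
next
  case (7 X)
  then show ?case
    using decomposition[of X] simple_generator by blast
qed

lemma generators_distinct:
  assumes "Z \<in> I" "Z' \<in> I" "isomorphic C Z Z'" shows "Z = Z'"
proof (rule ccontr)
  assume neq: "Z \<noteq> Z'"
  obtain f g where f: "f \<in> Hom C Z Z'" and g: "g \<in> Hom C Z' Z" and gf: "Comp C Z Z' Z g f = Ident C Z"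
    using assms(3) by (auto simp: isomorphic_def iso_arrow_def inverse_arrows_def)
  have "f = 0"
    using schur_diff[OF assms(1,2) neq f] .
  then show False
    using gf g assms(1,2) ident_nz[OF assms(1)] by simp
qed

lemma simple_classes_eq: "simple_classes C = iso_class C ` I"
proof -
  have "iso_class C X \<in> iso_class C ` I" if simple: "simple_object C X" for X
  proof -
    obtain Z where "Z \<in> I" "isomorphic C Z X"
      using simple_iso_generator[OF simple] by blast
    moreover have "X \<in> Obj C"
      using simple by (simp add: simple_object_def)
    ultimately have "iso_class C X = iso_class C Z"
      using iso_class_eq_iff[of Z X] by simp
    with \<open>Z \<in> I\<close> show ?thesis
      by blast
  qed
  then show ?thesis
    using simple_generator by (auto simp: simple_classes_def)
qed

lemma inj_on_iso_class: "inj_on (iso_class C) I"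
  using generators_distinct iso_class_eq_iff by (auto simp: inj_on_def)

lemma hom_simple_zero:
  assumes Z: "Z \<in> I" and W: "simple_object C W" "\<not> isomorphic C Z W" and f: "f \<in> Hom C Z W"
  shows "f = 0"
proof -
  have WO: "W \<in> Obj C"
    using W(1) by (simp add: simple_object_def)
  obtain Z' where Z': "Z' \<in> I" "isomorphic C Z' W"
    using simple_iso_generator[OF W(1)] by blast
  then obtain g h where g: "g \<in> Hom C Z' W" and h: "h \<in> Hom C W Z'" and gh: "Comp C W Z' W g h = Ident C W"
    by (auto simp: isomorphic_def iso_arrow_def inverse_arrows_def)
  have "Z \<noteq> Z'"
    using W(2) Z'(2) by auto
  then have "Comp C Z W Z' h f = 0"
    using schur_diff[OF Z Z'(1)] Z Z' WO f h by simp
  then have "Comp C Z W W (Comp C W Z' W g h) f = 0"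
    using Z Z' WO f g h by (simp add: comp_assoc)
  then show ?thesis
    using gh Z WO f by simp
qed

text \<open>The inclusions of the summands isomorphic to \<open>Z\<close>, transported to
  \<open>Z\<close>, form a basis of \<open>Hom C Z X\<close>. The count is thus independent of the
  decomposition, which the definite description in \<open>grothendieck_ring\<close> relies
  on.\<close>

lemma multiplicity:
  assumes X: "direct_sum C Ws X" and W: "\<And>W. W \<in> set Ws \<Longrightarrow> simple_object C W" and Z: "Z \<in> I"
  shows "length (filter (isomorphic C Z) Ws) = dim (Hom C Z X)"
proof -
  obtain \<iota> \<pi> where "sum_data C Ws X \<iota> \<pi>"
    using X unfolding direct_sum_iff by blast
  note D = sum_dataD[OF this]
  define S where "S = {j. j < length Ws \<and> isomorphic C Z (Ws ! j)}"
  have S: "j < length Ws" if "j \<in> S" for j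
    using that by (simp add: S_def)
  have "\<forall>j\<in>S. \<exists>\<theta> \<theta>'. inverse_arrows C Z (Ws ! j) \<theta> \<theta>'"
    by (auto simp: S_def isomorphic_def iso_arrow_def)
  then obtain \<theta> \<theta>' where "\<forall>j\<in>S. inverse_arrows C Z (Ws ! j) (\<theta> j) (\<theta>' j)"
    by metis
  then have \<theta>: "\<theta> j \<in> Hom C Z (Ws ! j)" "\<theta>' j \<in> Hom C (Ws ! j) Z"
    "Comp C Z (Ws ! j) Z (\<theta>' j) (\<theta> j) = Ident C Z" "Comp C (Ws ! j) Z (Ws ! j) (\<theta> j) (\<theta>' j) = Ident C (Ws ! j)"
    if "j \<in> S" for j
    using that by (auto simp: inverse_arrows_def)
  define v where "v j = Comp C Z (Ws ! j) X (\<iota> j) (\<theta> j)" for j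
  define w where "w j = Comp C X (Ws ! j) Z (\<theta>' j) (\<pi> j)" for j
  have v: "v j \<in> Hom C Z X" "w j \<in> Hom C X Z" if "j \<in> S" for j
    using that S D \<theta> Z by (simp_all add: v_def w_def)
  have wv: "Comp C Z X Z (w i) (v j) = (if i = j then Ident C Z else 0)" if i: "i \<in> S" and j: "j \<in> S" for i j
  proof -
    have "Comp C Z X Z (w i) (v j) = Comp C Z (Ws ! i) Z (\<theta>' i) (Comp C Z (Ws ! j) (Ws ! i) (Comp C (Ws ! j) X (Ws ! i) (\<pi> i) (\<iota> j)) (\<theta> j))"
      using S[OF i] S[OF j] D(1-4) \<theta>(1,2)[OF i] \<theta>(1,2)[OF j] Z by (simp add: v_def w_def comp_assoc)
    also have "\<dots> = (if i = j then Ident C Z else 0)"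
      using S[OF i] S[OF j] D(1,5) \<theta>[OF i] \<theta>[OF j] Z by simp
    finally show ?thesis .
  qed
  have fin: "finite S"
    by (simp add: S_def)
  have inj: "inj_on v S"
  proof (rule inj_onI)
    fix i j assume ij: "i \<in> S" "j \<in> S" "v i = v j"
    then show "i = j"
      using wv[of i i] wv[of i j] ident_nz[OF Z] by (auto split: if_splits)
  qed
  have "independent (v ` S)"
  proof (rule independent_if_scalars_zero)
    fix c x assume sum: "(\<Sum>x\<in>v ` S. Scal C (c x) x) = 0" and "x \<in> v ` S"
    then obtain i where i: "i \<in> S" "x = v i"
      by blast
    have "0 = Comp C Z X Z (w i) (\<Sum>j\<in>S. Scal C (c (v j)) (v j))"
      using sum i v Z D(2) by (simp add: sum.reindex[OF inj])
    also have "\<dots> = (\<Sum>j\<in>S. Comp C Z X Z (w i) (Scal C (c (v j)) (v j)))"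
      using i v Z D(2) by (intro comp_sum_right) auto
    also have "\<dots> = (\<Sum>j\<in>S. if i = j then Scal C (c (v j)) (Ident C Z) else 0)"
      using i v Z D(2) wv by (intro sum.cong) (auto simp: comp_scal_right)
    also have "\<dots> = Scal C (c x) (Ident C Z)"
      using i fin by simp
    finally show "c x = 0"
      using ident_nz[OF Z] by simp
  qed (simp add: fin)
  moreover have "h \<in> span (v ` S)" if h: "h \<in> Hom C Z X" for h
  proof -
    have "Comp C Z (Ws ! j) X (\<iota> j) (Comp C Z X (Ws ! j) (\<pi> j) h) \<in> span (v ` S)" if j: "j < length Ws" for j
    proof (cases "j \<in> S")
      case True
      obtain c where c: "Comp C Z X Z (w j) h = Scal C c (Ident C Z)"
        using schur_same[OF Z, of "Comp C Z X Z (w j) h"] Z D(2) h v[OF True] by auto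
      have "Comp C Z X (Ws ! j) (\<pi> j) h = Comp C Z (Ws ! j) (Ws ! j) (Comp C (Ws ! j) Z (Ws ! j) (\<theta> j) (\<theta>' j)) (Comp C Z X (Ws ! j) (\<pi> j) h)"
        using \<theta>[OF True] Z D j h by simp
      also have "\<dots> = Comp C Z Z (Ws ! j) (\<theta> j) (Comp C Z X Z (w j) h)"
        using \<theta>(1,2)[OF True] Z D(1-4) j h by (simp add: w_def comp_assoc)
      also have "\<dots> = Scal C c (\<theta> j)"
        using \<theta>(1)[OF True] Z D(1) j by (simp add: c comp_scal_right)
      finally have "Comp C Z (Ws ! j) X (\<iota> j) (Comp C Z X (Ws ! j) (\<pi> j) h) = Scal C c (v j)"
        using \<theta>(1)[OF True] Z D(1-4) j by (simp add: v_def comp_scal_right)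
      then show ?thesis
        using True by (auto intro: span_scale span_base)
    next
      case False
      then have "\<not> isomorphic C Z (Ws ! j)"
        using j by (simp add: S_def)
      then have "Comp C Z X (Ws ! j) (\<pi> j) h = 0"
        using hom_simple_zero[OF Z W[OF nth_mem[OF j]]] Z D j h by simp
      then show ?thesis
        using Z D j by (simp add: span_zero)
    qed
    then have "(\<Sum>j<length Ws. Comp C Z (Ws ! j) X (\<iota> j) (Comp C Z X (Ws ! j) (\<pi> j) h)) \<in> span (v ` S)"
      by (intro span_sum) auto
    then show ?thesis
      using hom_expand[of Z X h Ws \<iota> \<pi>] Z D h by simp
  qed
  moreover have "v ` S \<subseteq> Hom C Z X"
    using v by auto
  ultimately have "card (v ` S) = dim (Hom C Z X)"
    by (intro basis_card_eq_dim) auto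
  then have "card S = dim (Hom C Z X)"
    by (simp add: card_image[OF inj])
  then show ?thesis
    by (simp add: length_filter_conv_card S_def)
qed

end

section \<open>Duals in strict monoidal categories\<close>

text \<open>Tensor products agree as objects, not merely up to isomorphism, and the structure maps
  are identities. Equations between composites can then be written without associators.\<close>

locale strict_monoidal_category = linear_monoidal_category C for C :: "('o, 'm::ab_group_add) moncat" +
  assumes tobj_assoc: "\<lbrakk>X \<in> Obj C; Y \<in> Obj C; Z \<in> Obj C\<rbrakk> \<Longrightarrow> TObj C (TObj C X Y) Z = TObj C X (TObj C Y Z)"
    and tobj_unit: "X \<in> Obj C \<Longrightarrow> TObj C (Unit C) X = X" "X \<in> Obj C \<Longrightarrow> TObj C X (Unit C) = X"
    and assoc_ident: "\<lbrakk>X \<in> Obj C; Y \<in> Obj C; Z \<in> Obj C\<rbrakk> \<Longrightarrow> Assoc C X Y Z = Ident C (TObj C X (TObj C Y Z))"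
    and unit_ident: "X \<in> Obj C \<Longrightarrow> LUnit C X = Ident C X" "X \<in> Obj C \<Longrightarrow> RUnit C X = Ident C X"
begin

lemmas [simp] = unit_obj tobj_obj tmor_in_hom tobj_unit

text \<open>Arrows are packed with their source and target, so that equations between composites need no
  object annotations.\<close>

definition dm :: "'o \<times> 'm \<times> 'o \<Rightarrow> 'o" where "dm a = fst a"
definition cd :: "'o \<times> 'm \<times> 'o \<Rightarrow> 'o" where "cd a = snd (snd a)"
definition mr :: "'o \<times> 'm \<times> 'o \<Rightarrow> 'm" where "mr a = fst (snd a)"

definition arr where "arr a \<longleftrightarrow> dm a \<in> Obj C \<and> cd a \<in> Obj C \<and> mr a \<in> Hom C (dm a) (cd a)"

definition cmp (infixl "\<odot>" 65) where
  "g \<odot> f = (dm f, Comp C (dm f) (cd f) (cd g) (mr g) (mr f), cd g)"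
definition tns (infixl "\<otimes>" 70) where
  "f \<otimes> g = (TObj C (dm f) (dm g), TMor C (dm f) (cd f) (dm g) (cd g) (mr f) (mr g), TObj C (cd f) (cd g))"
definition ide where "ide X = (X, Ident C X, X)"

lemma arr_simps [simp]:
  "dm (g \<odot> f) = dm f" "cd (g \<odot> f) = cd g" "dm (f \<otimes> g) = TObj C (dm f) (dm g)"
  "cd (f \<otimes> g) = TObj C (cd f) (cd g)" "dm (ide X) = X" "cd (ide X) = X"
  "dm (X, h, Y) = X" "cd (X, h, Y) = Y" "mr (X, h, Y) = h"
  by (simp_all add: dm_def cd_def cmp_def tns_def ide_def mr_def)

lemma mr_simps:
  "mr (g \<odot> f) = Comp C (dm f) (cd f) (cd g) (mr g) (mr f)"
  "mr (f \<otimes> g) = TMor C (dm f) (cd f) (dm g) (cd g) (mr f) (mr g)" "mr (ide X) = Ident C X"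
  by (simp_all add: mr_def cmp_def tns_def ide_def)

lemma arr_eqI: "dm a = dm b \<Longrightarrow> cd a = cd b \<Longrightarrow> mr a = mr b \<Longrightarrow> a = b"
  by (cases a; cases b) (simp add: dm_def cd_def mr_def)

lemma arrD: "arr a \<Longrightarrow> dm a \<in> Obj C" "arr a \<Longrightarrow> cd a \<in> Obj C" "arr a \<Longrightarrow> mr a \<in> Hom C (dm a) (cd a)"
  by (simp_all add: arr_def)

lemma arr_intros [simp]:
  "arr f \<Longrightarrow> arr g \<Longrightarrow> dm g = cd f \<Longrightarrow> arr (g \<odot> f)" "arr f \<Longrightarrow> arr g \<Longrightarrow> arr (f \<otimes> g)"
  "X \<in> Obj C \<Longrightarrow> arr (ide X)"
  using comp_in_hom[of "dm f" "cd f" "cd g" "mr f" "mr g"]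
  by (simp_all add: arr_def mr_simps)

lemmas [simp] = arrD

lemma cmp_assoc: "arr f \<Longrightarrow> arr g \<Longrightarrow> arr h \<Longrightarrow> dm g = cd f \<Longrightarrow> dm h = cd g \<Longrightarrow> h \<odot> g \<odot> f = h \<odot> (g \<odot> f)"
  using arrD(3)[of g] arrD(3)[of h] by (intro arr_eqI) (simp_all add: mr_simps comp_assoc)

lemma cmp_ide [simp]: "arr f \<Longrightarrow> cd f = X \<Longrightarrow> ide X \<odot> f = f" "arr f \<Longrightarrow> dm f = X \<Longrightarrow> f \<odot> ide X = f"
  by (auto intro!: arr_eqI simp: mr_simps)

lemma tns_ide: "X \<in> Obj C \<Longrightarrow> Y \<in> Obj C \<Longrightarrow> ide X \<otimes> ide Y = ide (TObj C X Y)"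
  by (intro arr_eqI) (simp_all add: mr_simps tmor_ident)

lemma interchange:
  "arr f \<Longrightarrow> arr g \<Longrightarrow> arr f' \<Longrightarrow> arr g' \<Longrightarrow> dm g = cd f \<Longrightarrow> dm g' = cd f' \<Longrightarrow>
    (g \<otimes> g') \<odot> (f \<otimes> f') = (g \<odot> f) \<otimes> (g' \<odot> f')"
  using arrD(3)[of g] arrD(3)[of g'] by (intro arr_eqI) (simp_all add: mr_simps tmor_comp)

text \<open>This is naturality of the associator, read with the associator an identity.\<close>

lemma tns_assoc:
  assumes "arr f" "arr g" "arr h" shows "f \<otimes> g \<otimes> h = f \<otimes> (g \<otimes> h)"
proof (rule arr_eqI)
  show "mr (f \<otimes> g \<otimes> h) = mr (f \<otimes> (g \<otimes> h))"
    using assoc_natural[of "dm f" "dm g" "dm h" "cd f" "cd g" "cd h" "mr f" "mr g" "mr h"] assms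
      tmor_in_hom[of "TObj C (dm f) (dm g)" "TObj C (cd f) (cd g)" "dm h" "cd h" "TMor C (dm f) (cd f) (dm g) (cd g) (mr f) (mr g)" "mr h"]
    by (simp add: mr_simps assoc_ident tobj_assoc)
qed (use assms in \<open>simp_all add: tobj_assoc\<close>)

lemma tns_unit: "arr f \<Longrightarrow> ide (Unit C) \<otimes> f = f" "arr f \<Longrightarrow> f \<otimes> ide (Unit C) = f"
  using lunit_natural[of "dm f" "cd f" "mr f"] runit_natural[of "dm f" "cd f" "mr f"]
    tmor_in_hom[of "Unit C" "Unit C" "dm f" "cd f" "Ident C (Unit C)" "mr f"]
    tmor_in_hom[of "dm f" "cd f" "Unit C" "Unit C" "mr f" "Ident C (Unit C)"]
  by (auto intro!: arr_eqI simp: mr_simps unit_ident)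

definition dual_data where
  "dual_data X D e c \<longleftrightarrow> X \<in> Obj C \<and> D \<in> Obj C \<and> arr e \<and> arr c \<and>
    dm e = TObj C D X \<and> cd e = Unit C \<and> dm c = Unit C \<and> cd c = TObj C X D \<and>
    (ide X \<otimes> e) \<odot> (c \<otimes> ide X) = ide X \<and> (e \<otimes> ide D) \<odot> (ide D \<otimes> c) = ide D"

text \<open>The inverse of an identity associator is forced to be the identity, so the zigzag
  equations lose their associators and unitors.\<close>

lemma is_left_dual_iff: "is_left_dual C X D \<longleftrightarrow> (\<exists>e c. dual_data X D e c)"
proof (cases "X \<in> Obj C \<and> D \<in> Obj C")
  case True
  let ?a = "Ident C (TObj C D (TObj C X D))"
  have inv: "inverse_arrows C (TObj C (TObj C D X) D) (TObj C D (TObj C X D)) (Assoc C D X D) a' \<longleftrightarrow> a' = ?a" for a'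
    using True by (auto simp: inverse_arrows_def assoc_ident tobj_assoc)
  have hom: "TMor C X X (TObj C D X) (Unit C) (Ident C X) ev \<in> Hom C (TObj C X (TObj C D X)) X"
    "TMor C (Unit C) (TObj C X D) X X coev (Ident C X) \<in> Hom C X (TObj C X (TObj C D X))"
    "TMor C (TObj C D X) (Unit C) D D ev (Ident C D) \<in> Hom C (TObj C D (TObj C X D)) D"
    "TMor C D D (Unit C) (TObj C X D) (Ident C D) coev \<in> Hom C D (TObj C D (TObj C X D))"
    if "ev \<in> Hom C (TObj C D X) (Unit C)" "coev \<in> Hom C (Unit C) (TObj C X D)" for ev coev
    using True that tmor_in_hom[of X X "TObj C D X" "Unit C" "Ident C X" ev]
      tmor_in_hom[of "Unit C" "TObj C X D" X X coev "Ident C X"]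
      tmor_in_hom[of "TObj C D X" "Unit C" D D ev "Ident C D"]
      tmor_in_hom[of D D "Unit C" "TObj C X D" "Ident C D" coev]
    by (simp_all add: tobj_assoc)
  show ?thesis
  proof
    assume "is_left_dual C X D"
    then obtain ev coev where ec: "ev \<in> Hom C (TObj C D X) (Unit C)" "coev \<in> Hom C (Unit C) (TObj C X D)"
      and z: "Comp C (TObj C (Unit C) X) (TObj C X (Unit C)) X (RUnit C X)
          (Comp C (TObj C (Unit C) X) (TObj C X (TObj C D X)) (TObj C X (Unit C))
             (TMor C X X (TObj C D X) (Unit C) (Ident C X) ev)
             (Comp C (TObj C (Unit C) X) (TObj C (TObj C X D) X) (TObj C X (TObj C D X))
                (Assoc C X D X)
                (TMor C (Unit C) (TObj C X D) X X coev (Ident C X)))) = LUnit C X"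
       "Comp C (TObj C D (Unit C)) (TObj C (Unit C) D) D (LUnit C D)
          (Comp C (TObj C D (Unit C)) (TObj C (TObj C D X) D) (TObj C (Unit C) D)
             (TMor C (TObj C D X) (Unit C) D D ev (Ident C D))
             (Comp C (TObj C D (Unit C)) (TObj C D (TObj C X D)) (TObj C (TObj C D X) D)
                ?a
                (TMor C D D (Unit C) (TObj C X D) (Ident C D) coev))) = RUnit C D"
      unfolding is_left_dual_def inv by blast
    note h = hom[OF ec]
    have "dual_data X D (TObj C D X, ev, Unit C) (Unit C, coev, TObj C X D)"
      using z h True ec by (auto simp: dual_data_def arr_def unit_ident assoc_ident tobj_assoc mr_simps intro!: arr_eqI)
    then show "\<exists>e c. dual_data X D e c"
      by blast
  next
    assume "\<exists>e c. dual_data X D e c"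
    then obtain e c where "dual_data X D e c"
      by blast
    then have ec: "mr e \<in> Hom C (TObj C D X) (Unit C)" "mr c \<in> Hom C (Unit C) (TObj C X D)"
      and t: "dm e = TObj C D X" "cd e = Unit C" "dm c = Unit C" "cd c = TObj C X D"
      and z: "mr ((ide X \<otimes> e) \<odot> (c \<otimes> ide X)) = mr (ide X)" "mr ((e \<otimes> ide D) \<odot> (ide D \<otimes> c)) = mr (ide D)"
      using arrD(3)[of e] arrD(3)[of c] by (auto simp: dual_data_def)
    note h = hom[OF ec]
    show "is_left_dual C X D"
      unfolding is_left_dual_def inv using z h True ec
      by (intro conjI bexI[of _ "mr e"] bexI[of _ "mr c"] exI[of _ ?a])
        (simp_all add: unit_ident assoc_ident tobj_assoc mr_simps t)
  qed
qed (auto simp: is_left_dual_def dual_data_def)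

text \<open>The standard comparison maps, built from the evaluation of one dual and the coevaluation
  of the other. Interchange reorders their composite so that the zigzag on \<open>X\<close> can be
  applied first; the zigzag on the dual finishes.\<close>

lemma left_dual_unique:
  assumes "is_left_dual C X D" "is_left_dual C X D'"
  shows "isomorphic C D D'"
proof -
  have main: "((e' \<otimes> ide D) \<odot> (ide D' \<otimes> c)) \<odot> ((e \<otimes> ide D') \<odot> (ide D \<otimes> c')) = ide D"
    if d: "dual_data X D e c" and d': "dual_data X D' e' c'" for D D' e e' c c'
  proof -
    have o: "X \<in> Obj C" "D \<in> Obj C" "D' \<in> Obj C" "arr e" "arr c" "arr e'" "arr c'"
      and t: "dm e = TObj C D X" "cd e = Unit C" "dm c = Unit C" "cd c = TObj C X D"
      "dm e' = TObj C D' X" "cd e' = Unit C" "dm c' = Unit C" "cd c' = TObj C X D'"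
      and z: "(e \<otimes> ide D) \<odot> (ide D \<otimes> c) = ide D" "(ide X \<otimes> e') \<odot> (c' \<otimes> ide X) = ide X"
      using d d' by (auto simp: dual_data_def)
    note s = o t tobj_assoc
    have 1: "(ide D' \<otimes> c) \<odot> (e \<otimes> ide D') = e \<otimes> (ide D' \<otimes> c)"
    proof -
      have "(ide (Unit C) \<otimes> (ide D' \<otimes> c)) \<odot> (e \<otimes> (ide D' \<otimes> ide (Unit C))) = e \<otimes> (ide D' \<otimes> c)"
        using s by (simp add: interchange)
      then show ?thesis
        using s by (simp add: tns_unit)
    qed
    have 2: "e \<otimes> (ide D' \<otimes> c) = (e \<otimes> ide (TObj C D' (TObj C X D))) \<odot> (ide (TObj C D X) \<otimes> (ide D' \<otimes> c))"
      using s by (simp add: interchange)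
    have 3: "ide (TObj C D X) \<otimes> (ide D' \<otimes> c) = ide (TObj C D (TObj C X D')) \<otimes> c"
      using s by (simp add: tns_ide flip: tns_assoc)
    have 4: "(ide (TObj C D (TObj C X D')) \<otimes> c) \<odot> (ide D \<otimes> c') = (ide D \<otimes> c' \<otimes> ide (TObj C X D)) \<odot> (ide D \<otimes> c)"
    proof -
      have "(ide (TObj C D (TObj C X D')) \<otimes> c) \<odot> (ide D \<otimes> c' \<otimes> ide (Unit C)) = ide D \<otimes> c' \<otimes> c"
        using s by (simp add: interchange)
      moreover have "(ide D \<otimes> c' \<otimes> ide (TObj C X D)) \<odot> (ide D \<otimes> c) = ide D \<otimes> c' \<otimes> c"
        using s by (simp add: interchange)
      ultimately show ?thesis
        using s by (simp add: tns_unit)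
    qed
    have 5: "(e' \<otimes> ide D) \<odot> (e \<otimes> ide (TObj C D' (TObj C X D))) = (e \<otimes> ide D) \<odot> (ide (TObj C D X) \<otimes> (e' \<otimes> ide D))"
    proof -
      have "(ide (Unit C) \<otimes> (e' \<otimes> ide D)) \<odot> (e \<otimes> ide (TObj C D' (TObj C X D))) = e \<otimes> (e' \<otimes> ide D)"
        using s by (simp add: interchange)
      moreover have "(e \<otimes> ide D) \<odot> (ide (TObj C D X) \<otimes> (e' \<otimes> ide D)) = e \<otimes> (e' \<otimes> ide D)"
        using s by (simp add: interchange)
      ultimately show ?thesis
        using s by (simp add: tns_unit)
    qed
    \<comment> \<open>The zigzag on \<open>X\<close> for the dual \<open>D'\<close>, with
      \<open>D\<close> tensored on both sides.\<close>
    have 6: "(ide (TObj C D X) \<otimes> (e' \<otimes> ide D)) \<odot> (ide D \<otimes> c' \<otimes> ide (TObj C X D)) = ide (TObj C D (TObj C X D))"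
    proof -
      have "ide (TObj C D X) \<otimes> (e' \<otimes> ide D) = ide D \<otimes> ((ide X \<otimes> e') \<otimes> ide D)"
        using s by (simp add: tns_assoc flip: tns_ide)
      moreover have "ide D \<otimes> c' \<otimes> ide (TObj C X D) = ide D \<otimes> ((c' \<otimes> ide X) \<otimes> ide D)"
        using s by (simp add: tns_assoc flip: tns_ide)
      moreover have "(ide D \<otimes> ((ide X \<otimes> e') \<otimes> ide D)) \<odot> (ide D \<otimes> ((c' \<otimes> ide X) \<otimes> ide D)) =
          ide D \<otimes> (((ide X \<otimes> e') \<odot> (c' \<otimes> ide X)) \<otimes> ide D)"
        using s by (simp add: interchange)
      ultimately show ?thesis
        using s z(2) by (simp add: tns_ide)
    qed
    have "((e' \<otimes> ide D) \<odot> (ide D' \<otimes> c)) \<odot> ((e \<otimes> ide D') \<odot> (ide D \<otimes> c')) =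
        (e' \<otimes> ide D) \<odot> (((ide D' \<otimes> c) \<odot> (e \<otimes> ide D')) \<odot> (ide D \<otimes> c'))"
      using s by (simp add: cmp_assoc)
    also have "\<dots> = ((e' \<otimes> ide D) \<odot> (e \<otimes> ide (TObj C D' (TObj C X D)))) \<odot> ((ide (TObj C D (TObj C X D')) \<otimes> c) \<odot> (ide D \<otimes> c'))"
      unfolding 1 2 3 using s by (simp add: cmp_assoc)
    also have "\<dots> = (e \<otimes> ide D) \<odot> (((ide (TObj C D X) \<otimes> (e' \<otimes> ide D)) \<odot> (ide D \<otimes> c' \<otimes> ide (TObj C X D))) \<odot> (ide D \<otimes> c))"
      unfolding 4 5 using s by (simp add: cmp_assoc)
    also have "\<dots> = ide D"
      unfolding 6 using s z(1) by simp
    finally show ?thesis .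
  qed
  obtain e c e' c' where d: "dual_data X D e c" and d': "dual_data X D' e' c'"
    using assms unfolding is_left_dual_iff by blast
  let ?F = "(e \<otimes> ide D') \<odot> (ide D \<otimes> c')" and ?G = "(e' \<otimes> ide D) \<odot> (ide D' \<otimes> c)"
  have t: "D \<in> Obj C" "D' \<in> Obj C" "arr ?F" "arr ?G" "dm ?F = D" "cd ?F = D'" "dm ?G = D'" "cd ?G = D"
    using d d' by (auto simp: dual_data_def tobj_assoc)
  have "mr (?G \<odot> ?F) = mr (ide D)" "mr (?F \<odot> ?G) = mr (ide D')"
    using main[OF d d'] main[OF d' d] by simp_all
  then have "inverse_arrows C D D' (mr ?F) (mr ?G)"
    using t arrD(3)[OF t(3)] arrD(3)[OF t(4)] by (simp only: inverse_arrows_def mr_simps(1,3) t simp_thms)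
  then show ?thesis
    by (rule isomorphicI)
qed

section \<open>Duals of direct sums\<close>

lemma tmor_zero:
  assumes "X \<in> Obj C" "Y \<in> Obj C" "X' \<in> Obj C" "Y' \<in> Obj C"
  shows "f' \<in> Hom C X' Y' \<Longrightarrow> TMor C X Y X' Y' 0 f' = 0" "f \<in> Hom C X Y \<Longrightarrow> TMor C X Y X' Y' f 0 = 0"
  using tmor_add_left[OF assms, of 0 0 f'] tmor_add_right[OF assms, of f 0 0] assms by simp_all

lemma tmor_sum_left:
  assumes "X \<in> Obj C" "Y \<in> Obj C" "X' \<in> Obj C" "Y' \<in> Obj C" "f' \<in> Hom C X' Y'"
    and "\<And>i. i \<in> A \<Longrightarrow> f i \<in> Hom C X Y"
  shows "TMor C X Y X' Y' (\<Sum>i\<in>A. f i) f' = (\<Sum>i\<in>A. TMor C X Y X' Y' (f i) f')"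
  using assms(6)
proof (induction A rule: infinite_finite_induct)
  case (insert i A)
  then have "(\<Sum>i\<in>A. f i) \<in> Hom C X Y"
    using assms by (intro sum_in_hom) auto
  then show ?case
    using insert assms by (simp add: tmor_add_left)
qed (use assms in \<open>simp_all add: tmor_zero\<close>)

lemma tmor_sum_right:
  assumes "X \<in> Obj C" "Y \<in> Obj C" "X' \<in> Obj C" "Y' \<in> Obj C" "f' \<in> Hom C X' Y'"
    and "\<And>i. i \<in> A \<Longrightarrow> f i \<in> Hom C X Y"
  shows "TMor C X' Y' X Y f' (\<Sum>i\<in>A. f i) = (\<Sum>i\<in>A. TMor C X' Y' X Y f' (f i))"
  using assms(6)
proof (induction A rule: infinite_finite_induct)
  case (insert i A)
  then have "(\<Sum>i\<in>A. f i) \<in> Hom C X Y"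
    using assms by (intro sum_in_hom) auto
  then show ?case
    using insert assms by (simp add: tmor_add_right)
qed (use assms in \<open>simp_all add: tmor_zero\<close>)

lemma mr_zero:
  "arr f \<Longrightarrow> arr g \<Longrightarrow> dm g = cd f \<Longrightarrow> mr g = 0 \<or> mr f = 0 \<Longrightarrow> mr (g \<odot> f) = 0"
  "arr f \<Longrightarrow> arr g \<Longrightarrow> mr g = 0 \<or> mr f = 0 \<Longrightarrow> mr (f \<otimes> g) = 0"
  using arrD(3)[of g] by (auto simp: mr_simps tmor_zero)

text \<open>Evaluation and coevaluation are the sums over \<open>i\<close> of those of the summands,
  composed with projections and inclusions. In the zigzags each mixed term contains a projection
  after an inclusion of a different summand and vanishes; the diagonal terms add up to the
  identity.\<close>

lemma dual_direct_sum:
  assumes "direct_sum C Xs X" "direct_sum C Ds D" and len: "length Ds = length Xs"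
    and duals: "\<And>i. i < length Xs \<Longrightarrow> is_left_dual C (Xs ! i) (Ds ! i)"
  shows "is_left_dual C X D"
proof -
  let ?n = "length Xs"
  obtain \<iota> \<pi> where "sum_data C Xs X \<iota> \<pi>"
    using assms(1) unfolding direct_sum_iff by blast
  note DX = sum_dataD[OF this]
  obtain \<kappa> \<theta> where "sum_data C Ds D \<kappa> \<theta>"
    using assms(2) unfolding direct_sum_iff by blast
  note DD = sum_dataD[OF this, unfolded len]
  have "\<forall>i\<in>{..<?n}. \<exists>ec. dual_data (Xs ! i) (Ds ! i) (fst ec) (snd ec)"
    using duals unfolding is_left_dual_iff by auto
  then obtain ec where "\<forall>i\<in>{..<?n}. dual_data (Xs ! i) (Ds ! i) (fst (ec i)) (snd (ec i))"
    by (rule bchoice[THEN exE])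
  moreover define e where "e i = fst (ec i)" for i
  moreover define c where "c i = snd (ec i)" for i
  ultimately have dd: "dual_data (Xs ! i) (Ds ! i) (e i) (c i)" if "i < ?n" for i
    using that by simp
  have d: "arr (e i)" "arr (c i)" "dm (e i) = TObj C (Ds ! i) (Xs ! i)" "cd (e i) = Unit C" "dm (c i) = Unit C"
    "cd (c i) = TObj C (Xs ! i) (Ds ! i)"
    "(ide (Xs ! i) \<otimes> e i) \<odot> (c i \<otimes> ide (Xs ! i)) = ide (Xs ! i)"
    "(e i \<otimes> ide (Ds ! i)) \<odot> (ide (Ds ! i) \<otimes> c i) = ide (Ds ! i)" if "i < ?n" for i
    using dd[OF that] by (auto simp: dual_data_def)
  define I where "I i = (Xs ! i, \<iota> i, X)" for i
  define P where "P i = (X, \<pi> i, Xs ! i)" for i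
  define K where "K i = (Ds ! i, \<kappa> i, D)" for i
  define T where "T i = (D, \<theta> i, Ds ! i)" for i
  have ob: "X \<in> Obj C" "D \<in> Obj C" "\<And>i. i < ?n \<Longrightarrow> Xs ! i \<in> Obj C" "\<And>i. i < ?n \<Longrightarrow> Ds ! i \<in> Obj C"
    using DX DD by auto
  have ar: "arr (I i)" "arr (P i)" "arr (K i)" "arr (T i)" if "i < ?n" for i
    using that DX DD by (auto simp: arr_def I_def P_def K_def T_def)
  have ty: "dm (I i) = Xs ! i" "cd (I i) = X" "dm (P i) = X" "cd (P i) = Xs ! i"
    "dm (K i) = Ds ! i" "cd (K i) = D" "dm (T i) = D" "cd (T i) = Ds ! i" for i
    by (simp_all add: I_def P_def K_def T_def)
  have PI: "P i \<odot> I i = ide (Xs ! i)" "T i \<odot> K i = ide (Ds ! i)" if "i < ?n" for i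
    using that DX(5) DD(5) by (auto intro!: arr_eqI simp: ty mr_simps) (auto simp: I_def P_def K_def T_def)
  have PI0: "mr (P j \<odot> I i) = 0" "mr (T j \<odot> K i) = 0" if "i < ?n" "j < ?n" "i \<noteq> j" for i j
    using that DX(5) DD(5) by (auto simp: ty mr_simps) (auto simp: I_def P_def K_def T_def)
  define E where "E i = e i \<odot> (T i \<otimes> P i)" for i
  define G where "G i = (I i \<otimes> K i) \<odot> c i" for i
  have EG: "arr (E i)" "dm (E i) = TObj C D X" "cd (E i) = Unit C" "arr (G i)" "dm (G i) = Unit C" "cd (G i) = TObj C X D"
    if "i < ?n" for i
    using that d ar ty by (simp_all add: E_def G_def)
  have EGh: "mr (E i) \<in> Hom C (TObj C D X) (Unit C)" "mr (G i) \<in> Hom C (Unit C) (TObj C X D)" if "i < ?n" for i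
    using arrD(3)[OF EG(1)[OF that]] arrD(3)[OF EG(4)[OF that]] EG[OF that] by simp_all
  have z1: "mr ((ide X \<otimes> E j) \<odot> (G i \<otimes> ide X)) = (if i = j then mr (I i \<odot> P i) else 0)"
    if i: "i < ?n" and j: "j < ?n" for i j
  proof -
    note s = d(1-6)[OF i] d(1-6)[OF j] ar[OF i] ar[OF j] ty ob(1,2) ob(3)[OF i] ob(4)[OF i] ob(3)[OF j] ob(4)[OF j] tobj_assoc
    have a: "ide X \<otimes> E j = (ide X \<otimes> e j) \<odot> (ide X \<otimes> (T j \<otimes> P j))"
      using s by (simp add: E_def interchange)
    have b: "G i \<otimes> ide X = (I i \<otimes> (K i \<otimes> ide X)) \<odot> (c i \<otimes> ide X)"
      using s by (simp add: G_def interchange flip: tns_assoc)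
    have m: "(ide X \<otimes> (T j \<otimes> P j)) \<odot> (I i \<otimes> (K i \<otimes> ide X)) = I i \<otimes> ((T j \<odot> K i) \<otimes> P j)"
      using s by (simp add: interchange)
    have total: "(ide X \<otimes> E j) \<odot> (G i \<otimes> ide X) = (ide X \<otimes> e j) \<odot> (I i \<otimes> ((T j \<odot> K i) \<otimes> P j)) \<odot> (c i \<otimes> ide X)"
      unfolding a b m[symmetric] using s by (simp add: cmp_assoc)
    show ?thesis
    proof (cases "i = j")
      case False
      then have "mr (I i \<otimes> ((T j \<odot> K i) \<otimes> P j)) = 0"
        using s PI0(2)[OF i j False] by (simp add: mr_zero)
      then have "mr ((ide X \<otimes> E j) \<odot> (G i \<otimes> ide X)) = 0"
        unfolding total using s False by (intro mr_zero) (simp_all add: mr_zero)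
      then show ?thesis
        using False by simp
    next
      case True
      have "(ide X \<otimes> e i) \<odot> (I i \<otimes> (ide (Ds ! i) \<otimes> P i)) = I i \<odot> ((ide (Xs ! i) \<otimes> e i) \<odot> (ide (TObj C (Xs ! i) (Ds ! i)) \<otimes> P i))"
      proof -
        have "ide (TObj C (Xs ! i) (Ds ! i)) \<otimes> P i = ide (Xs ! i) \<otimes> (ide (Ds ! i) \<otimes> P i)"
          using s by (simp add: tns_assoc flip: tns_ide)
        moreover have "(I i \<otimes> ide (Unit C)) \<odot> ((ide (Xs ! i) \<otimes> e i) \<odot> (ide (Xs ! i) \<otimes> (ide (Ds ! i) \<otimes> P i))) =
            (ide X \<otimes> e i) \<odot> (I i \<otimes> (ide (Ds ! i) \<otimes> P i))"
          using s by (simp add: interchange)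
        ultimately show ?thesis
          using s by (simp add: tns_unit)
      qed
      moreover have "(ide (TObj C (Xs ! i) (Ds ! i)) \<otimes> P i) \<odot> (c i \<otimes> ide X) = (c i \<otimes> ide (Xs ! i)) \<odot> P i"
      proof -
        have "(c i \<otimes> ide (Xs ! i)) \<odot> (ide (Unit C) \<otimes> P i) = (ide (TObj C (Xs ! i) (Ds ! i)) \<otimes> P i) \<odot> (c i \<otimes> ide X)"
          using s by (simp add: interchange)
        then show ?thesis
          using s by (simp add: tns_unit)
      qed
      ultimately have "(ide X \<otimes> E i) \<odot> (G i \<otimes> ide X) = I i \<odot> (((ide (Xs ! i) \<otimes> e i) \<odot> (c i \<otimes> ide (Xs ! i))) \<odot> P i)"
        using total[unfolded True[symmetric]] s by (simp add: PI[OF i] cmp_assoc)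
      then show ?thesis
        using True d(7)[OF i] s by simp
    qed
  qed
  have z2: "mr ((E j \<otimes> ide D) \<odot> (ide D \<otimes> G i)) = (if i = j then mr (K i \<odot> T i) else 0)"
    if i: "i < ?n" and j: "j < ?n" for i j
  proof -
    note s = d(1-6)[OF i] d(1-6)[OF j] ar[OF i] ar[OF j] ty ob(1,2) ob(3)[OF i] ob(4)[OF i] ob(3)[OF j] ob(4)[OF j] tobj_assoc
    have a: "E j \<otimes> ide D = (e j \<otimes> ide D) \<odot> (T j \<otimes> (P j \<otimes> ide D))"
      using s by (simp add: E_def interchange flip: tns_assoc)
    have b: "ide D \<otimes> G i = (ide D \<otimes> (I i \<otimes> K i)) \<odot> (ide D \<otimes> c i)"
      using s by (simp add: G_def interchange)
    have m: "(T j \<otimes> (P j \<otimes> ide D)) \<odot> (ide D \<otimes> (I i \<otimes> K i)) = T j \<otimes> ((P j \<odot> I i) \<otimes> K i)"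
      using s by (simp add: interchange)
    have total: "(E j \<otimes> ide D) \<odot> (ide D \<otimes> G i) = (e j \<otimes> ide D) \<odot> (T j \<otimes> ((P j \<odot> I i) \<otimes> K i)) \<odot> (ide D \<otimes> c i)"
      unfolding a b m[symmetric] using s by (simp add: cmp_assoc)
    show ?thesis
    proof (cases "i = j")
      case False
      then have "mr (T j \<otimes> ((P j \<odot> I i) \<otimes> K i)) = 0"
        using s PI0(1)[OF i j False] by (simp add: mr_zero)
      then have "mr ((E j \<otimes> ide D) \<odot> (ide D \<otimes> G i)) = 0"
        unfolding total using s False by (intro mr_zero) (simp_all add: mr_zero)
      then show ?thesis
        using False by simp
    next
      case True
      have "(e i \<otimes> ide D) \<odot> (T i \<otimes> (ide (Xs ! i) \<otimes> K i)) = K i \<odot> ((e i \<otimes> ide (Ds ! i)) \<odot> (T i \<otimes> ide (TObj C (Xs ! i) (Ds ! i))))"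
      proof -
        have "T i \<otimes> ide (TObj C (Xs ! i) (Ds ! i)) = T i \<otimes> ide (Xs ! i) \<otimes> ide (Ds ! i)"
          using s by (simp add: tns_assoc flip: tns_ide)
        moreover have "(ide (Unit C) \<otimes> K i) \<odot> ((e i \<otimes> ide (Ds ! i)) \<odot> (T i \<otimes> ide (Xs ! i) \<otimes> ide (Ds ! i))) =
            (e i \<otimes> ide D) \<odot> (T i \<otimes> ide (Xs ! i) \<otimes> K i)"
          using s by (simp add: interchange)
        ultimately show ?thesis
          using s by (simp add: tns_unit tns_assoc)
      qed
      moreover have "(T i \<otimes> ide (TObj C (Xs ! i) (Ds ! i))) \<odot> (ide D \<otimes> c i) = (ide (Ds ! i) \<otimes> c i) \<odot> T i"
      proof -
        have "(ide (Ds ! i) \<otimes> c i) \<odot> (T i \<otimes> ide (Unit C)) = (T i \<otimes> ide (TObj C (Xs ! i) (Ds ! i))) \<odot> (ide D \<otimes> c i)"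
          using s by (simp add: interchange)
        then show ?thesis
          using s by (simp add: tns_unit)
      qed
      ultimately have "(E i \<otimes> ide D) \<odot> (ide D \<otimes> G i) = K i \<odot> (((e i \<otimes> ide (Ds ! i)) \<odot> (ide (Ds ! i) \<otimes> c i)) \<odot> T i)"
        using total[unfolded True[symmetric]] s by (simp add: PI[OF i] cmp_assoc)
      then show ?thesis
        using True d(8)[OF i] s by simp
    qed
  qed
  define ev where "ev = (TObj C D X, \<Sum>i<?n. mr (E i), Unit C)"
  define co where "co = (Unit C, \<Sum>i<?n. mr (G i), TObj C X D)"
  have ev: "arr ev" "dm ev = TObj C D X" "cd ev = Unit C" and co: "arr co" "dm co = Unit C" "cd co = TObj C X D"
    using ob EGh by (auto simp: ev_def co_def arr_def intro!: sum_in_hom)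
  have "(ide X \<otimes> ev) \<odot> (co \<otimes> ide X) = ide X"
  proof (rule arr_eqI)
    have h: "TMor C X X (TObj C D X) (Unit C) (Ident C X) (mr (E j)) \<in> Hom C (TObj C X (TObj C D X)) X"
      "TMor C (Unit C) (TObj C X D) X X (mr (G j)) (Ident C X) \<in> Hom C X (TObj C X (TObj C D X))" if "j < ?n" for j
      using tmor_in_hom[OF ob(1) ob(1) _ _ _ EGh(1)[OF that], of "Ident C X"]
        tmor_in_hom[OF _ _ ob(1) ob(1) EGh(2)[OF that], of "Ident C X"] ob by (simp_all add: tobj_assoc)
    have t: "TMor C X X (TObj C D X) (Unit C) (Ident C X) (\<Sum>j<?n. mr (E j)) =
        (\<Sum>j<?n. TMor C X X (TObj C D X) (Unit C) (Ident C X) (mr (E j)))"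
      "TMor C (Unit C) (TObj C X D) X X (\<Sum>i<?n. mr (G i)) (Ident C X) =
        (\<Sum>i<?n. TMor C (Unit C) (TObj C X D) X X (mr (G i)) (Ident C X))"
      by ((rule tmor_sum_right tmor_sum_left; use ob EGh in simp))+
    have "mr ((ide X \<otimes> ev) \<odot> (co \<otimes> ide X)) = Comp C X (TObj C X (TObj C D X)) X
        (\<Sum>j<?n. TMor C X X (TObj C D X) (Unit C) (Ident C X) (mr (E j)))
        (\<Sum>i<?n. TMor C (Unit C) (TObj C X D) X X (mr (G i)) (Ident C X))"
      using ob t by (simp add: mr_simps ev_def co_def tobj_assoc)
    also have "\<dots> = (\<Sum>j<?n. Comp C X (TObj C X (TObj C D X)) X (TMor C X X (TObj C D X) (Unit C) (Ident C X) (mr (E j)))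
        (\<Sum>i<?n. TMor C (Unit C) (TObj C X D) X X (mr (G i)) (Ident C X)))"
      using ob h by (intro comp_sum_left) (auto intro!: sum_in_hom)
    also have "\<dots> = (\<Sum>j<?n. \<Sum>i<?n. mr ((ide X \<otimes> E j) \<odot> (G i \<otimes> ide X)))"
    proof (rule sum.cong)
      fix j assume "j \<in> {..<?n}"
      then have j: "j < ?n" by simp
      have "Comp C X (TObj C X (TObj C D X)) X (TMor C X X (TObj C D X) (Unit C) (Ident C X) (mr (E j)))
        (\<Sum>i<?n. TMor C (Unit C) (TObj C X D) X X (mr (G i)) (Ident C X)) =
        (\<Sum>i<?n. Comp C X (TObj C X (TObj C D X)) X (TMor C X X (TObj C D X) (Unit C) (Ident C X) (mr (E j)))
          (TMor C (Unit C) (TObj C X D) X X (mr (G i)) (Ident C X)))"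
        using ob h j by (intro comp_sum_right) auto
      also have "\<dots> = (\<Sum>i<?n. mr ((ide X \<otimes> E j) \<odot> (G i \<otimes> ide X)))"
        using ob EG j by (intro sum.cong) (simp_all add: mr_simps tobj_assoc)
      finally show "Comp C X (TObj C X (TObj C D X)) X (TMor C X X (TObj C D X) (Unit C) (Ident C X) (mr (E j)))
        (\<Sum>i<?n. TMor C (Unit C) (TObj C X D) X X (mr (G i)) (Ident C X)) = (\<Sum>i<?n. mr ((ide X \<otimes> E j) \<odot> (G i \<otimes> ide X)))" .
    qed simp
    also have "\<dots> = (\<Sum>j<?n. \<Sum>i<?n. if i = j then mr (I i \<odot> P i) else 0)"
      using z1 by (intro sum.cong) auto
    also have "\<dots> = Ident C X"
      using DX(6) by (simp add: mr_simps) (simp add: I_def P_def)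
    finally show "mr ((ide X \<otimes> ev) \<odot> (co \<otimes> ide X)) = mr (ide X)"
      by (simp add: mr_simps)
  qed (use ev co ob in simp_all)
  moreover have "(ev \<otimes> ide D) \<odot> (ide D \<otimes> co) = ide D"
  proof (rule arr_eqI)
    have h: "TMor C (TObj C D X) (Unit C) D D (mr (E j)) (Ident C D) \<in> Hom C (TObj C D (TObj C X D)) D"
      "TMor C D D (Unit C) (TObj C X D) (Ident C D) (mr (G j)) \<in> Hom C D (TObj C D (TObj C X D))" if "j < ?n" for j
      using tmor_in_hom[OF _ _ ob(2) ob(2) EGh(1)[OF that], of "Ident C D"]
        tmor_in_hom[OF ob(2) ob(2) _ _ _ EGh(2)[OF that], of "Ident C D"] ob by (simp_all add: tobj_assoc)
    have t: "TMor C (TObj C D X) (Unit C) D D (\<Sum>j<?n. mr (E j)) (Ident C D) =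
        (\<Sum>j<?n. TMor C (TObj C D X) (Unit C) D D (mr (E j)) (Ident C D))"
      "TMor C D D (Unit C) (TObj C X D) (Ident C D) (\<Sum>i<?n. mr (G i)) =
        (\<Sum>i<?n. TMor C D D (Unit C) (TObj C X D) (Ident C D) (mr (G i)))"
      by ((rule tmor_sum_right tmor_sum_left; use ob EGh in simp))+
    have "mr ((ev \<otimes> ide D) \<odot> (ide D \<otimes> co)) = Comp C D (TObj C D (TObj C X D)) D
        (\<Sum>j<?n. TMor C (TObj C D X) (Unit C) D D (mr (E j)) (Ident C D))
        (\<Sum>i<?n. TMor C D D (Unit C) (TObj C X D) (Ident C D) (mr (G i)))"
      using ob t by (simp add: mr_simps ev_def co_def tobj_assoc)
    also have "\<dots> = (\<Sum>j<?n. Comp C D (TObj C D (TObj C X D)) D (TMor C (TObj C D X) (Unit C) D D (mr (E j)) (Ident C D))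
        (\<Sum>i<?n. TMor C D D (Unit C) (TObj C X D) (Ident C D) (mr (G i))))"
      using ob h by (intro comp_sum_left) (auto intro!: sum_in_hom)
    also have "\<dots> = (\<Sum>j<?n. \<Sum>i<?n. mr ((E j \<otimes> ide D) \<odot> (ide D \<otimes> G i)))"
    proof (rule sum.cong)
      fix j assume "j \<in> {..<?n}"
      then have j: "j < ?n" by simp
      have "Comp C D (TObj C D (TObj C X D)) D (TMor C (TObj C D X) (Unit C) D D (mr (E j)) (Ident C D))
        (\<Sum>i<?n. TMor C D D (Unit C) (TObj C X D) (Ident C D) (mr (G i))) =
        (\<Sum>i<?n. Comp C D (TObj C D (TObj C X D)) D (TMor C (TObj C D X) (Unit C) D D (mr (E j)) (Ident C D))
          (TMor C D D (Unit C) (TObj C X D) (Ident C D) (mr (G i))))"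
        using ob h j by (intro comp_sum_right) auto
      also have "\<dots> = (\<Sum>i<?n. mr ((E j \<otimes> ide D) \<odot> (ide D \<otimes> G i)))"
        using ob EG j by (intro sum.cong) (simp_all add: mr_simps tobj_assoc)
      finally show "Comp C D (TObj C D (TObj C X D)) D (TMor C (TObj C D X) (Unit C) D D (mr (E j)) (Ident C D))
        (\<Sum>i<?n. TMor C D D (Unit C) (TObj C X D) (Ident C D) (mr (G i))) = (\<Sum>i<?n. mr ((E j \<otimes> ide D) \<odot> (ide D \<otimes> G i)))" .
    qed simp
    also have "\<dots> = (\<Sum>j<?n. \<Sum>i<?n. if i = j then mr (K i \<odot> T i) else 0)"
      using z2 by (intro sum.cong) auto
    also have "\<dots> = Ident C D"
      using DD(6) by (simp add: mr_simps) (simp add: K_def T_def)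
    finally show "mr ((ev \<otimes> ide D) \<odot> (ide D \<otimes> co)) = mr (ide D)"
      by (simp add: mr_simps)
  qed (use ev co ob in simp_all)
  ultimately show ?thesis
    unfolding is_left_dual_iff dual_data_def using ev co ob by blast
qed

lemma direct_sum_singleton: "isomorphic C X Y \<Longrightarrow> X \<in> Obj C \<Longrightarrow> Y \<in> Obj C \<Longrightarrow> direct_sum C [X] Y"
proof -
  assume X: "isomorphic C X Y" "X \<in> Obj C" "Y \<in> Obj C"
  have "direct_sum C [X] X"
    using X(2) by (intro direct_sumI[of _ _ _ "\<lambda>_. Ident C X" "\<lambda>_. Ident C X"]) simp_all
  then show ?thesis
    using direct_sum_iso X by blast
qed

text \<open>An object isomorphic to \<open>X\<close> is a direct sum with \<open>X\<close> as its
  one summand, so this is a case of \<open>dual_direct_sum\<close>.\<close>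

lemma left_dual_iso:
  assumes "is_left_dual C X D" "isomorphic C X X'" "isomorphic C D D'" "X' \<in> Obj C" "D' \<in> Obj C"
  shows "is_left_dual C X' D'"
proof -
  have "X \<in> Obj C" "D \<in> Obj C"
    using assms(1) by (auto simp: is_left_dual_def)
  then show ?thesis
    using assms by (intro dual_direct_sum[of "[X]" X' "[D]" D'] direct_sum_singleton) auto
qed

end

section \<open>The Evans--Gannon category\<close>

lemma intertwiners_comp: "x \<in> intertwiners \<sigma> \<tau> \<Longrightarrow> y \<in> intertwiners \<tau> \<upsilon> \<Longrightarrow> y * x \<in> intertwiners \<sigma> \<upsilon>"
  by (simp add: intertwiners_def mult.assoc) (simp flip: mult.assoc)

lemma intertwinersD: "x \<in> intertwiners \<sigma> \<tau> \<Longrightarrow> \<tau> y * x = x * \<sigma> y"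
  by (simp add: intertwiners_def)

lemma intertwiners_zero: "0 \<in> intertwiners \<sigma> \<tau>"
  and intertwiners_add: "x \<in> intertwiners \<sigma> \<tau> \<Longrightarrow> y \<in> intertwiners \<sigma> \<tau> \<Longrightarrow> x + y \<in> intertwiners \<sigma> \<tau>"
  and intertwiners_scale: "x \<in> intertwiners \<sigma> \<tau> \<Longrightarrow> c *\<^sub>L x \<in> intertwiners \<sigma> \<tau>"
  and intertwiners_one: "1 \<in> intertwiners \<sigma> \<sigma>"
  by (simp_all add: intertwiners_def distrib_left distrib_right lscale_mult_left lscale_mult_right)

lemma intertwiners_tensor:
  assumes "unital_endo \<beta>" "r \<in> intertwiners \<beta> \<gamma>" "t \<in> intertwiners \<sigma> \<tau>"
  shows "r * \<beta> t \<in> intertwiners (\<beta> \<circ> \<sigma>) (\<gamma> \<circ> \<tau>)"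
proof -
  have m: "\<beta> (x * y) = \<beta> x * \<beta> y" for x y
    using assms(1) by (simp add: unital_endo_def)
  have "r * \<beta> t * \<beta> (\<sigma> y) = \<gamma> (\<tau> y) * (r * \<beta> t)" for y
  proof -
    have "r * \<beta> t * \<beta> (\<sigma> y) = r * \<beta> (t * \<sigma> y)"
      by (simp add: m mult.assoc)
    also have "\<dots> = (r * \<beta> (\<tau> y)) * \<beta> t"
      using assms(3) by (simp add: intertwiners_def m mult.assoc)
    also have "\<dots> = \<gamma> (\<tau> y) * (r * \<beta> t)"
      using assms(2) by (simp add: intertwiners_def mult.assoc)
    finally show ?thesis .
  qed
  then show ?thesis
    by (simp add: intertwiners_def)
qed

text \<open>Matches the lexicographic numbering of the summands of \<open>ds_tensor\<close>, where a
  product index is decoded by division with remainder.\<close>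

lemma sum_div_mod:
  "(\<Sum>J<m * n. F (J div n) (J mod n)) = (\<Sum>j<m. \<Sum>k<n. F j k)" for m n :: nat and F :: "nat \<Rightarrow> nat \<Rightarrow> 'a::comm_monoid_add"
proof (induction m)
  case (Suc m)
  have "(\<Sum>J<m * n + n. F (J div n) (J mod n)) = (\<Sum>J<m * n. F (J div n) (J mod n)) + (\<Sum>k<n. F m k)"
    unfolding sum_lessThan_add by (intro arg_cong2[where f = "(+)"] sum.cong) auto
  then show ?case
    using Suc by (simp add: add.commute)
qed simp

lemma length_ds_tensor [simp]: "length (ds_tensor Xs Ys) = length Xs * length Ys"
  by (induction Xs) (simp_all add: ds_tensor_def)

lemma nth_ds_tensor:
  "i < length Xs * length Ys \<Longrightarrow>
    ds_tensor Xs Ys ! i = karoubi_tensor (Xs ! (i div length Ys)) (Ys ! (i mod length Ys))"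
proof (induction Xs arbitrary: i)
  case (Cons X Xs)
  show ?case
  proof (cases "i < length Ys")
    case True
    then show ?thesis
      by (simp add: ds_tensor_def nth_append)
  next
    case False
    then have "0 < length Ys" "i - length Ys < length Xs * length Ys" "\<not> i < length Ys"
      using Cons.prems by (auto simp: not_less)
    then show ?thesis
      using Cons.IH[of "i - length Ys"]
      by (simp add: ds_tensor_def nth_append le_div_geq le_mod_geq not_less)
  qed
qed simp

locale endo_set =
  fixes \<E> :: "(('g::finite) leavitt \<Rightarrow> 'g leavitt) set"
  assumes unital: "\<sigma> \<in> \<E> \<Longrightarrow> unital_endo \<sigma>" and id_in: "id \<in> \<E>"
begin

abbreviation C where "C \<equiv> evans_gannon \<E>"

lemma unital_compositions: "\<sigma> \<in> compositions \<E> \<Longrightarrow> unital_endo \<sigma>"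
  by (induction rule: compositions.induct) (blast intro: unital unital_endo_comp)+

section \<open>The idempotent completion\<close>

lemma koD:
  assumes "X \<in> karoubi_obj \<E>"
  shows "snd X \<in> compositions \<E>" "unital_endo (snd X)" "fst X \<in> intertwiners (snd X) (snd X)" "fst X * fst X = fst X"
  using assms unital_compositions by (auto simp: karoubi_obj_def)

lemma khom_iff:
  assumes "X \<in> karoubi_obj \<E>" "Y \<in> karoubi_obj \<E>"
  shows "x \<in> karoubi_hom X Y \<longleftrightarrow> x \<in> intertwiners (snd X) (snd Y) \<and> fst Y * x = x \<and> x * fst X = x"
proof
  assume "x \<in> karoubi_hom X Y"
  then obtain y where "x = fst Y * y * fst X" "y \<in> intertwiners (snd X) (snd Y)"
    by (auto simp: karoubi_hom_def)
  then show "x \<in> intertwiners (snd X) (snd Y) \<and> fst Y * x = x \<and> x * fst X = x"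
    using koD(3,4)[OF assms(1)] koD(3,4)[OF assms(2)]
    by (auto intro: intertwiners_comp simp: mult.assoc) (simp flip: mult.assoc)
next
  assume "x \<in> intertwiners (snd X) (snd Y) \<and> fst Y * x = x \<and> x * fst X = x"
  then show "x \<in> karoubi_hom X Y"
    by (auto simp: karoubi_hom_def intro!: exI[of _ x])
qed

lemma khom_zero: "X \<in> karoubi_obj \<E> \<Longrightarrow> Y \<in> karoubi_obj \<E> \<Longrightarrow> 0 \<in> karoubi_hom X Y"
  and khom_add: "X \<in> karoubi_obj \<E> \<Longrightarrow> Y \<in> karoubi_obj \<E> \<Longrightarrow> x \<in> karoubi_hom X Y \<Longrightarrow> y \<in> karoubi_hom X Y \<Longrightarrow> x + y \<in> karoubi_hom X Y"
  and khom_scale: "X \<in> karoubi_obj \<E> \<Longrightarrow> Y \<in> karoubi_obj \<E> \<Longrightarrow> x \<in> karoubi_hom X Y \<Longrightarrow> c *\<^sub>L x \<in> karoubi_hom X Y"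
  by (simp_all add: khom_iff intertwiners_zero intertwiners_add intertwiners_scale distrib_left distrib_right
      lscale_mult_left lscale_mult_right)

lemma khom_sum: "X \<in> karoubi_obj \<E> \<Longrightarrow> Y \<in> karoubi_obj \<E> \<Longrightarrow> (\<And>i. i \<in> A \<Longrightarrow> f i \<in> karoubi_hom X Y) \<Longrightarrow> sum f A \<in> karoubi_hom X Y"
  by (induction A rule: infinite_finite_induct) (simp_all add: khom_zero khom_add)

lemma khom_comp:
  "X \<in> karoubi_obj \<E> \<Longrightarrow> Y \<in> karoubi_obj \<E> \<Longrightarrow> Z \<in> karoubi_obj \<E> \<Longrightarrow> x \<in> karoubi_hom X Y \<Longrightarrow> y \<in> karoubi_hom Y Z \<Longrightarrow> y * x \<in> karoubi_hom X Z"
  unfolding khom_iff by (intro conjI; metis intertwiners_comp mult.assoc)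

lemma khom_ident: "X \<in> karoubi_obj \<E> \<Longrightarrow> fst X \<in> karoubi_hom X X"
  by (simp add: khom_iff koD)

lemma khom_commute: "X \<in> karoubi_obj \<E> \<Longrightarrow> Y \<in> karoubi_obj \<E> \<Longrightarrow> x \<in> karoubi_hom X Y \<Longrightarrow> x * snd X y = snd Y y * x"
  by (simp add: khom_iff intertwiners_def)

lemma karoubi_tensor_obj:
  assumes "X \<in> karoubi_obj \<E>" "Y \<in> karoubi_obj \<E>" shows "karoubi_tensor X Y \<in> karoubi_obj \<E>"
proof -
  note X = koD[OF assms(1)] and Y = koD[OF assms(2)]
  have "fst X * snd X (fst Y) * (fst X * snd X (fst Y)) = fst X * (snd X (fst Y) * fst X) * snd X (fst Y)"
    by (simp add: mult.assoc)
  also have "\<dots> = fst X * fst X * (snd X (fst Y) * snd X (fst Y))"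
    by (simp only: intertwinersD[OF X(3)] mult.assoc)
  also have "\<dots> = fst X * fst X * snd X (fst Y * fst Y)"
    using X(2) by (simp add: unital_endo_def)
  finally show ?thesis
    using X Y intertwiners_tensor[OF X(2,3) Y(3)]
    by (simp add: karoubi_obj_def karoubi_tensor_def intertwiner_tensor_def compositions.comp)
qed

lemma khom_tensor:
  assumes "X \<in> karoubi_obj \<E>" "Y \<in> karoubi_obj \<E>" "X' \<in> karoubi_obj \<E>" "Y' \<in> karoubi_obj \<E>"
    and "x \<in> karoubi_hom X Y" "x' \<in> karoubi_hom X' Y'"
  shows "x * snd X x' \<in> karoubi_hom (karoubi_tensor X X') (karoubi_tensor Y Y')"
proof -
  have x: "x \<in> intertwiners (snd X) (snd Y)" "fst Y * x = x" "x * fst X = x"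
    and x': "x' \<in> intertwiners (snd X') (snd Y')" "fst Y' * x' = x'" "x' * fst X' = x'"
    using assms by (simp_all add: khom_iff)
  have m: "snd X (a * b) = snd X a * snd X b" for a b
    using koD(2)[OF assms(1)] by (simp add: unital_endo_def)
  have "fst Y * snd Y (fst Y') * (x * snd X x') = fst Y * (snd Y (fst Y') * x) * snd X x'"
    by (simp add: mult.assoc)
  also have "\<dots> = fst Y * x * snd X (fst Y' * x')"
    by (simp only: intertwinersD[OF x(1)] m mult.assoc)
  also have "\<dots> = x * snd X x'"
    by (simp add: x x')
  finally have 1: "fst Y * snd Y (fst Y') * (x * snd X x') = x * snd X x'" .
  have "x * snd X x' * (fst X * snd X (fst X')) = x * (snd X x' * fst X) * snd X (fst X')"
    by (simp add: mult.assoc)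
  also have "\<dots> = x * fst X * snd X (x' * fst X')"
    by (simp only: intertwinersD[OF koD(3)[OF assms(1)]] m mult.assoc)
  also have "\<dots> = x * snd X x'"
    by (simp add: x x')
  finally have 2: "x * snd X x' * (fst X * snd X (fst X')) = x * snd X x'" .
  show ?thesis
    using 1 2 intertwiners_tensor[OF koD(2)[OF assms(1)] x(1) x'(1)] karoubi_tensor_obj assms(1-4)
    by (simp add: khom_iff) (simp add: karoubi_tensor_def intertwiner_tensor_def)
qed

section \<open>Matrices over the idempotent completion\<close>

lemma C_simps [simp]:
  "Obj C = {Xs. set Xs \<subseteq> karoubi_obj \<E>}" "Hom C = ds_hom" "Ident C = ds_ident"
  "Scal C = (\<lambda>c A. \<lambda>i j. c *\<^sub>L A i j)" "TObj C = ds_tensor" "TMor C = ds_tensor_mor" "Unit C = [(1, id)]"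
  "Assoc C = (\<lambda>Xs Ys Zs. ds_ident (ds_tensor Xs (ds_tensor Ys Zs)))" "LUnit C = ds_ident" "RUnit C = ds_ident"
  by (simp_all add: evans_gannon_def)

lemma C_comp: "Comp C Xs Ys Zs B A = (\<lambda>i k. \<Sum>j<length Ys. B i j * A j k)"
  by (simp add: evans_gannon_def)

lemma ds_homD:
  assumes "A \<in> ds_hom Xs Ys"
  shows "i < length Ys \<Longrightarrow> j < length Xs \<Longrightarrow> A i j \<in> karoubi_hom (Xs ! j) (Ys ! i)"
    "\<not> i < length Ys \<Longrightarrow> A i j = 0" "\<not> j < length Xs \<Longrightarrow> A i j = 0"
  using assms by (auto simp: ds_hom_def split: if_splits)

lemma ds_homD0: "A \<in> ds_hom Xs Ys \<Longrightarrow> \<not> (i < length Ys \<and> j < length Xs) \<Longrightarrow> A i j = 0"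
  using ds_homD by blast

lemma ds_homI:
  assumes "\<And>i j. i < length Ys \<Longrightarrow> j < length Xs \<Longrightarrow> A i j \<in> karoubi_hom (Xs ! j) (Ys ! i)"
    and "\<And>i j. \<not> (i < length Ys \<and> j < length Xs) \<Longrightarrow> A i j = 0"
  shows "A \<in> ds_hom Xs Ys"
  using assms by (auto simp: ds_hom_def)

lemma ds_nth: "set Xs \<subseteq> karoubi_obj \<E> \<Longrightarrow> i < length Xs \<Longrightarrow> Xs ! i \<in> karoubi_obj \<E>"
  using nth_mem by blast

lemma linear: "linear_category C"
proof
  show "Scal C a (x + y) = Scal C a x + Scal C a y" for a x y
    by (auto simp: fun_eq_iff lvs.scale_right_distrib)
  show "Scal C (a + b) x = Scal C a x + Scal C b x" for a b x
    by (auto simp: fun_eq_iff lvs.scale_left_distrib)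
  show "Scal C a (Scal C b x) = Scal C (a * b) x" "Scal C 1 x = x" for a b x
    by (auto simp: fun_eq_iff)
next
  fix X Y assume "X \<in> Obj C" "Y \<in> Obj C"
  then have XY: "set X \<subseteq> karoubi_obj \<E>" "set Y \<subseteq> karoubi_obj \<E>"
    by auto
  interpret vector_space "Scal C"
    by standard (auto simp: fun_eq_iff lvs.scale_right_distrib lvs.scale_left_distrib)
  show "subspace (Hom C X Y)"
  proof (rule subspaceI)
    show "0 \<in> Hom C X Y"
      using XY by (simp add: ds_homI ds_nth khom_zero)
    show "A + B \<in> Hom C X Y" if "A \<in> Hom C X Y" "B \<in> Hom C X Y" for A B
      unfolding C_simps using XY that by (intro ds_homI) (simp_all add: ds_nth khom_add ds_homD(1) ds_homD0)
    show "Scal C c A \<in> Hom C X Y" if "A \<in> Hom C X Y" for c A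
      unfolding C_simps using XY that by (intro ds_homI) (simp_all add: ds_nth khom_scale ds_homD(1) ds_homD0)
  qed
next
  fix X assume "X \<in> Obj C"
  then show "Ident C X \<in> Hom C X X"
    by (auto simp: ds_ident_def ds_nth khom_ident khom_zero intro!: ds_homI split: if_splits)
next
  fix X Y Z f g assume *: "X \<in> Obj C" "Y \<in> Obj C" "Z \<in> Obj C" "f \<in> Hom C X Y" "g \<in> Hom C Y Z"
  then have o: "set X \<subseteq> karoubi_obj \<E>" "set Y \<subseteq> karoubi_obj \<E>" "set Z \<subseteq> karoubi_obj \<E>"
    and f: "f \<in> ds_hom X Y" and g: "g \<in> ds_hom Y Z"
    by simp_all
  have "(\<Sum>j<length Y. g i j * f j k) \<in> karoubi_hom (X ! k) (Z ! i)" if "i < length Z" "k < length X" for i k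
  proof (rule khom_sum[OF ds_nth[OF o(1) that(2)] ds_nth[OF o(3) that(1)]])
    fix j assume "j \<in> {..<length Y}"
    then have j: "j < length Y" by simp
    show "g i j * f j k \<in> karoubi_hom (X ! k) (Z ! i)"
      by (rule khom_comp[OF ds_nth[OF o(1) that(2)] ds_nth[OF o(2) j] ds_nth[OF o(3) that(1)]
            ds_homD(1)[OF f j that(2)] ds_homD(1)[OF g that(1) j]])
  qed
  moreover have "(\<Sum>j<length Y. g i j * f j k) = 0" if "\<not> (i < length Z \<and> k < length X)" for i k
    using that ds_homD(2)[OF g, of i] ds_homD(3)[OF f, of k] by auto
  ultimately show "Comp C X Y Z g f \<in> Hom C X Z"
    unfolding C_comp C_simps by (intro ds_homI)
next
  fix X Y f assume *: "X \<in> Obj C" "Y \<in> Obj C" "f \<in> Hom C X Y"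
  have f: "fst (Y ! i) * f i k = f i k" "f i k * fst (X ! k) = f i k" if "i < length Y" "k < length X" for i k
    using ds_homD(1)[of f X Y i k] * that khom_iff[OF ds_nth ds_nth] by auto
  show "Comp C X Y Y (Ident C Y) f = f"
  proof (intro ext)
    fix i k
    show "Comp C X Y Y (Ident C Y) f i k = f i k"
      using * f[of i k] ds_homD(2,3)[of f X Y]
      by (cases "i < length Y"; cases "k < length X")
        (auto simp: C_comp ds_ident_def if_zero_mult)
  qed
  show "Comp C X X Y f (Ident C X) = f"
  proof (intro ext)
    fix i k
    show "Comp C X X Y f (Ident C X) i k = f i k"
      using * f[of i k] ds_homD(2,3)[of f X Y]
      by (cases "i < length Y"; cases "k < length X")
        (auto simp: C_comp ds_ident_def if_zero_mult conj_commute cong: conj_cong)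
  qed
next
  fix W X Y Z f g h
  show "Comp C W X Z (Comp C X Y Z h g) f = Comp C W Y Z h (Comp C W X Y g f)"
    by (auto simp: C_comp fun_eq_iff sum_distrib_left sum_distrib_right mult.assoc intro: sum.swap)
qed (auto simp: C_comp fun_eq_iff distrib_left distrib_right sum.distrib lscale_mult_left lscale_mult_right lvs.scale_sum_right)

section \<open>The Kronecker tensor product of matrices\<close>

lemma tensor_obj: "set Xs \<subseteq> karoubi_obj \<E> \<Longrightarrow> set Ys \<subseteq> karoubi_obj \<E> \<Longrightarrow> set (ds_tensor Xs Ys) \<subseteq> karoubi_obj \<E>"
  by (auto simp: ds_tensor_def subset_iff karoubi_tensor_obj)

lemma div_mod_bounds:
  assumes "i < m * n" shows "i div n < m" "i mod n < (n :: nat)"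
  using assms by (simp add: less_mult_imp_div_less) (cases "n = 0"; use assms in simp)

lemma endo_at:
  assumes "set Xs \<subseteq> karoubi_obj \<E>" "i < length Xs"
  shows "snd (Xs ! i) (x * y) = snd (Xs ! i) x * snd (Xs ! i) y" "snd (Xs ! i) 1 = 1" "snd (Xs ! i) 0 = 0"
    "snd (Xs ! i) (x + y) = snd (Xs ! i) x + snd (Xs ! i) y" "snd (Xs ! i) (c *\<^sub>L x) = c *\<^sub>L snd (Xs ! i) x"
    "snd (Xs ! i) (\<Sum>j\<in>A. f j) = (\<Sum>j\<in>A. snd (Xs ! i) (f j))"
  using koD(2)[OF ds_nth[OF assms]] unital_endo_0 unital_endo_sum by (auto simp: unital_endo_def)

lemma T_hom:
  assumes "set X \<subseteq> karoubi_obj \<E>" "set Y \<subseteq> karoubi_obj \<E>" "set X' \<subseteq> karoubi_obj \<E>" "set Y' \<subseteq> karoubi_obj \<E>"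
    and "f \<in> ds_hom X Y" "f' \<in> ds_hom X' Y'"
  shows "ds_tensor_mor X Y X' Y' f f' \<in> ds_hom (ds_tensor X X') (ds_tensor Y Y')"
proof (rule ds_homI)
  fix i j assume "i < length (ds_tensor Y Y')" "j < length (ds_tensor X X')"
  then show "ds_tensor_mor X Y X' Y' f f' i j \<in> karoubi_hom (ds_tensor X X' ! j) (ds_tensor Y Y' ! i)"
    using assms by (simp add: ds_tensor_mor_def nth_ds_tensor intertwiner_tensor_def khom_tensor ds_nth ds_homD(1) div_mod_bounds)
qed (auto simp: ds_tensor_mor_def)

lemma T_ident:
  assumes "set X \<subseteq> karoubi_obj \<E>"
  shows "ds_tensor_mor X X Y Y (ds_ident X) (ds_ident Y) = ds_ident (ds_tensor X Y)"
proof (intro ext)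
  fix i j
  show "ds_tensor_mor X X Y Y (ds_ident X) (ds_ident Y) i j = ds_ident (ds_tensor X Y) i j"
  proof (cases "i < length X * length Y \<and> j < length X * length Y")
    case True
    note b = div_mod_bounds[OF True[THEN conjunct1]] div_mod_bounds[OF True[THEN conjunct2]]
    have "i = j \<longleftrightarrow> i div length Y = j div length Y \<and> i mod length Y = j mod length Y"
      by (metis div_mult_mod_eq)
    then show ?thesis
      using True b assms
      by (auto simp: ds_tensor_mor_def ds_ident_def intertwiner_tensor_def nth_ds_tensor karoubi_tensor_def endo_at)
  qed (auto simp: ds_tensor_mor_def ds_ident_def)
qed

text \<open>Entrywise, interchange is the intertwining property of \<open>f\<close>: its entry
  passes from the left of \<open>snd (X ! k)\<close> applied to \<open>g'\<close> to the right of
  \<open>snd (Y ! j)\<close> applied to it. The two intermediate indices merge into one by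
  \<open>sum_div_mod\<close>.\<close>

lemma T_comp:
  assumes o: "set X \<subseteq> karoubi_obj \<E>" "set Y \<subseteq> karoubi_obj \<E>"
    and f: "f \<in> ds_hom X Y"
  shows "ds_tensor_mor X Z X' Z' (Comp C X Y Z g f) (Comp C X' Y' Z' g' f') =
    Comp C (ds_tensor X X') (ds_tensor Y Y') (ds_tensor Z Z') (ds_tensor_mor Y Z Y' Z' g g') (ds_tensor_mor X Y X' Y' f f')"
proof (intro ext)
  fix i k
  show "ds_tensor_mor X Z X' Z' (Comp C X Y Z g f) (Comp C X' Y' Z' g' f') i k =
    Comp C (ds_tensor X X') (ds_tensor Y Y') (ds_tensor Z Z') (ds_tensor_mor Y Z Y' Z' g g') (ds_tensor_mor X Y X' Y' f f') i k"
  proof (cases "i < length Z * length Z' \<and> k < length X * length X'")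
    case True
    let ?i = "i div length Z'" and ?i' = "i mod length Z'" and ?k = "k div length X'" and ?k' = "k mod length X'"
    note b = div_mod_bounds[OF True[THEN conjunct1]] div_mod_bounds[OF True[THEN conjunct2]]
    let ?\<beta> = "snd (X ! ?k)"
    have "ds_tensor_mor X Z X' Z' (Comp C X Y Z g f) (Comp C X' Y' Z' g' f') i k =
        (\<Sum>j<length Y. \<Sum>j'<length Y'. g ?i j * f j ?k * ?\<beta> (g' ?i' j' * f' j' ?k'))"
      using True b o by (simp add: ds_tensor_mor_def intertwiner_tensor_def C_comp endo_at sum_distrib_left sum_distrib_right)
        (rule sum.swap)
    also have "\<dots> = (\<Sum>j<length Y. \<Sum>j'<length Y'. (g ?i j * snd (Y ! j) (g' ?i' j')) * (f j ?k * ?\<beta> (f' j' ?k')))"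
    proof (intro sum.cong refl)
      fix j j' assume "j \<in> {..<length Y}"
      then have j: "j < length Y" by simp
      have "f j ?k * ?\<beta> (g' ?i' j') = snd (Y ! j) (g' ?i' j') * f j ?k"
        using khom_commute[OF ds_nth[OF o(1) b(3)] ds_nth[OF o(2) j] ds_homD(1)[OF f j b(3)]] .
      then show "g ?i j * f j ?k * ?\<beta> (g' ?i' j' * f' j' ?k') = (g ?i j * snd (Y ! j) (g' ?i' j')) * (f j ?k * ?\<beta> (f' j' ?k'))"
        using b o by (simp add: endo_at mult.assoc) (simp flip: mult.assoc)
    qed
    also have "\<dots> = (\<Sum>J<length Y * length Y'. (g ?i (J div length Y') * snd (Y ! (J div length Y')) (g' ?i' (J mod length Y'))) *
        (f (J div length Y') ?k * ?\<beta> (f' (J mod length Y') ?k')))"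
      by (rule sum_div_mod[symmetric])
    also have "\<dots> = Comp C (ds_tensor X X') (ds_tensor Y Y') (ds_tensor Z Z') (ds_tensor_mor Y Z Y' Z' g g') (ds_tensor_mor X Y X' Y' f f') i k"
      using True by (simp add: C_comp ds_tensor_mor_def intertwiner_tensor_def)
    finally show ?thesis .
  qed (auto simp: ds_tensor_mor_def C_comp)
qed

lemma karoubi_tensor_assoc:
  "X \<in> karoubi_obj \<E> \<Longrightarrow> karoubi_tensor (karoubi_tensor X Y) Z = karoubi_tensor X (karoubi_tensor Y Z)"
  using koD(2)[of X] by (simp add: karoubi_tensor_def intertwiner_tensor_def unital_endo_def mult.assoc comp_assoc)

lemma tensor_assoc:
  assumes "set Xs \<subseteq> karoubi_obj \<E>"
  shows "ds_tensor (ds_tensor Xs Ys) Zs = ds_tensor Xs (ds_tensor Ys Zs)"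
  using assms
proof (induction Xs)
  case (Cons X Xs)
  have "ds_tensor (map (karoubi_tensor X) Ys) Zs = map (karoubi_tensor X) (ds_tensor Ys Zs)"
    using Cons.prems by (induction Ys) (simp_all add: ds_tensor_def karoubi_tensor_assoc)
  moreover have "ds_tensor (As @ Bs) Zs = ds_tensor As Zs @ ds_tensor Bs Zs" for As Bs
    by (simp add: ds_tensor_def)
  moreover have "ds_tensor (X # Xs) Ys' = map (karoubi_tensor X) Ys' @ ds_tensor Xs Ys'" for Ys'
    by (simp add: ds_tensor_def)
  ultimately show ?case
    using Cons by simp
qed (simp add: ds_tensor_def)

lemma tensor_unit: "ds_tensor [(1, id)] X = X" "set X \<subseteq> karoubi_obj \<E> \<Longrightarrow> ds_tensor X [(1, id)] = X"
proof -
  show "ds_tensor [(1, id)] X = X"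
    by (simp add: ds_tensor_def karoubi_tensor_def intertwiner_tensor_def map_idI)
  show "set X \<subseteq> karoubi_obj \<E> \<Longrightarrow> ds_tensor X [(1, id)] = X"
  proof (induction X)
    case (Cons A X)
    have "karoubi_tensor A (1, id) = A"
      using koD(2)[of A] Cons.prems by (simp add: karoubi_tensor_def intertwiner_tensor_def unital_endo_def)
    moreover have "ds_tensor (A # X) [(1, id)] = karoubi_tensor A (1, id) # ds_tensor X [(1, id)]"
      by (simp add: ds_tensor_def)
    moreover have "ds_tensor X [(1, id)] = X"
      by (rule Cons.IH) (use Cons.prems in simp)
    ultimately show ?case
      by (simp only:)
  qed (simp add: ds_tensor_def)
qed

lemma T_assoc:
  assumes o: "set X \<subseteq> karoubi_obj \<E>" "set Y \<subseteq> karoubi_obj \<E>"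
  shows "ds_tensor_mor (ds_tensor X Y) (ds_tensor X' Y') Z Z' (ds_tensor_mor X X' Y Y' f g) h =
    ds_tensor_mor X X' (ds_tensor Y Z) (ds_tensor Y' Z') f (ds_tensor_mor Y Y' Z Z' g h)"
proof (intro ext)
  fix i j
  show "ds_tensor_mor (ds_tensor X Y) (ds_tensor X' Y') Z Z' (ds_tensor_mor X X' Y Y' f g) h i j =
    ds_tensor_mor X X' (ds_tensor Y Z) (ds_tensor Y' Z') f (ds_tensor_mor Y Y' Z Z' g h) i j"
  proof (cases "i < length X' * length Y' * length Z' \<and> j < length X * length Y * length Z")
    case True
    note b = div_mod_bounds[OF True[THEN conjunct1]] div_mod_bounds[OF True[THEN conjunct2]]
    note b1 = div_mod_bounds[OF b(1)] and b2 = div_mod_bounds[OF b(3)]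
    have ne: "length Z \<noteq> 0" "length Z' \<noteq> 0"
      using True by auto
    \<comment> \<open>A triple of indices has the same lexicographic number under both bracketings;
      this decodes it in either order.\<close>
    have i: "i div (length Y' * length Z') = i div length Z' div length Y'"
      "i mod (length Y' * length Z') div length Z' = i div length Z' mod length Y'"
      "i mod (length Y' * length Z') mod length Z' = i mod length Z'"
      using ne by (simp_all add: mult.commute[of "length Y'"] div_mult2_eq mod_mult2_eq)
    have j: "j div (length Y * length Z) = j div length Z div length Y"
      "j mod (length Y * length Z) div length Z = j div length Z mod length Y"
      "j mod (length Y * length Z) mod length Z = j mod length Z"
      using ne by (simp_all add: mult.commute[of "length Y"] div_mult2_eq mod_mult2_eq)
    have pos: "0 < length Y' * length Z'" "0 < length Y * length Z"
      using True by (auto intro!: gr0I)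
    have "i mod (length Y' * length Z') < length Y' * length Z'" "j mod (length Y * length Z) < length Y * length Z"
      using pos by (simp_all only: mod_less_divisor)
    then show ?thesis
      using True b b1 b2 o
      by (simp add: ds_tensor_mor_def intertwiner_tensor_def i j nth_ds_tensor karoubi_tensor_def endo_at mult.assoc)
  qed (auto simp: ds_tensor_mor_def mult.assoc)
qed

lemma T_unit_left: "f \<in> ds_hom X Y \<Longrightarrow> ds_tensor_mor [(1, id)] [(1, id)] X Y (ds_ident [(1, id)]) f = f"
proof (intro ext)
  fix i j assume f: "f \<in> ds_hom X Y"
  show "ds_tensor_mor [(1, id)] [(1, id)] X Y (ds_ident [(1, id)]) f i j = f i j"
    using ds_homD0[OF f, of i j] by (auto simp: ds_tensor_mor_def ds_ident_def intertwiner_tensor_def)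
qed

lemma T_unit_right:
  "set X \<subseteq> karoubi_obj \<E> \<Longrightarrow> f \<in> ds_hom X Y \<Longrightarrow> ds_tensor_mor X Y [(1, id)] [(1, id)] f (ds_ident [(1, id)]) = f"
proof (intro ext)
  fix i j assume X: "set X \<subseteq> karoubi_obj \<E>" and f: "f \<in> ds_hom X Y"
  show "ds_tensor_mor X Y [(1, id)] [(1, id)] f (ds_ident [(1, id)]) i j = f i j"
    using ds_homD0[OF f, of i j] X by (auto simp: ds_tensor_mor_def ds_ident_def intertwiner_tensor_def endo_at)
qed

lemma T_add_left: "ds_tensor_mor X Y X' Y' (f + g) h = ds_tensor_mor X Y X' Y' f h + ds_tensor_mor X Y X' Y' g h"
  and T_scal_left: "ds_tensor_mor X Y X' Y' (Scal C c f) h = Scal C c (ds_tensor_mor X Y X' Y' f h)"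
  by (auto simp: fun_eq_iff ds_tensor_mor_def intertwiner_tensor_def distrib_right lscale_mult_left)

lemma T_add_right:
  assumes "set X \<subseteq> karoubi_obj \<E>"
  shows "ds_tensor_mor X Y X' Y' f (h + h') = ds_tensor_mor X Y X' Y' f h + ds_tensor_mor X Y X' Y' f h'"
    "ds_tensor_mor X Y X' Y' f (Scal C c h) = Scal C c (ds_tensor_mor X Y X' Y' f h)"
  using assms by (auto simp: fun_eq_iff ds_tensor_mor_def intertwiner_tensor_def endo_at div_mod_bounds distrib_left lscale_mult_right)

lemma strict: "strict_monoidal_category C"
proof -
  interpret linear_category C by (rule linear)
  have U: "[(1, id)] \<in> Obj C"
    using compositions.base[OF id_in] intertwiners_one[of id] by (simp add: karoubi_obj_def)
  have iso: "iso_arrow C X X (ds_ident X)" if "X \<in> Obj C" for X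
    using that ident_in_hom[OF that] comp_ident_left[OF that that ident_in_hom[OF that]]
    by (auto simp: iso_arrow_def inverse_arrows_def)
  have II: "Comp C X X X (ds_ident X) (ds_ident X) = ds_ident X" if "set X \<subseteq> karoubi_obj \<E>" for X
    using comp_ident_left[of X X "ds_ident X"] ident_in_hom[of X] that by simp
  show ?thesis
  proof (unfold_locales, goal_cases)
    case 1 then show ?case using U by simp
  next
    case 2 then show ?case by (simp add: tensor_obj)
  next
    case 3 then show ?case by (simp add: T_hom)
  next
    case 4 then show ?case by (simp add: T_ident)
  next
    case 5 then show ?case by (simp add: T_comp)
  next
    case 6 then show ?case by (simp add: T_add_left)
  next
    case 7 then show ?case by (simp add: T_add_right)
  next
    case 8 then show ?case using T_scal_left by simp
  next
    case 9 then show ?case using T_add_right(2) by simp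
  next
    case (10 X Y Z)
    then show ?case
      using iso[of "ds_tensor X (ds_tensor Y Z)"] by (simp add: tensor_assoc tensor_obj)
  next
    case (11 X Y Z X' Y' Z' f g h)
    then show ?case
      using comp_ident_left[of "ds_tensor X (ds_tensor Y Z)" "ds_tensor X' (ds_tensor Y' Z')" "ds_tensor_mor X X' (ds_tensor Y Z) (ds_tensor Y' Z') f (ds_tensor_mor Y Y' Z Z' g h)"]
        comp_ident_right[of "ds_tensor X (ds_tensor Y Z)" "ds_tensor X' (ds_tensor Y' Z')" "ds_tensor_mor X X' (ds_tensor Y Z) (ds_tensor Y' Z') f (ds_tensor_mor Y Y' Z Z' g h)"]
      by (simp add: tensor_assoc tensor_obj T_assoc T_hom)
  next
    case (12 X) then show ?case using iso[of X] by (simp add: tensor_unit)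
  next
    case (13 X Y f)
    then show ?case
      using comp_ident_left[of X Y f] comp_ident_right[of X Y f] by (simp add: tensor_unit T_unit_left)
  next
    case (14 X) then show ?case using iso[of X] by (simp add: tensor_unit)
  next
    case (15 X Y f)
    then show ?case
      using comp_ident_left[of X Y f] comp_ident_right[of X Y f] by (simp add: tensor_unit T_unit_right)
  next
    case 16 then show ?case by (simp add: tensor_assoc tensor_obj T_ident II)
  next
    case 17 then show ?case by (simp add: tensor_assoc tensor_unit tensor_obj T_ident II)
  next
    case 18 then show ?case by (simp add: tensor_assoc)
  next
    case 19 then show ?case by (simp add: tensor_unit)
  next
    case 20 then show ?case by (simp add: tensor_unit)
  qed simp_all
qed

end

section \<open>Endomorphisms generated by a family with Schur's property\<close>

text \<open>Passes from a span, convenient for inductions, to the indexed list of factorizations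
  that \<open>generated\<close> requires.\<close>

lemma (in linear_category) span_factored_list:
  assumes X: "X \<in> Obj C" and J: "J \<subseteq> Obj C"
    and f: "f \<in> span {Comp C X Z X i p | Z i p. Z \<in> J \<and> i \<in> Hom C Z X \<and> p \<in> Hom C X Z}"
  shows "\<exists>Zs i p. set Zs \<subseteq> J \<and> (\<forall>j<length Zs. i j \<in> Hom C (Zs ! j) X \<and> p j \<in> Hom C X (Zs ! j)) \<and>
    (\<Sum>j<length Zs. Comp C X (Zs ! j) X (i j) (p j)) = f"
  using f
proof (induction rule: span_induct_alt)
  case base
  have "set [] \<subseteq> J" by simp
  then show ?case by (intro exI[of _ "[]"]) simp
next
  case (step c x y)
  obtain Z i0 p0 where Z: "Z \<in> J" "i0 \<in> Hom C Z X" "p0 \<in> Hom C X Z" and x: "x = Comp C X Z X i0 p0"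
    using step(1) by blast
  obtain Zs i p where Zs: "set Zs \<subseteq> J" "\<forall>j<length Zs. i j \<in> Hom C (Zs ! j) X \<and> p j \<in> Hom C X (Zs ! j)"
    and y: "(\<Sum>j<length Zs. Comp C X (Zs ! j) X (i j) (p j)) = y"
    using step(2) by blast
  have ZO: "Z \<in> Obj C" using Z J by blast
  \<comment> \<open>The new summand is put in front at index 0; its scalar is absorbed into the
    inclusion.\<close>
  let ?i = "case_nat (Scal C c i0) i" and ?p = "case_nat p0 p"
  have "\<forall>j<length (Z # Zs). ?i j \<in> Hom C ((Z # Zs) ! j) X \<and> ?p j \<in> Hom C X ((Z # Zs) ! j)"
    using Zs(2) Z X ZO by (auto simp: nth_Cons split: nat.split)
  moreover have "(\<Sum>j<length (Z # Zs). Comp C X ((Z # Zs) ! j) X (?i j) (?p j)) = Scal C c x + y"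
    using Z X ZO by (simp add: sum.lessThan_Suc_shift y x comp_scal_left del: sum.lessThan_Suc)
  ultimately show ?case
    using Z(1) Zs(1) by (intro exI[of _ "Z # Zs"] exI[of _ ?i] exI[of _ ?p]) simp
qed

text \<open>That 1 lies in the span says that \<beta> is a retract of a finite direct sum of
  endomorphisms \<open>\<gamma> x\<close>, without naming indices or projections.\<close>

definition factored ::
  "('i \<Rightarrow> ('g::finite) leavitt \<Rightarrow> 'g leavitt) \<Rightarrow> ('g leavitt \<Rightarrow> 'g leavitt) \<Rightarrow> 'g leavitt set" where
  "factored \<gamma> \<beta> = {v * w | v w x. v \<in> intertwiners (\<gamma> x) \<beta> \<and> w \<in> intertwiners \<beta> (\<gamma> x)}"

lemma factoredI: "v \<in> intertwiners (\<gamma> x) \<beta> \<Longrightarrow> w \<in> intertwiners \<beta> (\<gamma> x) \<Longrightarrow> v * w \<in> factored \<gamma> \<beta>"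
  unfolding factored_def by blast

lemma span_factored_sandwich:
  assumes "a \<in> lvs.span (factored \<gamma> \<beta>)" "v \<in> intertwiners \<beta> \<beta>'" "w \<in> intertwiners \<beta>' \<beta>"
  shows "v * a * w \<in> lvs.span (factored \<gamma> \<beta>')"
  using assms(1)
proof (induction rule: lvs.span_induct_alt)
  case base then show ?case by (simp add: lvs.span_zero)
next
  case (step c x y)
  obtain z v' w' where x: "x = v' * w'" "v' \<in> intertwiners (\<gamma> z) \<beta>" "w' \<in> intertwiners \<beta> (\<gamma> z)"
    using step(1) unfolding factored_def by blast
  have "(v * v') * (w' * w) \<in> factored \<gamma> \<beta>'"
    using x assms(2,3) by (intro factoredI[of _ _ z] intertwiners_comp)
  moreover have "v * (c *\<^sub>L x + y) * w = c *\<^sub>L ((v * v') * (w' * w)) + v * y * w"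
    by (simp add: x distrib_left distrib_right lscale_mult_left lscale_mult_right mult.assoc)
  ultimately show ?case
    using step(2) by (simp add: lvs.span_add lvs.span_scale lvs.span_base)
qed

text \<open>The identity of the composite is \<open>1 * \<beta> 1\<close>. Tensoring factorizations
  through \<open>\<gamma> x\<close> and \<open>\<gamma> y\<close> gives one through
  \<open>\<gamma> x \<circ> \<gamma> y\<close>, where the hypothesis on products takes over.\<close>

lemma span_factored_comp:
  assumes prod: "\<And>x y. 1 \<in> lvs.span (factored \<gamma> (\<gamma> x \<circ> \<gamma> y))"
    and \<gamma>: "\<And>x. unital_endo (\<gamma> x)" and \<beta>: "unital_endo \<beta>"
    and "1 \<in> lvs.span (factored \<gamma> \<beta>)" "1 \<in> lvs.span (factored \<gamma> \<beta>')"
  shows "1 \<in> lvs.span (factored \<gamma> (\<beta> \<circ> \<beta>'))"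
proof -
  have \<beta>_simps: "\<beta> (r + t) = \<beta> r + \<beta> t" "\<beta> (c *\<^sub>L r) = c *\<^sub>L \<beta> r" "\<beta> (r * t) = \<beta> r * \<beta> t" "\<beta> 1 = 1" for r t c
    using \<beta> by (simp_all add: unital_endo_def)
  have "r * \<beta> t \<in> lvs.span (factored \<gamma> (\<beta> \<circ> \<beta>'))"
    if r: "r \<in> lvs.span (factored \<gamma> \<beta>)" and t: "t \<in> lvs.span (factored \<gamma> \<beta>')" for r t
    using r
  proof (induction rule: lvs.span_induct_alt)
    case base then show ?case by (simp add: lvs.span_zero)
  next
    case (step c r0 r)
    obtain x v w where v: "v \<in> intertwiners (\<gamma> x) \<beta>" and w: "w \<in> intertwiners \<beta> (\<gamma> x)" and r0: "r0 = v * w"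
      using step(1) unfolding factored_def by blast
    have "r0 * \<beta> t \<in> lvs.span (factored \<gamma> (\<beta> \<circ> \<beta>'))"
      using t
    proof (induction rule: lvs.span_induct_alt)
      case base then show ?case by (simp add: \<beta>_simps unital_endo_0[OF \<beta>] lvs.span_zero)
    next
      case (step c t0 t)
      obtain y v' w' where v': "v' \<in> intertwiners (\<gamma> y) \<beta>'" and w': "w' \<in> intertwiners \<beta>' (\<gamma> y)" and t0: "t0 = v' * w'"
        using step(1) unfolding factored_def by blast
      \<comment> \<open>The outer factors are the tensor products of \<open>v\<close> with
        \<open>v'\<close> and of \<open>w\<close> with \<open>w'\<close>; the middle 1 is factored
        by the hypothesis on products.\<close>
      have "(v * \<gamma> x v') * 1 * (w * \<beta> w') \<in> lvs.span (factored \<gamma> (\<beta> \<circ> \<beta>'))"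
        by (rule span_factored_sandwich[OF prod intertwiners_tensor[OF \<gamma> v v'] intertwiners_tensor[OF \<beta> w w']])
      also have "(v * \<gamma> x v') * 1 * (w * \<beta> w') = v * (\<gamma> x v' * w) * \<beta> w'"
        by (simp add: mult.assoc)
      also have "\<dots> = r0 * \<beta> t0"
        by (simp add: intertwinersD[OF w] r0 t0 \<beta>_simps mult.assoc)
      finally have "c *\<^sub>L (r0 * \<beta> t0) + r0 * \<beta> t \<in> lvs.span (factored \<gamma> (\<beta> \<circ> \<beta>'))"
        by (rule lvs.span_add[OF lvs.span_scale step(2)])
      then show ?case
        by (simp only: \<beta>_simps distrib_left lscale_mult_right)
    qed
    then have "c *\<^sub>L (r0 * \<beta> t) + r * \<beta> t \<in> lvs.span (factored \<gamma> (\<beta> \<circ> \<beta>'))"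
      by (rule lvs.span_add[OF lvs.span_scale step(2)])
    then show ?case
      by (simp only: distrib_right lscale_mult_left)
  qed
  from this[OF assms(4,5)] show ?thesis
    by (simp only: \<beta>_simps mult_1_right)
qed

definition unit_matrix :: "nat \<Rightarrow> nat \<Rightarrow> 'a::zero \<Rightarrow> nat \<Rightarrow> nat \<Rightarrow> 'a" where
  "unit_matrix k l a = (\<lambda>i j. if i = k \<and> j = l then a else 0)"

lemma sum_apply2: "(\<Sum>k\<in>A. f k) i j = (\<Sum>k\<in>A. f k i j)" for f :: "'k \<Rightarrow> 'a \<Rightarrow> 'b \<Rightarrow> 'c::ab_group_add"
  by (induction A rule: infinite_finite_induct) simp_all

context endo_set
begin

lemma unit_matrix_hom:
  assumes "set X \<subseteq> karoubi_obj \<E>" "set Y \<subseteq> karoubi_obj \<E>"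
    and "k < length Y" "l < length X" "a \<in> karoubi_hom (X ! l) (Y ! k)"
  shows "unit_matrix k l a \<in> ds_hom X Y"
  using assms by (auto simp: unit_matrix_def ds_nth khom_zero intro!: ds_homI split: if_splits)

lemma unit_matrix_comp:
  "n < length Y \<Longrightarrow> Comp C X Y Z (unit_matrix k n a) (unit_matrix n l c) = unit_matrix k l (a * c)"
proof (intro ext)
  fix i j assume n: "n < length Y"
  have "(\<Sum>m<length Y. unit_matrix k n a i m * unit_matrix n l c m j) =
      (\<Sum>m<length Y. if m = n then (if i = k \<and> j = l then a * c else 0) else 0)"
    by (rule sum.cong) (auto simp: unit_matrix_def)
  then show "Comp C X Y Z (unit_matrix k n a) (unit_matrix n l c) i j = unit_matrix k l (a * c) i j"
    using n by (simp add: C_comp unit_matrix_def)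
qed

lemma unit_matrix_lin:
  "unit_matrix k l (0 :: 'g leavitt) = 0" "unit_matrix k l (a + c) = unit_matrix k l a + unit_matrix k l c"
  "unit_matrix k l (z *\<^sub>L a) = Scal C z (unit_matrix k l a)" for a c :: "'g leavitt"
  by (auto simp: fun_eq_iff unit_matrix_def)

lemma one_obj: "\<beta> \<in> compositions \<E> \<Longrightarrow> (1, \<beta>) \<in> karoubi_obj \<E>"
  by (simp add: karoubi_obj_def intertwiners_one)

lemma hom_single:
  assumes "\<beta> \<in> compositions \<E>" "\<beta>' \<in> compositions \<E>"
  shows "ds_hom [(1, \<beta>)] [(1, \<beta>')] = unit_matrix 0 0 ` intertwiners \<beta> \<beta>'"
proof -
  have eq: "a \<in> karoubi_hom (1, \<beta>) (1, \<beta>') \<longleftrightarrow> a \<in> intertwiners \<beta> \<beta>'" for a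
    using assms by (simp add: khom_iff one_obj)
  show ?thesis
  proof
    show "unit_matrix 0 0 ` intertwiners \<beta> \<beta>' \<subseteq> ds_hom [(1, \<beta>)] [(1, \<beta>')]"
      using eq assms by (auto intro!: unit_matrix_hom simp: one_obj)
    show "ds_hom [(1, \<beta>)] [(1, \<beta>')] \<subseteq> unit_matrix 0 0 ` intertwiners \<beta> \<beta>'"
    proof
      fix A assume A: "A \<in> ds_hom [(1, \<beta>)] [(1, \<beta>')]"
      have "A = unit_matrix 0 0 (A 0 0)"
        using ds_homD0[OF A] by (auto simp: fun_eq_iff unit_matrix_def)
      moreover have "A 0 0 \<in> intertwiners \<beta> \<beta>'"
        using ds_homD(1)[OF A, of 0 0] eq by simp
      ultimately show "A \<in> unit_matrix 0 0 ` intertwiners \<beta> \<beta>'"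
        by blast
    qed
  qed
qed

lemma ident_single: "ds_ident [(1, \<beta>)] = unit_matrix 0 0 1"
  by (auto simp: fun_eq_iff ds_ident_def unit_matrix_def)

lemma tensor_single: "\<beta> \<in> compositions \<E> \<Longrightarrow> ds_tensor [(1, \<beta>)] [(1, \<beta>')] = [(1, \<beta> \<circ> \<beta>')]"
  using unital_compositions[of \<beta>]
  by (simp add: ds_tensor_def karoubi_tensor_def intertwiner_tensor_def unital_endo_def)

lemma tensor_mor_single:
  assumes "length X = 1" "length Y = 1" "length X' = 1" "length Y' = 1"
  shows "ds_tensor_mor X Y X' Y' (unit_matrix 0 0 a) (unit_matrix 0 0 c) = unit_matrix 0 0 (a * snd (X ! 0) c)"
  using assms by (auto simp: fun_eq_iff ds_tensor_mor_def unit_matrix_def intertwiner_tensor_def)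

end

text \<open>The \<open>\<gamma> x\<close> are the prospective simple objects. Factorization of the
  identity is asked for the generating endomorphisms and for products of two
  \<open>\<gamma>\<close>; \<open>span_factored_comp\<close> spreads it to all compositions.\<close>

locale endo_fusion = endo_set \<E> for \<E> :: "(('g::finite) leavitt \<Rightarrow> 'g leavitt) set" +
  fixes \<gamma> :: "'i \<Rightarrow> 'g leavitt \<Rightarrow> 'g leavitt"
  assumes finite_index: "finite (UNIV :: 'i set)"
    and \<gamma>_in: "\<gamma> x \<in> compositions \<E>"
    and \<gamma>_same: "a \<in> intertwiners (\<gamma> x) (\<gamma> x) \<Longrightarrow> \<exists>c. a = c *\<^sub>L 1"
    and \<gamma>_diff: "x \<noteq> y \<Longrightarrow> a \<in> intertwiners (\<gamma> x) (\<gamma> y) \<Longrightarrow> a = 0"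
    and base_factored: "\<beta> \<in> \<E> \<Longrightarrow> 1 \<in> lvs.span (factored \<gamma> \<beta>)"
    and prod_factored: "1 \<in> lvs.span (factored \<gamma> (\<gamma> x \<circ> \<gamma> y))"
begin

sublocale strict_monoidal_category C
  by (rule strict)

definition smp :: "'i \<Rightarrow> 'g kobj list" where "smp x = [(1, \<gamma> x)]"

lemma unital_\<gamma>: "unital_endo (\<gamma> x)"
  using \<gamma>_in by (rule unital_compositions)

lemma compositions_factored: "\<beta> \<in> compositions \<E> \<Longrightarrow> 1 \<in> lvs.span (factored \<gamma> \<beta>)"
proof (induction rule: compositions.induct)
  case (comp \<sigma> \<tau>)
  show ?case
    by (rule span_factored_comp[OF prod_factored unital_\<gamma> unital_compositions[OF comp(1)] comp.IH])
qed (rule base_factored)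

lemma smp_obj: "smp x \<in> Obj C"
  using \<gamma>_in[of x] by (simp add: smp_def one_obj)

lemma hom_smp: "Hom C (smp x) (smp y) = unit_matrix 0 0 ` intertwiners (\<gamma> x) (\<gamma> y)"
  by (simp add: smp_def hom_single \<gamma>_in)

lemma ident_smp: "Ident C (smp x) = unit_matrix 0 0 1"
  by (simp add: smp_def ident_single)

lemma unit_matrix_eq_iff: "unit_matrix k l a = unit_matrix k l c \<longleftrightarrow> a = c"
  unfolding unit_matrix_def by (metis (full_types))

lemma inj_smp: "inj smp"
proof (rule injI, rule ccontr)
  fix x y assume "smp x = smp y" "x \<noteq> y"
  then have "(1 :: 'g leavitt) \<in> intertwiners (\<gamma> x) (\<gamma> y)"
    by (simp add: smp_def intertwiners_one)
  then show False
    using \<gamma>_diff[OF \<open>x \<noteq> y\<close>] leavitt_one_neq_zero by blast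
qed

lemma sum_object:
  fixes xs defines "X \<equiv> map (\<lambda>x. (1, \<gamma> x)) xs"
  shows "direct_sum C (map smp xs) X"
proof (rule direct_sumI[of _ _ _ "\<lambda>k. unit_matrix k 0 1" "\<lambda>k. unit_matrix 0 k 1"])
  have X: "set X \<subseteq> karoubi_obj \<E>"
    by (auto simp: X_def one_obj \<gamma>_in)
  have S: "set (smp x) \<subseteq> karoubi_obj \<E>" for x
    using smp_obj by simp
  then show "map smp xs ! i \<in> Obj C" if "i < length (map smp xs)" for i
    using that by simp
  show "X \<in> Obj C"
    using X by simp
  have one: "1 \<in> karoubi_hom (1, \<gamma> x) (1, \<gamma> x)" for x
    using khom_ident[OF one_obj[OF \<gamma>_in]] by simp
  show "unit_matrix k 0 1 \<in> Hom C (map smp xs ! k) X" if "k < length (map smp xs)" for k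
    using that X S one unit_matrix_hom[of "map smp xs ! k" X k 0 1] by (simp add: X_def smp_def)
  show "unit_matrix 0 k 1 \<in> Hom C X (map smp xs ! k)" if "k < length (map smp xs)" for k
    using that X S one unit_matrix_hom[of X "map smp xs ! k" 0 k 1] by (simp add: X_def smp_def)
  show "Comp C (map smp xs ! j) X (map smp xs ! i) (unit_matrix 0 i 1) (unit_matrix j 0 1) =
      (if i = j then Ident C (map smp xs ! i) else 0)"
    if "i < length (map smp xs)" "j < length (map smp xs)" for i j
  proof (cases "i = j")
    case True
    have "j < length X" using that by (simp add: X_def)
    with True that show ?thesis
      unfolding ident_smp by (simp add: unit_matrix_comp ident_smp del: C_simps)
  qed (auto simp: C_comp unit_matrix_def fun_eq_iff intro!: sum.neutral)
  have "(\<Sum>i<length xs. unit_matrix i i 1) = (ds_ident X :: nat \<Rightarrow> nat \<Rightarrow> 'g leavitt)"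
  proof (intro ext)
    fix i j
    show "(\<Sum>k<length xs. unit_matrix k k 1) i j = (ds_ident X i j :: 'g leavitt)"
      unfolding sum_apply2 by (auto simp: ds_ident_def X_def unit_matrix_def intro!: sum.neutral)
  qed
  then show "(\<Sum>i<length (map smp xs). Comp C X (map smp xs ! i) X (unit_matrix i 0 1) (unit_matrix 0 i 1)) = Ident C X"
    by (simp add: unit_matrix_comp smp_def)
qed

lemma ident_factored:
  assumes X: "X \<in> Obj C"
  shows "Ident C X \<in> span {Comp C X Z X i p | Z i p. Z \<in> range smp \<and> i \<in> Hom C Z X \<and> p \<in> Hom C X Z}"
    (is "_ \<in> span ?S")
proof -
  have o: "set X \<subseteq> karoubi_obj \<E>" using X by simp
  have "unit_matrix k k (fst (X ! k)) \<in> span ?S" if k: "k < length X" for k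
  proof -
    let ?p = "fst (X ! k)" and ?\<beta> = "snd (X ! k)"
    have K: "X ! k \<in> karoubi_obj \<E>" using ds_nth[OF o k] .
    \<comment> \<open>The induction runs over the span before \<open>a\<close> is set to 1; then
      \<open>?p * 1 * ?p = ?p\<close> is the diagonal entry of the identity. The outer
      \<open>?p\<close> make the two factors morphisms of the idempotent completion.\<close>
    have "unit_matrix k k (?p * a * ?p) \<in> span ?S" if "a \<in> lvs.span (factored \<gamma> ?\<beta>)" for a
      using that
    proof (induction rule: lvs.span_induct_alt)
      case base
      show ?case
        by (simp only: mult_zero_left mult_zero_right unit_matrix_lin span_zero)
    next
      case (step c a0 a)
      obtain x v w where v: "v \<in> intertwiners (\<gamma> x) ?\<beta>" and w: "w \<in> intertwiners ?\<beta> (\<gamma> x)" and a0: "a0 = v * w"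
        using step(1) unfolding factored_def by blast
      have "?p * v \<in> karoubi_hom (1, \<gamma> x) (X ! k)"
        using koD(3,4)[OF K] v by (simp add: khom_iff one_obj \<gamma>_in K intertwiners_comp flip: mult.assoc)
      then have 1: "unit_matrix k 0 (?p * v) \<in> Hom C (smp x) X"
        using unit_matrix_hom[of "smp x" X k 0 "?p * v"] o k smp_obj[of x] by (simp add: smp_def)
      have "w * ?p \<in> karoubi_hom (X ! k) (1, \<gamma> x)"
        using koD(3,4)[OF K] w by (simp add: khom_iff one_obj \<gamma>_in K intertwiners_comp mult.assoc)
      then have 2: "unit_matrix 0 k (w * ?p) \<in> Hom C X (smp x)"
        using unit_matrix_hom[of X "smp x" 0 k "w * ?p"] o k smp_obj[of x] by (simp add: smp_def)
      have "0 < length (smp x)"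
        by (simp add: smp_def)
      from unit_matrix_comp[OF this, of X X k "?p * v" k "w * ?p"]
      have "unit_matrix k k (?p * v * (w * ?p)) = Comp C X (smp x) X (unit_matrix k 0 (?p * v)) (unit_matrix 0 k (w * ?p))"
        by (rule sym)
      then have "unit_matrix k k (?p * v * (w * ?p)) \<in> ?S"
        using 1 2 by blast
      moreover have "?p * (c *\<^sub>L a0 + a) * ?p = c *\<^sub>L (?p * v * (w * ?p)) + ?p * a * ?p"
        by (simp add: a0 distrib_left distrib_right lscale_mult_left lscale_mult_right mult.assoc)
      ultimately show ?case
        using step(2) unfolding unit_matrix_lin by (simp only: span_add span_scale span_base unit_matrix_lin)
    qed
    from this[OF compositions_factored[OF koD(1)[OF K]]] show ?thesis
      by (simp add: koD(4)[OF K])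
  qed
  then have "(\<Sum>k<length X. unit_matrix k k (fst (X ! k))) \<in> span ?S"
    by (intro span_sum) simp
  also have "(\<Sum>k<length X. unit_matrix k k (fst (X ! k))) = Ident C X"
  proof (intro ext)
    fix i j
    show "(\<Sum>k<length X. unit_matrix k k (fst (X ! k))) i j = Ident C X i j"
      unfolding sum_apply2 by (auto simp: ds_ident_def unit_matrix_def intro!: sum.neutral)
  qed
  finally show ?thesis .
qed

sublocale schur_category C "range smp"
proof (unfold_locales, goal_cases)
  case (1 Z) then show ?case using smp_obj by auto
next
  case 2 then show ?case using finite_index by simp
next
  case (3 Z f)
  then obtain x a where Z: "Z = smp x" and f: "f = unit_matrix 0 0 a" "a \<in> intertwiners (\<gamma> x) (\<gamma> x)"
    using hom_smp by auto
  obtain c where "a = c *\<^sub>L 1" using \<gamma>_same[OF f(2)] by blast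
  then show ?case
    using unit_matrix_lin(3)[of 0 0 c 1] unfolding Z f(1) ident_smp by metis
next
  case (4 Z Z' f)
  then obtain x y a where "Z = smp x" "Z' = smp y" "f = unit_matrix 0 0 a" "a \<in> intertwiners (\<gamma> x) (\<gamma> y)"
    using hom_smp by blast
  then show ?case using 4(3) \<gamma>_diff[of x y a] unit_matrix_lin(1) by blast
next
  case (5 Z)
  then show ?case
    using ident_smp unit_matrix_eq_iff[of 0 0 1 "0 :: 'g leavitt"] leavitt_one_neq_zero unit_matrix_lin(1) by auto
next
  case (6 Zs)
  then obtain xs where "Zs = map smp xs"
    by (metis ex_map_conv subset_iff rangeE)
  then show ?case using sum_object by blast
next
  case (7 X)
  have "range smp \<subseteq> Obj C" using smp_obj by blast
  from span_factored_list[OF 7 this ident_factored[OF 7]] show ?case .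
qed

end

section \<open>Recognition of the Grothendieck ring\<close>

lemma (in linear_monoidal_category) isomorphic_tobj:
  assumes "isomorphic C X X'" "isomorphic C Y Y'" "X \<in> Obj C" "X' \<in> Obj C" "Y \<in> Obj C" "Y' \<in> Obj C"
  shows "isomorphic C (TObj C X Y) (TObj C X' Y')"
proof -
  obtain f f' where f: "f \<in> Hom C X X'" "f' \<in> Hom C X' X" "Comp C X X' X f' f = Ident C X" "Comp C X' X X' f f' = Ident C X'"
    using assms(1) by (auto simp: isomorphic_def iso_arrow_def inverse_arrows_def)
  obtain g g' where g: "g \<in> Hom C Y Y'" "g' \<in> Hom C Y' Y" "Comp C Y Y' Y g' g = Ident C Y" "Comp C Y' Y Y' g g' = Ident C Y'"
    using assms(2) by (auto simp: isomorphic_def iso_arrow_def inverse_arrows_def)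
  have "inverse_arrows C (TObj C X Y) (TObj C X' Y') (TMor C X X' Y Y' f g) (TMor C X' X Y' Y f' g')"
    using assms f g by (simp add: inverse_arrows_def tmor_in_hom tmor_ident flip: tmor_comp)
  then show ?thesis
    by (rule isomorphicI)
qed

locale strict_schur_category = strict_monoidal_category C + schur_category C I
  for C :: "('o, 'm::ab_group_add) moncat" and I
begin

text \<open>Duals and fusion rules have to be checked on representatives \<open>S x\<close> only:
  \<open>multiplicity\<close> makes the count well defined on classes, and
  \<open>left_dual_unique\<close> with \<open>left_dual_iso\<close> shows that the duals of a class
  fill exactly one class.\<close>

theorem categorifiesI:
  fixes S :: "'b \<Rightarrow> 'o" and R :: "'b based_ring"
  assumes I: "I = range S" and inj: "inj S"
    and R: "Basis R = UNIV" "\<And>x. Star R (Star R x) = x"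
    and unit: "Unit C = S (One R)"
    and dual: "\<And>x. is_left_dual C (S x) (S (Star R x))"
    and fusion: "\<And>x y. \<exists>zs. direct_sum C (map S zs) (TObj C (S x) (S y)) \<and>
      (\<forall>z. length (filter ((=) z) zs) = Coeff R x y z)"
  shows "categorifies C R"
proof -
  have SI: "S x \<in> I" for x using I by simp
  have SO [simp]: "S x \<in> Obj C" for x using I_obj[OF SI] .
  have duals: "\<exists>D. is_left_dual C X D \<and> is_left_dual C D X" if X: "X \<in> Obj C" for X
  proof -
    obtain Zs where Zs: "set Zs \<subseteq> I" "direct_sum C Zs X"
      using decomposition[OF X] by blast
    then obtain xs where xs: "Zs = map S xs"
      unfolding I by (metis ex_map_conv subset_iff rangeE)
    obtain D where D: "direct_sum C (map S (map (Star R) xs)) D"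
      using sums_exist[of "map S (map (Star R) xs)"] SI by auto
    have "is_left_dual C X D"
      by (rule dual_direct_sum[OF Zs(2) D]) (simp_all add: xs dual)
    \<comment> \<open>\<open>Star R\<close> is an involution, so a left dual of
      \<open>S (Star R x)\<close> is \<open>S x\<close> itself; the same direct sum \<open>D\<close>
      is a dual on both sides.\<close>
    moreover have "is_left_dual C D X"
    proof (rule dual_direct_sum[OF D Zs(2)])
      show "is_left_dual C (map S (map (Star R) xs) ! i) (Zs ! i)" if "i < length (map S (map (Star R) xs))" for i
        using dual[of "Star R (xs ! i)"] that by (simp add: xs R)
    qed (simp add: xs)
    ultimately show ?thesis by blast
  qed
  have fusion_cat: "fusion_category C"
  proof (intro fusion_category.intro fusion_category_axioms.intro)
    show "semisimple_category C" by (rule semisimple)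
    show "linear_monoidal_category C" by unfold_locales
    show "\<exists>D. is_left_dual C X D" "\<exists>D. is_left_dual C D X" if "X \<in> Obj C" for X
      using duals[OF that] by blast+
    show "simple_object C (Unit C)"
      unfolding unit by (rule simple_generator[OF SI])
    show "finite (simple_classes C)"
      by (simp add: simple_classes_eq I_finite)
    show "\<exists>B. finite B \<and> span B = Hom C X Y" if "X \<in> Obj C" "Y \<in> Obj C" for X Y
      using hom_finite_span_general[OF that] .
  qed
  define \<psi> where "\<psi> x = iso_class C (S x)" for x
  have inj\<psi>: "inj \<psi>"
    using inj inj_on_iso_class unfolding I \<psi>_def by (auto simp: inj_def inj_on_def)
  have basis: "simple_classes C = range \<psi>"
    by (auto simp: simple_classes_eq I \<psi>_def)
  have coeff: "Coeff (grothendieck_ring C) (\<psi> x) (\<psi> y) (\<psi> z) = Coeff R x y z" for x y z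
  proof -
    have filt: "filter (\<lambda>Z. Z \<in> \<psi> z) Zs = filter (isomorphic C (S z)) Zs" if "\<forall>Z\<in>set Zs. simple_object C Z" for Zs
      using that by (intro filter_cong) (auto simp: \<psi>_def iso_class_def simple_object_def)
    obtain zs where zs: "direct_sum C (map S zs) (TObj C (S x) (S y))" "length (filter ((=) z) zs) = Coeff R x y z"
      using fusion by blast
    have simple: "simple_object C Z" if "Z \<in> set (map S zs)" for Z
      using that simple_generator SI by auto
    have "isomorphic C (S z) (S w) \<longleftrightarrow> z = w" for w
      using generators_distinct[OF SI SI] inj isomorphic_refl by (metis SO injD)
    then have len: "length (filter (\<lambda>Z. Z \<in> \<psi> z) (map S zs)) = Coeff R x y z"
      using filt[of "map S zs"] simple zs(2) by (simp add: filter_map comp_def)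
    have "(THE n. \<exists>X\<in>\<psi> x. \<exists>Y\<in>\<psi> y. \<exists>Zs. (\<forall>Z\<in>set Zs. simple_object C Z) \<and>
       direct_sum C Zs (TObj C X Y) \<and> n = length (filter (\<lambda>Z. Z \<in> \<psi> z) Zs)) = Coeff R x y z"
    proof (rule the_equality)
      have "S x \<in> \<psi> x" "S y \<in> \<psi> y"
        by (simp_all add: \<psi>_def iso_class_def isomorphic_refl)
      then show "\<exists>X\<in>\<psi> x. \<exists>Y\<in>\<psi> y. \<exists>Zs. (\<forall>Z\<in>set Zs. simple_object C Z) \<and>
         direct_sum C Zs (TObj C X Y) \<and> Coeff R x y z = length (filter (\<lambda>Z. Z \<in> \<psi> z) Zs)"
        using zs(1) simple len[symmetric] by blast
    next
      fix n assume "\<exists>X\<in>\<psi> x. \<exists>Y\<in>\<psi> y. \<exists>Zs. (\<forall>Z\<in>set Zs. simple_object C Z) \<and>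
         direct_sum C Zs (TObj C X Y) \<and> n = length (filter (\<lambda>Z. Z \<in> \<psi> z) Zs)"
      then obtain X Y Zs where X: "X \<in> \<psi> x" and Y: "Y \<in> \<psi> y" and Zs: "\<forall>Z\<in>set Zs. simple_object C Z"
        and sum: "direct_sum C Zs (TObj C X Y)" and n: "n = length (filter (\<lambda>Z. Z \<in> \<psi> z) Zs)"
        by blast
      \<comment> \<open>Other representatives give an isomorphic tensor product, and the count in
        any decomposition of it is the dimension of a Hom space.\<close>
      have "isomorphic C (TObj C X Y) (TObj C (S x) (S y))"
        using X Y by (intro isomorphic_tobj) (auto simp: \<psi>_def iso_class_def isomorphic_sym)
      then have "direct_sum C Zs (TObj C (S x) (S y))"
        using direct_sum_iso[OF sum] by simp
      then have "length (filter (isomorphic C (S z)) Zs) = length (filter (isomorphic C (S z)) (map S zs))"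
        using multiplicity[OF _ _ SI] Zs zs(1) simple by metis
      then show "n = Coeff R x y z"
        using len filt[OF Zs] filt[of "map S zs"] simple n by simp
    qed
    then show ?thesis
      by (simp add: grothendieck_ring_def)
  qed
  have star: "Star (grothendieck_ring C) (\<psi> x) = \<psi> (Star R x)" for x
  proof -
    have "(\<exists>X\<in>\<psi> x. is_left_dual C X D) \<longleftrightarrow> D \<in> \<psi> (Star R x)" for D
    proof
      assume "\<exists>X\<in>\<psi> x. is_left_dual C X D"
      then obtain X where X: "isomorphic C (S x) X" "X \<in> Obj C" "is_left_dual C X D"
        by (auto simp: \<psi>_def iso_class_def)
      have D: "D \<in> Obj C" using X(3) by (simp add: is_left_dual_def)
      have "is_left_dual C (S x) D"
        by (rule left_dual_iso[OF X(3) isomorphic_sym[OF X(1)] isomorphic_refl[OF D] SO D])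
      from left_dual_unique[OF dual this] show "D \<in> \<psi> (Star R x)"
        using D by (simp add: \<psi>_def iso_class_def)
    next
      assume "D \<in> \<psi> (Star R x)"
      then have D: "D \<in> Obj C" "isomorphic C (S (Star R x)) D"
        by (auto simp: \<psi>_def iso_class_def)
      have "is_left_dual C (S x) D"
        by (rule left_dual_iso[OF dual isomorphic_refl[OF SO] D(2) SO D(1)])
      then show "\<exists>X\<in>\<psi> x. is_left_dual C X D"
        by (intro bexI[of _ "S x"]) (simp_all add: \<psi>_def iso_class_def isomorphic_refl)
    qed
    then show ?thesis
      by (auto simp: grothendieck_ring_def)
  qed
  have inv: "inv \<psi> (\<psi> x) = x" for x
    by (rule inv_f_f[OF inj\<psi>])
  have B: "Basis (grothendieck_ring C) = range \<psi>" "One (grothendieck_ring C) = \<psi> (One R)"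
    using basis unit by (simp_all add: grothendieck_ring_def \<psi>_def)
  have "based_ring_iso (inv \<psi>) (grothendieck_ring C) R"
    unfolding based_ring_iso_def
  proof (intro conjI)
    show "bij_betw (inv \<psi>) (Basis (grothendieck_ring C)) (Basis R)"
      unfolding B R using inj\<psi> by (simp add: bij_betw_def inj_on_inv_into inj_imp_surj_inv image_comp inv)
  qed (auto simp: B coeff star inv)
  with fusion_cat show ?thesis
    unfolding categorifies_def by blast
qed

end

section \<open>The category generated by the Izumi endomorphisms\<close>

lemma (in strict_monoidal_category) left_dualI:
  assumes "X \<in> Obj C" "D \<in> Obj C" "e \<in> Hom C (TObj C D X) (Unit C)" "c \<in> Hom C (Unit C) (TObj C X D)"
    and "Comp C X (TObj C (TObj C X D) X) X (TMor C X X (TObj C D X) (Unit C) (Ident C X) e)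
      (TMor C (Unit C) (TObj C X D) X X c (Ident C X)) = Ident C X"
    and "Comp C D (TObj C D (TObj C X D)) D (TMor C (TObj C D X) (Unit C) D D e (Ident C D))
      (TMor C D D (Unit C) (TObj C X D) (Ident C D) c) = Ident C D"
  shows "is_left_dual C X D"
proof -
  let ?e = "(TObj C D X, e, Unit C)" and ?c = "(Unit C, c, TObj C X D)"
  have "arr ?e" "arr ?c"
    using assms by (simp_all add: arr_def)
  moreover have "(ide X \<otimes> ?e) \<odot> (?c \<otimes> ide X) = ide X" "(?e \<otimes> ide D) \<odot> (ide D \<otimes> ?c) = ide D"
    using assms by (auto intro!: arr_eqI simp: mr_simps)
  ultimately show ?thesis
    unfolding is_left_dual_iff dual_data_def using assms(1,2) by (intro exI[of _ ?e] exI[of _ ?c]) simp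
qed

context endo_fusion
begin

sublocale strict_schur_category C "range smp" ..

lemma direct_sum_smp:
  assumes \<beta>: "\<beta> \<in> compositions \<E>"
    and v: "\<And>k. k < length xs \<Longrightarrow> v k \<in> intertwiners (\<gamma> (xs ! k)) \<beta>"
    and w: "\<And>k. k < length xs \<Longrightarrow> w k \<in> intertwiners \<beta> (\<gamma> (xs ! k))"
    and wv: "\<And>i j. i < length xs \<Longrightarrow> j < length xs \<Longrightarrow> w i * v j = (if i = j then 1 else 0)"
    and vw: "(\<Sum>k<length xs. v k * w k) = 1"
  shows "direct_sum C (map smp xs) [(1, \<beta>)]"
proof (rule direct_sumI[of _ _ _ "\<lambda>k. unit_matrix 0 0 (v k)" "\<lambda>k. unit_matrix 0 0 (w k)"])
  show "map smp xs ! i \<in> Obj C" if "i < length (map smp xs)" for i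
    using that smp_obj by (simp del: C_simps)
  show "[(1, \<beta>)] \<in> Obj C"
    using one_obj[OF \<beta>] by simp
  show "unit_matrix 0 0 (v k) \<in> Hom C (map smp xs ! k) [(1, \<beta>)]"
    "unit_matrix 0 0 (w k) \<in> Hom C [(1, \<beta>)] (map smp xs ! k)" if "k < length (map smp xs)" for k
    using that v w by (simp_all add: smp_def hom_single \<beta> \<gamma>_in)
  show "Comp C (map smp xs ! j) [(1, \<beta>)] (map smp xs ! i) (unit_matrix 0 0 (w i)) (unit_matrix 0 0 (v j)) =
      (if i = j then Ident C (map smp xs ! i) else 0)" if "i < length (map smp xs)" "j < length (map smp xs)" for i j
    using that unit_matrix_lin(1) by (simp add: unit_matrix_comp ident_smp wv del: C_simps)
  have "(\<Sum>i<n. unit_matrix 0 0 (f i)) = unit_matrix 0 0 (\<Sum>i<n. f i)" for n and f :: "nat \<Rightarrow> 'g leavitt"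
    by (induction n) (simp_all only: sum.lessThan_Suc lessThan_0 sum.empty unit_matrix_lin)
  then show "(\<Sum>i<length (map smp xs). Comp C [(1, \<beta>)] (map smp xs ! i) [(1, \<beta>)] (unit_matrix 0 0 (v i)) (unit_matrix 0 0 (w i))) =
      Ident C [(1, \<beta>)]"
    by (simp add: unit_matrix_comp smp_def vw ident_single)
qed

lemma tobj_smp: "TObj C (smp x) (smp y) = [(1, \<gamma> x \<circ> \<gamma> y)]"
  by (simp add: smp_def tensor_single \<gamma>_in)

text \<open>For one-by-one matrices the zigzags become equations in the Leavitt algebra: tensoring
  with an identity on the left applies the endomorphism, on the right it changes nothing.\<close>

lemma dual_smp:
  assumes e: "e \<in> intertwiners (\<gamma> y \<circ> \<gamma> x) id" and c: "c \<in> intertwiners id (\<gamma> x \<circ> \<gamma> y)"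
    and zigzag: "\<gamma> x e * c = 1" "e * \<gamma> y c = 1"
  shows "is_left_dual C (smp x) (smp y)"
proof (rule left_dualI)
  have T: "ds_tensor (smp z) (smp z') = [(1, \<gamma> z \<circ> \<gamma> z')]" for z z'
    using tobj_smp by simp
  have id: "id \<in> compositions \<E>"
    using id_in by (rule compositions.base)
  show "smp x \<in> Obj C" "smp y \<in> Obj C"
    by (rule smp_obj)+
  show "unit_matrix 0 0 e \<in> Hom C (TObj C (smp y) (smp x)) (Unit C)"
    "unit_matrix 0 0 c \<in> Hom C (Unit C) (TObj C (smp x) (smp y))"
    using e c by (simp_all add: T hom_single id \<gamma>_in compositions.comp)
  have len: "length (smp z) = 1" "length (Unit C) = 1" "length (TObj C X Y) = length X * length Y" for z X Y
    by (simp_all add: smp_def)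
  have at0: "snd (smp z ! 0) = \<gamma> z" "snd (Unit C ! 0) = id" "snd (TObj C (smp z) (smp z') ! 0) = \<gamma> z \<circ> \<gamma> z'" for z z'
    by (simp_all add: smp_def tensor_single \<gamma>_in)
  have one: "\<gamma> z 1 = 1" for z
    using unital_\<gamma>[of z] by (simp add: unital_endo_def)
  show "Comp C (smp x) (TObj C (TObj C (smp x) (smp y)) (smp x)) (smp x)
      (TMor C (smp x) (smp x) (TObj C (smp y) (smp x)) (Unit C) (Ident C (smp x)) (unit_matrix 0 0 e))
      (TMor C (Unit C) (TObj C (smp x) (smp y)) (smp x) (smp x) (unit_matrix 0 0 c) (Ident C (smp x))) = Ident C (smp x)"
    using zigzag(1) unfolding C_simps(6)
    by (simp add: ident_smp tensor_mor_single unit_matrix_comp len at0 del: C_simps)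
  show "Comp C (smp y) (TObj C (smp y) (TObj C (smp x) (smp y))) (smp y)
      (TMor C (TObj C (smp y) (smp x)) (Unit C) (smp y) (smp y) (unit_matrix 0 0 e) (Ident C (smp y)))
      (TMor C (smp y) (smp y) (Unit C) (TObj C (smp x) (smp y)) (Ident C (smp y)) (unit_matrix 0 0 c)) = Ident C (smp y)"
    using zigzag(2) unfolding C_simps(6)
    by (simp add: ident_smp tensor_mor_single unit_matrix_comp len at0 one del: C_simps)
qed

end

context dilogarithm
begin

definition endos :: "('g leavitt \<Rightarrow> 'g leavitt) set" where "endos = {(\<rho> ^^ m) \<circ> \<alpha> g | m g. True}"

definition izumi_endo :: "'g izumi \<Rightarrow> 'g leavitt \<Rightarrow> 'g leavitt" where
  "izumi_endo x = (case x of Grp g \<Rightarrow> \<alpha> g | Rho \<Rightarrow> \<rho>)"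

lemma izumi_endo_simps [simp]: "izumi_endo (Grp g) = \<alpha> g" "izumi_endo Rho = \<rho>"
  by (simp_all add: izumi_endo_def)

lemma S'_Phi: "LS' g * Phi x = \<alpha> g x * LS' g" and T'_Phi: "LT' g * Phi x = \<rho> x * LT' g"
  by (simp_all add: Phi_def lexpand)

text \<open>The maps are already present in the algebra: 1 when the left factor is \<alpha>_g,
  \<open>U g\<close> between \<rho> and \<rho> \<circ> \<alpha>_g, and the generators themselves for
  \<rho> \<circ> \<rho>, with \<open>up\<close> as inclusions and \<open>dn\<close> as
  projections.\<close>

lemma izumi_decomposition:
  "\<exists>xs v w. (\<forall>k<length xs. v k \<in> intertwiners (izumi_endo (xs ! k)) (izumi_endo x \<circ> izumi_endo y) \<and>
      w k \<in> intertwiners (izumi_endo x \<circ> izumi_endo y) (izumi_endo (xs ! k))) \<and>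
    (\<forall>i<length xs. \<forall>j<length xs. w i * v j = (if i = j then 1 else 0)) \<and>
    (\<Sum>k<length xs. v k * w k) = 1 \<and> (\<forall>z. length (filter ((=) z) xs) = izumi_coeff x y z)"
proof (cases x)
  case x: (Grp g)
  let ?z = "case y of Grp h \<Rightarrow> Grp (g + h) | Rho \<Rightarrow> Rho"
  have "izumi_endo x \<circ> izumi_endo y = izumi_endo ?z"
    by (cases y) (simp_all add: x alpha_add alpha_rho)
  moreover have "length (filter ((=) z) [?z]) = izumi_coeff x y z" for z
    by (cases y) (auto simp: x)
  ultimately show ?thesis
    by (intro exI[of _ "[?z]"] exI[of _ "\<lambda>_. 1"]) (simp add: intertwiners_one)
next
  case x: Rho
  show ?thesis
  proof (cases y)
    case y: (Grp g)
    have "U g \<in> intertwiners \<rho> (\<rho> \<circ> \<alpha> g)" "U (- g) \<in> intertwiners (\<rho> \<circ> \<alpha> g) \<rho>"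
      by (simp_all add: intertwiners_def rho_alpha mult.assoc U_add U_add_assoc U_zero)
    then show ?thesis
      by (intro exI[of _ "[Rho]"] exI[of _ "\<lambda>_. U g"] exI[of _ "\<lambda>_. U (- g)"])
        (auto simp: x y U_add U_zero)
  next
    case y: Rho
    \<comment> \<open>The summands of \<rho> \<circ> \<rho> are numbered by the 2N generators; an
      S-letter belongs to its \<alpha>_g, a T-letter to a copy of \<rho>.\<close>
    obtain L where L: "distinct L" "set L = (UNIV :: (bool \<times> 'g) set)"
      using finite_distinct_list[of "UNIV :: (bool \<times> 'g) set"] by auto
    let ?f = "\<lambda>p :: bool \<times> 'g. if fst p then Grp (snd p) else Rho"
    have "up p \<in> intertwiners (izumi_endo (?f p)) (\<rho> \<circ> \<rho>) \<and> dn p \<in> intertwiners (\<rho> \<circ> \<rho>) (izumi_endo (?f p))" for p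
      unfolding rho_rho by (cases p rule: up.cases) (simp_all add: intertwiners_def Phi_S Phi_T S'_Phi T'_Phi)
    moreover have "dn (L ! i) * up (L ! j) = (if i = j then 1 else 0)" if "i < length L" "j < length L" for i j
      using that L(1) by (simp add: dn_up nth_eq_iff_index_eq)
    moreover have "(\<Sum>k<length L. up (L ! k) * dn (L ! k)) = 1"
    proof -
      have "(\<Sum>k<length L. up (L ! k) * dn (L ! k)) = (\<Sum>p\<in>UNIV. up p * dn p)"
        by (rule sum.reindex_bij_betw[OF bij_betw_nth]) (simp_all add: L)
      then show ?thesis by (simp add: sum_up_dn)
    qed
    moreover have "length (filter ((=) z) (map ?f L)) = izumi_coeff Rho Rho z" for z
    proof -
      have "length (filter ((=) z) (map ?f L)) = card {p. z = ?f p}"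
        using distinct_card[OF distinct_filter[OF L(1)], of "\<lambda>p. z = ?f p"] L(2)
        by (simp add: filter_map comp_def)
      also have "\<dots> = izumi_coeff Rho Rho z"
      proof (cases z)
        case (Grp g)
        then have "{p. z = ?f p} = {(True, g)}" by (auto split: if_splits)
        with Grp show ?thesis by simp
      next
        case Rho
        then have "{p. z = ?f p} = {False} \<times> UNIV" by (auto split: if_splits)
        with Rho show ?thesis by (simp add: card_cartesian_product)
      qed
      finally show ?thesis .
    qed
    ultimately show ?thesis
      by (intro exI[of _ "map ?f L"] exI[of _ "\<lambda>k. up (L ! k)"] exI[of _ "\<lambda>k. dn (L ! k)"])
        (simp add: x y)
  qed
qed

lemma izumi_endo_factored: "1 \<in> lvs.span (factored izumi_endo (izumi_endo x))"
  using factoredI[of 1 izumi_endo x "izumi_endo x" 1] by (simp add: intertwiners_one lvs.span_base)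

lemma izumi_prod_factored: "1 \<in> lvs.span (factored izumi_endo (izumi_endo x \<circ> izumi_endo y))"
proof -
  obtain xs v w where vw: "\<forall>k<length xs. v k \<in> intertwiners (izumi_endo (xs ! k)) (izumi_endo x \<circ> izumi_endo y) \<and>
      w k \<in> intertwiners (izumi_endo x \<circ> izumi_endo y) (izumi_endo (xs ! k))"
    and sum: "(\<Sum>k<length xs. v k * w k) = 1"
    using izumi_decomposition[of x y] by blast
  have "(\<Sum>k<length xs. v k * w k) \<in> lvs.span (factored izumi_endo (izumi_endo x \<circ> izumi_endo y))"
    using vw by (intro lvs.span_sum lvs.span_base factoredI[of _ _ "xs ! _"]) auto
  then show ?thesis
    by (simp only: sum)
qed

lemma unital_izumi_endo: "unital_endo (izumi_endo x)"
  by (cases x) (simp_all add: endo_alpha endo_rho)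

lemma endos_induct [consumes 1, case_names alpha rho]:
  assumes "\<beta> \<in> endos" "\<And>g. P (\<alpha> g)" "\<And>\<beta>. unital_endo \<beta> \<Longrightarrow> P \<beta> \<Longrightarrow> P (\<rho> \<circ> \<beta>)"
  shows "P \<beta>"
proof -
  have "unital_endo ((\<rho> ^^ m) \<circ> \<alpha> g) \<and> P ((\<rho> ^^ m) \<circ> \<alpha> g)" for m g
    using assms(2,3) by (induction m) (simp_all add: endo_alpha endo_rho unital_endo_comp comp_assoc)
  then show ?thesis
    using assms(1) by (auto simp: endos_def)
qed

sublocale eg: endo_fusion endos izumi_endo
proof (unfold_locales, goal_cases)
  case (1 \<sigma>)
  then show ?case
    by (induction rule: endos_induct) (blast intro: endo_alpha endo_rho unital_endo_comp)+
next
  case 2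
  have "id = (\<rho> ^^ 0) \<circ> \<alpha> 0" by (simp add: alpha_zero)
  then show ?case unfolding endos_def by blast
next
  case 3
  have "(UNIV :: 'g izumi set) = insert Rho (range Grp)"
    by (auto intro: izumi.exhaust)
  then show ?case by (metis finite_imageI finite_insert finite)
next
  case (4 x)
  have "\<alpha> g = (\<rho> ^^ 0) \<circ> \<alpha> g" "\<rho> = (\<rho> ^^ 1) \<circ> \<alpha> 0" for g
    by (simp_all add: alpha_zero)
  then have "\<alpha> g \<in> endos" "\<rho> \<in> endos" for g
    unfolding endos_def by blast+
  then show ?case
    by (cases x) (simp_all add: compositions.base)
next
  case (5 a x)
  show ?case
  proof (cases x)
    case (Grp g)
    then have "a \<in> intertwiners id id"
      using 5 inter_alpha_alpha[of a g g] by (simp add: alpha_zero)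
    then show ?thesis by (rule inter_id_id)
  qed (use 5 inter_rho_rho in simp)
next
  case (6 x y a)
  then show ?case
    using inter_alpha_alpha inter_id_alpha inter_alpha_rho inter_rho_alpha
    by (cases x; cases y) (simp_all, metis eq_iff_diff_eq_0)
next
  case (7 \<beta>)
  then show ?case
  proof (induction rule: endos_induct)
    case (alpha g)
    then show ?case using izumi_endo_factored[of "Grp g"] by simp
  next
    case (rho \<beta>)
    show ?case
      by (rule span_factored_comp[OF izumi_prod_factored unital_izumi_endo endo_rho _ rho(2)])
        (use izumi_endo_factored[of Rho] in simp)
  qed
next
  case (8 x y)
  show ?case by (rule izumi_prod_factored)
qed

theorem categorifies_izumi: "categorifies (evans_gannon endos) (izumi_ring :: 'g izumi based_ring)"
proof (rule eg.categorifiesI[of eg.smp])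
  show "inj eg.smp"
    by (rule eg.inj_smp)
  show "Unit (evans_gannon endos) = eg.smp (One (izumi_ring :: 'g izumi based_ring))"
    by (simp add: eg.smp_def izumi_ring_def alpha_zero)
  show "is_left_dual (evans_gannon endos) (eg.smp x) (eg.smp (Star izumi_ring x))" for x
  proof (cases x)
    case (Grp g)
    then show ?thesis
      using eg.dual_smp[of 1 "Grp (- g)" "Grp g" 1] endo_simps(3)[OF endo_alpha]
      by (simp add: izumi_ring_def alpha_add alpha_zero intertwiners_one)
  next
    case Rho
    \<comment> \<open>Both \<open>\<rho> (LS' 0) * LS 0\<close> and
      \<open>LS' 0 * \<rho> (LS 0)\<close> equal \<open>1 / d\<close>, so the factor
      \<open>d\<close> on the evaluation corrects both zigzags.\<close>
    have "d *\<^sub>L LS' 0 \<in> intertwiners (\<rho> \<circ> \<rho>) id" "LS 0 \<in> intertwiners id (\<rho> \<circ> \<rho>)"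
      unfolding rho_rho by (simp_all add: intertwiners_def Phi_S S'_Phi alpha_zero lscale_mult_left lscale_mult_right)
    then show ?thesis
      using eg.dual_smp[of "d *\<^sub>L LS' 0" Rho Rho "LS 0"] d_nz
      by (simp add: Rho izumi_ring_def endo_simps[OF endo_rho] rho_gens RS'_S S'_RS U_zero lscale_mult_left del: rho_on_gens.simps)
  qed
  show "\<exists>zs. direct_sum (evans_gannon endos) (map eg.smp zs)
          (TObj (evans_gannon endos) (eg.smp x) (eg.smp y)) \<and>
         (\<forall>z. length (filter ((=) z) zs) = Coeff izumi_ring x y z)" for x y
  proof -
    obtain xs v w where vw: "\<forall>k<length xs. v k \<in> intertwiners (izumi_endo (xs ! k)) (izumi_endo x \<circ> izumi_endo y) \<and>
        w k \<in> intertwiners (izumi_endo x \<circ> izumi_endo y) (izumi_endo (xs ! k))"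
      and orth: "\<forall>i<length xs. \<forall>j<length xs. w i * v j = (if i = j then 1 else 0)"
      and sum: "(\<Sum>k<length xs. v k * w k) = 1" and count: "\<forall>z. length (filter ((=) z) xs) = izumi_coeff x y z"
      using izumi_decomposition[of x y] by blast
    have "direct_sum (evans_gannon endos) (map eg.smp xs) (TObj (evans_gannon endos) (eg.smp x) (eg.smp y))"
      unfolding eg.tobj_smp using vw orth sum
      by (intro eg.direct_sum_smp[of _ _ v w] compositions.comp eg.\<gamma>_in) auto
    with count show ?thesis
      by (auto simp: izumi_ring_def)
  qed
  show "Basis (izumi_ring :: 'g izumi based_ring) = UNIV" "Star izumi_ring (Star izumi_ring x) = x" for x :: "'g izumi"
    by (cases x; simp add: izumi_ring_def)+
qed simp

end

text \<open>The first conjunct is stated because \<open>rho\<close> is a definite description: it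
  guarantees that the endomorphism described by its values on generators exists and is
  unique.\<close>

theorem theorem12:
  fixes q E :: "'g::{ab_group_add,finite} \<Rightarrow> complex" and s :: complex
  assumes "metric_group q"
    and "finite_quantum_dilogarithm q E"
    and "s\<^sup>2 = dilog_d E"
  shows "(\<exists>!f. unital_endo f \<and> (\<forall>l. f (leavitt_gen l) = rho_on_gens q E s l)) \<and>
    categorifies (evans_gannon {(rho q E s ^^ m) \<circ> alpha q g | m g. True})
      (izumi_ring :: 'g izumi based_ring)"
proof -
  interpret dilogarithm q "sqrt_card TYPE('g)" "of_nat CARD('g)" E s "dilog_d E" "dilog_lambda q E"
    using assms by unfold_locales simp_all
  show ?thesis
    using rho_well_defined categorifies_izumi unfolding endos_def by blast
qed

end
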